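(* Let $\mu$ denote the Möbius function and $\zeta$ the Riemann zeta-function. For an integer $k\ge1$ and real $z\ge1$, define $$\mathcal{M}_k(z)=\sum_{d_1\le z}\cdots\sum_{d_{2k}\le z}\frac{\mu(d_1)\cdots\mu(d_{2k})}{[d_1,\dots,d_{2k}]},$$ where the $d_j$ run over positive integers and $[d_1,\dots,d_{2k}]$ is their least common multiple. Let $G=G^{(k)}$ be the function defined in the context below, and put $G_k(t)=G(s_1,\dots,s_{2k})$ with $s_1=\dots=s_k=it$ and $s_{k+1}=\dots=s_{2k}=-it$ ($t\in\mathbb{R}$). Then, as $z\to\infty$, $$\mathcal{M}_1(z)=(1+o(1))\,\frac{1}{2\pi}\int_{-\infty}^{\infty}\frac{G_1(t)}{|\zeta(1+it)|^2}\,\frac{dt}{t^2},$$ $$\mathcal{M}_2(z)=(1+o(1))\,\frac{3}{4\pi}(\log z)^2\int_{-\infty}^{\infty}\frac{|\zeta(1+2it)|^2}{|\zeta(1+it)|^8}\,G_2(t)\,\frac{dt}{t^4}.$$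
   Context: For $\mathrm{Re}\,s_j>0$ ($j=1,\dots,2k$) let $$M(s_1,\dots,s_{2k})=\sum_{d_1=1}^\infty\cdots\sum_{d_{2k}=1}^\infty\frac{\mu(d_1)\cdots\mu(d_{2k})}{[d_1,\dots,d_{2k}]\,d_1^{s_1}\cdots d_{2k}^{s_{2k}}}=\prod_p\Big(1-\frac1p+\frac1p\prod_{j=1}^{2k}\big(1-p^{-s_j}\big)\Big).$$ For a nonempty subset $S\subseteq\{1,\dots,2k\}$ write $s_S=\sum_{j\in S}s_j$. Define $G(s_1,\dots,s_{2k})$ by $$M(s_1,\dots,s_{2k})=\frac{\prod_{S:\,|S|\ \mathrm{even},\,|S|\ge2}\zeta(1+s_S)}{\prod_{S:\,|S|\ \mathrm{odd}}\zeta(1+s_S)}\;G(s_1,\dots,s_{2k}),$$ the products running over subsets $S$ of $\{1,\dots,2k\}$. The function $G$ extends to a function that is holomorphic and bounded in the region $\mathrm{Re}\,s_j>-c(k)$ ($j=1,\dots,2k$) for some constant $c(k)>0$; $G_k(t)$ is defined via this extension (and $G_k(t)>0$). *)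

theory Defs
  imports "HOL-Analysis.Analysis" "HOL-Computational_Algebra.Squarefree"
    "HOL-Library.Landau_Symbols"
begin

definition moebius :: "nat \<Rightarrow> int" where
  "moebius n = (if n > 0 \<and> squarefree n then (-1) ^ card (prime_factors n) else 0)"

text \<open>Riemann zeta function on the half plane Re s > 0 (s not 1), via the standard
  absolutely convergent representation
  zeta s = 1/(s-1) + sum_{n>=1} (n^(-s) - integral_n^(n+1) x^(-s) dx);
  for Re s > 1 it coincides with the Dirichlet series sum n^(-s).\<close>
definition zeta :: "complex \<Rightarrow> complex" where
  "zeta s = 1 / (s - 1) +
     (\<Sum>m. (of_nat (Suc m)) powr (-s)
            - ((of_nat (Suc (Suc m))) powr (1 - s) - (of_nat (Suc m)) powr (1 - s)) / (1 - s))"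

text \<open>M(s_0,...,s_{2k-1}) as the Euler product (valid for Re s_j > 0).\<close>
definition Mfun :: "nat \<Rightarrow> (nat \<Rightarrow> complex) \<Rightarrow> complex" where
  "Mfun k s = (\<Prod>p. if prime p then
       1 - 1 / of_nat p + (1 / of_nat p) * (\<Prod>j<2*k. 1 - (of_nat p) powr (- s j))
     else 1)"

definition sS :: "(nat \<Rightarrow> complex) \<Rightarrow> nat set \<Rightarrow> complex" where
  "sS s S = (\<Sum>j\<in>S. s j)"

text \<open>G on the region Re s_j > 0, defined by
  M = (prod_{|S| even, |S|>=2} zeta(1+s_S) / prod_{|S| odd} zeta(1+s_S)) * G.\<close>
definition Gfun :: "nat \<Rightarrow> (nat \<Rightarrow> complex) \<Rightarrow> complex" where
  "Gfun k s = Mfun k s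
     * (\<Prod>S\<in>{S. S \<subseteq> {..<2*k} \<and> odd (card S)}. zeta (1 + sS s S))
     / (\<Prod>S\<in>{S. S \<subseteq> {..<2*k} \<and> even (card S) \<and> card S \<ge> 2}. zeta (1 + sS s S))"

text \<open>G_k(t): value of the holomorphic (hence continuous) extension of G at
  s_1 = ... = s_k = it, s_{k+1} = ... = s_{2k} = -it, obtained as the limit
  from inside the region Re s_j > 0.\<close>
definition Gk :: "nat \<Rightarrow> real \<Rightarrow> complex" where
  "Gk k t = Lim (at_right (0::real))
     (\<lambda>\<sigma>. Gfun k (\<lambda>j. if j < k then complex_of_real \<sigma> + \<i> * complex_of_real t
                         else complex_of_real \<sigma> - \<i> * complex_of_real t))"

definition Mk :: "nat \<Rightarrow> real \<Rightarrow> real" where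
  "Mk k z = (\<Sum>d\<in>Pi\<^sub>E {..<2*k} (\<lambda>_. {1..nat \<lfloor>z\<rfloor>}).
       (\<Prod>j<2*k. real_of_int (moebius (d j))) / real (Lcm (d ` {..<2*k})))"

end

theory Submission
  imports Defs "HOL-Complex_Analysis.Complex_Analysis" "HOL-Real_Asymp.Real_Asymp"
begin

text \<open>Put \<open>u = ln z\<close>. Replacing the cut-off \<open>d \<le> z\<close> by the weight \<open>1 - exp (-(u - ln d) / h)\<close> with
  \<open>h = u\<^sup>-\<^sup>3\<^sup>2\<close> changes the sum by \<open>o(1)\<close>, and Perron's formula turns the smoothed sum into an absolutely
  convergent integral of the Euler product over the lines \<open>Re s\<^sub>j = 1/u\<close>. Writing \<open>\<zeta>(1 + s) = Z(s)/s\<close>, the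
  lower bound for \<open>Z\<close> on \<open>Re s \<ge> 0\<close> that follows from the 3-4-1 inequality makes the factors
  \<open>1/\<zeta>(1 + s\<^sub>j)\<close> decay, so that only the poles at \<open>s\<^sub>i + s\<^sub>j = 0\<close> and \<open>s\<^sub>1 + \<dots> + s\<^sub>4 = 0\<close> matter.

  For \<open>k = 1\<close>, one integration by parts makes the pole double, and the substitution
  \<open>s\<^sub>1 + s\<^sub>2 = (2 + \<i>x)/u\<close> together with dominated convergence gives the limit.

  For \<open>k = 2\<close> the zeros at the triples \<open>s\<^sub>i + s\<^sub>j + s\<^sub>l = 0\<close> cancel one edge in each triangle of the complete
  graph formed by the six pair poles. What is left are spanning trees, which contribute powers
  of \<open>ln u\<close> only, and 4-cycles. A 4-cycle is large only where \<open>s\<^sub>1, s\<^sub>4\<close> are close to \<open>-s\<^sub>2, -s\<^sub>3\<close>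
  (up to the choice of the partner of \<open>s\<^sub>1\<close>, which gives three equal contributions). There the integral is
  rescaled by \<open>u\<close>, and the local integral is \<open>(2\<pi>)\<^sup>2 \<integral> exp (4 + \<i>q) / (4 + \<i>q)\<^sup>3 dq = 4\<pi>\<^sup>3\<close>.

  Since \<open>G\<^sub>k(t) > 0\<close>, the limiting integrals do not vanish, so convergence of the quotients is the
  asserted asymptotic equivalence.\<close>

section \<open>The zeta function to the right of the line \<open>Re s = 1\<close>\<close>

text \<open>The obstacle is integrability. The 3-4-1 inequality leaves 1/zeta(1 + s) a growth of
  |t|^(1/8192), so a Perron kernel divided by zeta(1 + s) decays like |t|^(-1 + 1/8192), just short
  of integrable. The damping factor 1/(1 + h s) closes this gap, and only its power 1/512 is spent,
  at the price h^(-1/512) = u^(1/16) per variable. For k = 2 the error is thus u^(5/4) up to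
  logarithms, including one factor u from the pole of the full sum, against a main term of order
  u^2. In the main region nearly opposite variables supply the decay jointly; no damping is used
  there and no power of u is lost.

  The size of h is dictated from the other side. Sorting primes by the set of d_j they divide gives
  2^(2 k) - 1 free variables, fifteen for k = 2, so a boundary layer of logarithmic width e
  contributes about e u^14. The width e = u^(-16) makes this small, and h = u^(-32) brings the
  weight within exp(-u^16) of 1 outside the layer.\<close>

type_synonym 'b fun4 = "real \<Rightarrow> real \<Rightarrow> real \<Rightarrow> real \<Rightarrow> 'b"

type_synonym real4 = "real \<times> real \<times> real \<times> real"

abbreviation (input) nm :: "real \<Rightarrow> real" where "nm x \<equiv> 1 + \<bar>x\<bar>"

text \<open>For k = 2 every variable enters three pair sums, three triple sums and the full sum.
  These seven small powers, and an eighth from the inverse of \<open>zeta_reg\<close>, add up to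
  8/8192 = 1/1024, the exponent in \<open>om\<close>.\<close>

abbreviation (input) pe :: "real \<Rightarrow> real" where "pe x \<equiv> nm x powr (1/8192)"

text \<open>The summand in \<open>zeta (1 + s)\<close> with its difference quotient written as an
  integral. In this form nothing is divided by s, so the terms are holomorphic through s = 0; their
  sum \<open>xi\<close> is zeta(1 + s) - 1/s.\<close>

definition xi_term :: "nat \<Rightarrow> complex \<Rightarrow> complex" where
  "xi_term m s = integral {0..1} (\<lambda>x::real. of_nat (Suc m) powr (-1 - s) - of_real (real (Suc m) + x) powr (-1 - s))"

definition xi :: "complex \<Rightarrow> complex" where
  "xi s = (\<Sum>m. xi_term m s)"

text \<open>The function Z of the overview. Being built from \<open>xi\<close>, it has the correct
  value 1 at the pole, where \<open>zeta 1\<close> itself carries no information.\<close>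

definition zeta_reg :: "complex \<Rightarrow> complex" where
  "zeta_reg s = 1 + s * xi s"

lemma has_vector_derivative_shift_powr:
  fixes s :: complex
  assumes "a > 0" "x \<ge> 0"
  shows "((\<lambda>x. of_real (a + x) powr (-1 - s)) has_vector_derivative (-1 - s) * of_real (a + x) powr (-2 - s)) (at x within A)"
proof -
  have B: "((\<lambda>z. z powr (-1 - s)) has_field_derivative (-1 - s) * of_real (a + x) powr (-1 - s - 1)) (at (of_real (a + x)))"
    by (rule has_field_derivative_powr) (use assms in \<open>auto simp: complex_nonpos_Reals_iff\<close>)
  have A: "((\<lambda>x. complex_of_real (a + x)) has_vector_derivative 1) (at x within A)"
    by (auto intro!: derivative_eq_intros simp: has_vector_derivative_def scaleR_conv_of_real)
  have "((\<lambda>x. of_real (a + x) powr (-1 - s)) has_vector_derivative 1 * ((-1 - s) * of_real (a + x) powr (-1 - s - 1))) (at x within A)"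
    using field_vector_diff_chain_within[OF A has_field_derivative_at_within[OF B]] by (simp only: o_def)
  moreover have "-1 - s - 1 = -2 - s" by simp
  ultimately show ?thesis by (simp only: mult_1)
qed

lemma norm_shift_powr_diff_le:
  assumes "Re s \<ge> -1" "a > 0" "0 \<le> x" "x \<le> 1"
  shows "norm (of_real a powr (-1 - s) - of_real (a + x) powr (-1 - s)) \<le> norm (1 + s) * a powr (-2 - Re s)"
proof -
  have "norm (of_real (a + x) powr (-1 - s) - of_real (a + 0) powr (-1 - s)) \<le> norm (1 + s) * a powr (-2 - Re s) * norm (x - 0)"
  proof (rule differentiable_bound[where S = "{0..x}" and f' = "\<lambda>y h. h *\<^sub>R ((-1 - s) * of_real (a + y) powr (-2 - s))"])
    fix y assume y: "y \<in> {0..x}"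
    show "((\<lambda>x. of_real (a + x) powr (-1 - s)) has_derivative (\<lambda>h. h *\<^sub>R ((-1 - s) * of_real (a + y) powr (-2 - s)))) (at y within {0..x})"
      using has_vector_derivative_shift_powr[of a y s "{0..x}"] assms y
      by (simp add: has_vector_derivative_def)
    have "norm ((-1 - s) * of_real (a + y) powr (-2 - s)) = norm (-(1 + s)) * (a + y) powr (-2 - Re s)"
      using assms y by (simp add: norm_mult norm_powr_real_powr)
    also have "\<dots> \<le> norm (1 + s) * a powr (-2 - Re s)"
      unfolding norm_minus_cancel using assms y by (intro mult_left_mono powr_mono2') auto
    finally show "onorm (\<lambda>h. h *\<^sub>R ((-1 - s) * of_real (a + y) powr (-2 - s))) \<le> norm (1 + s) * a powr (-2 - Re s)"
      by (intro onorm_le) (auto simp: mult.commute[of _ "\<bar>_\<bar>"] intro!: mult_left_mono)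
  qed (use assms in auto)
  also have "\<dots> \<le> norm (1 + s) * a powr (-2 - Re s) * 1"
    using assms by (intro mult_left_mono) auto
  finally show ?thesis by (simp add: norm_minus_commute)
qed

lemma continuous_on_xi_integrand:
  fixes s :: complex
  shows "a > 0 \<Longrightarrow> continuous_on {0..1} (\<lambda>x::real. of_real a powr (-1 - s) - of_real (a + x) powr (-1 - s))"
  by (intro continuous_intros) (auto simp: complex_nonpos_Reals_iff complex_eq_iff)

text \<open>A geometric mean with weights \<open>e\<close> and \<open>1 - e\<close>: the mean value
  bound \<open>A\<close> gains a power of n but grows with s, the trivial bound \<open>B\<close>
  does neither. A small \<open>e\<close> buys convergence slightly to the left of
  \<open>Re s = 0\<close> for a growth of only |s|^e.\<close>

lemma norm_xi_term_le:
  assumes "Re s \<ge> -1" "0 \<le> e" "e \<le> 1"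
  shows "norm (xi_term m s) \<le> 2 * norm (1 + s) powr e * real (Suc m) powr (-1 - Re s - e)"
proof -
  define n where "n = real (Suc m)"
  have n: "n > 0" by (simp add: n_def)
  define A where "A = norm (1 + s) * n powr (-2 - Re s)"
  define B where "B = 2 * n powr (-1 - Re s)"
  have le: "norm (xi_term m s) \<le> C" if "\<And>x. 0 \<le> x \<Longrightarrow> x \<le> 1 \<Longrightarrow> norm (of_real n powr (-1 - s) - of_real (n + x) powr (-1 - s)) \<le> C" for C
  proof -
    have "norm (xi_term m s) \<le> C * (1 - 0)"
      unfolding xi_term_def using that n continuous_on_xi_integrand[of n s]
      by (intro integral_bound) (auto simp: n_def)
    then show ?thesis by simp
  qed
  have 1: "norm (xi_term m s) \<le> A"
    unfolding A_def using assms n by (intro le norm_shift_powr_diff_le) auto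
  have 2: "norm (xi_term m s) \<le> B"
  proof (rule le)
    fix x :: real assume "0 \<le> x" "x \<le> 1"
    have "norm (of_real n powr (-1 - s) - of_real (n + x) powr (-1 - s)) \<le> n powr (-1 - Re s) + (n + x) powr (-1 - Re s)"
      by (rule order_trans[OF norm_triangle_ineq4]) (use n \<open>0 \<le> x\<close> in \<open>simp add: norm_powr_real_powr\<close>)
    also have "(n + x) powr (-1 - Re s) \<le> n powr (-1 - Re s)"
      using n \<open>0 \<le> x\<close> assms by (intro powr_mono2') auto
    finally show "norm (of_real n powr (-1 - s) - of_real (n + x) powr (-1 - s)) \<le> B" by (simp add: B_def)
  qed
  have "norm (xi_term m s) = norm (xi_term m s) powr e * norm (xi_term m s) powr (1 - e)"
    by (cases "xi_term m s = 0") (simp_all flip: powr_add)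
  also have "\<dots> \<le> A powr e * B powr (1 - e)"
    using 1 2 assms by (intro mult_mono powr_mono2) auto
  also have "\<dots> = norm (1 + s) powr e * 2 powr (1 - e) * (n powr ((-2 - Re s) * e) * n powr ((-1 - Re s) * (1 - e)))"
    using n by (simp add: A_def B_def powr_mult powr_powr)
  also have "n powr ((-2 - Re s) * e) * n powr ((-1 - Re s) * (1 - e)) = n powr (-1 - Re s - e)"
    using n by (simp add: algebra_simps flip: powr_add)
  also have "norm (1 + s) powr e * 2 powr (1 - e) * n powr (-1 - Re s - e) \<le> norm (1 + s) powr e * 2 * n powr (-1 - Re s - e)"
  proof -
    have "2 powr (1 - e) \<le> 2 powr (1::real)" using assms by (intro powr_mono) auto
    then show ?thesis by (intro mult_right_mono mult_left_mono) auto
  qed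
  finally show ?thesis by (simp add: n_def mult_ac)
qed

lemma summable_Suc_powr: "a > 1 \<Longrightarrow> summable (\<lambda>m. real (Suc m) powr (-a))"
  using summable_real_powr_iff[of "-a"] by (subst summable_Suc_iff) auto

lemma summable_xi_term:
  assumes "Re s > -1" shows "summable (\<lambda>m. norm (xi_term m s))"
proof -
  \<comment> \<open>For \<open>Re s > 0\<close> the trivial bound is summable by itself; otherwise
    the full mean value bound is used.\<close>
  define e where "e = (if Re s > 0 then 0 else 1 :: real)"
  have "summable (\<lambda>m. 2 * norm (1 + s) powr e * real (Suc m) powr (-(1 + Re s + e)))"
    using assms by (intro summable_mult summable_Suc_powr) (auto simp: e_def)
  then show ?thesis
  proof (rule summable_comparison_test'[where N = 0])
    fix m
    show "norm (norm (xi_term m s)) \<le> 2 * norm (1 + s) powr e * real (Suc m) powr (-(1 + Re s + e))"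
      using norm_xi_term_le[of s e m] assms by (simp add: e_def algebra_simps split: if_splits)
  qed
qed

text \<open>Interpolating between the two bounds on the terms gives convergence and growth at once.\<close>

lemma norm_xi_le:
  assumes "0 < e" "e \<le> 1"
  shows "\<exists>C>0. \<forall>s. Re s \<ge> -e/2 \<longrightarrow> norm (xi s) \<le> C * norm (1 + s) powr e"
proof -
  define S where "S = (\<Sum>m. real (Suc m) powr (-(1 + e/2)))"
  have sm: "summable (\<lambda>m. real (Suc m) powr (-(1 + e/2)))"
    using assms by (intro summable_Suc_powr) auto
  have "norm (xi s) \<le> 2 * (S + 1) * norm (1 + s) powr e" if "Re s \<ge> -e/2" for s
  proof -
    have s: "Re s > -1" using that assms by linarith
    have b: "norm (xi_term m s) \<le> 2 * norm (1 + s) powr e * real (Suc m) powr (-(1 + e/2))" for m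
    proof -
      have "norm (xi_term m s) \<le> 2 * norm (1 + s) powr e * real (Suc m) powr (-1 - Re s - e)"
        using norm_xi_term_le[of s e m] assms s by auto
      also have "\<dots> \<le> 2 * norm (1 + s) powr e * real (Suc m) powr (-(1 + e/2))"
        using that by (intro mult_left_mono powr_mono) auto
      finally show ?thesis .
    qed
    have "norm (xi s) \<le> (\<Sum>m. 2 * norm (1 + s) powr e * real (Suc m) powr (-(1 + e/2)))"
      unfolding xi_def using b by (intro norm_suminf_le summable_mult sm)
    also have "\<dots> = 2 * norm (1 + s) powr e * S"
      unfolding S_def by (intro suminf_mult sm)
    also have "\<dots> \<le> 2 * norm (1 + s) powr e * (S + 1)" by (intro mult_left_mono) auto
    finally show ?thesis by (simp only: mult_ac)
  qed
  moreover have "S \<ge> 0" unfolding S_def by (intro suminf_nonneg sm) auto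
  ultimately show ?thesis by (intro exI[of _ "2 * (S + 1)"]) auto
qed

lemma holomorphic_xi_term: "xi_term m holomorphic_on {s. Re s > -1}"
proof -
  define n where "n = real (Suc m)"
  have n: "n > 0" by (simp add: n_def)
  have np: "complex_of_real n + complex_of_real x \<notin> \<real>\<^sub>\<le>\<^sub>0" if "x \<ge> 0" for x
    using n that by (auto simp: complex_nonpos_Reals_iff)
  have np0: "complex_of_real n \<notin> \<real>\<^sub>\<le>\<^sub>0" using n by (auto simp: complex_nonpos_Reals_iff)
  have D: "((\<lambda>s. c powr (-1 - s)) has_field_derivative - Ln c * c powr (-1 - s)) (at s within A)" if "c \<noteq> 0" for c s :: complex and A
    using that by (auto simp: powr_def intro!: derivative_eq_intros)
  have "(\<lambda>s. integral (cbox 0 1) (\<lambda>x::real. of_real n powr (-1 - s) - of_real (n + x) powr (-1 - s))) holomorphic_on {s. Re s > -1}"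
  proof (rule leibniz_rule_holomorphic)
    fix s :: complex and x :: real assume x: "x \<in> cbox 0 1"
    have nz: "of_real n + of_real x \<noteq> (0::complex)"
      using n x by (metis add_pos_nonneg cbox_interval atLeastAtMost_iff less_irrefl of_real_add of_real_eq_0_iff)
    show "((\<lambda>s. of_real n powr (-1 - s) - of_real (n + x) powr (-1 - s)) has_field_derivative
        (- Ln (of_real n) * of_real n powr (-1 - s) + Ln (of_real (n + x)) * of_real (n + x) powr (-1 - s))) (at s within {s. Re s > -1})"
      using DERIV_diff[OF D[of "of_real n" s "{s. Re s > -1}"] D[of "of_real (n + x)" s "{s. Re s > -1}"]] n nz by simp
  next
    fix s :: complex assume "s \<in> {s. Re s > -1}"
    show "(\<lambda>x. of_real n powr (-1 - s) - of_real (n + x) powr (-1 - s)) integrable_on cbox 0 1"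
      using continuous_on_xi_integrand[OF n, of s] by (intro integrable_continuous) (simp add: cbox_interval)
  next
    show "continuous_on ({s. Re s > -1} \<times> cbox 0 1) (\<lambda>(s, x). - Ln (of_real n) * of_real n powr (-1 - s) + Ln (of_real (n + x)) * of_real (n + x) powr (-1 - s))"
      using np np0 n by (auto simp: case_prod_unfold complex_eq_iff intro!: continuous_intros)
  next
    have "{s. Re s > -1} = {s. -1 < Re s}" by auto
    then show "convex {s. Re s > -1}" by (simp add: convex_halfspace_Re_gt)
  qed
  then show ?thesis by (simp add: xi_term_def[abs_def] n_def)
qed

lemma holomorphic_xi: "xi holomorphic_on {s. Re s > -1}"
proof -
  have op: "open {s. Re s > -1}" by (simp add: open_halfspace_Re_gt)
  have "(\<lambda>s. \<Sum>m. xi_term m s) holomorphic_on {s. Re s > -1}"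
  proof (rule holomorphic_uniform_sequence[OF op, where f = "\<lambda>n s. \<Sum>m<n. xi_term m s"])
    fix n show "(\<lambda>s. \<Sum>m<n. xi_term m s) holomorphic_on {s. Re s > -1}"
      by (intro holomorphic_on_sum holomorphic_xi_term)
  next
    fix s assume "s \<in> {s. Re s > -1}"
    define d where "d = (Re s + 1) / 2"
    have d: "d > 0" "Re s = 2 * d - 1" using \<open>s \<in> _\<close> by (auto simp: d_def field_simps)
    have re: "\<bar>Re w - Re s\<bar> \<le> d" if "w \<in> cball s d" for w
      using abs_Re_le_cmod[of "w - s"] that by (simp add: dist_norm norm_minus_commute)
    have sub: "cball s d \<subseteq> {s. Re s > -1}"
    proof
      fix w assume "w \<in> cball s d"
      from re[OF this] show "w \<in> {s. Re s > -1}" using d by auto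
    qed
    have "uniform_limit (cball s d) (\<lambda>n s. \<Sum>m<n. xi_term m s) (\<lambda>s. \<Sum>m. xi_term m s) sequentially"
    proof (rule Weierstrass_m_test[where M = "\<lambda>m. 2 * (norm (1 + s) + d) * real (Suc m) powr (-(1 + d))"])
      fix m w assume w: "w \<in> cball s d"
      have "norm (1 + w) \<le> norm (1 + s) + norm (w - s)"
        using norm_triangle_ineq[of "1 + s" "w - s"] by simp
      also have "norm (w - s) \<le> d" using w by (simp add: dist_norm norm_minus_commute)
      finally have 1: "norm (1 + w) \<le> norm (1 + s) + d" by simp
      have "norm (xi_term m w) \<le> 2 * norm (1 + w) powr 1 * real (Suc m) powr (-1 - Re w - 1)"
        using re[OF w] d by (intro norm_xi_term_le) auto
      also have "\<dots> \<le> 2 * (norm (1 + s) + d) * real (Suc m) powr (-(1 + d))"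
        using 1 re[OF w] d by (intro mult_mono powr_mono) auto
      finally show "norm (xi_term m w) \<le> 2 * (norm (1 + s) + d) * real (Suc m) powr (-(1 + d))" .
    next
      show "summable (\<lambda>m. 2 * (norm (1 + s) + d) * real (Suc m) powr (-(1 + d)))"
        using d by (intro summable_mult summable_Suc_powr) auto
    qed
    then show "\<exists>d>0. cball s d \<subseteq> {s. Re s > -1} \<and> uniform_limit (cball s d) (\<lambda>n s. \<Sum>m<n. xi_term m s) (\<lambda>s. \<Sum>m. xi_term m s) sequentially"
      using d sub by blast
  qed
  then show ?thesis by (simp add: xi_def[abs_def])
qed

text \<open>The right-hand side is kept unsimplified so that it is literally the summand in the
  definition of \<open>zeta\<close> at \<open>1 + s\<close>.\<close>

lemma xi_term_eq:
  assumes "s \<noteq> 0"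
  shows "xi_term m s = of_nat (Suc m) powr (-(1 + s)) - (of_nat (Suc (Suc m)) powr (1 - (1 + s)) - of_nat (Suc m) powr (1 - (1 + s))) / (1 - (1 + s))"
proof -
  define n where "n = real (Suc m)"
  have n: "n > 0" by (simp add: n_def)
  have "((\<lambda>x::real. of_real (n + x) powr (-1 - s)) has_integral (of_real (n + 1) powr (-s) / (-s) - of_real (n + 0) powr (-s) / (-s))) {0..1}"
  proof (rule fundamental_theorem_of_calculus)
    fix x :: real assume "x \<in> {0..1}"
    \<comment> \<open>The derivative rule at \<open>s - 1\<close> in place of s yields the
      antiderivative of the integrand.\<close>
    then have "((\<lambda>x. of_real (n + x) powr (-1 - (s - 1))) has_vector_derivative (-1 - (s - 1)) * of_real (n + x) powr (-2 - (s - 1))) (at x within {0..1})"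
      using n by (intro has_vector_derivative_shift_powr) auto
    then have "((\<lambda>x. of_real (n + x) powr (-1 - (s - 1)) / (-s)) has_vector_derivative ((-1 - (s - 1)) * of_real (n + x) powr (-2 - (s - 1))) / (-s)) (at x within {0..1})"
      by (rule has_vector_derivative_divide)
    then show "((\<lambda>x. of_real (n + x) powr (-s) / (-s)) has_vector_derivative of_real (n + x) powr (-1 - s)) (at x within {0..1})"
      using assms by (simp add: algebra_simps)
  qed auto
  moreover have "((\<lambda>x::real. of_real n powr (-1 - s)) has_integral (1 - 0) *\<^sub>R of_real n powr (-1 - s)) {0..1}"
    using has_integral_const_real[of "of_real n powr (-1 - s)" 0 1] by simp
  ultimately have "((\<lambda>x::real. of_real n powr (-1 - s) - of_real (n + x) powr (-1 - s)) has_integral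
      ((1 - 0) *\<^sub>R of_real n powr (-1 - s) - (of_real (n + 1) powr (-s) / (-s) - of_real (n + 0) powr (-s) / (-s)))) {0..1}"
    by (intro has_integral_diff)
  then have "xi_term m s = of_real n powr (-1 - s) - (of_real (n + 1) powr (-s) / (-s) - of_real n powr (-s) / (-s))"
    unfolding xi_term_def n_def[symmetric] by (intro integral_unique) (simp add: n_def)
  then show ?thesis
    using assms by (simp add: n_def diff_divide_distrib add_ac)
qed

lemma zeta_eq_xi: "s \<noteq> 0 \<Longrightarrow> zeta (1 + s) = 1 / s + xi s"
  unfolding zeta_def xi_def by (subst xi_term_eq) auto

lemma zeta_eq_reg: "s \<noteq> 0 \<Longrightarrow> zeta (1 + s) = zeta_reg s / s"
  by (simp add: zeta_eq_xi zeta_reg_def field_simps)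

lemma holomorphic_zeta_reg: "zeta_reg holomorphic_on {s. Re s > -1}"
  unfolding zeta_reg_def[abs_def] by (intro holomorphic_intros holomorphic_xi)

lemma zeta_reg_0 [simp]: "zeta_reg 0 = 1" by (simp add: zeta_reg_def)

lemma continuous_zeta_reg: "continuous_on {s. Re s > -1} zeta_reg"
  by (rule holomorphic_on_imp_continuous_on[OF holomorphic_zeta_reg])

text \<open>The integral terms telescope, and their total is exactly the polar term
  \<open>1 / (s - 1)\<close>, from which they are subtracted.\<close>

lemma zeta_sums:
  assumes "Re s > 1" shows "(\<lambda>m. of_nat (Suc m) powr (-s)) sums zeta s"
proof -
  define w where "w = s - 1"
  have w: "Re w > 0" "s = 1 + w" "w \<noteq> 0" using assms by (auto simp: w_def)
  have "(\<lambda>m. of_nat (Suc m) powr (1 - s) :: complex) \<longlonglongrightarrow> 0"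
  proof (rule tendsto_norm_zero_cancel)
    have "((\<lambda>m. real (Suc m) powr (- Re w)) \<longlongrightarrow> 0) at_top"
      using w(1) by real_asymp
    also have "(\<lambda>m. real (Suc m) powr (- Re w)) = (\<lambda>m. norm (of_nat (Suc m) powr (1 - s) :: complex))"
      using norm_powr_real_powr[of "of_nat (Suc _)" "1 - s"] by (auto simp: w_def)
    finally show "(\<lambda>m. norm (of_nat (Suc m) powr (1 - s) :: complex)) \<longlonglongrightarrow> 0" .
  qed
  from telescope_sums[OF this] have "(\<lambda>m. (of_nat (Suc (Suc m)) powr (1 - s) - of_nat (Suc m) powr (1 - s)) / (1 - s)) sums ((0 - 1) / (1 - s))"
    by (intro sums_divide) simp
  moreover have "(\<lambda>m. xi_term m w) sums xi w"
    unfolding xi_def using summable_norm_cancel[OF summable_xi_term[of w]] w by (intro summable_sums) auto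
  ultimately have "(\<lambda>m. xi_term m w + (of_nat (Suc (Suc m)) powr (1 - s) - of_nat (Suc m) powr (1 - s)) / (1 - s)) sums (xi w + (0 - 1) / (1 - s))"
    by (intro sums_add)
  also have "(\<lambda>m. xi_term m w + (of_nat (Suc (Suc m)) powr (1 - s) - of_nat (Suc m) powr (1 - s)) / (1 - s)) = (\<lambda>m. of_nat (Suc m) powr (-s))"
    unfolding xi_term_eq[OF w(3)] w(2)[symmetric] by auto
  also have "xi w + (0 - 1) / (1 - s) = zeta s"
    using zeta_eq_xi[OF w(3)] w by (simp add: w_def[symmetric])
  finally show ?thesis .
qed

lemma zeta_abs_summable:
  assumes "Re s > 1" shows "summable (\<lambda>n. norm (of_nat n powr (-s) :: complex))"
proof -
  have "norm (of_nat n powr (-s) :: complex) = real n powr (- Re s)" for n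
    by (cases "n = 0") (use norm_powr_real_powr[of "of_nat n" "-s"] in auto)
  then show ?thesis using assms by (simp add: summable_real_powr_iff)
qed

lemma zeta_has_sum:
  assumes "Re s > 1" shows "((\<lambda>n. of_nat n powr (-s)) has_sum zeta s) {0<..}"
proof -
  have "(\<lambda>n. of_nat n powr (-s) :: complex) sums zeta s"
    using zeta_sums[OF assms] by (subst (asm) sums_Suc_iff) simp
  then have "((\<lambda>n. of_nat n powr (-s)) has_sum zeta s) UNIV"
    by (intro norm_summable_imp_has_sum zeta_abs_summable assms)
  then show ?thesis
    by (subst has_sum_cong_neutral[where T = UNIV and g = "\<lambda>n. of_nat n powr (-s)"]) auto
qed

text \<open>Euler's sieve. Inside the set of survivors the multiples of a new prime p are p times
  the whole set, and the summand is completely multiplicative, so removing them multiplies the sum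
  by \<open>1 - p powr (-s)\<close>.\<close>

lemma zeta_sieve:
  assumes s: "Re s > 1" and "finite A" "\<And>p. p \<in> A \<Longrightarrow> prime p"
  shows "((\<lambda>n. of_nat n powr (-s)) has_sum (\<Prod>p\<in>A. 1 - of_nat p powr (-s)) * zeta s) {n. n > 0 \<and> (\<forall>p\<in>A. \<not> p dvd n)}"
  using assms(2,3)
proof (induction A rule: finite_induct)
  case empty
  have "{n::nat. n > 0} = {0<..}" by auto
  then show ?case using zeta_has_sum[OF s] by simp
next
  case (insert p A)
  define f where "f = (\<lambda>n. of_nat n powr (-s) :: complex)"
  define U where "U = {n::nat. n > 0 \<and> (\<forall>p\<in>A. \<not> p dvd n)}"
  define V where "V = {n::nat. n > 0 \<and> (\<forall>p\<in>insert p A. \<not> p dvd n)}"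
  define I where "I = (\<Prod>p\<in>A. 1 - f p) * zeta s"
  have p: "prime p" "\<And>q. q \<in> A \<Longrightarrow> prime q" using insert by auto
  have U: "(f has_sum I) U" using insert by (simp add: f_def U_def I_def)
  have fm: "f (p * n) = f p * f n" for n
    unfolding f_def of_nat_mult by (intro powr_times_real) auto
  have "((\<lambda>n. f p * f n) has_sum (f p * I)) U" by (intro has_sum_cmult_right U)
  then have "((f \<circ> (\<lambda>n. p * n)) has_sum (f p * I)) U" by (simp add: fm o_def)
  then have "(f has_sum (f p * I)) ((\<lambda>n. p * n) ` U)"
    using p prime_gt_0_nat[of p] by (subst has_sum_reindex) (auto simp: inj_on_def)
  moreover have "(\<lambda>n. p * n) ` U \<subseteq> U"
  proof clarify
    fix n assume "n \<in> U"
    moreover have "\<not> q dvd p" if "q \<in> A" for q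
      using p that insert.hyps by (metis primes_dvd_imp_eq)
    ultimately show "p * n \<in> U"
      using p prime_gt_0_nat[of p] by (auto simp: U_def prime_dvd_mult_iff)
  qed
  ultimately have "(f has_sum (I - f p * I)) (U - (\<lambda>n. p * n) ` U)"
    by (intro has_sum_Diff U)
  also have "U - (\<lambda>n. p * n) ` U = V"
  proof safe
    fix n assume n: "n \<in> U" "n \<notin> (\<lambda>n. p * n) ` U"
    have "\<not> p dvd n"
    proof
      assume "p dvd n"
      then obtain m where m: "n = p * m" by auto
      then have "m \<in> U" using n by (auto simp: U_def)
      then show False using n m by auto
    qed
    then show "n \<in> V" using n by (auto simp: U_def V_def)
  qed (auto simp: U_def V_def)
  finally have "(f has_sum (I - f p * I)) V" .
  moreover have "I - f p * I = (\<Prod>p\<in>insert p A. 1 - f p) * zeta s"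
    using insert.hyps by (simp add: I_def algebra_simps)
  ultimately show ?case by (simp only: f_def V_def)
qed

text \<open>The reciprocal Euler factor of zeta. The value 1 at composite numbers lets all products
  run over initial segments of the naturals.\<close>

definition euler_fac :: "complex \<Rightarrow> nat \<Rightarrow> complex" where
  "euler_fac s p = (if prime p then 1 - of_nat p powr (-s) else 1)"

text \<open>After sieving by the primes up to N, what remains besides 1 lies beyond N, so the
  distance to 1 is at most a tail of an absolutely convergent series.\<close>

lemma euler_product_aux:
  assumes s: "Re s > 1"
  shows "(\<lambda>N. (\<Prod>p\<le>N. euler_fac s p) * zeta s) \<longlonglongrightarrow> 1"
proof -
  define f where "f = (\<lambda>n. of_nat n powr (-s) :: complex)"
  define T where "T = (\<Sum>n. norm (f n))"
  have sm: "summable (\<lambda>n. norm (f n))" unfolding f_def by (rule zeta_abs_summable[OF s])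
  have hs: "((\<lambda>n. norm (f n)) has_sum T) UNIV"
    unfolding T_def by (intro norm_summable_imp_has_sum summable_sums) (use sm in auto)
  have bound: "norm ((\<Prod>p\<le>N. euler_fac s p) * zeta s - 1) \<le> T - (\<Sum>n\<le>N. norm (f n))" for N
  proof -
    define A where "A = {p. prime p \<and> p \<le> N}"
    define U where "U = {n::nat. n > 0 \<and> (\<forall>p\<in>A. \<not> p dvd n)}"
    have fin: "finite A" unfolding A_def by (rule finite_subset[of _ "{..N}"]) auto
    have "(\<Prod>p\<le>N. euler_fac s p) = (\<Prod>p\<in>A. 1 - f p)"
      unfolding A_def euler_fac_def f_def
      by (subst prod.inter_filter[symmetric]) (auto intro!: prod.cong)
    moreover have "(f has_sum (\<Prod>p\<in>A. 1 - f p) * zeta s) U"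
      unfolding f_def U_def by (intro zeta_sieve s fin) (auto simp: A_def)
    moreover have "(f has_sum f 1) {1}" using has_sum_finite[of "{1}" f] by simp
    ultimately have "(f has_sum ((\<Prod>p\<le>N. euler_fac s p) * zeta s - f 1)) (U - {1})"
      by (intro has_sum_Diff) (auto simp: U_def A_def)
    then have 1: "(f has_sum ((\<Prod>p\<le>N. euler_fac s p) * zeta s - 1)) (U - {1})"
      by (simp add: f_def)
    have 2: "((\<lambda>n. norm (f n)) has_sum (T - (\<Sum>n\<le>N. norm (f n)))) (UNIV - {..N})"
      by (intro has_sum_Diff hs has_sum_finiteI) auto
    \<comment> \<open>A number above 1 without prime factors up to N has a prime factor beyond N and
      hence exceeds N itself.\<close>
    have 3: "U - {1} \<subseteq> UNIV - {..N}"
    proof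
      fix n assume n: "n \<in> U - {1}"
      then obtain p where p: "prime p" "p dvd n" using prime_factor_nat[of n] by auto
      then have "\<not> p \<le> N" using n by (auto simp: U_def A_def)
      moreover have "p \<le> n" using p n by (auto simp: U_def dvd_imp_le)
      ultimately show "n \<in> UNIV - {..N}" by auto
    qed
    obtain T' where T': "((\<lambda>n. norm (f n)) has_sum T') (U - {1})"
      using summable_on_subset_banach[of "\<lambda>n. norm (f n)" UNIV "U - {1}"] hs
      by (auto simp: summable_on_def)
    have "T' \<le> T - (\<Sum>n\<le>N. norm (f n))"
      by (rule has_sum_mono2[OF T' 2 3]) auto
    with norm_has_sum_bound[OF T' 1] show ?thesis by simp
  qed
  have "(\<lambda>N. T - (\<Sum>n\<le>N. norm (f n))) \<longlonglongrightarrow> T - T"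
    unfolding T_def by (intro tendsto_intros summable_LIMSEQ' sm)
  then have "(\<lambda>N. T - (\<Sum>n\<le>N. norm (f n))) \<longlonglongrightarrow> 0" by simp
  then have "(\<lambda>N. (\<Prod>p\<le>N. euler_fac s p) * zeta s - 1) \<longlonglongrightarrow> 0"
    by (rule Lim_null_comparison[rotated]) (use bound in simp)
  then show ?thesis by (rule LIM_zero_cancel)
qed

lemma zeta_nonzero:
  assumes "Re s > 1" shows "zeta s \<noteq> 0"
proof
  assume "zeta s = 0"
  with euler_product_aux[OF assms] have "(\<lambda>N::nat. 0::complex) \<longlonglongrightarrow> 1" by simp
  then show False by (simp add: LIMSEQ_const_iff)
qed

lemma euler_product:
  assumes "Re s > 1" shows "(\<lambda>N. \<Prod>p\<le>N. euler_fac s p) \<longlonglongrightarrow> 1 / zeta s"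
  using tendsto_divide[OF euler_product_aux[OF assms] tendsto_const[of "zeta s"] zeta_nonzero[OF assms]]
    zeta_nonzero[OF assms] by simp

lemma le_exp_minus_1: "x \<le> exp (x - 1)" for x :: real
  using exp_ge_add_one_self[of "x - 1"] by simp

text \<open>A form of the 3-4-1 inequality without logarithms. The bound x \<le> exp (x - 1),
  applied to the squared moduli, turns the product into an exponential with exponent 8 r^2 - 4 r (1
  + x)^2 for x = Re w; the subtracted square is the classical 3 + 4 cos + cos of the double angle.
  The term 8 r^2 is harmless because it is summable over primes.\<close>

lemma three_four_one_local:
  fixes r c :: real and w :: complex
  assumes "norm w = 1" "0 \<le> r" "r \<le> 1"
  shows "norm (1 - of_real r :: complex) ^ 3 * norm (1 - of_real r * w) ^ 4 * norm (1 - of_real r * w\<^sup>2) \<le> exp (4 * r\<^sup>2)"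
proof -
  define x where "x = Re w"
  define y where "y = Im w"
  have xy: "x\<^sup>2 + y\<^sup>2 = 1" using assms(1) by (simp add: x_def y_def cmod_def)
  define a where "a = (norm (1 - of_real r :: complex))\<^sup>2"
  have a: "a = (1 - r)\<^sup>2" by (simp add: a_def cmod_power2)
  define b where "b = (norm (1 - of_real r * w))\<^sup>2"
  define d where "d = (norm (1 - of_real r * w\<^sup>2))\<^sup>2"
  have b: "b = 1 - 2 * r * x + r\<^sup>2"
  proof -
    have "b = (1 - r * x)\<^sup>2 + (r * y)\<^sup>2" by (simp add: b_def cmod_power2 x_def y_def)
    also have "\<dots> = 1 - 2 * r * x + r\<^sup>2 * (x\<^sup>2 + y\<^sup>2)" by (simp add: power2_eq_square algebra_simps)
    finally show ?thesis by (simp add: xy)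
  qed
  have d: "d = 1 - 2 * r * (2 * x\<^sup>2 - 1) + r\<^sup>2"
  proof -
    have "d = (1 - r * (x\<^sup>2 - y\<^sup>2))\<^sup>2 + (r * (2 * x * y))\<^sup>2"
      by (simp add: d_def cmod_power2 x_def y_def Re_power2 Im_power2)
    also have "\<dots> = 1 - 2 * r * (x\<^sup>2 - y\<^sup>2) + r\<^sup>2 * (x\<^sup>2 + y\<^sup>2)\<^sup>2"
      by (simp add: power2_eq_square algebra_simps)
    also have "x\<^sup>2 - y\<^sup>2 = 2 * x\<^sup>2 - 1" using xy by simp
    finally show ?thesis by (simp add: xy)
  qed
  have "(norm (1 - of_real r :: complex) ^ 3 * norm (1 - of_real r * w) ^ 4 * norm (1 - of_real r * w\<^sup>2))\<^sup>2 = a ^ 3 * b ^ 4 * d"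
    by (simp add: a_def b_def d_def power_mult_distrib flip: power_mult)
  also have "\<dots> \<le> exp (a - 1) ^ 3 * exp (b - 1) ^ 4 * exp (d - 1)"
    by (intro mult_mono power_mono le_exp_minus_1) (auto simp: a_def b_def d_def)
  also have "\<dots> = exp (3 * (a - 1) + 4 * (b - 1) + (d - 1))"
    by (simp add: algebra_simps flip: exp_of_nat_mult exp_add)
  also have "3 * (a - 1) + 4 * (b - 1) + (d - 1) = 8 * r\<^sup>2 - 4 * r * (1 + x)\<^sup>2"
    by (simp add: a b d power2_eq_square algebra_simps)
  also have "exp (8 * r\<^sup>2 - 4 * r * (1 + x)\<^sup>2) \<le> exp (8 * r\<^sup>2)" using assms by simp
  also have "exp (8 * r\<^sup>2) = (exp (4 * r\<^sup>2))\<^sup>2" by (simp flip: exp_double)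
  finally show ?thesis by (rule power2_le_imp_le) simp
qed

lemma prod_exp_le:
  assumes "\<And>n. norm (f n) \<le> exp (4 * real n powr - 2)"
  shows "(\<Prod>p\<le>N. norm (f p)) \<le> exp (4 * (\<Sum>n. real n powr - 2))"
proof -
  have "(\<Prod>p\<le>N. norm (f p)) \<le> (\<Prod>p\<le>N. exp (4 * real p powr - 2))"
    by (intro prod_mono) (use assms in auto)
  also have "\<dots> = exp (4 * (\<Sum>p\<le>N. real p powr - 2))"
    by (simp add: exp_sum sum_distrib_left)
  also have "(\<Sum>p\<le>N. real p powr - 2) \<le> (\<Sum>n. real n powr - 2)"
    by (intro sum_le_suminf) (auto simp: summable_real_powr_iff)
  finally show ?thesis by simp
qed

text \<open>The local bounds multiply to exp (4 * sum of n^(-2)), uniformly in \<sigma> and t, and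
  the inequality passes to the limit of the partial Euler products. A constant C in place of the
  classical 1 is enough, since only orders of magnitude matter later.\<close>

lemma three_four_one:
  obtains C where "C > 0"
    "\<And>\<sigma> t. \<sigma> > 1 \<Longrightarrow> 1 \<le> C * (norm (zeta (of_real \<sigma>)) ^ 3 * norm (zeta (of_real \<sigma> + \<i> * of_real t)) ^ 4 * norm (zeta (of_real \<sigma> + \<i> * of_real (2 * t))))"
proof
  define C where "C = exp (4 * (\<Sum>n. real n powr - 2))"
  show "C > 0" by (simp add: C_def)
  fix \<sigma> t :: real assume \<sigma>: "\<sigma> > 1"
  define s where "s = (of_real \<sigma> :: complex)"
  define s' where "s' = of_real \<sigma> + \<i> * of_real t"
  define s'' where "s'' = of_real \<sigma> + \<i> * of_real (2 * t)"
  have re: "Re s > 1" "Re s' > 1" "Re s'' > 1" using \<sigma> by (auto simp: s_def s'_def s''_def)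
  define P where "P = (\<lambda>N. norm (\<Prod>p\<le>N. euler_fac s p) ^ 3 * norm (\<Prod>p\<le>N. euler_fac s' p) ^ 4 * norm (\<Prod>p\<le>N. euler_fac s'' p))"
  have "P N \<le> C" for N
  proof -
    have "P N = (\<Prod>p\<le>N. norm (euler_fac s p ^ 3 * euler_fac s' p ^ 4 * euler_fac s'' p))"
      by (simp add: P_def prod_norm[symmetric] norm_mult norm_power prod.distrib prod_power_distrib)
    also have "\<dots> \<le> C" unfolding C_def
    proof (rule prod_exp_le)
      fix p :: nat
      show "norm (euler_fac s p ^ 3 * euler_fac s' p ^ 4 * euler_fac s'' p) \<le> exp (4 * real p powr - 2)"
      proof (cases "prime p")
        case True
        have p: "p > 0" "p \<ge> 1" using True prime_gt_0_nat[of p] by auto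
        define r where "r = real p powr - \<sigma>"
        have r01: "0 \<le> r" "r \<le> 1"
          using powr_mono[of "-\<sigma>" 0 "real p"] p \<sigma> by (auto simp: r_def)
        define w where "w = (of_nat p :: complex) powr (-(\<i> * of_real t))"
        have r: "of_nat p powr (-s) = of_real r"
          using powr_of_real[of "real p" "-\<sigma>"] p by (simp add: s_def r_def)
        have w: "norm w = 1" using norm_powr_real_powr[of "of_nat p" "-(\<i> * of_real t)"] p by (simp add: w_def)
        have 1: "of_nat p powr (-s') = of_real r * w"
        proof -
          have "-s' = -s + -(\<i> * of_real t)" by (simp add: s_def s'_def)
          then show ?thesis by (simp only: powr_add r w_def)
        qed
        have 2: "of_nat p powr (-s'') = of_real r * w\<^sup>2"
        proof -
          have "-s'' = -s + -(\<i> * of_real t) + -(\<i> * of_real t)" by (simp add: s_def s''_def)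
          then show ?thesis by (simp only: powr_add r w_def power2_eq_square mult.assoc)
        qed
        have "norm (euler_fac s p ^ 3 * euler_fac s' p ^ 4 * euler_fac s'' p) \<le> exp (4 * r\<^sup>2)"
          using three_four_one_local[OF w, of r] r01 True
          by (simp add: euler_fac_def r 1 2 norm_mult norm_power)
        also have "r\<^sup>2 \<le> real p powr - 2"
          using \<sigma> p by (auto simp: r_def power2_eq_square intro!: powr_mono simp flip: powr_add)
        finally show ?thesis by simp
      qed (simp add: euler_fac_def)
    qed
    finally show ?thesis .
  qed
  moreover have "P \<longlonglongrightarrow> norm (1 / zeta s) ^ 3 * norm (1 / zeta s') ^ 4 * norm (1 / zeta s'')"
    unfolding P_def by (intro tendsto_intros euler_product re)
  ultimately have "norm (1 / zeta s) ^ 3 * norm (1 / zeta s') ^ 4 * norm (1 / zeta s'') \<le> C"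
    by (intro LIMSEQ_le_const2) auto
  then show "1 \<le> C * (norm (zeta s) ^ 3 * norm (zeta s') ^ 4 * norm (zeta s''))"
    using zeta_nonzero[OF re(1)] zeta_nonzero[OF re(2)] zeta_nonzero[OF re(3)]
    by (simp add: norm_divide field_simps)
qed

lemma norm_le_9: "\<lbrakk>-1 \<le> Re s; Re s \<le> 8\<rbrakk> \<Longrightarrow> norm (1 + s) \<le> 9 * nm (Im s)"
  using cmod_le[of "1 + s"] by auto

lemma xi_growth:
  assumes "0 < e" "e \<le> 1"
  shows "\<exists>C>0. \<forall>s. -e/2 \<le> Re s \<and> Re s \<le> 8 \<longrightarrow> norm (xi s) \<le> C * nm (Im s) powr e"
proof -
  obtain C where C: "C > 0" "\<And>s. Re s \<ge> -e/2 \<Longrightarrow> norm (xi s) \<le> C * norm (1 + s) powr e"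
    using norm_xi_le[OF assms] by blast
  have "norm (xi s) \<le> C * 9 powr e * nm (Im s) powr e" if s: "-e/2 \<le> Re s" "Re s \<le> 8" for s
  proof -
    have "norm (1 + s) powr e \<le> (9 * nm (Im s)) powr e"
      using s assms norm_le_9[of s] by (intro powr_mono2) auto
    also have "\<dots> = 9 powr e * nm (Im s) powr e" by (rule powr_mult)
    finally have "C * norm (1 + s) powr e \<le> C * (9 powr e * nm (Im s) powr e)"
      using C(1) by (intro mult_left_mono) auto
    then show ?thesis using C(2)[of s] s by (simp add: mult.assoc)
  qed
  then show ?thesis using C(1) by (intro exI[of _ "C * 9 powr e"]) auto
qed

text \<open>Cauchy's inequality on discs of radius e/2, which stay in the half plane
  \<open>Re s \<ge> -e/2\<close> where \<open>xi_growth\<close> applies.\<close>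

lemma deriv_xi_growth:
  assumes "0 < e" "e \<le> 1"
  shows "\<exists>C>0. \<forall>s. 0 \<le> Re s \<and> Re s \<le> 7 \<longrightarrow> norm (deriv xi s) \<le> C * nm (Im s) powr e"
proof -
  obtain C where C: "C > 0" "\<And>s. -e/2 \<le> Re s \<Longrightarrow> Re s \<le> 8 \<Longrightarrow> norm (xi s) \<le> C * nm (Im s) powr e"
    using xi_growth[OF assms] by blast
  have "norm (deriv xi s) \<le> C * 2 powr e / (e/2) * nm (Im s) powr e" if s: "0 \<le> Re s" "Re s \<le> 7" for s
  proof -
    have near: "\<bar>Re w - Re s\<bar> \<le> e/2 \<and> \<bar>Im w - Im s\<bar> \<le> e/2" if "w \<in> cball s (e/2)" for w
      using that abs_Re_le_cmod[of "w - s"] abs_Im_le_cmod[of "w - s"] by (auto simp: dist_norm norm_minus_commute)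
    have sub: "cball s (e/2) \<subseteq> {s. Re s > -1}"
    proof
      fix w assume "w \<in> cball s (e/2)"
      then have "\<bar>Re w - Re s\<bar> \<le> e/2" using near by blast
      then have "Re w > -1" using s assms by linarith
      then show "w \<in> {s. Re s > -1}" by simp
    qed
    have "norm ((deriv ^^ 1) xi s) \<le> fact 1 * (C * (2 * nm (Im s)) powr e) / (e/2) ^ 1"
    proof (rule Cauchy_inequality)
      show "xi holomorphic_on ball s (e/2)"
        by (rule holomorphic_on_subset[OF holomorphic_xi]) (use sub ball_subset_cball in blast)
      show "continuous_on (cball s (e/2)) xi"
        by (rule holomorphic_on_imp_continuous_on[OF holomorphic_on_subset[OF holomorphic_xi sub]])
      fix w assume "norm (s - w) = e/2"
      then have w: "\<bar>Re w - Re s\<bar> \<le> e/2 \<and> \<bar>Im w - Im s\<bar> \<le> e/2"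
        by (intro near) (auto simp: dist_norm)
      have "-e/2 \<le> Re w" "Re w \<le> 8" using conjunct1[OF w] s assms by linarith+
      then have "norm (xi w) \<le> C * nm (Im w) powr e" by (rule C(2))
      also have "\<dots> \<le> C * (2 * nm (Im s)) powr e"
      proof -
        have "1 + \<bar>Im w\<bar> \<le> 2 * nm (Im s)" using conjunct2[OF w] assms unfolding distrib_left by linarith
        then show ?thesis using C(1) assms by (intro mult_left_mono powr_mono2) auto
      qed
      finally show "norm (xi w) \<le> C * (2 * nm (Im s)) powr e" .
    qed (use assms in auto)
    also have "(2 * nm (Im s)) powr e = 2 powr e * nm (Im s) powr e" by (rule powr_mult)
    finally show ?thesis by (simp add: mult_ac)
  qed
  then show ?thesis using C(1) assms by (intro exI[of _ "C * 2 powr e / (e/2)"]) auto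
qed

lemma deriv_zeta_reg:
  assumes "Re s > -1"
  shows "(zeta_reg has_field_derivative (xi s + s * deriv xi s)) (at s)"
proof -
  have "(xi has_field_derivative deriv xi s) (at s)"
    using assms by (intro holomorphic_derivI[OF holomorphic_xi]) (auto simp: open_halfspace_Re_gt)
  then show ?thesis unfolding zeta_reg_def[abs_def]
    by (auto intro!: derivative_eq_intros)
qed

lemma deriv_zeta_reg_growth:
  assumes "0 < e" "e \<le> 1"
  shows "\<exists>C>0. \<forall>s. 0 \<le> Re s \<and> Re s \<le> 7 \<longrightarrow> norm (deriv zeta_reg s) \<le> C * nm (Im s) powr (1 + e)"
proof -
  obtain C where C: "C > 0" "\<And>s. -e/2 \<le> Re s \<Longrightarrow> Re s \<le> 8 \<Longrightarrow> norm (xi s) \<le> C * nm (Im s) powr e"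
    using xi_growth[OF assms] by blast
  obtain D where D: "D > 0" "\<And>s. 0 \<le> Re s \<Longrightarrow> Re s \<le> 7 \<Longrightarrow> norm (deriv xi s) \<le> D * nm (Im s) powr e"
    using deriv_xi_growth[OF assms] by blast
  have "norm (deriv zeta_reg s) \<le> (C + 7 * D) * nm (Im s) powr (1 + e)" if s: "0 \<le> Re s" "Re s \<le> 7" for s
  proof -
    define p where "p = 1 + \<bar>Im s\<bar>"
    have p: "p \<ge> 1" by (simp add: p_def)
    have "norm s \<le> 7 * p" using cmod_le[of s] s by (auto simp: p_def)
    have "deriv zeta_reg s = xi s + s * deriv xi s"
      using s by (intro DERIV_imp_deriv deriv_zeta_reg) auto
    also have "norm \<dots> \<le> norm (xi s) + norm s * norm (deriv xi s)"
      by (metis norm_mult norm_triangle_ineq)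
    also have "\<dots> \<le> C * p powr e + (7 * p) * (D * p powr e)"
      using C(2)[of s] D(2)[of s] s assms \<open>norm s \<le> 7 * p\<close> by (intro add_mono mult_mono) (auto simp: p_def)
    also have "\<dots> \<le> C * (p * p powr e) + (7 * p) * (D * p powr e)"
      using p C(1) by (intro add_right_mono mult_left_mono) (auto simp: mult_le_cancel_right1)
    also have "\<dots> = (C + 7 * D) * p powr (1 + e)"
      using p by (simp add: powr_add algebra_simps)
    finally show ?thesis by (simp add: p_def)
  qed
  then show ?thesis using C(1) D(1) by (intro exI[of _ "C + 7 * D"]) auto
qed

text \<open>Let p = 1 + |Im s|. To the right of the curve Re s = q^4 p^(-5 e) the 3-4-1 inequality
  gives the bound directly. To its left, a horizontal step onto the curve changes zeta by at most L
  p^e times the length of the step, that is L q^4 p^(-4 e), and a small q keeps this below half of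
  the bound already proved on the curve.\<close>

lemma zeta_lower_away:
  assumes "0 < e" "e \<le> 1" "0 < d" "d \<le> 1"
  shows "\<exists>c>0. \<forall>s. 0 \<le> Re s \<and> Re s \<le> 1 \<and> \<bar>Im s\<bar> \<ge> d \<longrightarrow> norm (zeta (1 + s)) \<ge> c * nm (Im s) powr (-4 * e)"
proof -
  obtain C where C: "C > 0" "\<And>s. -e/2 \<le> Re s \<Longrightarrow> Re s \<le> 8 \<Longrightarrow> norm (xi s) \<le> C * nm (Im s) powr e"
    using xi_growth[OF assms(1,2)] by blast
  obtain D where D: "D > 0" "\<And>s. 0 \<le> Re s \<Longrightarrow> Re s \<le> 7 \<Longrightarrow> norm (deriv xi s) \<le> D * nm (Im s) powr e"
    using deriv_xi_growth[OF assms(1,2)] by blast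
  obtain K where K: "K > 0" "\<And>\<sigma> t. \<sigma> > 1 \<Longrightarrow> 1 \<le> K * (norm (zeta (of_real \<sigma>)) ^ 3 * norm (zeta (of_real \<sigma> + \<i> * of_real t)) ^ 4 * norm (zeta (of_real \<sigma> + \<i> * of_real (2 * t))))"
    using three_four_one by blast
  define L where "L = max (1 / d + C) (1 / d\<^sup>2 + D)"
  have L: "L > 0" using C(1) assms by (auto simp: L_def less_max_iff_disj add_pos_pos)
  have up: "norm (zeta (1 + s)) \<le> L * nm (Im s) powr e" if "0 \<le> Re s" "Re s \<le> 1" "\<bar>Im s\<bar> \<ge> d" for s
  proof -
    have nz: "s \<noteq> 0" using that assms by auto
    have ge1: "nm (Im s) powr e \<ge> 1" using assms by (intro ge_one_powr_ge_zero) auto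
    have "norm s \<ge> d" using abs_Im_le_cmod[of s] that by linarith
    have "norm (zeta (1 + s)) \<le> norm (1 / s) + norm (xi s)"
      unfolding zeta_eq_xi[OF nz] by (rule norm_triangle_ineq)
    also have "\<dots> \<le> 1 / d * 1 + C * nm (Im s) powr e"
      using \<open>norm s \<ge> d\<close> assms C(2)[of s] that by (intro add_mono) (auto simp: norm_divide frac_le)
    also have "\<dots> \<le> 1 / d * nm (Im s) powr e + C * nm (Im s) powr e"
      using ge1 assms by (intro add_right_mono mult_left_mono) auto
    also have "\<dots> = (1 / d + C) * nm (Im s) powr e" by (simp add: algebra_simps)
    also have "\<dots> \<le> L * nm (Im s) powr e" by (intro mult_right_mono) (auto simp: L_def)
    finally show ?thesis .
  qed
  have lip: "norm (zeta (1 + s) - zeta (1 + s')) \<le> L * nm (Im s) powr e * norm (s - s')"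
    if "0 \<le> Re s" "Re s \<le> 1" "\<bar>Im s\<bar> \<ge> d" "0 \<le> Re s'" "Re s' \<le> 1" "Im s' = Im s" for s s'
  proof -
    define S where "S = {w. Im w = Im s} \<inter> ({w. Re w \<ge> 0} \<inter> {w. Re w \<le> 1})"
    have nz: "w \<noteq> 0" if "w \<in> S" for w using that \<open>\<bar>Im s\<bar> \<ge> d\<close> assms by (auto simp: S_def)
    have "norm ((1 / s + xi s) - (1 / s' + xi s')) \<le> L * nm (Im s) powr e * norm (s - s')"
    proof (rule field_differentiable_bound)
      show "convex S" unfolding S_def
        by (intro convex_Int convex_halfspace_Re_ge convex_halfspace_Re_le)
           (auto simp: convex_def distrib_right[symmetric])
      fix w assume w: "w \<in> S"
      have X: "(xi has_field_derivative deriv xi w) (at w)"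
        using w by (intro holomorphic_derivI[OF holomorphic_xi]) (auto simp: open_halfspace_Re_gt S_def)
      have Y: "((\<lambda>w. 1 / w) has_field_derivative -(1 / w\<^sup>2)) (at w)"
        using DERIV_inverse[OF nz[OF w]] by (simp add: inverse_eq_divide[abs_def] power2_eq_square)
      show "((\<lambda>w. 1 / w + xi w) has_field_derivative (-(1 / w\<^sup>2) + deriv xi w)) (at w within S)"
        by (rule has_field_derivative_at_within[OF DERIV_add[OF Y X]])
      have ge1: "nm (Im s) powr e \<ge> 1" using assms by (intro ge_one_powr_ge_zero) auto
      have "norm w \<ge> d" using abs_Im_le_cmod[of w] that w by (auto simp: S_def)
      have "norm (-(1 / w\<^sup>2) + deriv xi w) \<le> norm (-(1 / w\<^sup>2)) + norm (deriv xi w)"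
        by (rule norm_triangle_ineq)
      also have "norm (-(1 / w\<^sup>2)) \<le> 1 / d\<^sup>2"
        using \<open>norm w \<ge> d\<close> assms by (auto simp: norm_divide norm_power intro!: frac_le power_mono)
      also have "norm (deriv xi w) \<le> D * nm (Im s) powr e"
        using D(2)[of w] w by (auto simp: S_def)
      also have "1 / d\<^sup>2 + D * nm (Im s) powr e \<le> 1 / d\<^sup>2 * nm (Im s) powr e + D * nm (Im s) powr e"
        using mult_left_mono[OF ge1, of "1 / d\<^sup>2"] by simp
      also have "\<dots> = (1 / d\<^sup>2 + D) * nm (Im s) powr e" by (simp add: algebra_simps)
      also have "\<dots> \<le> L * nm (Im s) powr e" by (intro mult_right_mono) (auto simp: L_def)
      finally show "norm (-(1 / w\<^sup>2) + deriv xi w) \<le> L * nm (Im s) powr e" by simp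
    qed (use that in \<open>auto simp: S_def\<close>)
    moreover have "s \<noteq> 0" "s' \<noteq> 0" using that assms by auto
    ultimately show ?thesis by (simp add: zeta_eq_xi)
  qed
  define M where "M = K * (1 + C) ^ 3 * (L * 2)"
  have M: "M > 0" using K C L by (auto simp: M_def)
  define b where "b = (1 / M) powr (1/4)"
  have b: "b > 0" "b ^ 4 = 1 / M"
    using M by (simp_all add: b_def powr_power)
  \<comment> \<open>The choice L * q \<le> b / 2 is what makes the horizontal step cost at most half
    of the lower bound.\<close>
  define q where "q = min 1 (b / (2 * L))"
  have q: "q > 0" "q \<le> 1" "L * q \<le> b / 2" using b L by (auto simp: q_def min_def field_simps)
  \<comment> \<open>The factor at \<sigma> is at most (1 + C)/\<sigma> and the one at double height
    at most a multiple of p^e, so |zeta|^4 is at least \<sigma>^3 p^(-e) / M. With \<sigma> \<ge>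
    q^4 p^(-5 e) the fourth root is b q^3 p^(-4 e).\<close>
  have main: "norm (zeta (1 + s)) \<ge> b * q ^ 3 * nm (Im s) powr (-4 * e)"
    if s: "q ^ 4 * nm (Im s) powr (-5 * e) \<le> Re s" "Re s \<le> 1" "\<bar>Im s\<bar> \<ge> d" for s
  proof -
    define p where "p = 1 + \<bar>Im s\<bar>"
    have p: "p \<ge> 1" by (simp add: p_def)
    define \<sigma> where "\<sigma> = Re s"
    have sp: "q ^ 4 * p powr (-5 * e) \<le> \<sigma>" "\<sigma> \<le> 1" using s by (auto simp: p_def \<sigma>_def)
    have \<sigma>: "\<sigma> > 0" by (rule less_le_trans[OF _ sp(1)]) (use q p in auto)
    have "of_real (1 + \<sigma>) + \<i> * of_real (Im s) = 1 + s" by (simp add: complex_eq_iff \<sigma>_def)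
    then have 1: "1 \<le> K * (norm (zeta (1 + of_real \<sigma>)) ^ 3 * norm (zeta (1 + s)) ^ 4 * norm (zeta (1 + Complex \<sigma> (2 * Im s))))"
      using K(2)[of "1 + \<sigma>" "Im s"] \<sigma> by (simp add: Complex_eq add_ac)
    have 2: "norm (zeta (1 + of_real \<sigma>)) \<le> (1 + C) / \<sigma>"
    proof -
      have "norm (zeta (1 + of_real \<sigma>)) \<le> norm (1 / complex_of_real \<sigma>) + norm (xi (of_real \<sigma>))"
        using \<sigma> by (subst zeta_eq_xi) (auto intro: norm_triangle_ineq)
      also have "\<dots> \<le> 1 / \<sigma> + C * 1"
        using C(2)[of "of_real \<sigma>"] \<sigma> sp assms by (intro add_mono) (auto simp: norm_divide)
      also have "\<dots> \<le> 1 / \<sigma> + C * (1 / \<sigma>)"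
        using \<sigma> sp C(1) by (intro add_left_mono mult_left_mono) auto
      finally show ?thesis by (simp add: add_divide_distrib)
    qed
    have 3: "norm (zeta (1 + Complex \<sigma> (2 * Im s))) \<le> L * 2 * p powr e"
    proof -
      have "norm (zeta (1 + Complex \<sigma> (2 * Im s))) \<le> L * nm (2 * Im s) powr e"
        using up[of "Complex \<sigma> (2 * Im s)"] \<sigma> sp s by auto
      also have "\<dots> \<le> L * (2 * p) powr e"
        using L assms by (intro mult_left_mono powr_mono2) (auto simp: p_def)
      also have "\<dots> = L * (2 powr e * p powr e)" by (simp only: powr_mult)
      also have "\<dots> \<le> L * (2 powr 1 * p powr e)"
        using L assms by (intro mult_left_mono mult_right_mono powr_mono) auto
      finally show ?thesis by simp
    qed
    have "1 \<le> K * (((1 + C) / \<sigma>) ^ 3 * norm (zeta (1 + s)) ^ 4 * (L * 2 * p powr e))"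
      by (rule order_trans[OF 1]) (use K(1) 2 3 L p C(1) \<sigma> in \<open>intro mult_left_mono mult_mono power_mono; simp\<close>)
    also have "\<dots> = M * p powr e / \<sigma> ^ 3 * norm (zeta (1 + s)) ^ 4"
      by (simp add: M_def power_divide)
    finally have "\<sigma> ^ 3 * p powr (-e) / M \<le> norm (zeta (1 + s)) ^ 4"
      using \<sigma> M p by (simp add: field_simps powr_minus)
    moreover have "(b * q ^ 3 * p powr (-4 * e)) ^ 4 \<le> \<sigma> ^ 3 * p powr (-e) / M"
    proof -
      have "(b * q ^ 3 * p powr (-4 * e)) ^ 4 = (1 / M) * ((q ^ 4 * p powr (-5 * e)) ^ 3 * p powr (-e))"
        using p by (simp add: power_mult_distrib b powr_power flip: power_mult powr_add)
      also have "\<dots> \<le> (1 / M) * (\<sigma> ^ 3 * p powr (-e))"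
        using sp M q p by (intro mult_left_mono mult_right_mono power_mono) auto
      finally show ?thesis by simp
    qed
    ultimately have "(b * q ^ 3 * p powr (-4 * e)) ^ 4 \<le> norm (zeta (1 + s)) ^ 4" by linarith
    then show ?thesis unfolding p_def by (rule power_le_imp_le_base[of _ 3, simplified]) simp
  qed
  have "norm (zeta (1 + s)) \<ge> b * q ^ 3 / 2 * nm (Im s) powr (-4 * e)" if s: "0 \<le> Re s" "Re s \<le> 1" "\<bar>Im s\<bar> \<ge> d" for s
  proof -
    define p where "p = 1 + \<bar>Im s\<bar>"
    have p: "p \<ge> 1" by (simp add: p_def)
    define \<sigma> where "\<sigma> = q ^ 4 * p powr (-5 * e)"
    have "\<sigma> \<le> 1 * 1" unfolding \<sigma>_def
      using q p assms powr_mono[of "-5 * e" 0 p] by (intro mult_mono power_le_one) auto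
    show ?thesis
    proof (cases "\<sigma> \<le> Re s")
      case True
      then have "norm (zeta (1 + s)) \<ge> b * q ^ 3 * p powr (-4 * e)"
        using main[of s] s by (simp add: p_def \<sigma>_def)
      moreover have "b * q ^ 3 / 2 * p powr (-4 * e) \<le> b * q ^ 3 * p powr (-4 * e)"
        using b q by (intro mult_right_mono) auto
      ultimately show ?thesis by (simp add: p_def)
    next
      case False
      define w where "w = Complex \<sigma> (Im s)"
      have sg: "\<sigma> > 0" using q p by (simp add: \<sigma>_def)
      have w: "norm (zeta (1 + w)) \<ge> b * q ^ 3 * p powr (-4 * e)"
      proof -
        have reim: "Re w = \<sigma>" "1 + \<bar>Im w\<bar> = p" "Im w = Im s" by (simp_all add: w_def p_def)
        show ?thesis
          using main[of w, unfolded reim(1,2)] s(3) \<open>\<sigma> \<le> 1 * 1\<close> reim(3)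
          unfolding \<sigma>_def[symmetric] by simp
      qed
      have "norm (zeta (1 + w) - zeta (1 + s)) \<le> L * p powr e * norm (w - s)"
      proof -
        have reim: "Re w = \<sigma>" "Im w = Im s" by (simp_all add: w_def)
        have le: "0 \<le> \<sigma>" "\<sigma> \<le> 1" using sg \<open>\<sigma> \<le> 1 * 1\<close> by linarith+
        show ?thesis
          using lip[of w s, unfolded reim, OF le s(3,1,2) refl] unfolding p_def .
      qed
      also have "norm (w - s) = \<sigma> - Re s" using False by (simp add: w_def cmod_def)
      also have "L * p powr e * (\<sigma> - Re s) \<le> L * p powr e * \<sigma>"
        using s L by (intro mult_left_mono) auto
      also have "L * p powr e * \<sigma> = L * q ^ 4 * (p powr e * p powr (-5 * e))"
        by (simp add: \<sigma>_def)
      also have "p powr e * p powr (-5 * e) = p powr (-4 * e)"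
        by (simp flip: powr_add)
      also have "L * q ^ 4 * p powr (-4 * e) = (L * q) * q ^ 3 * p powr (-4 * e)"
        by (simp add: eval_nat_numeral)
      also have "\<dots> \<le> (b / 2) * q ^ 3 * p powr (-4 * e)"
        using q by (intro mult_right_mono) auto
      finally have "norm (zeta (1 + w) - zeta (1 + s)) \<le> b * q ^ 3 / 2 * p powr (-4 * e)" by simp
      moreover have "norm (zeta (1 + w)) \<le> norm (zeta (1 + w) - zeta (1 + s)) + norm (zeta (1 + s))"
        using norm_triangle_ineq[of "zeta (1 + w) - zeta (1 + s)" "zeta (1 + s)"] by simp
      moreover have "b * q ^ 3 * p powr (-4 * e) = b * q ^ 3 / 2 * p powr (-4 * e) + b * q ^ 3 / 2 * p powr (-4 * e)"
        by simp
      ultimately show ?thesis using w by (simp add: p_def)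
    qed
  qed
  then show ?thesis using b q by (intro exI[of _ "b * q ^ 3 / 2"]) auto
qed

text \<open>Near 0 the function is close to its value 1; away from 0 the bound for zeta with e/4 is
  multiplied by |s|. The estimate includes the imaginary axis, where the limiting integrands
  live.\<close>

lemma zeta_reg_lower:
  assumes "0 < e" "e \<le> 1"
  shows "\<exists>c>0. \<exists>d>0. d \<le> 1 \<and> (\<forall>s. 0 \<le> Re s \<and> Re s \<le> d \<longrightarrow> norm (zeta_reg s) \<ge> c * nm (Im s) powr (1 - e))"
proof -
  have "isCont zeta_reg 0"
    using continuous_zeta_reg by (rule continuous_on_interior) (simp add: interior_open open_halfspace_Re_gt)
  then obtain r where r: "r > 0" "\<And>s. norm s < r \<Longrightarrow> norm (zeta_reg s - 1) < 1/2"
    unfolding continuous_at_eps_delta by (metis zero_less_divide_1_iff zero_less_numeral dist_norm diff_zero zeta_reg_0)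
  define d where "d = min 1 (r / 3)"
  have d: "d > 0" "d \<le> 1" "2 * d < r" using r by (auto simp: d_def min_def)
  obtain c where c: "c > 0" "\<And>s. 0 \<le> Re s \<Longrightarrow> Re s \<le> 1 \<Longrightarrow> \<bar>Im s\<bar> \<ge> d \<Longrightarrow> norm (zeta (1 + s)) \<ge> c * nm (Im s) powr (-4 * (e/4))"
    using zeta_lower_away[of "e/4" d] assms d by auto
  have "norm (zeta_reg s) \<ge> min (1/4) (c * (d / 2)) * nm (Im s) powr (1 - e)" if s: "0 \<le> Re s" "Re s \<le> d" for s
  proof (cases "\<bar>Im s\<bar> \<ge> d")
    case True
    define p where "p = 1 + \<bar>Im s\<bar>"
    have p: "p \<ge> 1" by (simp add: p_def)
    have "d * nm (Im s) \<le> 2 * \<bar>Im s\<bar>"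
    proof -
      have "d * \<bar>Im s\<bar> \<le> 1 * \<bar>Im s\<bar>" using d by (intro mult_right_mono) auto
      with True show ?thesis by (simp add: algebra_simps)
    qed
    then have im: "d / 2 * p \<le> norm s" using abs_Im_le_cmod[of s] by (simp add: p_def)
    have nz: "s \<noteq> 0" using True d by auto
    have "min (1/4) (c * (d / 2)) * p powr (1 - e) \<le> c * (d / 2) * p powr (1 - e)"
      by (intro mult_right_mono) auto
    also have "\<dots> = (d / 2 * p) * (c * p powr (-e))" using p by (simp add: powr_diff powr_minus field_simps)
    also have "\<dots> \<le> norm s * norm (zeta (1 + s))"
      using im c(2)[of s] s d True c(1) by (intro mult_mono) (auto simp: p_def)
    also have "\<dots> = norm (zeta_reg s)" using nz by (simp add: zeta_eq_reg norm_divide)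
    finally show ?thesis by (simp add: p_def)
  next
    case False
    have "norm s < r" using cmod_le[of s] s False d by auto
    then have "norm (zeta_reg s - 1) < 1/2" by (rule r)
    then have "norm (zeta_reg s) \<ge> 1/2"
      using norm_triangle_ineq2[of 1 "1 - zeta_reg s"] by (simp add: norm_minus_commute)
    moreover have "min (1/4) (c * (d / 2)) * nm (Im s) powr (1 - e) \<le> 1/4 * 2"
    proof (intro mult_mono)
      have "nm (Im s) powr (1 - e) \<le> nm (Im s) powr 1" using assms by (intro powr_mono) auto
      also have "\<dots> \<le> 2" using False d by auto
      finally show "nm (Im s) powr (1 - e) \<le> 2" .
    qed auto
    ultimately show ?thesis by linarith
  qed
  moreover have "min (1/4) (c * (d / 2)) > 0" using c d by simp
  ultimately show ?thesis using d by blast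
qed

lemma zeta_cnj: "Re s > 0 \<Longrightarrow> s \<noteq> 1 \<Longrightarrow> zeta (cnj s) = cnj (zeta s)"
proof -
  assume s: "Re s > 0" "s \<noteq> 1"
  define w where "w = s - 1"
  have w: "w \<noteq> 0" "Re w > -1" "s = 1 + w" "cnj w \<noteq> 0" using s by (auto simp: w_def)
  have pw: "cnj (of_nat (Suc m) powr a) = of_nat (Suc m) powr (cnj a)" for m a
    by (subst cnj_powr) auto
  have t: "xi_term m (cnj w) = cnj (xi_term m w)" for m
    unfolding xi_term_eq[OF w(1)] xi_term_eq[OF w(4)] by (simp add: pw del: of_nat_Suc)
  have "summable (\<lambda>m. xi_term m w)"
    using summable_norm_cancel[OF summable_xi_term[OF w(2)]] .
  then have "xi (cnj w) = cnj (xi w)"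
    unfolding xi_def t by (rule bounded_linear.suminf[OF bounded_linear_cnj, symmetric])
  then show ?thesis
    using zeta_eq_xi[OF w(1)] zeta_eq_xi[OF w(4)] by (simp add: w(3))
qed

text \<open>Weierstrass's test for products, on an arbitrary index space because it is applied to
  functions of 2k complex variables. Both claims rest on the majorant exp (\<Sum> M).\<close>

lemma uniformly_convergent_prod_M_test:
  fixes f :: "nat \<Rightarrow> 'a :: topological_space \<Rightarrow> complex"
  assumes le: "\<And>n x. x \<in> A \<Longrightarrow> norm (f n x - 1) \<le> M n" and sm: "summable M"
  shows "uniformly_convergent_on A (\<lambda>N x. \<Prod>n<N. f n x)"
    and "\<And>x N. x \<in> A \<Longrightarrow> norm (\<Prod>n<N. f n x) \<le> exp (\<Sum>n. M n)"
proof -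
  show bd: "norm (\<Prod>n<N. f n x) \<le> exp (\<Sum>n. M n)" if x: "x \<in> A" for x N
  proof -
    have "norm (\<Prod>n<N. f n x) = (\<Prod>n<N. norm (f n x))" by (simp add: prod_norm)
    also have "\<dots> \<le> (\<Prod>n<N. 1 + M n)"
    proof (intro prod_mono conjI)
      fix n
      show "norm (f n x) \<le> 1 + M n"
        using le[OF x, of n] norm_triangle_ineq[of "f n x - 1" 1] by simp
    qed simp
    also have "\<dots> \<le> exp (\<Sum>n<N. M n)"
      using le[OF x] norm_ge_zero order_trans by (intro prod_le_exp_sum) blast
    also have "(\<Sum>n<N. M n) \<le> (\<Sum>n. M n)"
      using le[OF x] norm_ge_zero order_trans by (intro sum_le_suminf sm) blast+
    finally show ?thesis by simp
  qed
  show "uniformly_convergent_on A (\<lambda>N x. \<Prod>n<N. f n x)"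
  proof (rule uniformly_convergent_prod_Cauchy)
    fix e :: real assume e: "e > 0"
    \<comment> \<open>A tail of M below ln (1 + e) keeps the corresponding partial product within
      exp (ln (1 + e)) - 1 = e of 1.\<close>
    have "ln (1 + e) > 0" using e by simp
    then obtain N where N: "\<And>m n. m \<ge> N \<Longrightarrow> norm (sum M {m..<n}) < ln (1 + e)"
      using sm unfolding summable_Cauchy by blast
    show "\<exists>M. \<forall>x\<in>A. \<forall>m\<ge>M. \<forall>n\<ge>m. dist (\<Prod>k=m..n. f k x) 1 < e"
    proof (intro exI[of _ N] ballI allI impI)
      fix x m n assume x: "x \<in> A" and m: "N \<le> m" "m \<le> n"
      have "dist (\<Prod>k=m..n. f k x) 1 = norm ((\<Prod>k=m..n. 1 + (f k x - 1)) - 1)"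
        by (simp add: dist_norm)
      also have "\<dots> \<le> (\<Prod>k=m..n. 1 + norm (f k x - 1)) - 1"
        by (rule norm_prod_minus1_le_prod_minus1)
      also have "(\<Prod>k=m..n. 1 + norm (f k x - 1)) \<le> (\<Prod>k=m..n. 1 + M k)"
        by (intro prod_mono) (use le[OF x] in auto)
      also have "\<dots> \<le> exp (\<Sum>k=m..n. M k)"
        using le[OF x] norm_ge_zero order_trans by (intro prod_le_exp_sum) blast
      also have "(\<Sum>k=m..n. M k) < ln (1 + e)"
        using N[OF m(1), of "Suc n"] by (simp add: atLeastLessThanSuc_atLeastAtMost)
      finally show "dist (\<Prod>k=m..n. f k x) 1 < e" using e by simp
    qed
  qed (use bd in auto)
qed

section \<open>The extension of \<open>G\<close>\<close>

definition Odd_sets :: "nat \<Rightarrow> nat set set" where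
  "Odd_sets k = {S. S \<subseteq> {..<2*k} \<and> odd (card S)}"

definition Even_sets :: "nat \<Rightarrow> nat set set" where
  "Even_sets k = {S. S \<subseteq> {..<2*k} \<and> even (card S) \<and> card S \<ge> 2}"

definition Mfac :: "nat \<Rightarrow> (nat \<Rightarrow> complex) \<Rightarrow> nat \<Rightarrow> complex" where
  "Mfac k s p = (if prime p then
       1 - 1 / of_nat p + (1 / of_nat p) * (\<Prod>j<2*k. 1 - (of_nat p) powr (- s j))
     else 1)"

text \<open>The local factor of G. Since \<open>euler_fac\<close> is the reciprocal Euler factor of
  zeta, the even sets stand in the numerator and the odd ones in the denominator.\<close>

definition gfac :: "nat \<Rightarrow> (nat \<Rightarrow> complex) \<Rightarrow> nat \<Rightarrow> complex" where
  "gfac k s p = Mfac k s p * (\<Prod>S\<in>Even_sets k. euler_fac (1 + sS s S) p) / (\<Prod>S\<in>Odd_sets k. euler_fac (1 + sS s S) p)"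

definition Gext :: "nat \<Rightarrow> (nat \<Rightarrow> complex) \<Rightarrow> complex" where
  "Gext k s = lim (\<lambda>N. \<Prod>p<N. gfac k s p)"

text \<open>With at most 2k summands, the bound -1/(8k) gives Re (1 + s_S) \<ge> 3/4 for every S, so
  that squares of the terms are of size p^(-3/2), which is summable.\<close>

definition Gregion :: "nat \<Rightarrow> (nat \<Rightarrow> complex) set" where
  "Gregion k = {s. \<forall>j<2*k. Re (s j) \<ge> -(1 / (8 * real k))}"

lemma finite_Odd_sets [simp]: "finite (Odd_sets k)"
  by (rule finite_subset[of _ "Pow {..<2*k}"]) (auto simp: Odd_sets_def)

lemma finite_Even_sets [simp]: "finite (Even_sets k)"
  by (rule finite_subset[of _ "Pow {..<2*k}"]) (auto simp: Even_sets_def)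

lemma finite_memb: "S \<subseteq> {..<2*k} \<Longrightarrow> finite (S :: nat set)"
  by (rule finite_subset) auto

lemma Odd_Even_sets:
  "Odd_sets k \<union> Even_sets k = Pow {..<2*k} - {{}}" "Odd_sets k \<inter> Even_sets k = {}"
proof -
  have "card S \<ge> 2" if "S \<subseteq> {..<2*k}" "even (card S)" "S \<noteq> {}" for S
  proof -
    have "card S \<noteq> 0" using that finite_memb by auto
    with that show ?thesis by (cases "card S = 1") auto
  qed
  then show "Odd_sets k \<union> Even_sets k = Pow {..<2*k} - {{}}"
    by (auto simp: Odd_sets_def Even_sets_def)
qed (auto simp: Odd_sets_def Even_sets_def)

text \<open>The empty set contributes 1/p, which cancels the -1/p in the Euler factor of M.\<close>

lemma Mfac_expand:
  assumes "prime p"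
  shows "Mfac k s p = 1 + (\<Sum>S\<in>Pow {..<2*k} - {{}}. (-1) ^ card S * of_nat p powr (-(1 + sS s S)))"
proof -
  have p: "p > 0" using assms prime_gt_0_nat by blast
  have pr: "(\<Prod>j\<in>S. of_nat p powr (- s j)) = of_nat p powr (- sS s S)" if "finite S" for S
    unfolding sS_def using that p
    by (induction S rule: finite_induct) (auto simp flip: powr_add simp: add.commute)
  have "(\<Prod>j<2*k. 1 - of_nat p powr (- s j)) = (\<Prod>j<2*k. - (of_nat p powr (- s j)) + 1)" by simp
  also have "\<dots> = (\<Sum>S\<in>Pow {..<2*k}. (\<Prod>j\<in>S. - (of_nat p powr (- s j))) * (\<Prod>j\<in>{..<2*k} - S. 1))"
    by (rule prod_add) auto
  also have "\<dots> = (\<Sum>S\<in>Pow {..<2*k}. (-1) ^ card S * of_nat p powr (- sS s S))"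
  proof (intro sum.cong refl)
    fix S assume "S \<in> Pow {..<2*k}"
    then have fin: "finite S" using finite_memb by auto
    have "(\<Prod>j\<in>S. - (of_nat p powr (- s j))) = (\<Prod>j\<in>S. (-1) * of_nat p powr (- s j))" by simp
    also have "\<dots> = (-1) ^ card S * of_nat p powr (- sS s S)"
      unfolding prod.distrib pr[OF fin] by simp
    finally show "(\<Prod>j\<in>S. - (of_nat p powr (- s j))) * (\<Prod>j\<in>{..<2*k} - S. 1) = (-1) ^ card S * of_nat p powr (- sS s S)" by simp
  qed
  also have "\<dots> = 1 + (\<Sum>S\<in>Pow {..<2*k} - {{}}. (-1) ^ card S * of_nat p powr (- sS s S))"
    using p by (subst sum.remove[of _ "{}"]) (auto simp: sS_def)
  finally have "Mfac k s p = 1 + (1 / of_nat p) * (\<Sum>S\<in>Pow {..<2*k} - {{}}. (-1) ^ card S * of_nat p powr (- sS s S))"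
    using assms by (simp add: Mfac_def algebra_simps)
  also have "(1 / of_nat p) * (\<Sum>S\<in>Pow {..<2*k} - {{}}. (-1) ^ card S * of_nat p powr (- sS s S)) =
     (\<Sum>S\<in>Pow {..<2*k} - {{}}. (-1) ^ card S * of_nat p powr (-(1 + sS s S)))"
    unfolding sum_distrib_left using p
    by (intro sum.cong refl) (simp add: powr_diff powr_minus field_simps)
  finally show ?thesis .
qed

text \<open>The relation A = 1 + a + O(e^2) with a = O(e). The constant is explicit so that it
  passes through finite products uniformly in p and s.\<close>

definition first_order :: "real \<Rightarrow> real \<Rightarrow> complex \<Rightarrow> complex \<Rightarrow> bool" where
  "first_order e C A a \<longleftrightarrow> norm (A - (1 + a)) \<le> C * e\<^sup>2 \<and> norm a \<le> C * e"

lemma first_order_mult: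
  assumes A: "first_order e C A a" and B: "first_order e D B b" and e: "0 \<le> e" "e \<le> 1" and CD: "0 \<le> C" "0 \<le> D"
  shows "first_order e (C + D + 4 * C * D) (A * B) (a + b)"
proof -
  have a: "norm (A - (1 + a)) \<le> C * e\<^sup>2" "norm a \<le> C * e" and b: "norm (B - (1 + b)) \<le> D * e\<^sup>2" "norm b \<le> D * e"
    using A B by (auto simp: first_order_def)
  have e2: "e\<^sup>2 \<le> 1" using e by (simp add: power_le_one)
  have C1: "C * e \<le> C * 1" "D * e \<le> D * 1" "D * e\<^sup>2 \<le> D * 1" using CD e e2 by (intro mult_left_mono; simp)+
  have nB: "norm B \<le> 1 + 2 * D"
  proof -
    have "norm ((B - (1 + b)) + (1 + b)) \<le> norm (B - (1 + b)) + (norm (1::complex) + norm b)"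
      by (meson add_left_mono norm_triangle_ineq order_trans)
    then show ?thesis using b C1 by simp
  qed
  have na: "norm (1 + a) \<le> 1 + C"
    using norm_triangle_ineq[of 1 a] a C1 by simp
  have "A * B - (1 + (a + b)) = (A - (1 + a)) * B + ((1 + a) * (B - (1 + b)) + a * b)"
    by (simp add: algebra_simps)
  then have "norm (A * B - (1 + (a + b))) \<le> norm (A - (1 + a)) * norm B + (norm (1 + a) * norm (B - (1 + b)) + norm a * norm b)"
    by (metis (no_types, lifting) add_left_mono norm_mult norm_triangle_ineq order_trans)
  also have "\<dots> \<le> (C * e\<^sup>2) * (1 + 2 * D) + ((1 + C) * (D * e\<^sup>2) + (C * e) * (D * e))"
    using a b nB na CD e by (intro add_mono mult_mono) auto
  also have "\<dots> = (C + D + 4 * C * D) * e\<^sup>2" by (simp add: power2_eq_square algebra_simps)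
  finally have 1: "norm (A * B - (1 + (a + b))) \<le> (C + D + 4 * C * D) * e\<^sup>2" .
  have "norm (a + b) \<le> C * e + D * e" using a b norm_triangle_ineq[of a b] by linarith
  also have "\<dots> \<le> (C + D + 4 * C * D) * e"
    using CD e by (simp add: algebra_simps)
  finally show ?thesis using 1 by (simp add: first_order_def)
qed

lemma first_order_prod:
  assumes "finite T" "0 \<le> C"
  shows "\<exists>K\<ge>0. \<forall>e A a. 0 \<le> e \<longrightarrow> e \<le> 1 \<longrightarrow> (\<forall>S\<in>T. first_order e C (A S) (a S)) \<longrightarrow> first_order e K (\<Prod>S\<in>T. A S) (\<Sum>S\<in>T. a S)"
  using assms(1)
proof (induction T rule: finite_induct)
  case empty
  show ?case by (intro exI[of _ 0]) (auto simp: first_order_def)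
next
  case (insert S T)
  then obtain K where K: "K \<ge> 0" "\<And>e A a. 0 \<le> e \<Longrightarrow> e \<le> 1 \<Longrightarrow> (\<forall>S\<in>T. first_order e C (A S) (a S)) \<Longrightarrow> first_order e K (\<Prod>S\<in>T. A S) (\<Sum>S\<in>T. a S)"
    by blast
  show ?case
  proof (intro exI[of _ "C + K + 4 * C * K"] conjI allI impI)
    fix e :: real and A a
    assume e: "0 \<le> e" "e \<le> 1" and A: "\<forall>S\<in>insert S T. first_order e C (A S) (a S)"
    then show "first_order e (C + K + 4 * C * K) (\<Prod>S\<in>insert S T. A S) (\<Sum>S\<in>insert S T. a S)"
      using insert.hyps K assms(2) by (simp add: first_order_mult)
  qed (use K assms(2) in auto)
qed

text \<open>The geometric series to first order; 5/2 is the reciprocal of 1 - 3/5, the lower bound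
  for |1 - y|.\<close>

lemma first_order_inverse:
  assumes "norm y \<le> e" "e \<le> 3/5"
  shows "first_order e (5/2) (1 / (1 - y)) y"
proof -
  have "norm (1 - y) \<ge> 1 - norm y" using norm_triangle_ineq2[of 1 y] by simp
  then have n: "norm (1 - y) \<ge> 2/5" using assms by simp
  then have nz: "1 - y \<noteq> 0" by auto
  have "1 / (1 - y) - (1 + y) = y\<^sup>2 / (1 - y)"
    using nz by (simp add: field_simps power2_eq_square)
  then have "norm (1 / (1 - y) - (1 + y)) = (norm y)\<^sup>2 / norm (1 - y)"
    by (simp add: norm_divide norm_power)
  also have "\<dots> \<le> e\<^sup>2 / (2/5)"
    using n assms by (intro frac_le power_mono) auto
  also have "\<dots> = 5/2 * e\<^sup>2" by simp
  finally have "norm (1 / (1 - y) - (1 + y)) \<le> 5/2 * e\<^sup>2" .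
  moreover have "norm y \<le> 5/2 * e" using assms(1) norm_ge_zero[of y] by linarith
  ultimately show ?thesis by (simp add: first_order_def)
qed

text \<open>The worst case is p = 2. The bound keeps every \<open>euler_fac\<close> in the extended
  region away from 0, so that division by it is harmless.\<close>

lemma prime_powr_le_3_5: "prime p \<Longrightarrow> real p powr (-3/4) \<le> 3/5"
proof -
  assume "prime p"
  then have "p \<ge> 2" by (simp add: prime_ge_2_nat)
  then have "real p powr (-3/4) \<le> 2 powr (-3/4)" by (intro powr_mono2') auto
  also have "\<dots> \<le> 3/5"
  proof (rule power_le_imp_le_base[of _ 3, simplified])
    have "(2 powr (-3/4) :: real) ^ 4 = 2 powr -3" by (simp add: powr_power)
    also have "\<dots> = 1/8" by (simp add: powr_minus powr_numeral)
    also have "\<dots> \<le> (3/5)^4" by (simp add: power_numeral_reduce)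
    finally show "(2 powr (-3/4) :: real) ^ 4 \<le> (3/5) ^ 4" .
  qed auto
  finally show ?thesis .
qed

lemma norm_euler_term_le:
  assumes "s \<in> Gregion k" "S \<subseteq> {..<2*k}" "prime p"
  shows "norm (of_nat p powr (-(1 + sS s S)) :: complex) \<le> real p powr (-3/4)"
proof -
  have p: "p \<ge> 1" using assms(3) prime_ge_1_nat by blast
  have "(\<Sum>j\<in>S. -(1 / (8 * real k))) \<le> (\<Sum>j\<in>S. Re (s j))"
    using assms by (intro sum_mono) (auto simp: Gregion_def)
  moreover have "real (card S) \<le> 2 * real k"
    using card_mono[OF _ assms(2)] by simp
  then have "real (card S) * (1 / (8 * real k)) \<le> 1 / 4"
    by (cases "k = 0") (simp_all add: field_simps)
  ultimately have "Re (sS s S) \<ge> -1/4"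
    by (simp add: sS_def)
  have "norm (of_nat p powr (-(1 + sS s S)) :: complex) = real p powr (-(1 + Re (sS s S)))"
    using p by (subst norm_powr_real_powr) auto
  also have "\<dots> \<le> real p powr (-3/4)"
  proof (rule powr_mono)
    have "3/4 \<le> 1 + Re (sS s S)" using \<open>Re (sS s S) \<ge> -1/4\<close> by linarith
    then show "-(1 + Re (sS s S)) \<le> -3/4" by simp
  qed (use p in simp)
  finally show ?thesis .
qed

lemma euler_fac_nonzero:
  assumes "s \<in> Gregion k" "S \<subseteq> {..<2*k}"
  shows "euler_fac (1 + sS s S) p \<noteq> 0"
proof (cases "prime p")
  case True
  have "norm (of_nat p powr (-(1 + sS s S)) :: complex) \<le> 3/5"
    using norm_euler_term_le[OF assms True] prime_powr_le_3_5[OF True] by simp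
  then show ?thesis using True by (auto simp: euler_fac_def)
qed (simp add: euler_fac_def)

text \<open>Each nonempty S enters M to first order with the sign (-1)^|S|, and the Euler factors
  attached to S contribute the opposite of it. All first order terms cancel, which leaves e^2 =
  p^(-3/2) for e = p^(-3/4). This cancellation is the reason why G extends beyond Re s_j >
  0.\<close>

lemma gfac_bound:
  "\<exists>K\<ge>0. \<forall>s\<in>Gregion k. \<forall>p. norm (gfac k s p - 1) \<le> K * real p powr (-3/2)"
proof -
  obtain K1 where K1: "K1 \<ge> 0" "\<And>e A a. 0 \<le> e \<Longrightarrow> e \<le> 1 \<Longrightarrow> (\<forall>S\<in>Even_sets k. first_order e 1 (A S) (a S)) \<Longrightarrow> first_order e K1 (\<Prod>S\<in>Even_sets k. A S) (\<Sum>S\<in>Even_sets k. a S)"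
    using first_order_prod[of "Even_sets k" 1] by auto
  obtain K2 where K2: "K2 \<ge> 0" "\<And>e A a. 0 \<le> e \<Longrightarrow> e \<le> 1 \<Longrightarrow> (\<forall>S\<in>Odd_sets k. first_order e (5/2) (A S) (a S)) \<Longrightarrow> first_order e K2 (\<Prod>S\<in>Odd_sets k. A S) (\<Sum>S\<in>Odd_sets k. a S)"
    using first_order_prod[of "Odd_sets k" "5/2"] by auto
  define K0 where "K0 = real (card (Pow {..<2*k} - {{}}))"
  have K0: "K0 \<ge> 0" by (simp add: K0_def)
  define K3 where "K3 = K0 + K1 + 4 * K0 * K1"
  define K where "K = K3 + K2 + 4 * K3 * K2"
  have pos: "K3 \<ge> 0" "K \<ge> 0" using K0 K1 K2 by (auto simp: K3_def K_def)
  have "norm (gfac k s p - 1) \<le> K * real p powr (-3/2)" if s: "s \<in> Gregion k" for s p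
  proof (cases "prime p")
    case False
    then show ?thesis using pos by (simp add: gfac_def Mfac_def euler_fac_def)
  next
    case True
    define e where "e = real p powr (-3/4)"
    have e: "0 \<le> e" "e \<le> 3/5" using prime_powr_le_3_5[OF True] by (auto simp: e_def)
    define y where "y = (\<lambda>S. of_nat p powr (-(1 + sS s S)) :: complex)"
    have y: "norm (y S) \<le> e" if "S \<subseteq> {..<2*k}" for S
      unfolding y_def e_def by (rule norm_euler_term_le[OF s that True])
    define m where "m = (\<Sum>S\<in>Pow {..<2*k} - {{}}. (-1) ^ card S * y S)"
    have M: "first_order e K0 (Mfac k s p) m"
    proof -
      have "norm m \<le> (\<Sum>S\<in>Pow {..<2*k} - {{}}. e)"
        unfolding m_def using y by (intro sum_norm_le) (auto simp: norm_mult norm_power)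
      moreover have "Mfac k s p = 1 + m" by (simp only: Mfac_expand[OF True] m_def y_def)
      ultimately show ?thesis
        using e by (simp add: first_order_def K0_def)
    qed
    have ef: "euler_fac (1 + sS s S) p = 1 - y S" for S
      unfolding euler_fac_def y_def using True by simp
    have E: "first_order e K1 (\<Prod>S\<in>Even_sets k. euler_fac (1 + sS s S) p) (\<Sum>S\<in>Even_sets k. - y S)"
      unfolding ef using e y by (intro K1(2)) (auto simp: first_order_def Even_sets_def)
    have O: "first_order e K2 (\<Prod>S\<in>Odd_sets k. 1 / euler_fac (1 + sS s S) p) (\<Sum>S\<in>Odd_sets k. y S)"
      unfolding ef using e y
      by (intro K2(2)) (auto simp: Odd_sets_def intro!: first_order_inverse)
    have "first_order e K (Mfac k s p * (\<Prod>S\<in>Even_sets k. euler_fac (1 + sS s S) p) * (\<Prod>S\<in>Odd_sets k. 1 / euler_fac (1 + sS s S) p))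
       (m + (\<Sum>S\<in>Even_sets k. - y S) + (\<Sum>S\<in>Odd_sets k. y S))"
      unfolding K_def K3_def using M E O e K0 K1(1) K2(1)
      by (intro first_order_mult) auto
    moreover have "m + (\<Sum>S\<in>Even_sets k. - y S) + (\<Sum>S\<in>Odd_sets k. y S) = 0"
    proof -
      have "m = (\<Sum>S\<in>Odd_sets k. (-1) ^ card S * y S) + (\<Sum>S\<in>Even_sets k. (-1) ^ card S * y S)"
        unfolding m_def Odd_Even_sets(1)[symmetric] by (rule sum.union_disjoint) (auto simp: Odd_Even_sets)
      also have "(\<Sum>S\<in>Odd_sets k. (-1) ^ card S * y S) = (\<Sum>S\<in>Odd_sets k. - y S)"
        by (intro sum.cong) (auto simp: Odd_sets_def)
      also have "(\<Sum>S\<in>Even_sets k. (-1) ^ card S * y S) = (\<Sum>S\<in>Even_sets k. y S)"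
        by (intro sum.cong) (auto simp: Even_sets_def)
      finally show ?thesis by (simp add: sum_negf)
    qed
    moreover have "Mfac k s p * (\<Prod>S\<in>Even_sets k. euler_fac (1 + sS s S) p) * (\<Prod>S\<in>Odd_sets k. 1 / euler_fac (1 + sS s S) p) = gfac k s p"
      by (simp add: gfac_def prod_dividef)
    ultimately have "norm (gfac k s p - 1) \<le> K * e\<^sup>2"
      by (simp add: first_order_def)
    also have "e\<^sup>2 = real p powr (-3/2)" by (simp add: e_def power2_eq_square flip: powr_add)
    finally show ?thesis .
  qed
  with pos show ?thesis by blast
qed

lemma Gext_props:
  shows uniform_limit_Gext: "uniform_limit (Gregion k) (\<lambda>N s. \<Prod>p<N. gfac k s p) (Gext k) sequentially"
    and Gext_bounded: "\<exists>B>0. \<forall>s\<in>Gregion k. norm (Gext k s) \<le> B"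
proof -
  obtain K where K: "K \<ge> 0" "\<And>s p. s \<in> Gregion k \<Longrightarrow> norm (gfac k s p - 1) \<le> K * real p powr (-3/2)"
    using gfac_bound by blast
  have sm: "summable (\<lambda>p. K * real p powr (-3/2))"
    by (intro summable_mult) (simp add: summable_real_powr_iff)
  have "uniformly_convergent_on (Gregion k) (\<lambda>N s. \<Prod>p<N. gfac k s p)"
    by (rule uniformly_convergent_prod_M_test(1)[OF _ sm]) (use K in auto)
  then show U: "uniform_limit (Gregion k) (\<lambda>N s. \<Prod>p<N. gfac k s p) (Gext k) sequentially"
    unfolding uniformly_convergent_uniform_limit_iff Gext_def[abs_def] .
  have "norm (Gext k s) \<le> exp (\<Sum>p. K * real p powr (-3/2))" if s: "s \<in> Gregion k" for s
  proof (rule LIMSEQ_le_const2)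
    show "(\<lambda>N. norm (\<Prod>p<N. gfac k s p)) \<longlonglongrightarrow> norm (Gext k s)"
      by (intro tendsto_norm tendsto_uniform_limitI[OF U s])
    show "\<exists>N. \<forall>n\<ge>N. norm (\<Prod>p<n. gfac k s p) \<le> exp (\<Sum>p. K * real p powr (-3/2))"
      using uniformly_convergent_prod_M_test(2)[of "Gregion k" "\<lambda>p s. gfac k s p", OF _ sm s] K by blast
  qed
  then show "\<exists>B>0. \<forall>s\<in>Gregion k. norm (Gext k s) \<le> B"
    by (intro exI[of _ "exp (\<Sum>p. K * real p powr (-3/2))"]) auto
qed

lemma continuous_on_coord: "continuous_on A (\<lambda>s :: nat \<Rightarrow> complex. s j)"
  by (rule continuous_on_product_then_coordinatewise[OF continuous_on_id])

lemma continuous_on_euler_fac: "continuous_on A f \<Longrightarrow> continuous_on A (\<lambda>s. euler_fac (f s) p)"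
  by (cases "prime p") (auto simp: euler_fac_def powr_def intro!: continuous_intros)

lemma continuous_on_gfac: "continuous_on (Gregion k) (\<lambda>s. gfac k s p)"
proof -
  have "continuous_on (Gregion k) (\<lambda>s. Mfac k s p)"
    unfolding Mfac_def
    by (cases "prime p") (auto simp: powr_def intro!: continuous_intros continuous_on_coord)
  moreover have "continuous_on (Gregion k) (\<lambda>s. euler_fac (1 + sS s S) p)" for S
    unfolding sS_def by (intro continuous_on_euler_fac continuous_intros continuous_on_coord)
  moreover have "(\<Prod>S\<in>Odd_sets k. euler_fac (1 + sS s S) p) \<noteq> 0" if "s \<in> Gregion k" for s
    using that by (auto simp: prod_zero_iff Odd_sets_def euler_fac_nonzero)
  ultimately show ?thesis unfolding gfac_def
    by (intro continuous_intros) auto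
qed

lemma continuous_on_Gext: "continuous_on (Gregion k) (Gext k)"
  by (rule uniform_limit_theorem[OF _ uniform_limit_Gext])
     (auto intro!: always_eventually continuous_intros continuous_on_gfac)

lemma Mfun_LIMSEQ:
  assumes s: "\<And>j. j < 2*k \<Longrightarrow> Re (s j) > 0"
  shows "(\<lambda>N. \<Prod>p\<le>N. Mfac k s p) \<longlonglongrightarrow> Mfun k s"
proof -
  \<comment> \<open>The extra element 1 keeps the set nonempty when k = 0. Every nonempty S then has
    Re s_S \<ge> d, which makes its term at most p^(-1 - d).\<close>
  define d where "d = Min (insert 1 ((\<lambda>j. Re (s j)) ` {..<2*k}))"
  have d: "d > 0" unfolding d_def using s by (subst Min_gr_iff) auto
  have dle: "d \<le> Re (s j)" if "j < 2*k" for j unfolding d_def using that by (intro Min_le) auto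
  define K where "K = real (card (Pow {..<2*k} - {{}}))"
  have b: "norm (Mfac k s p - 1) \<le> K * real p powr (-(1 + d))" for p
  proof (cases "prime p")
    case True
    have p: "p \<ge> 1" using True prime_ge_1_nat by blast
    have "norm (Mfac k s p - 1) \<le> (\<Sum>S\<in>Pow {..<2*k} - {{}}. real p powr (-(1 + d)))"
      unfolding Mfac_expand[OF True] add_diff_cancel_left'
    proof (rule sum_norm_le)
      fix S assume S: "S \<in> Pow {..<2*k} - {{}}"
      then have "finite S" and "card S \<ge> 1" using finite_memb[of S k] by (auto simp: Suc_le_eq card_gt_0_iff)
      have "d \<le> real (card S) * d" using \<open>card S \<ge> 1\<close> d by simp
      also have "\<dots> = (\<Sum>j\<in>S. d)" by simp
      also have "\<dots> \<le> Re (sS s S)" unfolding sS_def Re_sum using S dle by (intro sum_mono) auto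
      finally have "d \<le> Re (sS s S)" .
      then show "norm ((-1) ^ card S * of_nat p powr (-(1 + sS s S)) :: complex) \<le> real p powr (-(1 + d))"
        using p by (simp add: norm_mult norm_power norm_powr_real_powr powr_mono)
    qed
    then show ?thesis by (simp add: K_def)
  qed (simp add: Mfac_def K_def)
  have "summable (\<lambda>p. norm (Mfac k s p - 1))"
  proof (rule summable_comparison_test'[where N = 0])
    show "summable (\<lambda>p. K * real p powr (-(1 + d)))"
      using d by (intro summable_mult) (simp add: summable_real_powr_iff)
  qed (use b in auto)
  then have "convergent_prod (Mfac k s)"
    by (intro abs_convergent_prod_imp_convergent_prod summable_imp_abs_convergent_prod)
  from convergent_prod_LIMSEQ[OF this] show ?thesis
    by (simp add: Mfun_def Mfac_def[abs_def])
qed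

lemma Gregion_pos: "(\<And>j. j < 2*k \<Longrightarrow> Re (s j) \<ge> 0) \<Longrightarrow> s \<in> Gregion k"
  unfolding Gregion_def by (auto intro: order_trans[of _ 0])

text \<open>Where all real parts are positive, the Euler products of M and of every zeta factor
  converge separately, so the product of the local factors splits into them.\<close>

lemma Gfun_eq_Gext:
  assumes s: "\<And>j. j < 2*k \<Longrightarrow> Re (s j) > 0"
  shows "Gfun k s = Gext k s"
proof -
  have re: "Re (1 + sS s S) > 1" if "S \<in> Odd_sets k \<union> Even_sets k" for S
  proof -
    have S: "S \<subseteq> {..<2*k}" "S \<noteq> {}" using that by (auto simp: Odd_Even_sets)
    then have "(\<Sum>j\<in>S. Re (s j)) > 0" using s finite_memb[of S k] by (intro sum_pos) auto
    then show ?thesis by (simp add: sS_def)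
  qed
  have "s \<in> Gregion k" using s by (intro Gregion_pos) (auto intro: less_imp_le)
  then have "(\<lambda>N. \<Prod>p<N. gfac k s p) \<longlonglongrightarrow> Gext k s"
    by (rule tendsto_uniform_limitI[OF uniform_limit_Gext])
  then have 1: "(\<lambda>N. \<Prod>p\<le>N. gfac k s p) \<longlonglongrightarrow> Gext k s"
    using LIMSEQ_lessThan_iff_atMost by blast
  have "(\<lambda>N. (\<Prod>p\<le>N. Mfac k s p) * (\<Prod>S\<in>Even_sets k. \<Prod>p\<le>N. euler_fac (1 + sS s S) p) / (\<Prod>S\<in>Odd_sets k. \<Prod>p\<le>N. euler_fac (1 + sS s S) p))
     \<longlonglongrightarrow> Mfun k s * (\<Prod>S\<in>Even_sets k. 1 / zeta (1 + sS s S)) / (\<Prod>S\<in>Odd_sets k. 1 / zeta (1 + sS s S))"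
    using re zeta_nonzero by (intro tendsto_intros Mfun_LIMSEQ s euler_product) (auto simp: prod_zero_iff)
  moreover have "(\<Prod>p\<le>N. Mfac k s p) * (\<Prod>S\<in>Even_sets k. \<Prod>p\<le>N. euler_fac (1 + sS s S) p) / (\<Prod>S\<in>Odd_sets k. \<Prod>p\<le>N. euler_fac (1 + sS s S) p)
    = (\<Prod>p\<le>N. gfac k s p)" for N
    unfolding gfac_def prod_dividef prod.distrib
    by (simp add: prod.swap[of _ "{..N}"])
  ultimately have 2: "(\<lambda>N. \<Prod>p\<le>N. gfac k s p) \<longlonglongrightarrow> Mfun k s * (\<Prod>S\<in>Even_sets k. 1 / zeta (1 + sS s S)) / (\<Prod>S\<in>Odd_sets k. 1 / zeta (1 + sS s S))"
    by simp
  have "Gext k s = Mfun k s * (\<Prod>S\<in>Even_sets k. 1 / zeta (1 + sS s S)) / (\<Prod>S\<in>Odd_sets k. 1 / zeta (1 + sS s S))"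
    by (rule LIMSEQ_unique[OF 1 2])
  also have "\<dots> = Gfun k s"
    by (simp add: Gfun_def Even_sets_def Odd_sets_def prod_dividef)
  finally show ?thesis by simp
qed

lemma Mfun_eq_Gext:
  assumes s: "\<And>j. j < 2*k \<Longrightarrow> Re (s j) > 0"
  shows "Mfun k s = Gext k s * (\<Prod>S\<in>Even_sets k. zeta (1 + sS s S)) / (\<Prod>S\<in>Odd_sets k. zeta (1 + sS s S))"
proof -
  have "zeta (1 + sS s S) \<noteq> 0" if "S \<in> Odd_sets k \<union> Even_sets k" for S
  proof -
    have S: "S \<subseteq> {..<2*k}" "S \<noteq> {}" using that by (auto simp: Odd_Even_sets)
    then have "(\<Sum>j\<in>S. Re (s j)) > 0" using s finite_memb[of S k] by (intro sum_pos) auto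
    then show ?thesis by (intro zeta_nonzero) (simp add: sS_def)
  qed
  then have "(\<Prod>S\<in>Even_sets k. zeta (1 + sS s S)) \<noteq> 0" "(\<Prod>S\<in>Odd_sets k. zeta (1 + sS s S)) \<noteq> 0"
    by (auto simp: prod_zero_iff)
  moreover have "Gfun k s = Mfun k s * (\<Prod>S\<in>Odd_sets k. zeta (1 + sS s S)) / (\<Prod>S\<in>Even_sets k. zeta (1 + sS s S))"
    by (simp add: Gfun_def Even_sets_def Odd_sets_def)
  moreover have "Gext k s = Gfun k s" using Gfun_eq_Gext[of k s] s by simp
  ultimately show ?thesis by simp
qed

text \<open>The one-sided limit in the definition of \<open>Gk\<close> is a limit of the continuous
  function \<open>Gext\<close> along a path that stays in \<open>Gregion k\<close>, hence its value
  at the endpoint.\<close>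

lemma Gk_eq_Gext:
  "Gk k t = Gext k (\<lambda>j. if j < k then \<i> * complex_of_real t else - (\<i> * complex_of_real t))"
proof -
  define v where "v = (\<lambda>\<sigma>::real. \<lambda>j. if j < k then complex_of_real \<sigma> + \<i> * complex_of_real t else complex_of_real \<sigma> - \<i> * complex_of_real t)"
  have "continuous_on {0..} v"
    unfolding v_def
  proof (rule continuous_on_coordinatewise_then_product)
    fix j show "continuous_on {0..} (\<lambda>\<sigma>::real. if j < k then complex_of_real \<sigma> + \<i> * complex_of_real t else complex_of_real \<sigma> - \<i> * complex_of_real t)"
      by (cases "j < k") (auto intro!: continuous_intros)
  qed
  moreover have "v ` {0..} \<subseteq> Gregion k" by (auto intro!: Gregion_pos simp: v_def)
  ultimately have "continuous_on {0..} (\<lambda>\<sigma>. Gext k (v \<sigma>))"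
    by (rule continuous_on_compose2[OF continuous_on_Gext])
  then have "((\<lambda>\<sigma>. Gext k (v \<sigma>)) \<longlongrightarrow> Gext k (v 0)) (at 0 within {0..})"
    by (simp add: continuous_on)
  then have "((\<lambda>\<sigma>. Gext k (v \<sigma>)) \<longlongrightarrow> Gext k (v 0)) (at_right 0)"
    by (rule tendsto_within_subset) auto
  moreover have "eventually (\<lambda>\<sigma>. Gext k (v \<sigma>) = Gfun k (v \<sigma>)) (at_right 0)"
    by (rule eventually_mono[OF eventually_at_right_less[of 0]]) (auto simp: v_def Gfun_eq_Gext)
  ultimately have "((\<lambda>\<sigma>. Gfun k (v \<sigma>)) \<longlongrightarrow> Gext k (v 0)) (at_right 0)"
    by (rule Lim_transform_eventually)
  then have "Gk k t = Gext k (v 0)"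
    unfolding Gk_def v_def by (intro tendsto_Lim) auto
  then show ?thesis by (simp add: v_def cong: if_cong)
qed

section \<open>Integrable powers on the line and contour integrals over rectangles\<close>

lemma integrable_even_real:
  fixes f :: "real \<Rightarrow> real"
  assumes m: "f \<in> borel_measurable borel" and nn: "\<And>x. f x \<ge> 0" and ev: "\<And>x. f (-x) = f x"
    and fin: "(\<integral>\<^sup>+x. ennreal (f x) * indicator {0..} x \<partial>lborel) < \<infinity>"
  shows "integrable lborel f"
proof -
  define g where "g = (\<lambda>x. indicator {0..} x * f x)"
  have "(\<integral>\<^sup>+x. ennreal (norm (g x)) \<partial>lborel) = (\<integral>\<^sup>+x. ennreal (f x) * indicator {0..} x \<partial>lborel)"
    by (intro nn_integral_cong) (auto simp: g_def indicator_def nn)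
  then have "integrable lborel g"
    using fin m by (intro integrableI_bounded) (auto simp: g_def)
  moreover from this have "integrable lborel (\<lambda>x. g (0 + (-1) * x))"
    by (rule lborel_integrable_real_affine) simp
  ultimately have "integrable lborel (\<lambda>x. g x + g (0 + (-1) * x))" by (rule Bochner_Integration.integrable_add)
  then show ?thesis
    by (rule Bochner_Integration.integrable_bound) (use m nn ev in \<open>auto simp: g_def indicator_def\<close>)
qed

lemma integrable_one_plus_abs_powr:
  assumes "a > 1"
  shows "integrable lborel (\<lambda>x::real. nm x powr (-a))"
proof (rule integrable_even_real)
  have "(\<integral>\<^sup>+x. ennreal (nm x powr (-a)) * indicator {0..} x \<partial>lborel) =
        (\<integral>\<^sup>+x. ennreal ((1 + x) powr (-a)) * indicator {0..} x \<partial>lborel)"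
    by (intro nn_integral_cong) (auto simp: indicator_def)
  also have "\<dots> = ennreal (0 - (1 + 0) powr (1 - a) / (1 - a))"
  proof (rule nn_integral_FTC_atLeast)
    show "((\<lambda>x::real. (1 + x) powr (1 - a) / (1 - a)) \<longlongrightarrow> 0) at_top"
      using assms by real_asymp
    show "((\<lambda>x. (1 + x) powr (1 - a) / (1 - a)) has_real_derivative (1 + x) powr (-a)) (at x)" if "0 \<le> x" for x :: real
    proof -
      have "((\<lambda>x. (1 + x) powr (1 - a) / (1 - a)) has_real_derivative (1 - a) * (1 + x) powr (1 - a - real 1) * 1 / (1 - a)) (at x)"
        using that by (intro DERIV_cdivide DERIV_fun_powr) (auto intro!: derivative_eq_intros)
      then show ?thesis using assms by simp
    qed
  qed auto
  finally show "(\<integral>\<^sup>+x. ennreal (nm x powr (-a)) * indicator {0..} x \<partial>lborel) < \<infinity>" by simp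
qed auto

text \<open>The top and left sides are reversed so that every side runs in the direction of an
  increasing coordinate, as the vertical integrals in Perron's formula do.\<close>

lemma rectpath_contour_integral:
  assumes "Re a < Re b" "Im a < Im b" "continuous_on (path_image (rectpath a b)) f"
  defines "c \<equiv> Complex (Re b) (Im a)" and "d \<equiv> Complex (Re a) (Im b)"
  shows "contour_integral (rectpath a b) f = contour_integral (linepath a c) f + contour_integral (linepath c b) f
      - contour_integral (linepath d b) f - contour_integral (linepath a d) f"
    and "f contour_integrable_on linepath a c" "f contour_integrable_on linepath c b"
      "f contour_integrable_on linepath d b" "f contour_integrable_on linepath a d"
proof -
  have im: "path_image (rectpath a b) = closed_segment a c \<union> closed_segment c b \<union> closed_segment b d \<union> closed_segment d a"
    unfolding rectpath_def Let_def c_def d_def by (simp add: path_image_join Un_assoc)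
  have ci: "f contour_integrable_on linepath a c" "f contour_integrable_on linepath c b"
     "f contour_integrable_on linepath b d" "f contour_integrable_on linepath d a"
     "f contour_integrable_on linepath d b" "f contour_integrable_on linepath a d"
    by (intro contour_integrable_continuous_linepath continuous_on_subset[OF assms(3)]; simp add: im closed_segment_commute; blast)+
  have "contour_integral (rectpath a b) f = contour_integral (linepath a c) f + contour_integral (linepath c b) f
      + contour_integral (linepath b d) f + contour_integral (linepath d a) f"
    unfolding rectpath_def Let_def c_def[symmetric] d_def[symmetric] using ci by simp
  also have "contour_integral (linepath b d) f = - contour_integral (linepath d b) f"
    using contour_integral_reversepath[of "linepath d b" f] by simp
  also have "contour_integral (linepath d a) f = - contour_integral (linepath a d) f"
    using contour_integral_reversepath[of "linepath a d" f] by simp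
  finally show "contour_integral (rectpath a b) f = contour_integral (linepath a c) f + contour_integral (linepath c b) f
      - contour_integral (linepath d b) f - contour_integral (linepath a d) f" by simp
  show "f contour_integrable_on linepath a c" "f contour_integrable_on linepath c b"
    "f contour_integrable_on linepath d b" "f contour_integrable_on linepath a d" by (rule ci)+
qed

section \<open>Perron's formula with a smooth cut-off\<close>

definition perron_fun :: "real \<Rightarrow> real \<Rightarrow> complex \<Rightarrow> complex" where
  "perron_fun h v s = exp (of_real v * s) / (s * (1 + of_real h * s))"

text \<open>For v \<ge> 0 the terms 1 and - exp (- v / h) are the residues of
  \<open>perron_fun h v\<close> at 0 and at -1/h.\<close>

definition perron_weight :: "real \<Rightarrow> real \<Rightarrow> real" where
  "perron_weight h v = (if v \<ge> 0 then 1 - exp (- v / h) else 0)"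

lemma perron_fun_le:
  assumes h: "h > 0" and T: "T \<ge> 2 / h" and s: "norm s \<ge> T" and e: "Re s * v \<le> c"
  shows "norm (perron_fun h v s) \<le> 2 * exp c / (h * T\<^sup>2)"
proof -
  have T0: "T > 0" using h T by (metis divide_pos_pos less_le_trans zero_less_numeral)
  have hT: "h * T \<ge> 2" using h T by (simp add: field_simps)
  have "norm (of_real h * s) - norm (1::complex) \<le> norm (1 + of_real h * s)"
    using norm_triangle_ineq2[of "of_real h * s" "-1"] by (simp add: add.commute)
  then have "h * norm s - 1 \<le> norm (1 + of_real h * s)" using h by (simp add: norm_mult)
  moreover have "h * T \<le> h * norm s" using h s by simp
  ultimately have 1: "h * T / 2 \<le> norm (1 + of_real h * s)" using hT by linarith
  have "norm (perron_fun h v s) = exp (v * Re s) / (norm s * norm (1 + of_real h * s))"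
    by (simp add: perron_fun_def norm_divide norm_mult)
  also have "\<dots> \<le> exp c / (T * (h * T / 2))"
    using 1 s T0 h e by (intro frac_le mult_mono) (auto simp: mult.commute)
  also have "\<dots> = 2 * exp c / (h * T\<^sup>2)" by (simp add: power2_eq_square mult_ac)
  finally show ?thesis .
qed

text \<open>The vertical segment is completed to a rectangle on the side where the exponential does
  not grow. The integrand is O(T^(-2)) on the other three sides, whose lengths are at most 2T, so
  together they contribute O(1/T).\<close>

lemma perron_truncated:
  assumes \<sigma>: "\<sigma> > 0" and h: "h > 0"
  shows "\<exists>C T0. \<forall>T\<ge>T0. norm (integral {-T..T} (\<lambda>t. perron_fun h v (Complex \<sigma> t)) - of_real (2 * pi * perron_weight h v)) \<le> C / T"
proof -
  define c where "c = \<sigma> * \<bar>v\<bar>"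
  \<comment> \<open>T \<ge> 2/h makes |1 + h s| \<ge> h T / 2 on the remote sides and puts the pole
    -1/h inside the left rectangle; T > \<sigma> makes the right rectangle nondegenerate.\<close>
  define T0 where "T0 = max (2 / h) (\<sigma> + 1)"
  define C where "C = 12 * exp c / h"
  have "norm (integral {-T..T} (\<lambda>t. perron_fun h v (Complex \<sigma> t)) - of_real (2 * pi * perron_weight h v)) \<le> C / T" if T: "T \<ge> T0" for T
  proof -
    have T1: "T \<ge> 2 / h" "T > \<sigma>" "T > 0" using T \<sigma> by (auto simp: T0_def)
    have T2: "T > 1 / h" using T1(1) h by (smt (verit) divide_strict_right_mono)
    define B where "B = 2 * exp c / (h * T\<^sup>2)"
    have B: "B \<ge> 0" using h by (simp add: B_def)
    define I where "I = integral {-T..T} (\<lambda>t. perron_fun h v (Complex \<sigma> t))"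
    have BC: "B * (2 * T) + B * (2 * T) + B * (2 * T) = C / T"
      using T1 by (simp add: B_def C_def power2_eq_square field_simps)
    have bd: "norm (perron_fun h v z) \<le> B" if "norm z \<ge> T" "Re z * v \<le> c" for z
      unfolding B_def by (rule perron_fun_le[OF h T1(1) that])
    have vert: "contour_integral (linepath (Complex \<sigma> (-T)) (Complex \<sigma> T)) (perron_fun h v) = \<i> * I"
      unfolding I_def using T1 by (intro contour_integral_linepath_same_Re) auto
    have edge: "norm (contour_integral (linepath p q) (perron_fun h v)) \<le> B * (2 * T)"
      if "perron_fun h v contour_integrable_on linepath p q"
         "\<bar>Im p\<bar> = T \<and> Im q = Im p \<or> \<bar>Re p\<bar> = T \<and> Re q = Re p" "Re p * v \<le> c" "Re q * v \<le> c" "norm (q - p) \<le> 2 * T" for p q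
    proof -
      have seg: "norm z \<ge> T \<and> Re z * v \<le> c" if "z \<in> closed_segment p q" for z
      proof
        obtain w where w: "z = (1 - w) *\<^sub>R p + w *\<^sub>R q" "0 \<le> w" "w \<le> 1" using \<open>z \<in> _\<close> by (auto simp: in_segment)
        have "Re z * v = (1 - w) * (Re p * v) + w * (Re q * v)" by (simp add: w algebra_simps)
        also have "\<dots> \<le> (1 - w) * c + w * c" using w \<open>Re p * v \<le> c\<close> \<open>Re q * v \<le> c\<close> by (intro add_mono mult_left_mono) auto
        finally show "Re z * v \<le> c" by (simp add: algebra_simps)
        have "Im q = Im p \<Longrightarrow> Im z = Im p" "Re q = Re p \<Longrightarrow> Re z = Re p" by (simp_all add: w algebra_simps)
        then show "norm z \<ge> T"
          using \<open>_ \<or> _\<close> abs_Im_le_cmod[of z] abs_Re_le_cmod[of z] by auto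
      qed
      have "norm (contour_integral (linepath p q) (perron_fun h v)) \<le> B * norm (q - p)"
        by (rule contour_integral_bound_linepath[OF that(1) B]) (use seg bd in blast)
      also have "\<dots> \<le> B * (2 * T)" by (rule mult_left_mono[OF that(5) B])
      finally show ?thesis .
    qed
    have "norm (I - of_real (2 * pi * perron_weight h v)) \<le> B * (2 * T) + B * (2 * T) + B * (2 * T)"
    proof (cases "v > 0")
      case False
      \<comment> \<open>For v \<le> 0 the rectangle lies to the right of the line, away from both
        poles. At v = 0 the weight vanishes as well, so this case belongs here.\<close>
      define a where "a = Complex \<sigma> (-T)"
      define b where "b = Complex T T"
      have hol: "perron_fun h v holomorphic_on {s. Re s > 0}"
      proof -
        have "s \<noteq> 0 \<and> 1 + of_real h * s \<noteq> 0" if "Re s > 0" for s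
        proof -
          have "Re (1 + of_real h * s) > 0" using that h by (simp add: add_pos_pos)
          then show ?thesis using that by (metis less_irrefl zero_complex.sel(1))
        qed
        then show ?thesis unfolding perron_fun_def by (intro holomorphic_intros) auto
      qed
      have sub: "path_image (rectpath a b) \<subseteq> {s. Re s > 0}"
        using path_image_rectpath_subset_cbox[of a b] T1 \<sigma> by (auto simp: a_def b_def in_cbox_complex_iff)
      have "convex {s. Re s > 0}" by (simp add: convex_halfspace_Re_gt)
      then have "(perron_fun h v has_contour_integral 0) (rectpath a b)"
        by (intro Cauchy_theorem_convex_simple[OF hol]) (use sub in auto)
      then have z: "contour_integral (rectpath a b) (perron_fun h v) = 0" by (rule contour_integral_unique)
      have cont: "continuous_on (path_image (rectpath a b)) (perron_fun h v)"
        by (rule continuous_on_subset[OF holomorphic_on_imp_continuous_on[OF hol] sub])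
      have ab: "Re a < Re b" "Im a < Im b" using T1 by (auto simp: a_def b_def)
      note R = rectpath_contour_integral[OF ab cont, unfolded z]
      have rv: "x * v \<le> c" if "x \<ge> \<sigma>" for x
      proof -
        have "x * v \<le> 0" using that \<sigma> False by (intro mult_nonneg_nonpos) auto
        also have "0 \<le> c" using \<sigma> by (simp add: c_def)
        finally show ?thesis .
      qed
      have "norm (contour_integral (linepath a (Complex (Re b) (Im a))) (perron_fun h v)) \<le> B * (2 * T)"
        by (rule edge[OF R(2)]) (use T1 \<sigma> cmod_le[of "(Complex (Re b) (Im a)) - a"] in \<open>auto simp: a_def b_def intro: rv\<close>)
      moreover have "norm (contour_integral (linepath (Complex (Re b) (Im a)) b) (perron_fun h v)) \<le> B * (2 * T)"
        by (rule edge[OF R(3)]) (use T1 \<sigma> cmod_le[of "b - (Complex (Re b) (Im a))"] in \<open>auto simp: a_def b_def intro: rv\<close>)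
      moreover have "norm (contour_integral (linepath (Complex (Re a) (Im b)) b) (perron_fun h v)) \<le> B * (2 * T)"
        by (rule edge[OF R(4)]) (use T1 \<sigma> cmod_le[of "b - (Complex (Re a) (Im b))"] in \<open>auto simp: a_def b_def intro: rv\<close>)
      moreover have "contour_integral (linepath a (Complex (Re a) (Im b))) (perron_fun h v) = \<i> * I"
        using vert by (simp add: a_def b_def)
      moreover have "perron_weight h v = 0" using False by (cases "v = 0") (auto simp: perron_weight_def)
      moreover have "norm (I - of_real (2 * pi * perron_weight h v)) = norm (\<i> * I)" using \<open>perron_weight h v = 0\<close> by (simp add: norm_mult)
      moreover have "\<i> * I = contour_integral (linepath a (Complex (Re b) (Im a))) (perron_fun h v) +
          contour_integral (linepath (Complex (Re b) (Im a)) b) (perron_fun h v) -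
          contour_integral (linepath (Complex (Re a) (Im b)) b) (perron_fun h v)"
        using R(1) calculation(4) by (simp add: algebra_simps)
      ultimately show ?thesis
        by (smt (verit) norm_triangle_ineq norm_triangle_ineq4)
    next
      case True
      \<comment> \<open>For v > 0 the rectangle extends to the left and encloses both 0 and
        -1/h.\<close>
      define a where "a = Complex (-T) (-T)"
      define b where "b = Complex \<sigma> T"
      have ab: "Re a < Re b" "Im a < Im b" using T1 \<sigma> by (auto simp: a_def b_def)
      have inb: "0 \<in> box a b" "- of_real (1 / h) \<in> box a b"
        using T1 T2 \<sigma> h by (auto simp: a_def b_def in_box_complex_iff less_trans[of _ 0])
      have notin: "z \<notin> path_image (rectpath a b)" if "z \<in> box a b" for z
        using path_image_rectpath_inter_box[of a b] that ab by auto
      have cif: "((\<lambda>w. exp (of_real v * w) / (w - z)) has_contour_integral (2 * pi * \<i> * exp (of_real v * z))) (rectpath a b)"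
        if "z \<in> box a b" for z
        using Cauchy_integral_formula_convex_simple[of UNIV "\<lambda>w. exp (of_real v * w)" z "rectpath a b"]
          winding_number_rectpath[OF that] notin[OF that] by (auto intro!: holomorphic_intros)
      have nz: "z \<noteq> 0 \<and> 1 + of_real h * z \<noteq> 0" if "z \<in> path_image (rectpath a b)" for z
      proof
        show "z \<noteq> 0" using notin[OF inb(1)] that by auto
        show "1 + of_real h * z \<noteq> 0"
        proof
          assume "1 + of_real h * z = 0"
          then have "of_real h * z = -1" by (simp add: eq_neg_iff_add_eq_0 add.commute)
          then have "z = - of_real (1 / h)" using h by (simp add: field_simps)
          then show False using notin[OF inb(2)] that by auto
        qed
      qed
      \<comment> \<open>Partial fractions: the kernel is the difference of two Cauchy kernels, at 0
        and at -1/h.\<close>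
      have "((\<lambda>w. exp (of_real v * w) / (w - 0) - exp (of_real v * w) / (w - (- of_real (1 / h)))) has_contour_integral
        (2 * pi * \<i> * exp (of_real v * 0) - 2 * pi * \<i> * exp (of_real v * (- of_real (1 / h))))) (rectpath a b)"
        by (intro has_contour_integral_diff cif inb)
      then have "(perron_fun h v has_contour_integral
        (2 * pi * \<i> * exp (of_real v * 0) - 2 * pi * \<i> * exp (of_real v * (- of_real (1 / h))))) (rectpath a b)"
      proof (rule has_contour_integral_eq)
        fix w assume "w \<in> path_image (rectpath a b)"
        note n = nz[OF this]
        have "w + 1 / of_real h = (1 + of_real h * w) / of_real h" using h by (simp add: field_simps)
        then have n2: "w + 1 / of_real h \<noteq> 0" using n h by simp
        have "1 / w - 1 / (w + 1 / of_real h) = (1 / of_real h) / (w * (w + 1 / of_real h))"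
          using n n2 by (simp add: diff_frac_eq)
        also have "\<dots> = 1 / (w * (1 + of_real h * w))"
          using h by (simp add: distrib_left mult_ac add.commute divide_simps)
        finally have "exp (of_real v * w) * (1 / w - 1 / (w + 1 / of_real h)) = exp (of_real v * w) * (1 / (w * (1 + of_real h * w)))" by simp
        then show "exp (of_real v * w) / (w - 0) - exp (of_real v * w) / (w - (- of_real (1 / h))) = perron_fun h v w"
          by (simp add: perron_fun_def right_diff_distrib)
      qed
      also have "2 * pi * \<i> * exp (of_real v * 0) - 2 * pi * \<i> * exp (of_real v * (- of_real (1 / h))) = \<i> * of_real (2 * pi * perron_weight h v)"
        using True by (simp add: perron_weight_def algebra_simps flip: exp_of_real)
      finally have z: "contour_integral (rectpath a b) (perron_fun h v) = \<i> * of_real (2 * pi * perron_weight h v)"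
        by (rule contour_integral_unique)
      have cont: "continuous_on (path_image (rectpath a b)) (perron_fun h v)"
        unfolding perron_fun_def[abs_def] using nz by (intro continuous_intros) auto
      note R = rectpath_contour_integral[OF ab cont, unfolded z]
      have rv: "x * v \<le> c" if "x \<le> \<sigma>" for x
        using that True by (simp add: c_def)
      have "norm (contour_integral (linepath a (Complex (Re b) (Im a))) (perron_fun h v)) \<le> B * (2 * T)"
        by (rule edge[OF R(2)]) (use rv[of "-T"] T1 \<sigma> cmod_le[of "(Complex (Re b) (Im a)) - a"] in \<open>auto simp: a_def b_def intro: rv\<close>)
      moreover have "norm (contour_integral (linepath a (Complex (Re a) (Im b))) (perron_fun h v)) \<le> B * (2 * T)"
        by (rule edge[OF R(5)]) (use rv[of "-T"] T1 \<sigma> cmod_le[of "(Complex (Re a) (Im b)) - a"] in \<open>auto simp: a_def b_def intro: rv\<close>)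
      moreover have "norm (contour_integral (linepath (Complex (Re a) (Im b)) b) (perron_fun h v)) \<le> B * (2 * T)"
        by (rule edge[OF R(4)]) (use rv[of "-T"] T1 \<sigma> cmod_le[of "b - (Complex (Re a) (Im b))"] in \<open>auto simp: a_def b_def intro: rv\<close>)
      moreover have v': "contour_integral (linepath (Complex (Re b) (Im a)) b) (perron_fun h v) = \<i> * I"
        using vert by (simp add: a_def b_def)
      moreover have "norm (I - of_real (2 * pi * perron_weight h v)) = norm (\<i> * (I - of_real (2 * pi * perron_weight h v)))" by (simp add: norm_mult)
      moreover have "\<i> * (I - of_real (2 * pi * perron_weight h v)) = contour_integral (linepath (Complex (Re a) (Im b)) b) (perron_fun h v)
          + contour_integral (linepath a (Complex (Re a) (Im b))) (perron_fun h v)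
          - contour_integral (linepath a (Complex (Re b) (Im a))) (perron_fun h v)"
        using R(1) unfolding v' right_diff_distrib by (simp add: algebra_simps)
      ultimately show ?thesis
        by (smt (verit) norm_triangle_ineq norm_triangle_ineq4)
    qed
    then show ?thesis unfolding I_def BC .
  qed
  then show ?thesis by blast
qed

lemma norm_Complex_ge: "\<sigma> > 0 \<Longrightarrow> norm (Complex \<sigma> t) \<ge> min \<sigma> 1 / 2 * nm t"
proof -
  assume s: "\<sigma> > 0"
  have "min \<sigma> 1 \<le> norm (Complex \<sigma> t)" using abs_Re_le_cmod[of "Complex \<sigma> t"] s by auto
  moreover have "min \<sigma> 1 * \<bar>t\<bar> \<le> 1 * \<bar>t\<bar>" by (intro mult_right_mono) auto
  moreover have "\<bar>t\<bar> \<le> norm (Complex \<sigma> t)" using abs_Im_le_cmod[of "Complex \<sigma> t"] by simp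
  ultimately show ?thesis by (simp add: algebra_simps)
qed

lemma norm_one_plus_ge:
  assumes "h \<ge> 0" "Re s \<ge> 0"
  shows "norm (1 + of_real h * s) \<ge> 1" "norm (1 + of_real h * s) \<ge> h * norm s"
proof -
  have "1 \<le> 1 + h * Re s" using assms by simp
  also have "\<dots> \<le> norm (1 + of_real h * s)" using abs_Re_le_cmod[of "1 + of_real h * s"] by simp
  finally show "norm (1 + of_real h * s) \<ge> 1" .
  have "(h * norm s)\<^sup>2 = (h * Re s)\<^sup>2 + (h * Im s)\<^sup>2"
    by (simp add: power_mult_distrib cmod_power2 distrib_left)
  also have "\<dots> \<le> (1 + h * Re s)\<^sup>2 + (h * Im s)\<^sup>2" using assms by (intro add_right_mono power_mono) auto
  also have "\<dots> = (norm (1 + of_real h * s))\<^sup>2" by (simp add: cmod_power2)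
  finally show "norm (1 + of_real h * s) \<ge> h * norm s" by (rule power2_le_imp_le) simp
qed

lemma continuous_Complex [continuous_intros]:
  "continuous_on A f \<Longrightarrow> continuous_on A g \<Longrightarrow> continuous_on A (\<lambda>x. Complex (f x) (g x))"
  unfolding Complex_eq by (intro continuous_intros)

lemma perron_integrable:
  assumes \<sigma>: "\<sigma> > 0" and h: "h > 0"
  shows "integrable lborel (\<lambda>t. perron_fun h v (Complex \<sigma> t))"
proof (rule Bochner_Integration.integrable_bound)
  define m where "m = min \<sigma> 1 / 2"
  have m: "m > 0" using \<sigma> by (simp add: m_def)
  show "integrable lborel (\<lambda>t. exp (v * \<sigma>) / (h * m\<^sup>2) * nm t powr (-2))"
    by (intro integrable_mult_right integrable_one_plus_abs_powr) simp
  have "Complex \<sigma> t \<noteq> 0 \<and> 1 + of_real h * Complex \<sigma> t \<noteq> 0" for t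
  proof -
    have "norm (1 + of_real h * Complex \<sigma> t) \<ge> 1" using h \<sigma> by (intro norm_one_plus_ge) auto
    then have "1 + of_real h * Complex \<sigma> t \<noteq> 0" by (metis norm_zero not_one_le_zero)
    then show ?thesis using \<sigma> by (auto simp: complex_eq_iff)
  qed
  then show "(\<lambda>t. perron_fun h v (Complex \<sigma> t)) \<in> borel_measurable lborel"
    unfolding perron_fun_def by (simp, intro borel_measurable_continuous_onI continuous_intros) auto
  show "AE t in lborel. norm (perron_fun h v (Complex \<sigma> t)) \<le> norm (exp (v * \<sigma>) / (h * m\<^sup>2) * nm t powr (-2))"
  proof (rule AE_I2)
    fix t
    define s where "s = Complex \<sigma> t"
    have 1: "norm s \<ge> m * nm t" unfolding s_def m_def by (rule norm_Complex_ge[OF \<sigma>])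
    have 2: "norm (1 + of_real h * s) \<ge> h * norm s" using h \<sigma> by (intro norm_one_plus_ge) (auto simp: s_def)
    have "norm (perron_fun h v s) = exp (v * \<sigma>) / (norm s * norm (1 + of_real h * s))"
      by (simp add: perron_fun_def norm_divide norm_mult s_def)
    also have "\<dots> \<le> exp (v * \<sigma>) / ((m * nm t) * (h * (m * nm t)))"
      using 1 m h by (intro frac_le mult_mono order_trans[OF _ 2]) auto
    also have "\<dots> = exp (v * \<sigma>) / (h * m\<^sup>2) * nm t powr (-2)"
      by (simp add: powr_minus powr_numeral power2_eq_square divide_simps)
    finally show "norm (perron_fun h v (Complex \<sigma> t)) \<le> norm (exp (v * \<sigma>) / (h * m\<^sup>2) * nm t powr (-2))"
      using h by (simp add: s_def)
  qed
qed

lemma integral_truncation_LIMSEQ: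
  fixes f :: "real \<Rightarrow> complex"
  assumes "integrable lborel f"
  shows "((\<lambda>T. integral {-T..T} f) \<longlongrightarrow> integral\<^sup>L lborel f) at_top"
proof -
  have [measurable]: "f \<in> borel_measurable borel" using borel_measurable_integrable[OF assms] by simp
  have "((\<lambda>T. LBINT x. indicator {-T..T} x *\<^sub>R f x) \<longlongrightarrow> integral\<^sup>L lborel f) at_top"
  proof (rule integral_dominated_convergence_at_top[where w = "\<lambda>x. norm (f x)"])
    show "AE x in lborel. ((\<lambda>T. indicator {-T..T} x *\<^sub>R f x) \<longlongrightarrow> f x) at_top"
    proof (rule AE_I2)
      fix x
      have "eventually (\<lambda>T. f x = indicator {-T..T} x *\<^sub>R f x) at_top"
        using eventually_ge_at_top[of "\<bar>x\<bar>"] by eventually_elim (auto simp: indicator_def)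
      then show "((\<lambda>T. indicator {-T..T} x *\<^sub>R f x) \<longlongrightarrow> f x) at_top"
        by (rule tendsto_eventually[OF eventually_mono]) simp
    qed
  qed (use assms in \<open>auto simp: indicator_def\<close>)
  moreover have "(LBINT x. indicator {-T..T} x *\<^sub>R f x) = integral {-T..T} f" for T
    using set_borel_integral_eq_integral(2)[of "{-T..T}" f] integrable_mult_indicator[of "{-T..T}" lborel f] assms
    by (simp add: set_lebesgue_integral_def set_integrable_def)
  ultimately show ?thesis by simp
qed

lemma perron_formula:
  assumes \<sigma>: "\<sigma> > 0" and h: "h > 0"
  shows "(LBINT t. perron_fun h v (Complex \<sigma> t)) = of_real (2 * pi * perron_weight h v)"
proof -
  define f where "f = (\<lambda>T. integral {-T..T} (\<lambda>t. perron_fun h v (Complex \<sigma> t)))"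
  obtain C T0 where C: "\<And>T. T \<ge> T0 \<Longrightarrow> norm (f T - of_real (2 * pi * perron_weight h v)) \<le> C / T"
    using perron_truncated[OF assms] unfolding f_def by blast
  have "((\<lambda>T. C / T) \<longlongrightarrow> 0) at_top" by real_asymp
  then have "((\<lambda>T. f T - of_real (2 * pi * perron_weight h v)) \<longlongrightarrow> 0) at_top"
    by (rule Lim_null_comparison[rotated]) (use C in \<open>auto simp: eventually_at_top_linorder\<close>)
  then have "(f \<longlongrightarrow> of_real (2 * pi * perron_weight h v)) at_top" by (rule LIM_zero_cancel)
  moreover have "(f \<longlongrightarrow> (LBINT t. perron_fun h v (Complex \<sigma> t))) at_top"
    unfolding f_def by (rule integral_truncation_LIMSEQ[OF perron_integrable[OF assms]])
  ultimately show ?thesis by (intro tendsto_unique[of at_top]) auto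
qed

section \<open>Squarefree numbers as finite sets of primes\<close>

lemma prod_primes_dvd_iff:
  fixes m :: nat
  assumes "finite X" "\<And>p. p \<in> X \<Longrightarrow> prime p"
  shows "\<Prod>X dvd m \<longleftrightarrow> (\<forall>p\<in>X. p dvd m)"
  using assms
proof (induction X rule: finite_induct)
  case (insert p X)
  have "coprime p (\<Prod>X)"
    using insert by (intro prod_coprime_right primes_coprime) auto
  then show ?case using insert by (auto intro: divides_mult dvd_mult_left dvd_mult_right)
qed auto

lemma prime_factors_prod_primes:
  fixes X :: "nat set"
  assumes "finite X" "\<And>p. p \<in> X \<Longrightarrow> prime p"
  shows "prime_factors (\<Prod>X) = X"
proof -
  have nz: "\<Prod>X \<noteq> 0" using assms by (auto simp: prod_zero_iff dest!: assms(2)[of 0])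
  have "p \<in> X" if "prime p" "p dvd \<Prod>X" for p
    using that assms by (metis prime_dvd_prod_iff primes_dvd_imp_eq)
  then show ?thesis using assms nz by (auto simp: prime_factors_dvd intro: dvd_prodI)
qed

lemma squarefree_prod_primes:
  fixes X :: "nat set"
  assumes "finite X" "\<And>p. p \<in> X \<Longrightarrow> prime p"
  shows "squarefree (\<Prod>X)"
  using assms by (intro squarefree_prod_coprime) (auto intro: primes_coprime squarefree_prime)

lemma prod_prime_factors_squarefree:
  fixes n :: nat
  assumes "squarefree n"
  shows "\<Prod>(prime_factors n) = n"
proof -
  have n: "n \<noteq> 0" using assms not_squarefree_0 by metis
  have "n = (\<Prod>p\<in>prime_factors n. p ^ multiplicity p n)"
    using prod_prime_factors[OF n] n by simp
  also have "\<dots> = (\<Prod>p\<in>prime_factors n. p)"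
  proof (rule prod.cong)
    fix p assume "p \<in> prime_factors n"
    then have "multiplicity p n = 1"
      using squarefree_factorial_semiring''[OF n] assms n
      by (metis One_nat_def in_prime_factors_iff le_antisym multiplicity_gt_zero_iff not_prime_unit Suc_leI)
    then show "p ^ multiplicity p n = p" by simp
  qed simp
  finally show ?thesis by simp
qed

lemma Lcm_prod_primes:
  fixes X :: "'j \<Rightarrow> nat set"
  assumes "finite J" "\<And>j. j \<in> J \<Longrightarrow> finite (X j)" "\<And>j p. j \<in> J \<Longrightarrow> p \<in> X j \<Longrightarrow> prime p"
  shows "Lcm ((\<lambda>j. \<Prod>(X j)) ` J) = \<Prod>(\<Union>j\<in>J. X j)"
proof (rule dvd_antisym)
  show "Lcm ((\<lambda>j. \<Prod>(X j)) ` J) dvd \<Prod>(\<Union>j\<in>J. X j)"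
    using assms by (intro Lcm_least) (auto intro!: prod_dvd_prod_subset)
  show "\<Prod>(\<Union>j\<in>J. X j) dvd Lcm ((\<lambda>j. \<Prod>(X j)) ` J)"
  proof (subst prod_primes_dvd_iff)
    show "\<forall>p\<in>\<Union>j\<in>J. X j. p dvd Lcm ((\<lambda>j. \<Prod>(X j)) ` J)"
    proof clarify
      fix p j assume "j \<in> J" "p \<in> X j"
      then have "p dvd \<Prod>(X j)" using assms by (intro dvd_prodI) auto
      also have "\<Prod>(X j) dvd Lcm ((\<lambda>j. \<Prod>(X j)) ` J)" using \<open>j \<in> J\<close> by auto
      finally show "p dvd Lcm ((\<lambda>j. \<Prod>(X j)) ` J)" .
    qed
  qed (use assms in auto)
qed

section \<open>The smoothing error\<close>

definition primes_upto :: "nat \<Rightarrow> nat set" where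
  "primes_upto N = {p. prime p \<and> p \<le> N}"

lemma finite_primes_upto [simp]: "finite (primes_upto N)"
  by (rule finite_subset[of _ "{..N}"]) (auto simp: primes_upto_def)

lemma primes_upto_subset:
  assumes "X \<subseteq> primes_upto N"
  shows "finite X" "\<And>p. p \<in> X \<Longrightarrow> prime p"
  using assms finite_subset[OF assms] by (auto simp: primes_upto_def)

text \<open>Tuples with an entry that is not squarefree drop out because f 0 = 0; the rest
  correspond to tuples of prime sets. The function f is left open since the identity is applied both
  to \<mu> itself and to |\<mu>|, with weights H. Any N \<ge> Y serves, because the prime factors of
  a number up to Y are at most Y.\<close>

lemma sum_moebius_tuples:
  fixes f :: "int \<Rightarrow> real"
  assumes J: "finite J" and f: "f 0 = 0" and N: "N \<ge> Y"
  shows "(\<Sum>d\<in>PiE J (\<lambda>_. {1..Y}). (\<Prod>j\<in>J. f (moebius (d j))) * H d / real (Lcm (d ` J))) =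
     (\<Sum>X\<in>{X\<in>PiE J (\<lambda>_. Pow (primes_upto N)). \<forall>j\<in>J. \<Prod>(X j) \<le> Y}.
        (\<Prod>j\<in>J. f ((-1) ^ card (X j))) * H (\<lambda>j\<in>J. \<Prod>(X j)) / real (\<Prod>(\<Union>j\<in>J. X j)))"
    (is "?L = ?R")
proof -
  define S where "S = PiE J (\<lambda>_. {1..Y})"
  define S' where "S' = {d\<in>S. \<exists>j\<in>J. \<not> squarefree (d j)}"
  define T where "T = {X\<in>PiE J (\<lambda>_. Pow (primes_upto N)). \<forall>j\<in>J. \<Prod>(X j) \<le> Y}"
  have fin: "finite S" unfolding S_def by (intro finite_PiE J) auto
  define g where "g = (\<lambda>d. (\<Prod>j\<in>J. f (moebius (d j))) * H d / real (Lcm (d ` J)))"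
  define g' where "g' = (\<lambda>X. (\<Prod>j\<in>J. f ((-1) ^ card (X j))) * H (\<lambda>j\<in>J. \<Prod>(X j)) / real (\<Prod>(\<Union>j\<in>J. X j)))"
  have "sum g S = sum g (S - S')"
  proof (rule sum.mono_neutral_right[OF fin])
    show "\<forall>d\<in>S - (S - S'). g d = 0"
    proof
      fix d assume "d \<in> S - (S - S')"
      then obtain j where "j \<in> J" "\<not> squarefree (d j)" by (auto simp: S'_def)
      then have "(\<Prod>j\<in>J. f (moebius (d j))) = 0"
        using J f by (intro prod_zero bexI[of _ j]) (auto simp: moebius_def)
      then show "g d = 0" by (simp add: g_def)
    qed
  qed auto
  also have "\<dots> = sum g' T"
  proof (rule sum.reindex_bij_witness[where i = "\<lambda>X. \<lambda>j\<in>J. \<Prod>(X j)" and j = "\<lambda>d. \<lambda>j\<in>J. prime_factors (d j)"])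
    fix d assume d: "d \<in> S - S'"
    then have sq: "squarefree (d j)" "1 \<le> d j" "d j \<le> Y" if "j \<in> J" for j using that by (auto simp: S_def S'_def)
    have ext: "d \<in> extensional J" using d by (auto simp: S_def PiE_def)
    show eq: "(\<lambda>j\<in>J. \<Prod>((\<lambda>j\<in>J. prime_factors (d j)) j)) = d"
      using sq ext by (auto simp: fun_eq_iff restrict_def prod_prime_factors_squarefree extensional_def)
    have "p \<le> N" if "j \<in> J" "p \<in> prime_factors (d j)" for j p
    proof -
      have "p \<le> d j" using that sq[OF that(1)] by (auto intro: dvd_imp_le simp: prime_factors_dvd)
      then show ?thesis using sq[OF that(1)] N by linarith
    qed
    then show "(\<lambda>j\<in>J. prime_factors (d j)) \<in> T"
      using sq by (auto simp: T_def primes_upto_def prod_prime_factors_squarefree)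
    have "moebius (d j) = (-1) ^ card (prime_factors (d j))" if "j \<in> J" for j
      using sq[OF that] by (simp add: moebius_def)
    then have 1: "(\<Prod>j\<in>J. f ((-1) ^ card ((\<lambda>j\<in>J. prime_factors (d j)) j))) = (\<Prod>j\<in>J. f (moebius (d j)))"
      by (intro prod.cong) auto
    have "Lcm (d ` J) = Lcm ((\<lambda>j. \<Prod>(prime_factors (d j))) ` J)"
      using sq by (intro arg_cong[where f = Lcm] image_cong) (auto simp: prod_prime_factors_squarefree)
    also have "\<dots> = \<Prod>(\<Union>j\<in>J. prime_factors (d j))"
      using J by (intro Lcm_prod_primes) auto
    finally show "g' (\<lambda>j\<in>J. prime_factors (d j)) = g d"
      unfolding g'_def 1 eq by (simp add: g_def)
  next
    fix X assume X: "X \<in> T"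
    then have X': "X j \<subseteq> primes_upto N" "\<Prod>(X j) \<le> Y" if "j \<in> J" for j using that by (auto simp: T_def PiE_iff)
    note X2 = primes_upto_subset[OF X'(1)]
    have ext: "X \<in> extensional J" using X by (auto simp: T_def PiE_def)
    show "(\<lambda>j\<in>J. prime_factors ((\<lambda>j\<in>J. \<Prod>(X j)) j)) = X"
      using X2 ext by (auto simp: fun_eq_iff restrict_def prime_factors_prod_primes extensional_def)
    have "\<Prod>(X j) \<ge> 1" if "j \<in> J" for j
      using X2[OF that] by (auto simp: Suc_le_eq intro!: prod_pos prime_gt_0_nat)
    then show "(\<lambda>j\<in>J. \<Prod>(X j)) \<in> S - S'"
      using X' X2 by (auto simp: S_def S'_def squarefree_prod_primes)
  qed
  finally show ?thesis by (simp add: g_def g'_def S_def T_def)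
qed

lemma prod_subset_if:
  assumes "finite A" "B \<subseteq> A"
  shows "(\<Prod>p\<in>B. g p) = (\<Prod>p\<in>A. if p \<in> B then g p else (1::'a::comm_monoid_mult))"
  using assms by (subst prod.If_cases) (auto simp: Int_absorb1 intro!: prod.cong)

text \<open>A tuple of prime sets, read the other way round, assigns to each prime the set of
  indices that contain it. These assignments are independent for different primes, so the sum
  factors into an Euler product. No bound on the products of the sets is imposed here.\<close>

lemma sum_prime_tuples_euler:
  fixes s :: "nat \<Rightarrow> complex"
  shows "(\<Sum>X\<in>PiE {..<2*k} (\<lambda>_. Pow (primes_upto N)).
            (\<Prod>j<2*k. (-1) ^ card (X j) * of_nat (\<Prod>(X j)) powr (- s j)) / of_nat (\<Prod>(\<Union>j<2*k. X j)))
       = (\<Prod>p\<le>N. Mfac k s p)"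
proof -
  define J where "J = {..<2*k}"
  define A where "A = primes_upto N"
  have fin: "finite J" "finite A" by (auto simp: J_def A_def)
  define g where "g = (\<lambda>j p. - (of_nat p powr (- s j)) :: complex)"
  \<comment> \<open>A prime enters the lcm once, no matter how many indices contain it: hence a
    single 1/p exactly when S is nonempty.\<close>
  define c where "c = (\<lambda>p S. (if S = {} then 1 else 1 / of_nat p) * (\<Prod>j\<in>S. g j p))"
  define \<phi> where "\<phi> = (\<lambda>X. \<lambda>p\<in>A. {j\<in>J. p \<in> X j})"
  have "(\<Sum>X\<in>PiE J (\<lambda>_. Pow A). (\<Prod>j\<in>J. (-1) ^ card (X j) * of_nat (\<Prod>(X j)) powr (- s j)) / of_nat (\<Prod>(\<Union>j\<in>J. X j)))
     = (\<Sum>F\<in>PiE A (\<lambda>_. Pow J). \<Prod>p\<in>A. c p (F p))"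
  proof (rule sum.reindex_bij_witness[where i = "\<lambda>F. \<lambda>j\<in>J. {p\<in>A. j \<in> F p}" and j = \<phi>])
    fix X assume XX: "X \<in> PiE J (\<lambda>_. Pow A)"
    then have ext: "X \<in> extensional J" by (simp add: PiE_def)
    have X: "X j \<subseteq> A" if "j \<in> J" for j using that XX by (auto simp: PiE_iff)
    note X2 = primes_upto_subset[OF X[unfolded A_def]]
    show "(\<lambda>j\<in>J. {p \<in> A. j \<in> \<phi> X p}) = X"
      using X ext by (auto simp: fun_eq_iff restrict_def \<phi>_def extensional_def)
    show "\<phi> X \<in> PiE A (\<lambda>_. Pow J)" by (auto simp: \<phi>_def)
    have 1: "(-1) ^ card (X j) * of_nat (\<Prod>(X j)) powr (- s j) = (\<Prod>p\<in>A. if p \<in> X j then g j p else 1)" if "j \<in> J" for j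
    proof -
      have "of_nat (\<Prod>B) powr (- s j) = (\<Prod>p\<in>B. of_nat p powr (- s j) :: complex)" if "finite B" for B :: "nat set"
        using that
      proof (induction B rule: finite_induct)
        case (insert x F)
        have "of_nat (\<Prod>(insert x F)) powr (- s j) = (of_nat x * of_nat (\<Prod>F)) powr (- s j)"
          using insert by simp
        also have "\<dots> = of_nat x powr (- s j) * of_nat (\<Prod>F) powr (- s j)"
          by (rule powr_times_real) (auto simp del: of_nat_prod)
        finally show ?case using insert by simp
      qed auto
      then have "(-1) ^ card (X j) * of_nat (\<Prod>(X j)) powr (- s j) = (\<Prod>p\<in>X j. (-1) * of_nat p powr (- s j))"
        unfolding prod.distrib using X2[OF that] by simp
      also have "\<dots> = (\<Prod>p\<in>X j. g j p)" by (simp add: g_def)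
      also have "\<dots> = (\<Prod>p\<in>A. if p \<in> X j then g j p else 1)"
        using fin X[OF that] by (intro prod_subset_if)
      finally show ?thesis .
    qed
    have 2: "(\<Prod>j\<in>J. if p \<in> X j then g j p else 1) = (\<Prod>j\<in>\<phi> X p. g j p)" if "p \<in> A" for p
      using fin that by (simp add: \<phi>_def prod.inter_filter)
    have "(\<Prod>j\<in>J. (-1) ^ card (X j) * of_nat (\<Prod>(X j)) powr (- s j)) = (\<Prod>p\<in>A. \<Prod>j\<in>J. if p \<in> X j then g j p else 1)"
      by (subst prod.swap, rule prod.cong[OF refl]) (rule 1)
    also have "\<dots> = (\<Prod>p\<in>A. \<Prod>j\<in>\<phi> X p. g j p)" by (rule prod.cong[OF refl]) (rule 2)
    finally have 3: "(\<Prod>j\<in>J. (-1) ^ card (X j) * of_nat (\<Prod>(X j)) powr (- s j)) = (\<Prod>p\<in>A. \<Prod>j\<in>\<phi> X p. g j p)" .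
    have "1 / of_nat (\<Prod>(\<Union>j\<in>J. X j)) = (\<Prod>p\<in>(\<Union>j\<in>J. X j). 1 / of_nat p :: complex)"
      by (simp add: prod_dividef)
    also have "\<dots> = (\<Prod>p\<in>A. if p \<in> (\<Union>j\<in>J. X j) then 1 / of_nat p else 1)"
      using fin X by (intro prod_subset_if) auto
    also have "\<dots> = (\<Prod>p\<in>A. if \<phi> X p = {} then 1 else 1 / of_nat p)"
      by (intro prod.cong) (auto simp: \<phi>_def)
    finally have 4: "1 / of_nat (\<Prod>(\<Union>j\<in>J. X j)) = (\<Prod>p\<in>A. if \<phi> X p = {} then 1 else 1 / of_nat p :: complex)" .
    show "(\<Prod>p\<in>A. c p (\<phi> X p)) = (\<Prod>j\<in>J. (-1) ^ card (X j) * of_nat (\<Prod>(X j)) powr (- s j)) / of_nat (\<Prod>(\<Union>j\<in>J. X j))"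
      unfolding c_def prod.distrib 3[symmetric] 4[symmetric] by simp
  next
    fix F assume FF: "F \<in> PiE A (\<lambda>_. Pow J)"
    then have ext: "F \<in> extensional A" by (simp add: PiE_def)
    have F: "F p \<subseteq> J" if "p \<in> A" for p using that FF by (auto simp: PiE_iff)
    show "\<phi> (\<lambda>j\<in>J. {p \<in> A. j \<in> F p}) = F"
      using F ext by (auto simp: fun_eq_iff restrict_def \<phi>_def extensional_def)
    show "(\<lambda>j\<in>J. {p \<in> A. j \<in> F p}) \<in> PiE J (\<lambda>_. Pow A)" by auto
  qed
  also have "\<dots> = (\<Prod>p\<in>A. \<Sum>S\<in>Pow J. c p S)"
    using fin by (intro prod_sum_PiE[symmetric]) auto
  also have "\<dots> = (\<Prod>p\<in>A. Mfac k s p)"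
  proof (intro prod.cong refl)
    fix p assume "p \<in> A"
    then have p: "prime p" by (simp add: A_def primes_upto_def)
    have "c p S = (-1) ^ card S * of_nat p powr (-(1 + sS s S))" if "S \<in> Pow J - {{}}" for S
    proof -
      have fS: "finite S" using that fin finite_subset by auto
      have p0: "p > 0" using p prime_gt_0_nat by blast
      have "(\<Prod>j\<in>S. g j p) = (\<Prod>j\<in>S. (-1) * of_nat p powr (- s j))" by (simp add: g_def)
      also have "\<dots> = (-1) ^ card S * (\<Prod>j\<in>S. of_nat p powr (- s j))" unfolding prod.distrib by simp
      also have "(\<Prod>j\<in>S. of_nat p powr (- s j)) = of_nat p powr (- sS s S)"
        unfolding sS_def using fS p0
        by (induction S rule: finite_induct) (auto simp flip: powr_add simp: add.commute)
      finally show ?thesis using that p0 by (simp add: c_def powr_diff powr_minus field_simps)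
    qed
    then have "(\<Sum>S\<in>Pow J - {{}}. c p S) = (\<Sum>S\<in>Pow J - {{}}. (-1) ^ card S * of_nat p powr (-(1 + sS s S)))"
      by (intro sum.cong refl)
    moreover have "(\<Sum>S\<in>Pow J. c p S) = c p {} + (\<Sum>S\<in>Pow J - {{}}. c p S)"
      using fin by (intro sum.remove) auto
    ultimately show "(\<Sum>S\<in>Pow J. c p S) = Mfac k s p"
      unfolding Mfac_expand[OF p] J_def by (simp add: c_def)
  qed
  also have "\<dots> = (\<Prod>p\<le>N. Mfac k s p)"
    unfolding A_def primes_upto_def
    by (rule prod.mono_neutral_left) (auto simp: Mfac_def)
  finally show ?thesis by (simp add: J_def A_def)
qed

section \<open>Divisibility patterns and sums near the boundary of the range\<close>

definition nonempty_subsets :: "nat set \<Rightarrow> nat set set" where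
  "nonempty_subsets J = Pow J - {{}}"

text \<open>The atoms of the Venn diagram of the sets \<open>X j\<close>: the primes whose pattern
  of occurrence is exactly S.\<close>

definition cells :: "nat set \<Rightarrow> nat set \<Rightarrow> (nat \<Rightarrow> nat set) \<Rightarrow> nat set \<Rightarrow> nat set" where
  "cells J A X S = {p\<in>A. {j\<in>J. p \<in> X j} = S}"

lemma UN_cells:
  assumes "\<And>j. j \<in> J \<Longrightarrow> X j \<subseteq> A"
  shows "(\<Union>j\<in>J. X j) = (\<Union>S\<in>nonempty_subsets J. cells J A X S)"
proof (intro equalityI subsetI)
  fix p assume "p \<in> (\<Union>j\<in>J. X j)"
  then obtain j where j: "j \<in> J" "p \<in> X j" by blast
  then have "{j\<in>J. p \<in> X j} \<in> nonempty_subsets J" by (auto simp: nonempty_subsets_def)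
  moreover have "p \<in> cells J A X {j\<in>J. p \<in> X j}" using j assms by (auto simp: cells_def)
  ultimately show "p \<in> (\<Union>S\<in>nonempty_subsets J. cells J A X S)" by blast
next
  fix p assume "p \<in> (\<Union>S\<in>nonempty_subsets J. cells J A X S)"
  then obtain S where S: "S \<in> nonempty_subsets J" "{j\<in>J. p \<in> X j} = S" by (auto simp: cells_def)
  then obtain j where "j \<in> S" by (auto simp: nonempty_subsets_def)
  then show "p \<in> (\<Union>j\<in>J. X j)" using S by auto
qed

lemma component_UN_cells:
  assumes "X j \<subseteq> A" "j \<in> J"
  shows "X j = (\<Union>S\<in>{S\<in>nonempty_subsets J. j \<in> S}. cells J A X S)"
proof (intro equalityI subsetI)
  fix p assume p: "p \<in> X j"
  then have "{j\<in>J. p \<in> X j} \<in> {S\<in>nonempty_subsets J. j \<in> S}" using assms by (auto simp: nonempty_subsets_def)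
  moreover have "p \<in> cells J A X {j\<in>J. p \<in> X j}" using p assms by (auto simp: cells_def)
  ultimately show "p \<in> (\<Union>S\<in>{S\<in>nonempty_subsets J. j \<in> S}. cells J A X S)" by blast
next
  fix p assume "p \<in> (\<Union>S\<in>{S\<in>nonempty_subsets J. j \<in> S}. cells J A X S)"
  then obtain S where "j \<in> S" "{j\<in>J. p \<in> X j} = S" by (auto simp: cells_def)
  then show "p \<in> X j" by auto
qed

text \<open>Sorting the primes by the set of indices j with p dividing d j turns a tuple of squarefree
  numbers into an injectively chosen family of free variables whose product is the lcm.\<close>

lemma sum_prime_tuples_le_cells:
  fixes P :: "(nat set \<Rightarrow> nat) \<Rightarrow> real"
  assumes J: "finite J" and Pn: "\<And>D. P D \<ge> 0"
  shows "(\<Sum>X\<in>{X\<in>PiE J (\<lambda>_. Pow (primes_upto N)). \<forall>j\<in>J. \<Prod>(X j) \<le> Y}.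
        P (\<lambda>S\<in>nonempty_subsets J. \<Prod>(cells J (primes_upto N) X S)) / real (\<Prod>(\<Union>j\<in>J. X j)))
     \<le> (\<Sum>D\<in>PiE (nonempty_subsets J) (\<lambda>_. {1..Y}). P D * (\<Prod>S\<in>nonempty_subsets J. 1 / real (D S)))"
proof -
  define A where "A = primes_upto N"
  have A: "finite A" "\<And>p. p \<in> A \<Longrightarrow> prime p" by (auto simp: A_def primes_upto_def)
  define T where "T = nonempty_subsets J"
  have T: "finite T" using J by (simp add: T_def nonempty_subsets_def)
  define XX where "XX = {X\<in>PiE J (\<lambda>_. Pow A). \<forall>j\<in>J. \<Prod>(X j) \<le> Y}"
  define \<psi> where "\<psi> = (\<lambda>X. \<lambda>S\<in>T. \<Prod>(cells J A X S))"
  have cells: "finite (cells J A X S)" "\<And>p. p \<in> cells J A X S \<Longrightarrow> prime p" for X S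
    using A by (auto simp: cells_def)
  have pf: "prime_factors (\<Prod>(cells J A X S)) = cells J A X S" for X S
    by (rule prime_factors_prod_primes) (use A in \<open>auto simp: cells_def\<close>)
  have union: "(\<Union>j\<in>J. X j) = (\<Union>S\<in>T. cells J A X S)" if "X \<in> XX" for X
  proof -
    have "X j \<subseteq> A" if "j \<in> J" for j using that \<open>X \<in> XX\<close> by (auto simp: XX_def PiE_iff)
    then show ?thesis unfolding T_def by (rule UN_cells)
  qed
  have lcm: "real (\<Prod>(\<Union>j\<in>J. X j)) = (\<Prod>S\<in>T. real (\<psi> X S))" if "X \<in> XX" for X
  proof -
    have "\<Prod>(\<Union>S\<in>T. cells J A X S) = (\<Prod>S\<in>T. \<Prod>(cells J A X S))"
      by (rule prod.UNION_disjoint) (use T A(1) in \<open>auto simp: cells_def\<close>)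
    then show ?thesis unfolding union[OF that] by (simp add: \<psi>_def)
  qed
  have "(\<Sum>X\<in>XX. P (\<psi> X) / real (\<Prod>(\<Union>j\<in>J. X j))) = (\<Sum>X\<in>XX. (\<lambda>D. P D * (\<Prod>S\<in>T. 1 / real (D S))) (\<psi> X))"
    by (intro sum.cong refl, subst lcm) (simp_all add: prod_dividef)
  also have "\<dots> = (\<Sum>D\<in>\<psi> ` XX. P D * (\<Prod>S\<in>T. 1 / real (D S)))"
  proof (rule sum.reindex[symmetric, unfolded o_def])
    show "inj_on \<psi> XX"
    proof (rule inj_onI)
      fix X X' assume X: "X \<in> XX" "X' \<in> XX" and eq: "\<psi> X = \<psi> X'"
      have c: "cells J A X S = cells J A X' S" if "S \<in> T" for S
      proof -
        have "\<psi> X S = \<psi> X' S" using eq by simp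
        then have "\<Prod>(cells J A X S) = \<Prod>(cells J A X' S)" using that by (simp add: \<psi>_def)
        then show ?thesis using pf by metis
      qed
      have sub: "X j \<subseteq> A" "X' j \<subseteq> A" if "j \<in> J" for j using that X by (auto simp: XX_def PiE_iff)
      have "X j = X' j" if j: "j \<in> J" for j
      proof -
        have *: "Z j = (\<Union>S\<in>{S\<in>T. j \<in> S}. cells J A Z S)" if "Z j \<subseteq> A" for Z
          unfolding T_def using component_UN_cells[of Z j A J, OF that j] .
        have "X j = (\<Union>S\<in>{S\<in>T. j \<in> S}. cells J A X S)" using *[of X] sub(1)[OF j] .
        also have "\<dots> = (\<Union>S\<in>{S\<in>T. j \<in> S}. cells J A X' S)" using c by auto
        also have "\<dots> = X' j" using *[of X', symmetric] sub(2)[OF j] .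
        finally show ?thesis .
      qed
      moreover have "X \<in> extensional J" "X' \<in> extensional J" using X by (auto simp: XX_def PiE_def)
      ultimately show "X = X'" by (intro extensionalityI[of X J X']) auto
    qed
  qed
  also have "\<dots> \<le> (\<Sum>D\<in>PiE T (\<lambda>_. {1..Y}). P D * (\<Prod>S\<in>T. 1 / real (D S)))"
  proof (rule sum_mono2)
    show "finite (PiE T (\<lambda>_. {1..Y}))" using T by (intro finite_PiE) auto
    show "\<psi> ` XX \<subseteq> PiE T (\<lambda>_. {1..Y})"
    proof clarify
      fix X assume X: "X \<in> XX"
      have "\<Prod>(cells J A X S) \<in> {1..Y}" if S: "S \<in> T" for S
      proof -
        obtain j where j: "j \<in> S" "j \<in> J" using S by (auto simp: T_def nonempty_subsets_def)
        have Xj: "X j \<subseteq> A" "\<Prod>(X j) \<le> Y" using X j by (auto simp: XX_def PiE_iff)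
        have "\<Prod>(cells J A X S) \<le> \<Prod>(X j)"
        proof (rule dvd_imp_le)
          show "\<Prod>(cells J A X S) dvd \<Prod>(X j)"
            using j Xj A by (intro prod_dvd_prod_subset finite_subset[OF Xj(1)]) (auto simp: cells_def)
          show "\<Prod>(X j) > 0" using Xj(1) A(2) prime_gt_0_nat by (intro prod_pos) blast
        qed
        moreover have "\<Prod>(cells J A X S) > 0" using cells by (intro prod_pos) (auto intro: prime_gt_0_nat)
        ultimately show ?thesis using Xj by auto
      qed
      then show "\<psi> X \<in> PiE T (\<lambda>_. {1..Y})" by (auto simp: \<psi>_def)
    qed
  qed (use Pn in \<open>auto intro!: mult_nonneg_nonneg prod_nonneg\<close>)
  finally show ?thesis by (simp add: XX_def A_def T_def \<psi>_def)
qed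

lemma component_eq_prod_cells:
  assumes J: "finite J" and X: "X j \<subseteq> A" "finite A" and j: "j \<in> J"
  shows "\<Prod>(X j) = (\<Prod>S\<in>{S\<in>nonempty_subsets J. j \<in> S}. \<Prod>(cells J A X S))"
proof -
  have "X j = (\<Union>S\<in>{S\<in>nonempty_subsets J. j \<in> S}. cells J A X S)"
    using component_UN_cells[of X j A J, OF X(1) j] .
  then have "\<Prod>(X j) = \<Prod>(\<Union>S\<in>{S\<in>nonempty_subsets J. j \<in> S}. cells J A X S)" by (rule arg_cong)
  also have "\<dots> = (\<Prod>S\<in>{S\<in>nonempty_subsets J. j \<in> S}. \<Prod>(cells J A X S))"
    by (rule prod.UNION_disjoint) (use J X(2) in \<open>auto simp: cells_def nonempty_subsets_def\<close>)
  finally show ?thesis .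
qed

lemma sum_reciprocals_le_ln:
  assumes "1 \<le> m" "m \<le> n"
  shows "(\<Sum>i\<in>{m<..n}. 1 / real i) \<le> ln (real n / real m)"
  using assms(2)
proof (induction n rule: dec_induct)
  case base
  then show ?case using assms by simp
next
  case (step n)
  have n: "n \<ge> 1" using step assms by simp
  have "{m<..Suc n} = insert (Suc n) {m<..n}" using step by auto
  then have "(\<Sum>i\<in>{m<..Suc n}. 1 / real i) = 1 / real (Suc n) + (\<Sum>i\<in>{m<..n}. 1 / real i)" by simp
  also have "\<dots> \<le> 1 / real (Suc n) + ln (real n / real m)" using step by simp
  also have "1 / real (Suc n) \<le> ln (real (Suc n) / real n)"
  proof -
    have "ln (real n / real (Suc n)) \<le> real n / real (Suc n) - 1"
      using n by (intro ln_le_minus_one) auto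
    then show ?thesis using n by (simp add: ln_div field_simps)
  qed
  finally show ?case using n assms by (simp add: ln_div)
qed

text \<open>The least element is split off, since a multiplicatively short interval may contain just
  one integer, which costs up to 1/y. The others are compared with the logarithm of the ratio of the
  end points, at most e.\<close>

lemma sum_reciprocals_interval_le:
  assumes B: "finite B" "\<And>n. n \<in> B \<Longrightarrow> a < real n \<and> real n \<le> a * exp e \<and> y \<le> real n" and a: "a > 0" and y: "y > 0" and e: "e \<ge> 0"
  shows "(\<Sum>n\<in>B. 1 / real n) \<le> 1 / y + e"
proof (cases "B = {}")
  case False
  define m where "m = Min B"
  define M where "M = Max B"
  have m: "m \<in> B" "M \<in> B" using B(1) False by (auto simp: m_def M_def)
  have mM: "m \<le> M" using B(1) m by (simp add: m_def)
  have m1: "1 \<le> m"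
  proof -
    have "real m > 0" using B(2)[OF m(1)] a by linarith
    then show ?thesis by simp
  qed
  have "(\<Sum>n\<in>B. 1 / real n) = 1 / real m + (\<Sum>n\<in>B - {m}. 1 / real n)"
    using B(1) m by (intro sum.remove) auto
  also have "(\<Sum>n\<in>B - {m}. 1 / real n) \<le> (\<Sum>n\<in>{m<..M}. 1 / real n)"
  proof (rule sum_mono2)
    show "B - {m} \<subseteq> {m<..M}"
      using Min_le[OF B(1)] Max_ge[OF B(1)] unfolding m_def M_def by (auto simp: order_less_le)
  qed auto
  also have "\<dots> \<le> ln (real M / real m)" by (rule sum_reciprocals_le_ln[OF m1 mM])
  also have "\<dots> \<le> ln (exp e)"
  proof (rule ln_mono)
    have "real M \<le> a * exp e" "a < real m" using B(2) m by auto
    then have "real M \<le> real m * exp e" by (meson mult_right_mono exp_ge_zero less_imp_le order_trans)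
    then show "real M / real m \<le> exp e" using m1 by (simp add: field_simps)
    show "0 < real M / real m" using m1 mM by simp
  qed
  also have "1 / real m \<le> 1 / y" using B(2)[OF m(1)] y by (intro frac_le) auto
  finally show ?thesis by simp
qed (use y e in auto)

lemma sum_harmonic_PiE_le:
  assumes T: "finite T" and Y: "Y \<ge> 1"
  shows "(\<Sum>D\<in>PiE T (\<lambda>_. {1..Y}). \<Prod>S\<in>T. 1 / real (D S)) \<le> (1 + ln (real Y)) ^ card T"
proof -
  have "(\<Sum>D\<in>PiE T (\<lambda>_. {1..Y}). \<Prod>S\<in>T. 1 / real (D S)) = (\<Prod>S\<in>T. \<Sum>n\<in>{1..Y}. 1 / real n)"
    using T by (intro prod_sum_PiE[symmetric]) auto
  also have "\<dots> = (\<Sum>n\<in>{1..Y}. 1 / real n) ^ card T" by simp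
  also have "\<dots> \<le> (1 + ln (real Y)) ^ card T"
  proof (rule power_mono)
    have "{1..Y} = insert 1 {1<..Y}" using Y by auto
    then have "(\<Sum>n\<in>{1..Y}. 1 / real n) = 1 + (\<Sum>n\<in>{1<..Y}. 1 / real n)" by simp
    also have "\<dots> \<le> 1 + ln (real Y)" using sum_reciprocals_le_ln[of 1 Y] Y by simp
    finally show "(\<Sum>n\<in>{1..Y}. 1 / real n) \<le> 1 + ln (real Y)" .
  qed (auto intro!: sum_nonneg)
  finally show ?thesis .
qed

text \<open>If the product over T1 exceeds x \<ge> y^(card T), one of its factors exceeds y. With
  all other coordinates frozen this factor is confined to an interval of ratio exp e, which gives
  1/y + e, while each of the others contributes a harmonic sum. Summing over the choice of the large
  factor accounts for \<open>card T\<close>.\<close>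

lemma sum_interval_PiE_le:
  fixes T1 :: "'s set"
  assumes T: "finite T" and T1: "T1 \<subseteq> T" and Y: "Y \<ge> 1" and y: "y \<ge> 1" "y ^ card T \<le> x" and e: "e \<ge> 0"
  shows "(\<Sum>D\<in>PiE T (\<lambda>_. {1..Y}). of_bool (x < real (\<Prod>S\<in>T1. D S) \<and> real (\<Prod>S\<in>T1. D S) \<le> x * exp e) * (\<Prod>S\<in>T. 1 / real (D S)))
    \<le> real (card T) * ((1 / y + e) * (1 + ln (real Y)) ^ (card T - 1))"
proof -
  define Q where "Q = (\<lambda>D. x < real (\<Prod>S\<in>T1. D S) \<and> real (\<Prod>S\<in>T1. D S) \<le> x * exp e)"
  define w where "w = (\<lambda>D. \<Prod>S\<in>T. 1 / real (D S :: nat))"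
  define PP where "PP = PiE T (\<lambda>_. {1..Y})"
  have finT1: "finite T1" using T T1 finite_subset by blast
  have w0: "w D \<ge> 0" for D by (auto simp: w_def intro!: prod_nonneg)
  have "x > 0" using y by (smt (verit) one_le_power)
  have one: "(\<Sum>D\<in>PP. of_bool (Q D \<and> y \<le> real (D S0)) * w D) \<le> (1 / y + e) * (1 + ln (real Y)) ^ (card T - 1)" if S0: "S0 \<in> T1" for S0
  proof -
    define T' where "T' = T - {S0}"
    have T': "finite T'" "T = insert S0 T'" "S0 \<notin> T'" "card T' = card T - 1"
      using T T1 S0 by (auto simp: T'_def)
    have T1': "T1 - {S0} \<subseteq> T'" using T1 by (auto simp: T'_def)
    have "(\<Sum>D\<in>PP. of_bool (Q D \<and> y \<le> real (D S0)) * w D) =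
      (\<Sum>(n, D)\<in>{1..Y} \<times> PiE T' (\<lambda>_. {1..Y}). of_bool (Q (D(S0 := n)) \<and> y \<le> real n) * w (D(S0 := n)))"
      unfolding PP_def T'(2) PiE_insert_eq
      by (subst sum.reindex[OF inj_combinator[OF T'(3)]]) (simp add: case_prod_unfold)
    also have "\<dots> = (\<Sum>D\<in>PiE T' (\<lambda>_. {1..Y}). \<Sum>n\<in>{1..Y}. of_bool (Q (D(S0 := n)) \<and> y \<le> real n) * w (D(S0 := n)))"
      by (subst sum.cartesian_product[symmetric], subst sum.swap) simp
    also have "\<dots> \<le> (\<Sum>D\<in>PiE T' (\<lambda>_. {1..Y}). (1 / y + e) * (\<Prod>S\<in>T'. 1 / real (D S)))"
    proof (rule sum_mono)
      fix D assume D: "D \<in> PiE T' (\<lambda>_. {1..Y})"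
      define c where "c = real (\<Prod>S\<in>T1 - {S0}. D S)"
      have c: "c > 0" unfolding c_def of_nat_0_less_iff
        using D T1' by (intro prod_pos) (auto simp: PiE_iff Suc_le_eq subset_iff)
      have wD: "w (D(S0 := n)) = 1 / real n * (\<Prod>S\<in>T'. 1 / real (D S))" for n
      proof -
        have "(\<Prod>S\<in>T'. 1 / real ((D(S0 := n)) S)) = (\<Prod>S\<in>T'. 1 / real (D S))"
          using T'(3) by (intro prod.cong) auto
        then show ?thesis unfolding w_def T'(2) prod.insert[OF T'(1,3)] by simp
      qed
      have QD: "Q (D(S0 := n)) \<longleftrightarrow> x / c < real n \<and> real n \<le> x / c * exp e" for n
      proof -
        have "(\<Prod>S\<in>T1. (D(S0 := n)) S) = n * (\<Prod>S\<in>T1 - {S0}. (D(S0 := n)) S)"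
          using prod.remove[OF finT1 S0, of "D(S0 := n)"] by simp
        also have "(\<Prod>S\<in>T1 - {S0}. (D(S0 := n)) S) = (\<Prod>S\<in>T1 - {S0}. D S)" by (intro prod.cong) auto
        finally have "real (\<Prod>S\<in>T1. (D(S0 := n)) S) = real n * c" by (simp add: c_def)
        then show ?thesis unfolding Q_def using c by (simp add: field_simps)
      qed
      define B where "B = {n\<in>{1..Y}. Q (D(S0 := n)) \<and> y \<le> real n}"
      have "(\<Sum>n\<in>{1..Y}. of_bool (Q (D(S0 := n)) \<and> y \<le> real n) * w (D(S0 := n))) =
            (\<Sum>n\<in>{1..Y}. if Q (D(S0 := n)) \<and> y \<le> real n then 1 / real n else 0) * (\<Prod>S\<in>T'. 1 / real (D S))"
        unfolding wD sum_distrib_right by (intro sum.cong) auto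
      also have "(\<Sum>n\<in>{1..Y}. if Q (D(S0 := n)) \<and> y \<le> real n then 1 / real n else 0) = (\<Sum>n\<in>B. 1 / real n)"
        unfolding B_def by (rule sum.inter_filter[symmetric]) simp
      also have "(\<Sum>n\<in>B. 1 / real n) * (\<Prod>S\<in>T'. 1 / real (D S)) \<le> (1 / y + e) * (\<Prod>S\<in>T'. 1 / real (D S))"
        using y c e \<open>x > 0\<close>
        by (intro mult_right_mono sum_reciprocals_interval_le[where a = "x / c"] prod_nonneg) (auto simp: B_def QD)
      finally show "(\<Sum>n\<in>{1..Y}. of_bool (Q (D(S0 := n)) \<and> y \<le> real n) * w (D(S0 := n))) \<le> (1 / y + e) * (\<Prod>S\<in>T'. 1 / real (D S))" .
    qed
    also have "\<dots> = (1 / y + e) * (\<Sum>D\<in>PiE T' (\<lambda>_. {1..Y}). \<Prod>S\<in>T'. 1 / real (D S))"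
      by (simp add: sum_distrib_left)
    also have "\<dots> \<le> (1 / y + e) * (1 + ln (real Y)) ^ card T'"
      using y e Y by (intro mult_left_mono sum_harmonic_PiE_le T') auto
    finally show ?thesis by (simp add: T'(4))
  qed
  have "(\<Sum>D\<in>PP. of_bool (Q D) * w D) \<le> (\<Sum>D\<in>PP. \<Sum>S0\<in>T1. of_bool (Q D \<and> y \<le> real (D S0)) * w D)"
  proof (rule sum_mono)
    fix D assume D: "D \<in> PP"
    show "of_bool (Q D) * w D \<le> (\<Sum>S0\<in>T1. of_bool (Q D \<and> y \<le> real (D S0)) * w D)"
    proof (cases "Q D")
      case True
      have "\<exists>S0\<in>T1. y \<le> real (D S0)"
      proof (rule ccontr)
        assume neg: "\<not> ?thesis"
        have "real (\<Prod>S\<in>T1. D S) = (\<Prod>S\<in>T1. real (D S))" by simp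
        also have "\<dots> \<le> (\<Prod>S\<in>T1. y)" using neg by (intro prod_mono) (auto simp: not_le intro: less_imp_le)
        also have "\<dots> = y ^ card T1" by simp
        also have "\<dots> \<le> y ^ card T" using y T T1 by (intro power_increasing card_mono) auto
        also have "\<dots> \<le> x" by (rule y)
        finally show False using True by (simp add: Q_def)
      qed
      then obtain S0 where S0: "S0 \<in> T1" "y \<le> real (D S0)" by blast
      then have "of_bool (Q D) * w D = of_bool (Q D \<and> y \<le> real (D S0)) * w D" by simp
      also have "\<dots> \<le> (\<Sum>S0\<in>T1. of_bool (Q D \<and> y \<le> real (D S0)) * w D)"
        using w0 by (intro member_le_sum S0 finT1) auto
      finally show ?thesis .
    qed (use w0 in \<open>auto intro!: sum_nonneg\<close>)
  qed
  also have "\<dots> = (\<Sum>S0\<in>T1. \<Sum>D\<in>PP. of_bool (Q D \<and> y \<le> real (D S0)) * w D)" by (rule sum.swap)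
  also have "\<dots> \<le> (\<Sum>S0\<in>T1. (1 / y + e) * (1 + ln (real Y)) ^ (card T - 1))"
    by (intro sum_mono one)
  also have "\<dots> = real (card T1) * ((1 / y + e) * (1 + ln (real Y)) ^ (card T - 1))" by simp
  also have "\<dots> \<le> real (card T) * ((1 / y + e) * (1 + ln (real Y)) ^ (card T - 1))"
    using card_mono[OF T T1] y e Y by (intro mult_right_mono mult_nonneg_nonneg) auto
  finally show ?thesis by (simp add: PP_def Q_def w_def)
qed

definition smooth_Mk :: "nat \<Rightarrow> real \<Rightarrow> real \<Rightarrow> real" where
  "smooth_Mk k u h = (\<Sum>d\<in>Pi\<^sub>E {..<2*k} (\<lambda>_. {1..nat \<lfloor>exp u\<rfloor>}).
       (\<Prod>j<2*k. real_of_int (moebius (d j))) * (\<Prod>j<2*k. perron_weight h (u - ln (real (d j)))) / real (Lcm (d ` {..<2*k})))"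

lemma perron_weight_bounds: "h > 0 \<Longrightarrow> 0 \<le> perron_weight h v \<and> perron_weight h v \<le> 1"
  by (simp add: perron_weight_def)

lemma one_minus_prod_le:
  fixes w :: "'j \<Rightarrow> real"
  assumes "finite J" "\<And>j. j \<in> J \<Longrightarrow> 0 \<le> w j \<and> w j \<le> 1"
  shows "1 - (\<Prod>j\<in>J. w j) \<le> (\<Sum>j\<in>J. 1 - w j)" "(\<Prod>j\<in>J. w j) \<le> 1"
proof -
  have "1 - (\<Prod>j\<in>J. w j) \<le> (\<Sum>j\<in>J. 1 - w j) \<and> (\<Prod>j\<in>J. w j) \<le> 1 \<and> 0 \<le> (\<Prod>j\<in>J. w j)"
    using assms
  proof (induction J rule: finite_induct)
    case (insert i J)
    define P where "P = (\<Prod>j\<in>J. w j)"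
    have IH: "1 - P \<le> (\<Sum>j\<in>J. 1 - w j)" "P \<le> 1" "0 \<le> P" and w: "0 \<le> w i" "w i \<le> 1"
      using insert by (auto simp: P_def)
    have "w i * P \<le> 1 * 1" using IH w by (intro mult_mono) auto
    moreover have "(1 - w i) * (1 - P) \<ge> 0" using IH w by (intro mult_nonneg_nonneg) auto
    ultimately show ?case using insert.hyps IH w by (simp add: P_def[symmetric] algebra_simps)
  qed auto
  then show "1 - (\<Prod>j\<in>J. w j) \<le> (\<Sum>j\<in>J. 1 - w j)" "(\<Prod>j\<in>J. w j) \<le> 1" by auto
qed

text \<open>In terms of the cells, d_j is the product of the variables D_S with j in S, so the
  condition that ln d_j lies in (u - e, u] becomes the interval condition of
  \<open>sum_interval_PiE_le\<close> with x = exp (u - e) and y = exp ((u - e) / n), n being the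
  number of cells. The constant E is carried along for tuples away from the boundary.\<close>

lemma sum_near_boundary_le:
  fixes u e E :: real
  assumes k: "k \<ge> 1" and j: "j < 2*k" and e: "0 \<le> e" "e \<le> u" and E: "E \<ge> 0"
  defines "n \<equiv> 2 ^ (2*k) - 1 :: nat" and "Y \<equiv> nat \<lfloor>exp u\<rfloor>"
  shows "(\<Sum>d\<in>Pi\<^sub>E {..<2*k} (\<lambda>_. {1..Y}). (\<Prod>j<2*k. \<bar>real_of_int (moebius (d j))\<bar>) *
            (of_bool (u - e < ln (real (d j))) + E) / real (Lcm (d ` {..<2*k})))
     \<le> real n * ((exp (-((u - e) / real n)) + e) * (1 + u) ^ (n - 1)) + E * (1 + u) ^ n"
proof -
  define J where "J = {..<2*k}"
  have J: "finite J" "j \<in> J" using j by (auto simp: J_def)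
  define T where "T = nonempty_subsets J"
  have T: "finite T" "card T = n"
    by (auto simp: T_def nonempty_subsets_def J_def n_def card_Pow)
  have "(2::nat) ^ 1 \<le> 2 ^ (2*k)" using k by (intro power_increasing) auto
  then have n: "n \<ge> 1" by (simp add: n_def)
  have u: "u \<ge> 0" using e by simp
  have "1 \<le> \<lfloor>exp u\<rfloor>" using u by (simp add: le_floor_iff)
  then have Y: "Y \<ge> 1" unfolding Y_def by linarith
  have Yu: "real Y \<le> exp u" unfolding Y_def using \<open>1 \<le> \<lfloor>exp u\<rfloor>\<close> by linarith
  have "ln (real Y) \<le> ln (exp u)" using Yu Y by (intro ln_mono) auto
  then have lnY: "1 + ln (real Y) \<le> 1 + u" "0 \<le> ln (real Y)" using Y by auto
  define x where "x = exp (u - e)"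
  have xe: "x * exp e = exp u" by (simp add: x_def flip: exp_add)
  define T1 where "T1 = {S\<in>T. j \<in> S}"
  define P where "P = (\<lambda>D. of_bool (x < real (\<Prod>S\<in>T1. D S) \<and> real (\<Prod>S\<in>T1. D S) \<le> x * exp e) + E)"
  define F where "F = {X\<in>PiE J (\<lambda>_. Pow (primes_upto Y)). \<forall>j\<in>J. \<Prod>(X j) \<le> Y}"
  have "(\<Sum>d\<in>PiE J (\<lambda>_. {1..Y}). (\<Prod>j\<in>J. \<bar>real_of_int (moebius (d j))\<bar>) *
            (of_bool (u - e < ln (real (d j))) + E) / real (Lcm (d ` J)))
     = (\<Sum>X\<in>F. (\<Prod>j\<in>J. \<bar>real_of_int ((-1) ^ card (X j))\<bar>) * (of_bool (u - e < ln (real ((\<lambda>j\<in>J. \<Prod>(X j)) j))) + E) / real (\<Prod>(\<Union>j\<in>J. X j)))"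
    unfolding F_def
    by (rule sum_moebius_tuples[OF J(1), where f = "\<lambda>i. \<bar>real_of_int i\<bar>" and H = "\<lambda>d. of_bool (u - e < ln (real (d j))) + E"]) auto
  also have "\<dots> = (\<Sum>X\<in>F. P (\<lambda>S\<in>T. \<Prod>(cells J (primes_upto Y) X S)) / real (\<Prod>(\<Union>j\<in>J. X j)))"
  proof (rule sum.cong[OF refl])
    fix X assume X: "X \<in> F"
    have Xj: "X j \<subseteq> primes_upto Y" "\<Prod>(X j) \<le> Y" using X J(2) by (auto simp: F_def PiE_iff)
    have pos: "\<Prod>(X j) > 0" using primes_upto_subset[OF Xj(1)] by (intro prod_pos) (auto intro: prime_gt_0_nat)
    have "(\<Prod>S\<in>T1. (\<lambda>S\<in>T. \<Prod>(cells J (primes_upto Y) X S)) S) = (\<Prod>S\<in>T1. \<Prod>(cells J (primes_upto Y) X S))"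
      by (rule prod.cong) (auto simp: T1_def)
    also have "\<dots> = \<Prod>(X j)"
      unfolding T1_def T_def using component_eq_prod_cells[of J X j "primes_upto Y"] J Xj by simp
    finally have c: "(\<Prod>S\<in>T1. (\<lambda>S\<in>T. \<Prod>(cells J (primes_upto Y) X S)) S) = \<Prod>(X j)" .
    have "real (\<Prod>(X j)) \<le> exp u" using Xj(2) Yu by linarith
    moreover have "u - e < ln (real (\<Prod>(X j))) \<longleftrightarrow> x < real (\<Prod>(X j))"
      unfolding x_def using pos by (metis exp_less_cancel_iff exp_ln of_nat_0_less_iff)
    ultimately have "P (\<lambda>S\<in>T. \<Prod>(cells J (primes_upto Y) X S)) = of_bool (u - e < ln (real (\<Prod>(X j)))) + E"
      unfolding P_def c xe by simp
    moreover have "(\<Prod>j\<in>J. \<bar>real_of_int ((-1) ^ card (X j))\<bar>) = 1" by (simp add: power_abs)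
    ultimately show "(\<Prod>j\<in>J. \<bar>real_of_int ((-1) ^ card (X j))\<bar>) * (of_bool (u - e < ln (real ((\<lambda>j\<in>J. \<Prod>(X j)) j))) + E) / real (\<Prod>(\<Union>j\<in>J. X j))
       = P (\<lambda>S\<in>T. \<Prod>(cells J (primes_upto Y) X S)) / real (\<Prod>(\<Union>j\<in>J. X j))"
      using J(2) by simp
  qed
  also have "\<dots> \<le> (\<Sum>D\<in>PiE T (\<lambda>_. {1..Y}). P D * (\<Prod>S\<in>T. 1 / real (D S)))"
    unfolding T_def F_def using E by (intro sum_prime_tuples_le_cells J) (auto simp: P_def)
  also have "\<dots> = (\<Sum>D\<in>PiE T (\<lambda>_. {1..Y}). of_bool (x < real (\<Prod>S\<in>T1. D S) \<and> real (\<Prod>S\<in>T1. D S) \<le> x * exp e) * (\<Prod>S\<in>T. 1 / real (D S)))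
      + E * (\<Sum>D\<in>PiE T (\<lambda>_. {1..Y}). \<Prod>S\<in>T. 1 / real (D S))"
    by (simp add: P_def distrib_right sum.distrib sum_distrib_left)
  also have "\<dots> \<le> real (card T) * ((1 / exp ((u - e) / real n) + e) * (1 + ln (real Y)) ^ (card T - 1)) + E * (1 + ln (real Y)) ^ card T"
  proof (intro add_mono mult_left_mono sum_harmonic_PiE_le T Y E sum_interval_PiE_le)
    show "T1 \<subseteq> T" by (auto simp: T1_def)
    show "1 \<le> exp ((u - e) / real n)" using e by simp
    have "exp ((u - e) / real n) ^ card T = exp (real n * ((u - e) / real n))"
      unfolding T(2) by (rule exp_of_nat_mult[symmetric])
    then show "exp ((u - e) / real n) ^ card T \<le> x" using n by (simp add: x_def)
  qed (use e in auto)
  also have "\<dots> \<le> real n * ((exp (-((u - e) / real n)) + e) * (1 + u) ^ (n - 1)) + E * (1 + u) ^ n"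
    unfolding T(2) using lnY e E
    by (intro add_mono mult_mono mult_left_mono power_mono) (auto simp: exp_minus inverse_eq_divide)
  finally show ?thesis by (simp add: J_def)
qed

text \<open>A weight differs from 1 by at most exp (- e / h) unless ln d_j is within e of u, and
  there the trivial bound 1 is used. The layer width e is a free parameter, to be chosen much larger
  than h.\<close>

lemma Mk_minus_smooth_le:
  fixes u e h :: real
  assumes k: "k \<ge> 1" and e: "0 \<le> e" "e \<le> u" and h: "h > 0"
  defines "n \<equiv> 2 ^ (2*k) - 1 :: nat"
  shows "\<bar>Mk k (exp u) - smooth_Mk k u h\<bar> \<le> real (2*k) * (real n * ((exp (-((u - e) / real n)) + e) * (1 + u) ^ (n - 1)) + exp (- e / h) * (1 + u) ^ n)"
proof -
  define J where "J = {..<2*k}"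
  define Y where "Y = nat \<lfloor>exp u\<rfloor>"
  define \<Omega> where "\<Omega> = PiE J (\<lambda>_. {1..Y})"
  define m where "m = (\<lambda>d. \<Prod>j\<in>J. real_of_int (moebius (d j)))"
  define w where "w = (\<lambda>(d :: nat \<Rightarrow> nat) j. perron_weight h (u - ln (real (d j))))"
  have w: "0 \<le> w d j \<and> w d j \<le> 1" for d j unfolding w_def by (rule perron_weight_bounds[OF h])
  have J: "finite J" by (simp add: J_def)
  have "Mk k (exp u) - smooth_Mk k u h = (\<Sum>d\<in>\<Omega>. m d * (1 - (\<Prod>j\<in>J. w d j)) / real (Lcm (d ` J)))"
    unfolding Mk_def smooth_Mk_def J_def[symmetric] Y_def[symmetric] \<Omega>_def[symmetric] m_def w_def sum_subtractf[symmetric]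
    by (intro sum.cong) (auto simp: diff_divide_distrib right_diff_distrib)
  also have "\<bar>\<dots>\<bar> \<le> (\<Sum>d\<in>\<Omega>. \<Sum>i\<in>J. (\<Prod>j\<in>J. \<bar>real_of_int (moebius (d j))\<bar>) *
            (of_bool (u - e < ln (real (d i))) + exp (- e / h)) / real (Lcm (d ` J)))"
  proof (rule order_trans[OF sum_abs], rule sum_mono)
    fix d assume d: "d \<in> \<Omega>"
    have wi: "1 - w d i \<le> of_bool (u - e < ln (real (d i))) + exp (- e / h)" if "i \<in> J" for i
    proof (cases "u - e < ln (real (d i))")
      case False
      then have "u - ln (real (d i)) \<ge> e" by simp
      then have "1 - w d i = exp (- (u - ln (real (d i))) / h)" using e by (simp add: w_def perron_weight_def)
      also have "\<dots> \<le> exp (- e / h)"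
        using \<open>u - ln (real (d i)) \<ge> e\<close> h by (subst exp_le_cancel_iff, intro divide_right_mono) auto
      finally show ?thesis using False by simp
    next
      case True
      have "1 - w d i \<le> 1" using w by simp
      also have "1 \<le> of_bool (u - e < ln (real (d i))) + exp (- e / h)" using True by simp
      finally show ?thesis .
    qed
    have "\<bar>m d * (1 - (\<Prod>j\<in>J. w d j)) / real (Lcm (d ` J))\<bar> = \<bar>m d\<bar> / real (Lcm (d ` J)) * (1 - (\<Prod>j\<in>J. w d j))"
      using one_minus_prod_le(2)[OF J, of "w d"] w by (simp add: abs_mult)
    also have "\<dots> \<le> \<bar>m d\<bar> / real (Lcm (d ` J)) * (\<Sum>i\<in>J. 1 - w d i)"
      using one_minus_prod_le(1)[OF J, of "w d"] w by (intro mult_left_mono) auto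
    also have "\<dots> \<le> \<bar>m d\<bar> / real (Lcm (d ` J)) * (\<Sum>i\<in>J. of_bool (u - e < ln (real (d i))) + exp (- e / h))"
      by (intro mult_left_mono sum_mono wi) auto
    also have "\<dots> = (\<Sum>i\<in>J. (\<Prod>j\<in>J. \<bar>real_of_int (moebius (d j))\<bar>) *
            (of_bool (u - e < ln (real (d i))) + exp (- e / h)) / real (Lcm (d ` J)))"
      by (simp add: m_def abs_prod sum_distrib_left)
    finally show "\<bar>m d * (1 - (\<Prod>j\<in>J. w d j)) / real (Lcm (d ` J))\<bar> \<le> (\<Sum>i\<in>J. (\<Prod>j\<in>J. \<bar>real_of_int (moebius (d j))\<bar>) *
            (of_bool (u - e < ln (real (d i))) + exp (- e / h)) / real (Lcm (d ` J)))" .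
  qed
  also have "\<dots> = (\<Sum>i\<in>J. \<Sum>d\<in>\<Omega>. (\<Prod>j\<in>J. \<bar>real_of_int (moebius (d j))\<bar>) *
            (of_bool (u - e < ln (real (d i))) + exp (- e / h)) / real (Lcm (d ` J)))"
    by (rule sum.swap)
  also have "\<dots> \<le> (\<Sum>i\<in>J. real n * ((exp (-((u - e) / real n)) + e) * (1 + u) ^ (n - 1)) + exp (- e / h) * (1 + u) ^ n)"
    unfolding \<Omega>_def J_def Y_def n_def
    by (intro sum_mono sum_near_boundary_le k e) auto
  also have "\<dots> = real (2*k) * (real n * ((exp (-((u - e) / real n)) + e) * (1 + u) ^ (n - 1)) + exp (- e / h) * (1 + u) ^ n)"
    by (simp add: J_def)
  finally show ?thesis .
qed

lemma smooth_Mk_eq_sum: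
  assumes h: "h > 0" and N: "N \<ge> nat \<lfloor>exp u\<rfloor>"
  shows "smooth_Mk k u h = (\<Sum>X\<in>PiE {..<2*k} (\<lambda>_. Pow (primes_upto N)).
     (\<Prod>j<2*k. (-1) ^ card (X j) * perron_weight h (u - ln (real (\<Prod>(X j))))) / real (\<Prod>(\<Union>j<2*k. X j)))"
proof -
  define J where "J = {..<2*k}"
  define Y where "Y = nat \<lfloor>exp u\<rfloor>"
  have J: "finite J" by (simp add: J_def)
  define g where "g = (\<lambda>X. (\<Prod>j\<in>J. (-1) ^ card (X j) * perron_weight h (u - ln (real (\<Prod>(X j))))) / real (\<Prod>(\<Union>j\<in>J. X j)))"
  have "smooth_Mk k u h = (\<Sum>X\<in>{X\<in>PiE J (\<lambda>_. Pow (primes_upto N)). \<forall>j\<in>J. \<Prod>(X j) \<le> Y}.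
        (\<Prod>j\<in>J. real_of_int ((-1) ^ card (X j))) * (\<Prod>j\<in>J. perron_weight h (u - ln (real ((\<lambda>j\<in>J. \<Prod>(X j)) j)))) / real (\<Prod>(\<Union>j\<in>J. X j)))"
    unfolding smooth_Mk_def J_def[symmetric] Y_def[symmetric]
    by (rule sum_moebius_tuples[OF J, where f = real_of_int and H = "\<lambda>d. \<Prod>j\<in>J. perron_weight h (u - ln (real (d j)))"])
       (use N in \<open>auto simp: Y_def\<close>)
  also have "\<dots> = sum g {X\<in>PiE J (\<lambda>_. Pow (primes_upto N)). \<forall>j\<in>J. \<Prod>(X j) \<le> Y}"
    unfolding g_def by (intro sum.cong refl) (simp add: prod.distrib)
  also have "\<dots> = sum g (PiE J (\<lambda>_. Pow (primes_upto N)))"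
  proof (rule sum.mono_neutral_left)
    show "finite (PiE J (\<lambda>_. Pow (primes_upto N)))" using J by (intro finite_PiE) auto
    show "\<forall>X\<in>PiE J (\<lambda>_. Pow (primes_upto N)) - {X\<in>PiE J (\<lambda>_. Pow (primes_upto N)). \<forall>j\<in>J. \<Prod>(X j) \<le> Y}. g X = 0"
    proof
      fix X assume "X \<in> PiE J (\<lambda>_. Pow (primes_upto N)) - {X\<in>PiE J (\<lambda>_. Pow (primes_upto N)). \<forall>j\<in>J. \<Prod>(X j) \<le> Y}"
      then obtain j where j: "j \<in> J" "\<Prod>(X j) > Y" by auto
      have "exp u < real (\<Prod>(X j))" using j(2) unfolding Y_def by (simp add: nat_less_iff floor_less_iff del: of_nat_prod)
      then have "u < ln (real (\<Prod>(X j)))" by (metis exp_gt_zero exp_less_cancel_iff exp_ln less_trans)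
      then have "perron_weight h (u - ln (real (\<Prod>(X j)))) = 0" by (simp add: perron_weight_def)
      then have "(\<Prod>j\<in>J. (-1) ^ card (X j) * perron_weight h (u - ln (real (\<Prod>(X j))))) = 0"
        using j(1) J by (intro prod_zero bexI[of _ j]) auto
      then show "g X = 0" by (simp add: g_def)
    qed
  qed auto
  finally show ?thesis by (simp add: g_def J_def)
qed

section \<open>The smoothed sum as an integral of the Euler product\<close>

lemma
  fixes f :: "'a::euclidean_space \<Rightarrow> 'c::{real_normed_field, banach, second_countable_topology}"
    and g :: "'b::euclidean_space \<Rightarrow> 'c"
  assumes f: "integrable lborel f" and g: "integrable lborel g"
  shows integrable_lborel_times: "integrable lborel (\<lambda>z. f (fst z) * g (snd z))"
    and integral_lborel_times: "(LBINT z. f (fst z) * g (snd z)) = (LBINT x. f x) * (LBINT y. g y)"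
proof -
  have [measurable]: "f \<in> borel_measurable borel" "g \<in> borel_measurable borel"
    using borel_measurable_integrable[OF f] borel_measurable_integrable[OF g] by simp_all
  have int: "integrable (lborel \<Otimes>\<^sub>M lborel) (\<lambda>(x, y). f x * g y)"
  proof (rule lborel_pair.Fubini_integrable)
    have "(\<lambda>x. LBINT y. norm (f x * g y)) = (\<lambda>x. norm (f x) * (LBINT y. norm (g y)))"
      by (simp add: norm_mult)
    then show "integrable lborel (\<lambda>x. LBINT y. norm (case (x, y) of (x, y) \<Rightarrow> f x * g y))"
      using f by simp
  qed (use g in auto)
  then show "integrable lborel (\<lambda>z. f (fst z) * g (snd z))"
    by (simp add: lborel_prod case_prod_unfold)
  have "(LBINT z. f (fst z) * g (snd z)) = (\<integral>x. \<integral>y. f x * g y \<partial>lborel \<partial>lborel)"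
    using lborel_pair.integral_fst'[of "\<lambda>z. f (fst z) * g (snd z)"] int by (simp add: lborel_prod case_prod_unfold)
  then show "(LBINT z. f (fst z) * g (snd z)) = (LBINT x. f x) * (LBINT y. g y)"
    by simp
qed

lemma integral_lborel_times4:
  fixes f1 f2 f3 f4 :: "real \<Rightarrow> complex"
  assumes "integrable lborel f1" "integrable lborel f2" "integrable lborel f3" "integrable lborel f4"
  shows "(LBINT z. f1 (fst z) * (f2 (fst (snd z)) * (f3 (fst (snd (snd z))) * f4 (snd (snd (snd z))))))
     = (LBINT t. f1 t) * ((LBINT t. f2 t) * ((LBINT t. f3 t) * (LBINT t. f4 t)))"
proof -
  have 34: "integrable lborel (\<lambda>z. f3 (fst z) * f4 (snd z))" by (intro integrable_lborel_times assms)
  have 234: "integrable lborel (\<lambda>z. f2 (fst z) * (f3 (fst (snd z)) * f4 (snd (snd z))))"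
    using integrable_lborel_times[OF assms(2) 34] by simp
  show ?thesis
    using integral_lborel_times[OF assms(1) 234] integral_lborel_times[OF assms(2) 34] integral_lborel_times[OF assms(3,4)] by simp
qed

text \<open>The same function as \<open>perron_fun h u\<close>, named separately so that the
  dependence on the summation variable n sits in the factor \<open>n powr (-s)\<close>
  alone.\<close>

definition perron_kernel :: "real \<Rightarrow> real \<Rightarrow> complex \<Rightarrow> complex" where
  "perron_kernel u h s = exp (of_real u * s) / (s * (1 + of_real h * s))"

lemma perron_fun_eq_kernel:
  assumes "n > 0"
  shows "perron_fun h (u - ln (real n)) s = perron_kernel u h s * of_nat n powr (-s)"
proof -
  have 1: "of_nat n powr (-s) = exp (-(s * of_real (ln (real n))))"
    using assms by (simp add: powr_def Ln_of_nat)
  have 2: "of_real (u - ln (real n)) * s = of_real u * s + -(s * of_real (ln (real n)))"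
    by (simp add: algebra_simps)
  have "exp (of_real (u - ln (real n)) * s) = exp (of_real u * s) * of_nat n powr (-s)"
    by (simp only: 1 2 exp_add)
  then show ?thesis by (simp add: perron_fun_def perron_kernel_def)
qed

lemma perron_kernel_integrable:
  assumes "\<sigma> > 0" "h > 0"
  shows "integrable lborel (\<lambda>t. perron_kernel u h (Complex \<sigma> t))"
  using perron_integrable[OF assms, of u] by (simp add: perron_fun_def perron_kernel_def)

lemma
  assumes "\<sigma> > 0" "h > 0" "n > 0"
  shows perron_kernel_powr_integrable: "integrable lborel (\<lambda>t. perron_kernel u h (Complex \<sigma> t) * of_nat n powr (-Complex \<sigma> t))"
    and perron_kernel_powr_integral: "(LBINT t. perron_kernel u h (Complex \<sigma> t) * of_nat n powr (-Complex \<sigma> t)) = of_real (2 * pi * perron_weight h (u - ln (real n)))"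
  using perron_integrable[OF assms(1,2), of "u - ln (real n)"] perron_formula[OF assms(1,2), of "u - ln (real n)"]
  by (simp_all only: perron_fun_eq_kernel[OF assms(3)])

text \<open>Uniformity in N and in the imaginary parts is the point: the bound dominates the
  integrands while N tends to infinity.\<close>

lemma prod_Mfac_bounded:
  assumes \<sigma>: "\<sigma> > 0"
  shows "\<exists>C. \<forall>N s. (\<forall>j<2*k. Re (s j) = \<sigma>) \<longrightarrow> norm (\<Prod>p\<le>N. Mfac k s p) \<le> C"
proof -
  define K where "K = real (card (Pow {..<2*k} - {{}}))"
  define A where "A = {s::nat \<Rightarrow> complex. \<forall>j<2*k. Re (s j) = \<sigma>}"
  have b: "norm (Mfac k s p - 1) \<le> K * real p powr (-(1 + \<sigma>))" if s: "s \<in> A" for s p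
  proof (cases "prime p")
    case True
    have p: "p \<ge> 1" using True prime_ge_1_nat by blast
    have "norm (Mfac k s p - 1) \<le> (\<Sum>S\<in>Pow {..<2*k} - {{}}. real p powr (-(1 + \<sigma>)))"
      unfolding Mfac_expand[OF True] add_diff_cancel_left'
    proof (rule sum_norm_le)
      fix S assume S: "S \<in> Pow {..<2*k} - {{}}"
      then have "finite S" and "card S \<ge> 1" using finite_memb[of S k] by (auto simp: Suc_le_eq card_gt_0_iff)
      have "\<sigma> \<le> real (card S) * \<sigma>" using \<open>card S \<ge> 1\<close> \<sigma> by simp
      also have "\<dots> = (\<Sum>j\<in>S. Re (s j))" using S s by (subst sum.cong[OF refl, of S _ "\<lambda>_. \<sigma>"]) (auto simp: A_def)
      also have "\<dots> = Re (sS s S)" by (simp add: sS_def)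
      finally have "\<sigma> \<le> Re (sS s S)" .
      then show "norm ((-1) ^ card S * of_nat p powr (-(1 + sS s S)) :: complex) \<le> real p powr (-(1 + \<sigma>))"
        using p by (simp add: norm_mult norm_power norm_powr_real_powr powr_mono)
    qed
    then show ?thesis by (simp add: K_def)
  qed (simp add: Mfac_def K_def)
  have sm: "summable (\<lambda>p. K * real p powr (-(1 + \<sigma>)))"
    using \<sigma> by (intro summable_mult) (simp add: summable_real_powr_iff)
  have "norm (\<Prod>p<N. Mfac k s p) \<le> exp (\<Sum>p. K * real p powr (-(1 + \<sigma>)))" if "s \<in> A" for s N
    by (rule uniformly_convergent_prod_M_test(2)[of A "\<lambda>p s. Mfac k s p", OF b sm that])
  from this[of _ "Suc _"] show ?thesis unfolding lessThan_Suc_atMost A_def by blast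
qed

definition vec2 :: "complex \<Rightarrow> complex \<Rightarrow> nat \<Rightarrow> complex" where
  "vec2 a b j = (if j = 0 then a else b)"

text \<open>The index order in \<open>vec4\<close> makes the pairing of the first with the fourth variable the
  one that appears in \<open>Gk 2\<close>.\<close>

definition vec4 :: "complex \<Rightarrow> complex \<Rightarrow> complex \<Rightarrow> complex \<Rightarrow> nat \<Rightarrow> complex" where
  "vec4 a b c d j = (if j = 0 then a else if j = 1 then d else if j = 2 then b else c)"

abbreviation (input) line2 :: "real \<Rightarrow> nat \<Rightarrow> complex" where
  "line2 a \<equiv> vec2 (Complex 0 a) (Complex 0 (-a))"

abbreviation (input) line4 :: "real \<Rightarrow> nat \<Rightarrow> complex" where
  "line4 a \<equiv> vec4 (Complex 0 a) (Complex 0 (-a)) (Complex 0 (-a)) (Complex 0 a)"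

lemma lessThan_2_2: "{..<2*2} = {0, 1, 2, 3::nat}" and lessThan_2_1: "{..<2*1} = {0, 1::nat}"
  by (auto simp: lessThan_def)

text \<open>For each large N the integral of the partial Euler product is a finite sum of products
  of one-dimensional Perron integrals, and it already equals the smoothed sum. Letting N grow
  replaces the partial product by \<open>Mfun\<close> under the integral. The map V and the
  hypothesis \<open>prod\<close> stand for an identification of the space with nested pairs of
  reals, so that one proof serves both k = 1 and k = 2.\<close>

lemma smooth_Mk_integral:
  fixes V :: "'z::euclidean_space \<Rightarrow> nat \<Rightarrow> complex" and \<sigma> u h :: real
  assumes \<sigma>: "\<sigma> > 0" and h: "h > 0" and reV: "\<And>z j. Re (V z j) = \<sigma>"
    and prod: "\<And>f :: nat \<Rightarrow> real \<Rightarrow> complex. (\<And>j. j < 2*k \<Longrightarrow> integrable lborel (f j)) \<Longrightarrow>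
      integrable lborel (\<lambda>z. \<Prod>j<2*k. f j (Im (V z j))) \<and> (LBINT z. \<Prod>j<2*k. f j (Im (V z j))) = (\<Prod>j<2*k. LBINT t. f j t)"
  defines "KK \<equiv> (\<lambda>z. \<Prod>j<2*k. perron_kernel u h (V z j))"
  shows "integrable lborel (\<lambda>z. KK z * Mfun k (V z))"
    and "of_real ((2 * pi)^(2*k) * smooth_Mk k u h) = (LBINT z. KK z * Mfun k (V z))"
proof -
  have V: "V z j = Complex \<sigma> (Im (V z j))" for z j by (simp add: complex_eq_iff reV)
  have KKi: "integrable lborel KK"
    using prod[of "\<lambda>_ t. perron_kernel u h (Complex \<sigma> t)"] perron_kernel_integrable[OF \<sigma> h] by (simp add: KK_def V[symmetric])
  obtain C where C: "\<And>N z. norm (\<Prod>p\<le>N. Mfac k (V z) p) \<le> C"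
    using prod_Mfac_bounded[OF \<sigma>, of k] reV by blast
  define R where "R = (\<lambda>N z. KK z * (\<Prod>p\<le>N. Mfac k (V z) p))"
  have N: "integrable lborel (R N) \<and> (LBINT z. R N z) = of_real ((2 * pi)^(2*k) * smooth_Mk k u h)" if N: "N \<ge> nat \<lfloor>exp u\<rfloor>" for N
  proof -
    define \<Omega> where "\<Omega> = PiE {..<2*k} (\<lambda>_. Pow (primes_upto N))"
    define n where "n = (\<lambda>(X::nat \<Rightarrow> nat set) j. \<Prod>(X j))"
    define co where "co = (\<lambda>(X::nat \<Rightarrow> nat set). (\<Prod>j<2*k. (-1) ^ card (X j)) / of_nat (\<Prod>(\<Union>j<2*k. X j)) :: complex)"
    have npos: "n X j > 0" if "X \<in> \<Omega>" "j < 2*k" for X j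
    proof -
      have "X j \<subseteq> primes_upto N" using that by (auto simp: \<Omega>_def PiE_iff)
      from primes_upto_subset(2)[OF this] show ?thesis unfolding n_def by (intro prod_pos) (auto intro: prime_gt_0_nat)
    qed
    define P where "P = (\<lambda>m t. perron_kernel u h (Complex \<sigma> t) * of_nat m powr (- Complex \<sigma> t))"
    have P: "integrable lborel (P m)" "(LBINT t. P m t) = of_real (2 * pi * perron_weight h (u - ln (real m)))" if "m > 0" for m
      unfolding P_def by (rule perron_kernel_powr_integrable[OF \<sigma> h that], rule perron_kernel_powr_integral[OF \<sigma> h that])
    have R: "R N z = (\<Sum>X\<in>\<Omega>. co X * (\<Prod>j<2*k. P (n X j) (Im (V z j))))" for z
      unfolding R_def sum_prime_tuples_euler[symmetric] \<Omega>_def[symmetric] sum_distrib_left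
      by (intro sum.cong refl) (simp add: co_def P_def KK_def V[symmetric] n_def prod.distrib mult_ac)
    have i: "integrable lborel (\<lambda>z. co X * (\<Prod>j<2*k. P (n X j) (Im (V z j))))"
      and v: "(LBINT z. co X * (\<Prod>j<2*k. P (n X j) (Im (V z j)))) = of_real ((2 * pi)^(2*k) * ((\<Prod>j<2*k. (-1) ^ card (X j) * perron_weight h (u - ln (real (\<Prod>(X j))))) / real (\<Prod>(\<Union>j<2*k. X j))))"
      if X: "X \<in> \<Omega>" for X
      using prod[of "\<lambda>j. P (n X j)"] P npos[OF X] by (auto simp: prod.distrib co_def n_def)
    have "(LBINT z. R N z) = (\<Sum>X\<in>\<Omega>. of_real ((2 * pi)^(2*k) * ((\<Prod>j<2*k. (-1) ^ card (X j) * perron_weight h (u - ln (real (\<Prod>(X j))))) / real (\<Prod>(\<Union>j<2*k. X j)))))"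
      unfolding R using i by (subst Bochner_Integration.integral_sum) (auto simp only: v intro: sum.cong)
    also have "\<dots> = of_real ((2 * pi)^(2*k) * smooth_Mk k u h)"
      unfolding smooth_Mk_eq_sum[OF h N] \<Omega>_def[symmetric] of_real_sum[symmetric] sum_distrib_left[symmetric] by (rule refl)
    finally show ?thesis
      unfolding R using i by (auto intro!: Bochner_Integration.integrable_sum)
  qed
  \<comment> \<open>From N0 on the integrals are constant in N, so their limit is known in
    advance.\<close>
  define N0 where "N0 = nat \<lfloor>exp u\<rfloor>"
  have LIM: "(\<lambda>N. R (N + N0) z) \<longlonglongrightarrow> KK z * Mfun k (V z)" for z
    unfolding R_def
    by (intro tendsto_intros LIMSEQ_ignore_initial_segment[OF Mfun_LIMSEQ]) (use reV \<sigma> in auto)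
  have m: "R (N + N0) \<in> borel_measurable lborel" for N using N[of "N + N0"] by (auto simp: N0_def)
  have meas: "(\<lambda>z. KK z * Mfun k (V z)) \<in> borel_measurable lborel"
    by (rule borel_measurable_LIMSEQ_metric[OF m LIM])
  have dom: "norm (R (N + N0) z) \<le> norm (KK z) * C" for N z
    unfolding R_def norm_mult using C by (intro mult_left_mono) auto
  have di: "integrable lborel (\<lambda>z. norm (KK z) * C)" using KKi by (intro integrable_mult_left integrable_norm)
  show "integrable lborel (\<lambda>z. KK z * Mfun k (V z))"
    by (rule integrable_dominated_convergence[where s = "\<lambda>N. R (N + N0)", OF meas m di]) (use LIM dom in auto)
  have "(\<lambda>N. LBINT z. R (N + N0) z) \<longlonglongrightarrow> (LBINT z. KK z * Mfun k (V z))"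
    by (rule integral_dominated_convergence[where s = "\<lambda>N. R (N + N0)", OF meas m di]) (use LIM dom in auto)
  moreover have "(LBINT z. R (N + N0) z) = of_real ((2 * pi)^(2*k) * smooth_Mk k u h)" for N
    using N[of "N + N0"] by (simp add: N0_def)
  ultimately have "(\<lambda>N::nat. of_real ((2 * pi)^(2*k) * smooth_Mk k u h)) \<longlonglongrightarrow> (LBINT z. KK z * Mfun k (V z))" by simp
  then show "of_real ((2 * pi)^(2*k) * smooth_Mk k u h) = (LBINT z. KK z * Mfun k (V z))"
    unfolding LIMSEQ_const_iff .
qed

lemma smooth_Mk_1_integral:
  fixes u \<sigma> h :: real
  assumes "\<sigma> > 0" and "h > 0"
  defines "F \<equiv> (\<lambda>z. perron_kernel u h (Complex \<sigma> (fst z)) * perron_kernel u h (Complex \<sigma> (snd z)) * Mfun 1 (vec2 (Complex \<sigma> (fst z)) (Complex \<sigma> (snd z))))"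
  shows "integrable lborel F" and "of_real ((2 * pi)^2 * smooth_Mk 1 u h) = (LBINT z. F z)"
proof -
  define V where "V = (\<lambda>z::real\<times>real. vec2 (Complex \<sigma> (fst z)) (Complex \<sigma> (snd z)))"
  have "Re (V z j) = \<sigma>" for z j by (simp add: V_def vec2_def)
  moreover have "integrable lborel (\<lambda>z. \<Prod>j<2*1. f j (Im (V z j))) \<and> (LBINT z. \<Prod>j<2*1. f j (Im (V z j))) = (\<Prod>j<2*1. LBINT t. f j t)"
    if "\<And>j. j < 2*1 \<Longrightarrow> integrable lborel (f j)" for f :: "nat \<Rightarrow> real \<Rightarrow> complex"
    using integrable_lborel_times[of "f 0" "f 1"] integral_lborel_times[of "f 0" "f 1"] that by (simp add: lessThan_2_1[simplified] V_def vec2_def)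
  ultimately show "integrable lborel F" "of_real ((2 * pi)^2 * smooth_Mk 1 u h) = (LBINT z. F z)"
    using smooth_Mk_integral[OF assms(1,2), of V 1 u] by (simp_all add: lessThan_2_1[simplified] V_def vec2_def F_def del: One_nat_def)
qed

lemma smooth_Mk_2_integral:
  fixes u \<sigma> h :: real
  assumes "\<sigma> > 0" and "h > 0"
  defines "F \<equiv> (\<lambda>z::real4. perron_kernel u h (Complex \<sigma> (fst z)) * (perron_kernel u h (Complex \<sigma> (fst (snd z))) *
            (perron_kernel u h (Complex \<sigma> (fst (snd (snd z)))) * perron_kernel u h (Complex \<sigma> (snd (snd (snd z)))))) *
            Mfun 2 (vec4 (Complex \<sigma> (fst z)) (Complex \<sigma> (fst (snd z))) (Complex \<sigma> (fst (snd (snd z)))) (Complex \<sigma> (snd (snd (snd z))))))"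
  shows "integrable lborel F" and "of_real ((2 * pi)^4 * smooth_Mk 2 u h) = (LBINT z. F z)"
proof -
  define V where "V = (\<lambda>z::real4. vec4 (Complex \<sigma> (fst z)) (Complex \<sigma> (fst (snd z))) (Complex \<sigma> (fst (snd (snd z)))) (Complex \<sigma> (snd (snd (snd z)))))"
  have "Re (V z j) = \<sigma>" for z j by (simp add: V_def vec4_def)
  moreover have "integrable lborel (\<lambda>z. \<Prod>j<2*2. f j (Im (V z j))) \<and> (LBINT z. \<Prod>j<2*2. f j (Im (V z j))) = (\<Prod>j<2*2. LBINT t. f j t)"
    if f: "\<And>j. j < 2*2 \<Longrightarrow> integrable lborel (f j)" for f :: "nat \<Rightarrow> real \<Rightarrow> complex"
  proof -
    have i: "integrable lborel (\<lambda>z. f 0 (fst z) * (f 2 (fst (snd z)) * (f 3 (fst (snd (snd z))) * f 1 (snd (snd (snd z))))))"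
      by (intro integrable_lborel_times f) auto
    show ?thesis
      using i integral_lborel_times4[of "f 0" "f 2" "f 3" "f 1"] f by (simp add: lessThan_2_2[simplified] V_def vec4_def mult_ac)
  qed
  ultimately show "integrable lborel F" "of_real ((2 * pi)^4 * smooth_Mk 2 u h) = (LBINT z. F z)"
    using smooth_Mk_integral[OF assms(1,2), of V 2 u] by (simp_all add: lessThan_2_2[simplified] V_def vec4_def F_def mult_ac)
qed

section \<open>The zeta factors written out, and G in the case k = 1\<close>

lemma prod_Pow_insert:
  assumes "finite A" "a \<notin> A"
  shows "(\<Prod>S\<in>Pow (insert a A). g S) = (\<Prod>S\<in>Pow A. g S) * (\<Prod>S\<in>Pow A. g (insert a S) :: 'b :: comm_monoid_mult)"
proof -
  have "(\<Prod>S\<in>insert a ` Pow A. g S) = (\<Prod>S\<in>Pow A. g (insert a S))"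
    using assms by (subst prod.reindex) (auto simp: inj_on_def)
  moreover have "Pow A \<inter> insert a ` Pow A = {}" using assms by auto
  ultimately show ?thesis unfolding Pow_insert using assms by (simp add: prod.union_disjoint)
qed

lemma prod_Odd_sets: "(\<Prod>S\<in>Odd_sets k. g S) = (\<Prod>S\<in>Pow {..<2*k}. if odd (card S) then g S else 1)"
proof -
  have "Odd_sets k = {S \<in> Pow {..<2*k}. odd (card S)}" by (auto simp: Odd_sets_def)
  then show ?thesis by (simp only: prod.inter_filter finite_Pow_iff finite_lessThan)
qed

lemma prod_Even_sets: "(\<Prod>S\<in>Even_sets k. g S) = (\<Prod>S\<in>Pow {..<2*k}. if even (card S) \<and> card S \<ge> 2 then g S else 1)"
proof -
  have "Even_sets k = {S \<in> Pow {..<2*k}. even (card S) \<and> card S \<ge> 2}" by (auto simp: Even_sets_def)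
  then show ?thesis by (simp only: prod.inter_filter finite_Pow_iff finite_lessThan)
qed

lemma prods_sS_1:
  shows "(\<Prod>S\<in>Odd_sets 1. g (sS s S)) = g (s 0) * g (s 1)"
    and "(\<Prod>S\<in>Even_sets 1. g (sS s S)) = g (s 0 + s 1)"
  unfolding prod_Odd_sets prod_Even_sets lessThan_2_1
  by (simp_all add: prod_Pow_insert sS_def mult_ac)

lemma prods_sS_2:
  shows "(\<Prod>S\<in>Odd_sets 2. g (sS s S)) = g (s 0) * g (s 1) * g (s 2) * g (s 3) *
            (g (s 0 + s 1 + s 2) * g (s 0 + s 1 + s 3) * g (s 0 + s 2 + s 3) * g (s 1 + s 2 + s 3))"
    and "(\<Prod>S\<in>Even_sets 2. g (sS s S)) = g (s 0 + s 1) * g (s 0 + s 2) * g (s 0 + s 3) * g (s 1 + s 2) * g (s 1 + s 3) * g (s 2 + s 3) *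
            g (s 0 + s 1 + s 2 + s 3)"
  unfolding prod_Odd_sets prod_Even_sets lessThan_2_2
  by (simp_all add: prod_Pow_insert sS_def mult_ac add_ac)

lemma vec2_Gregion: "Re z \<ge> -(1/8) \<Longrightarrow> Re w \<ge> -(1/8) \<Longrightarrow> vec2 z w \<in> Gregion 1"
  by (auto simp: Gregion_def vec2_def)

lemma vec4_Gregion: "\<lbrakk>Re a \<ge> 0; Re b \<ge> 0; Re c \<ge> 0; Re d \<ge> 0\<rbrakk> \<Longrightarrow> vec4 a b c d \<in> Gregion 2"
  by (rule Gregion_pos) (auto simp: vec4_def)

text \<open>Holomorphy in one variable suffices, because the integration by parts for k = 1
  differentiates along the first variable only.\<close>

lemma holomorphic_Gext_1:
  assumes w: "Re w \<ge> 0"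
  shows "(\<lambda>z. Gext 1 (vec2 z w)) holomorphic_on {z. Re z > -(1/8)}"
proof (rule holomorphic_uniform_sequence[where f = "\<lambda>N z. \<Prod>p<N. gfac 1 (vec2 z w) p"])
  show op: "open {z. Re z > -(1/8)}" by (simp add: open_halfspace_Re_gt)
  fix N
  show "(\<lambda>z. \<Prod>p<N. gfac 1 (vec2 z w) p) holomorphic_on {z. Re z > -(1/8)}"
  proof (intro holomorphic_on_prod)
    fix p
    have ef: "(\<lambda>z. euler_fac (1 + f z) p) holomorphic_on A" if "f holomorphic_on A" for f A
      by (cases "prime p") (auto simp: euler_fac_def powr_def intro!: holomorphic_intros that)
    have M: "(\<lambda>z. Mfac 1 (vec2 z w) p) holomorphic_on A" for A
      unfolding Mfac_def lessThan_2_1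
      by (cases "prime p") (auto simp: vec2_def powr_def intro!: holomorphic_intros)
    have nz: "euler_fac (1 + sS (vec2 z w) S) p \<noteq> 0" if "Re z > -(1/8)" "S \<subseteq> {..<2*1}" for z S
      using that w by (intro euler_fac_nonzero[of _ 1] vec2_Gregion) auto
    have nz0: "euler_fac (1 + z) p \<noteq> 0" if "Re z > -(1/8)" for z
      using nz[OF that, of "{0}"] by (simp add: sS_def vec2_def)
    have nz1: "euler_fac (1 + w) p \<noteq> 0"
      using nz[of 0 "{1}"] by (simp add: sS_def vec2_def)
    show "(\<lambda>z. gfac 1 (vec2 z w) p) holomorphic_on {z. Re z > -(1/8)}"
      unfolding gfac_def prods_sS_1[where g = "\<lambda>x. euler_fac (1 + x) p"]
      by (intro holomorphic_intros M ef) (auto simp: vec2_def nz0 nz1)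
  qed
next
  fix z assume "z \<in> {z. Re z > -(1/8)}"
  then obtain d where d: "d > 0" "cball z d \<subseteq> {z. Re z > -(1/8)}"
    using open_contains_cball[of "{z. Re z > -(1/8)}"] open_halfspace_Re_gt by blast
  have "uniform_limit (cball z d) (\<lambda>N z. \<Prod>p<N. gfac 1 (vec2 z w) p) (\<lambda>z. Gext 1 (vec2 z w)) sequentially"
    unfolding uniform_limit_iff
  proof (intro allI impI)
    fix e :: real assume "e > 0"
    then have "\<forall>\<^sub>F N in sequentially. \<forall>s\<in>Gregion 1. dist (\<Prod>p<N. gfac 1 s p) (Gext 1 s) < e"
      using uniform_limit_Gext[of 1] unfolding uniform_limit_iff by blast
    then show "\<forall>\<^sub>F N in sequentially. \<forall>z\<in>cball z d. dist (\<Prod>p<N. gfac 1 (vec2 z w) p) (Gext 1 (vec2 z w)) < e"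
    proof eventually_elim
      case (elim N)
      have "vec2 x w \<in> Gregion 1" if "x \<in> cball z d" for x
        using that d w by (intro vec2_Gregion) auto
      then show ?case using elim by blast
    qed
  qed
  then show "\<exists>d>0. cball z d \<subseteq> {z. Re z > -(1/8)} \<and> uniform_limit (cball z d) (\<lambda>N z. \<Prod>p<N. gfac 1 (vec2 z w) p) (\<lambda>z. Gext 1 (vec2 z w)) sequentially"
    using d by blast
qed

text \<open>Cauchy's inequality on discs of radius 1/16, which stay inside the region Re > -1/8
  where G is bounded. Here the extension of G across the line Re s = 0 is used in an essential
  way.\<close>

lemma deriv_Gext_1_bounded:
  "\<exists>B>0. \<forall>z w. Re z \<ge> 0 \<longrightarrow> Re w \<ge> 0 \<longrightarrow> norm (deriv (\<lambda>z. Gext 1 (vec2 z w)) z) \<le> B"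
proof -
  obtain B where B: "B > 0" "\<And>s. s \<in> Gregion 1 \<Longrightarrow> norm (Gext 1 s) \<le> B" using Gext_bounded[of 1] by blast
  have "norm (deriv (\<lambda>z. Gext 1 (vec2 z w)) z) \<le> 16 * B" if "Re z \<ge> 0" "Re w \<ge> 0" for z w
  proof -
    have sub: "cball z (1/16) \<subseteq> {z. Re z > -(1/8)}"
    proof
      fix x assume "x \<in> cball z (1/16)"
      then have "\<bar>Re x - Re z\<bar> \<le> 1/16"
        using abs_Re_le_cmod[of "x - z"] by (simp add: dist_norm norm_minus_commute)
      then have "Re x > -(1/8)" using that(1) by linarith
      then show "x \<in> {z. Re z > -(1/8)}" by simp
    qed
    have "norm ((deriv ^^ 1) (\<lambda>z. Gext 1 (vec2 z w)) z) \<le> fact 1 * B / (1/16) ^ 1"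
    proof (rule Cauchy_inequality)
      show "(\<lambda>z. Gext 1 (vec2 z w)) holomorphic_on ball z (1/16)"
        by (rule holomorphic_on_subset[OF holomorphic_Gext_1[OF that(2)]]) (use sub ball_subset_cball in blast)
      show "continuous_on (cball z (1/16)) (\<lambda>z. Gext 1 (vec2 z w))"
        by (rule holomorphic_on_imp_continuous_on[OF holomorphic_on_subset[OF holomorphic_Gext_1[OF that(2)] sub]])
      fix x assume "norm (z - x) = 1/16"
      then have "x \<in> cball z (1/16)" by (simp add: dist_norm)
      then have "Re x > -(1/8)" using sub by blast
      then show "norm (Gext 1 (vec2 x w)) \<le> B" using that by (intro B vec2_Gregion) auto
    qed auto
    then show ?thesis by simp
  qed
  then show ?thesis using B(1) by (intro exI[of _ "16 * B"]) auto
qed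

text \<open>On the lines \<open>Re s = 1/u\<close>, \<open>kk u (a + b)\<close> is the size of the pole of a pair factor, and \<open>om\<close> is what is
  left of the decay of \<open>1/\<zeta>(1 + s)\<close> and of the damping factor after all small powers are absorbed.\<close>

definition om :: "real \<Rightarrow> real" where
  "om t = nm t powr (-(1 + 1/1024))"

definition kk :: "real \<Rightarrow> real \<Rightarrow> real" where
  "kk u t = 1 + 1 / norm (Complex (2 / u) t)"

lemma om_pos: "om t > 0"
proof -
  have "1 + \<bar>t\<bar> > 0" by linarith
  then show ?thesis by (simp add: om_def)
qed

lemma om_le_1: "om t \<le> 1"
  using powr_mono[of "-(1 + 1/1024)" 0 "1 + \<bar>t\<bar>"] by (simp add: om_def split: if_splits)

lemma om_measurable [measurable]: "om \<in> borel_measurable borel"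
  unfolding om_def[abs_def] by measurable

lemma om_integrable: "integrable lborel om"
  unfolding om_def[abs_def] by (rule integrable_one_plus_abs_powr) simp

lemma kk_ge_1: "kk u t \<ge> 1" by (simp add: kk_def)

lemma kk_measurable [measurable]: "kk u \<in> borel_measurable borel"
  unfolding kk_def[abs_def] complex_norm by measurable

lemma kk_le: "u \<ge> 1 \<Longrightarrow> kk u t \<le> 2 * u"
proof -
  assume u: "u \<ge> 1"
  have "norm (Complex (2 / u) t) \<ge> 2 / u" using abs_Re_le_cmod[of "Complex (2/u) t"] u by simp
  then have "1 / norm (Complex (2 / u) t) \<le> 1 / (2 / u)" using u by (intro frac_le) auto
  then show ?thesis using u by (simp add: kk_def)
qed

lemma norm_Complex_ge_half: "a \<ge> 0 \<Longrightarrow> norm (Complex a t) \<ge> (a + \<bar>t\<bar>) / 2"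
  using abs_Re_le_cmod[of "Complex a t"] abs_Im_le_cmod[of "Complex a t"] by auto

lemma nn_integral_shift:
  fixes f :: "real \<Rightarrow> ennreal"
  assumes [measurable]: "f \<in> borel_measurable borel"
  shows "(\<integral>\<^sup>+t. f (x + t) \<partial>lborel) = (\<integral>\<^sup>+t. f t \<partial>lborel)"
  using nn_integral_real_affine[of f 1 x] by simp

definition om_mass :: real where "om_mass = (LBINT t. om t)"

lemma nn_integral_om: "(\<integral>\<^sup>+t. ennreal (om t) \<partial>lborel) = ennreal om_mass"
  unfolding om_mass_def by (rule nn_integral_eq_integral[OF om_integrable]) (simp add: om_pos less_imp_le)

lemma om_mass_nonneg: "om_mass \<ge> 0"
  unfolding om_mass_def by (intro integral_nonneg_AE) (simp add: om_pos less_imp_le)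

text \<open>A bound for the convolution of \<open>om\<close> with \<open>kk u\<close> that does not
  depend on the shift. A simple pole at distance 2/u from the line costs only a logarithm.\<close>

definition kappa :: "real \<Rightarrow> real" where
  "kappa u = 4 * (1 + ln u) + 2 * om_mass"

lemma kappa_ge_0: "u \<ge> 1 \<Longrightarrow> kappa u \<ge> 0"
  using om_mass_nonneg by (simp add: kappa_def)

text \<open>Where |x + t| \<le> 1, \<open>om\<close> is bounded by 1 and the integral of 2/(2/u +
  |v|) over [-1, 1] produces the logarithm; elsewhere \<open>kk\<close> is at most 2 and the mass of
  \<open>om\<close> remains.\<close>

lemma nn_integral_kk_om:
  assumes u: "u \<ge> 1"
  shows "(\<integral>\<^sup>+t. ennreal (om t * kk u (x + t)) \<partial>lborel) \<le> ennreal (kappa u)"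
proof -
  define a where "a = 2 / u"
  have a: "a > 0" using u by (simp add: a_def)
  define g where "g = (\<lambda>v::real. ennreal (1 / norm (Complex a v)) * indicator {-1..1} v)"
  have [measurable]: "g \<in> borel_measurable borel" unfolding g_def complex_norm by measurable
  have b: "1 / norm (Complex a v) \<le> 2 / (a + \<bar>v\<bar>)" for v
    using frac_le[of 1 1 "(a + \<bar>v\<bar>) / 2" "norm (Complex a v)"] norm_Complex_ge_half[of a v] a by simp
  have g: "(\<integral>\<^sup>+v. g v \<partial>lborel) \<le> ennreal (4 * (1 + ln u))"
  proof -
    have "(\<integral>\<^sup>+v. g v \<partial>lborel) \<le> (\<integral>\<^sup>+v. ennreal (2 / (a + v)) * indicator {0..1} v + ennreal (2 / (a - v)) * indicator {-1..0} v \<partial>lborel)"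
      unfolding g_def
    proof (intro nn_integral_mono)
      fix v
      show "ennreal (1 / norm (Complex a v)) * indicator {-1..1} v \<le> ennreal (2 / (a + v)) * indicator {0..1} v + ennreal (2 / (a - v)) * indicator {-1..0} v"
        using b[of v] by (auto simp: indicator_def intro!: ennreal_leI add_increasing2)
    qed
    also have "\<dots> = (\<integral>\<^sup>+v. ennreal (2 / (a + v)) * indicator {0..1} v \<partial>lborel) + (\<integral>\<^sup>+v. ennreal (2 / (a - v)) * indicator {-1..0} v \<partial>lborel)"
      by (intro nn_integral_add) auto
    also have "(\<integral>\<^sup>+v. ennreal (2 / (a + v)) * indicator {0..1} v \<partial>lborel) = ennreal (2 * ln (a + 1) - 2 * ln (a + 0))"
      using a by (intro nn_integral_FTC_Icc) (auto intro!: derivative_eq_intros)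
    also have "(\<integral>\<^sup>+v. ennreal (2 / (a - v)) * indicator {-1..0} v \<partial>lborel) = ennreal (- 2 * ln (a - 0) - (- 2 * ln (a - (-1))))"
      using a by (intro nn_integral_FTC_Icc) (auto intro!: derivative_eq_intros)
    also have "ennreal (2 * ln (a + 1) - 2 * ln (a + 0)) + ennreal (- 2 * ln (a - 0) - (- 2 * ln (a - (-1)))) = ennreal (4 * (ln (a + 1) - ln a))"
      using a by (subst ennreal_plus[symmetric]) auto
    also have "\<dots> \<le> ennreal (4 * (1 + ln u))"
    proof (intro ennreal_leI mult_left_mono)
      have "ln (a + 1) - ln a = ln ((a + 1) / a)" using a by (simp add: ln_div)
      also have "(a + 1) / a = 1 + u / 2" using u by (simp add: a_def field_simps)
      also have "ln (1 + u / 2) \<le> ln (2 * u)" using u by (intro ln_mono) auto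
      also have "\<dots> = ln 2 + ln u" using u by (simp add: ln_mult)
      also have "\<dots> \<le> 1 + ln u" using ln_le_minus_one[of 2] by simp
      finally show "ln (a + 1) - ln a \<le> 1 + ln u" .
    qed auto
    finally show ?thesis .
  qed
  have "(\<integral>\<^sup>+t. ennreal (om t * kk u (x + t)) \<partial>lborel) \<le> (\<integral>\<^sup>+t. 2 * ennreal (om t) + g (x + t) \<partial>lborel)"
  proof (intro nn_integral_mono)
    fix t
    show "ennreal (om t * kk u (x + t)) \<le> 2 * ennreal (om t) + g (x + t)"
    proof (cases "x + t \<in> {-1..1}")
      case True
      have "om t * kk u (x + t) = om t + om t * (1 / norm (Complex a (x + t)))" by (simp add: kk_def a_def distrib_left)
      also have "\<dots> \<le> 2 * om t + 1 * (1 / norm (Complex a (x + t)))"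
        using om_pos[of t] om_le_1[of t] by (intro add_mono mult_right_mono) auto
      finally show ?thesis
        using True om_pos[of t] by (simp add: g_def ennreal_leI ennreal_mult'[symmetric] flip: ennreal_plus ennreal_numeral)
    next
      case False
      have "norm (Complex a (x + t)) \<ge> 1" using abs_Im_le_cmod[of "Complex a (x + t)"] False by auto
      then have "1 / norm (Complex a (x + t)) \<le> 1" by (simp add: divide_le_eq)
      then have "kk u (x + t) \<le> 2" by (simp add: kk_def a_def)
      then have "om t * kk u (x + t) \<le> om t * 2" using om_pos[of t] by (intro mult_left_mono) auto
      then show ?thesis using False om_pos[of t] 
        by (simp add: g_def ennreal_leI ennreal_mult'[symmetric] mult.commute flip: ennreal_numeral)
    qed
  qed
  also have "\<dots> = 2 * ennreal om_mass + (\<integral>\<^sup>+v. g v \<partial>lborel)"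
    by (subst nn_integral_add) (auto simp: nn_integral_cmult nn_integral_om nn_integral_shift)
  also have "\<dots> \<le> 2 * ennreal om_mass + ennreal (4 * (1 + ln u))" using g by (intro add_left_mono)
  also have "\<dots> = ennreal (kappa u)"
    using om_mass_nonneg u by (simp add: kappa_def ennreal_mult'[symmetric] add.commute flip: ennreal_plus ennreal_numeral)
  finally show ?thesis .
qed

section \<open>Uniform bounds for the factors of the integrand\<close>

locale zeta_estimates =
  fixes C d :: real
  assumes C1: "C \<ge> 1" and d01: "0 < d" "d \<le> 1"
    and reg_lower: "\<And>s. 0 \<le> Re s \<Longrightarrow> Re s \<le> d \<Longrightarrow> nm (Im s) powr (1 - 1/8192) \<le> C * norm (zeta_reg s)"
    and reg_deriv: "\<And>s. 0 \<le> Re s \<Longrightarrow> Re s \<le> 1 \<Longrightarrow> norm (deriv zeta_reg s) \<le> C * nm (Im s) powr (1 + 1/8192)"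
    and xi_upper: "\<And>s. 0 \<le> Re s \<Longrightarrow> Re s \<le> 1 \<Longrightarrow> norm (xi s) \<le> C * pe (Im s)"
    and G1: "\<And>s. s \<in> Gregion 1 \<Longrightarrow> norm (Gext 1 s) \<le> C"
    and G2: "\<And>s. s \<in> Gregion 2 \<Longrightarrow> norm (Gext 2 s) \<le> C"
    and dG1: "\<And>z w. Re z \<ge> 0 \<Longrightarrow> Re w \<ge> 0 \<Longrightarrow> norm (deriv (\<lambda>z. Gext 1 (vec2 z w)) z) \<le> C"

text \<open>The sum of the separate constants serves as a common C, so that all later estimates can
  be stated with one constant and one strip of width d.\<close>

lemma zeta_estimates_exist: "\<exists>C d. zeta_estimates C d"
proof -
  obtain c d where c: "c > 0" "0 < d" "d \<le> 1" "\<And>s. 0 \<le> Re s \<Longrightarrow> Re s \<le> d \<Longrightarrow> norm (zeta_reg s) \<ge> c * nm (Im s) powr (1 - 1/8192)"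
    using zeta_reg_lower[of "1/8192"] by auto
  obtain C1 where C1: "C1 > 0" "\<And>s. 0 \<le> Re s \<Longrightarrow> Re s \<le> 7 \<Longrightarrow> norm (deriv zeta_reg s) \<le> C1 * nm (Im s) powr (1 + 1/8192)"
    using deriv_zeta_reg_growth[of "1/8192"] by auto
  obtain C2 where C2: "C2 > 0" "\<And>s. -(1/8192)/2 \<le> Re s \<Longrightarrow> Re s \<le> 8 \<Longrightarrow> norm (xi s) \<le> C2 * pe (Im s)"
    using xi_growth[of "1/8192"] by auto
  obtain C3 where C3: "C3 > 0" "\<And>s. s \<in> Gregion 1 \<Longrightarrow> norm (Gext 1 s) \<le> C3" using Gext_bounded[of 1] by blast
  obtain C4 where C4: "C4 > 0" "\<And>s. s \<in> Gregion 2 \<Longrightarrow> norm (Gext 2 s) \<le> C4" using Gext_bounded[of 2] by blast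
  obtain C5 where C5: "C5 > 0" "\<And>z w. Re z \<ge> 0 \<Longrightarrow> Re w \<ge> 0 \<Longrightarrow> norm (deriv (\<lambda>z. Gext 1 (vec2 z w)) z) \<le> C5"
    using deriv_Gext_1_bounded by blast
  define C where "C = 1 + 1 / c + C1 + C2 + C3 + C4 + C5"
  have le: "1 \<le> C" "1 / c \<le> C" "C1 \<le> C" "C2 \<le> C" "C3 \<le> C" "C4 \<le> C" "C5 \<le> C"
    using c(1) C1(1) C2(1) C3(1) C4(1) C5(1) by (auto simp: C_def add_nonneg_nonneg)
  have "zeta_estimates C d"
  proof
    fix s assume s: "0 \<le> Re s" "Re s \<le> d"
    have "nm (Im s) powr (1 - 1/8192) \<le> 1 / c * norm (zeta_reg s)" using c(4)[OF s] c(1) by (simp add: field_simps)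
    also have "\<dots> \<le> C * norm (zeta_reg s)" using le by (intro mult_right_mono) auto
    finally show "nm (Im s) powr (1 - 1/8192) \<le> C * norm (zeta_reg s)" .
  next
    fix s assume s: "0 \<le> Re s" "Re s \<le> 1"
    have "C1 * nm (Im s) powr (1 + 1/8192) \<le> C * nm (Im s) powr (1 + 1/8192)" using le by (intro mult_right_mono) auto
    then show "norm (deriv zeta_reg s) \<le> C * nm (Im s) powr (1 + 1/8192)" using C1(2)[of s] s by linarith
    have "C2 * pe (Im s) \<le> C * pe (Im s)" using le by (intro mult_right_mono) auto
    moreover have "norm (xi s) \<le> C2 * pe (Im s)" by (rule C2(2)) (use s in linarith)+
    ultimately show "norm (xi s) \<le> C * pe (Im s)" by linarith
  next
    fix s assume "s \<in> Gregion 1" from C3(2)[OF this] show "norm (Gext 1 s) \<le> C" using le by linarith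
  next
    fix s assume "s \<in> Gregion 2" from C4(2)[OF this] show "norm (Gext 2 s) \<le> C" using le by linarith
  next
    fix z w assume "0 \<le> Re z" "0 \<le> Re w" from C5(2)[OF this] show "norm (deriv (\<lambda>z. Gext 1 (vec2 z w)) z) \<le> C" using le by linarith
  qed (use le c in auto)
  then show ?thesis by blast
qed

text \<open>What is left of a Perron kernel divided by zeta(1 + s) apart from the exponential: the
  pole 1/s of the kernel cancels against the zero of 1/zeta(1 + s) at s = 0.\<close>

definition Vfac :: "real \<Rightarrow> complex \<Rightarrow> complex" where
  "Vfac h s = 1 / ((1 + of_real h * s) * zeta_reg s)"

context zeta_estimates
begin

abbreviation pw :: "complex \<Rightarrow> real \<Rightarrow> real" where
  "pw s a \<equiv> nm (Im s) powr a"

lemma pw_ge_1: "a \<ge> 0 \<Longrightarrow> pw s a \<ge> 1" by (simp add: ge_one_powr_ge_zero)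

lemma C_pw_ge_1: "a \<ge> 0 \<Longrightarrow> 1 \<le> C * pw s a"
  using mult_mono[OF C1 pw_ge_1[of a s]] C1 by simp

lemma reg_nonzero: "0 \<le> Re s \<Longrightarrow> Re s \<le> d \<Longrightarrow> zeta_reg s \<noteq> 0"
  using reg_lower[of s] by (auto simp: powr_nonneg_iff not_le[symmetric])

lemma reg_upper_ratio:
  assumes s: "0 \<le> Re s" "Re s \<le> 1" "s \<noteq> 0"
  shows "norm (zeta_reg s / s) \<le> C * pw s (1/8192) * (1 + 1 / norm s)"
proof -
  have "norm (zeta_reg s / s) = norm (1 / s + xi s)" using s by (simp add: zeta_reg_def field_simps)
  also have "\<dots> \<le> 1 / norm s + norm (xi s)" using norm_triangle_ineq[of "1/s" "xi s"] by (simp add: norm_divide)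
  also have "\<dots> \<le> (C * pw s (1/8192)) * (1 / norm s) + C * pw s (1/8192)"
  proof (intro add_mono xi_upper s)
    have "1 \<le> C * pw s (1/8192)" by (rule C_pw_ge_1) simp
    then show "1 / norm s \<le> (C * pw s (1/8192)) * (1 / norm s)" using mult_right_mono[of 1 _ "1 / norm s"] by simp
  qed
  finally show ?thesis by (simp add: algebra_simps)
qed

text \<open>The derivative grows by one power of |t| more than the bound for \<open>xi\<close>, and
  the division by s takes that power back.\<close>

lemma reg_deriv_ratio:
  assumes s: "0 \<le> Re s" "Re s \<le> 1" "s \<noteq> 0"
  shows "norm (deriv zeta_reg s / s) \<le> C * pw s (1/8192) * (1 + 1 / norm s)"
proof -
  have "1 + \<bar>Im s\<bar> \<le> 1 + norm s" using abs_Im_le_cmod[of s] by simp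
  then have r: "nm (Im s) / norm s \<le> 1 + 1 / norm s" using s by (simp add: field_simps)
  have "norm (deriv zeta_reg s / s) \<le> C * pw s (1 + 1/8192) / norm s"
    unfolding norm_divide by (intro divide_right_mono reg_deriv s) auto
  also have "\<dots> = C * pw s (1/8192) * (nm (Im s) / norm s)"
    using powr_add[of "1 + \<bar>Im s\<bar>" 1 "1/8192"] by simp
  also have "\<dots> \<le> C * pw s (1/8192) * (1 + 1 / norm s)" using C1 r by (intro mult_left_mono) auto
  finally show ?thesis .
qed

lemma inverse_reg_le:
  assumes s: "0 \<le> Re s" "Re s \<le> d"
  shows "1 / norm (zeta_reg s) \<le> C * pw s (-1 + 1/8192)"
proof -
  have "pw s (1 - 1/8192) / norm (zeta_reg s) \<le> C"
    using reg_lower[OF s] reg_nonzero[OF s] by (simp add: divide_le_eq)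
  then have "pw s (-(1 - 1/8192)) * (pw s (1 - 1/8192) / norm (zeta_reg s)) \<le> pw s (-(1 - 1/8192)) * C"
    by (intro mult_left_mono) auto
  also have "pw s (-(1 - 1/8192)) * (pw s (1 - 1/8192) / norm (zeta_reg s)) = 1 / norm (zeta_reg s)"
    by (simp add: powr_minus field_simps)
  finally show ?thesis by (simp add: mult.commute)
qed

text \<open>The quotient is 1/zeta(1 + s). The factor min 1 |s| records its zero at s = 0, which for
  triple sums has to cancel the pole of a pair.\<close>

lemma ratio_reg_le:
  assumes s: "0 \<le> Re s" "Re s \<le> d"
  shows "norm (s / zeta_reg s) \<le> 2 * C * pw s (1/8192) * min 1 (norm s)"
proof -
  have "norm s \<le> Re s + \<bar>Im s\<bar>" using cmod_le[of s] s by simp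
  then have n: "norm s \<le> 1 + \<bar>Im s\<bar>" using s d01 by linarith
  have "norm s \<le> nm (Im s) * min 1 (norm s)"
    using n mult_right_mono[of 1 "1 + \<bar>Im s\<bar>" "norm s"] by (auto simp: min_def)
  have "norm (s / zeta_reg s) = norm s * (1 / norm (zeta_reg s))" by (simp add: norm_divide)
  also have "\<dots> \<le> (nm (Im s) * min 1 (norm s)) * (C * pw s (-1 + 1/8192))"
    using inverse_reg_le[OF s] \<open>norm s \<le> nm (Im s) * min 1 (norm s)\<close> by (intro mult_mono) auto
  also have "\<dots> = C * (nm (Im s) * pw s (-1 + 1/8192)) * min 1 (norm s)" by (simp add: mult_ac)
  also have "nm (Im s) * pw s (-1 + 1/8192) = pw s (1/8192)"
    using powr_add[of "1 + \<bar>Im s\<bar>" 1 "-1 + 1/8192"] by simp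
  also have "C * pw s (1/8192) * min 1 (norm s) \<le> 2 * C * pw s (1/8192) * min 1 (norm s)"
    using C1 by (intro mult_right_mono) auto
  finally show ?thesis .
qed

lemma Vfac_le:
  assumes s: "0 \<le> Re s" "Re s \<le> d" and h: "h \<ge> 0"
  shows "norm (Vfac h s) \<le> C * pw s (-1 + 1/8192) / norm (1 + of_real h * s)"
    and "norm (Vfac h s) \<le> C * pw s (-1 + 1/8192)"
proof -
  have n: "norm (1 + of_real h * s) \<ge> 1" using s h by (intro norm_one_plus_ge) auto
  have "norm (Vfac h s) = 1 / norm (zeta_reg s) / norm (1 + of_real h * s)"
    by (simp add: Vfac_def norm_divide norm_mult)
  also have "\<dots> \<le> C * pw s (-1 + 1/8192) / norm (1 + of_real h * s)"
    by (intro divide_right_mono inverse_reg_le s) auto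
  finally show 1: "norm (Vfac h s) \<le> C * pw s (-1 + 1/8192) / norm (1 + of_real h * s)" .
  also have "\<dots> \<le> C * pw s (-1 + 1/8192) / 1"
    using n C1 by (intro divide_left_mono) auto
  finally show "norm (Vfac h s) \<le> C * pw s (-1 + 1/8192)" by simp
qed

lemma one_plus_nonzero: "Re s \<ge> 0 \<Longrightarrow> h \<ge> 0 \<Longrightarrow> 1 + of_real h * s \<noteq> 0"
  using norm_one_plus_ge(1)[of h s] by auto

text \<open>The term with the derivative of \<open>zeta_reg\<close> over its square has exponent (1
  + 1/8192) + 2 (-1 + 1/8192) = -1 + 3/8192. So differentiation loses only a small power of |t|, and
  the damping factor survives.\<close>

lemma Vfac_deriv:
  assumes s: "0 \<le> Re s" "Re s \<le> d" and h: "0 \<le> h" "h \<le> 1"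
  shows "\<exists>v. (Vfac h has_field_derivative v) (at s) \<and> norm v \<le> 2 * C^3 * pw s (-1 + 3/8192) / norm (1 + of_real h * s)"
proof -
  define D where "D = 1 + of_real h * s"
  define z where "z = zeta_reg s"
  have D0: "D \<noteq> 0" "norm D \<ge> 1" using one_plus_nonzero[of s h] norm_one_plus_ge(1)[of h s] s h by (auto simp: D_def)
  have z0: "z \<noteq> 0" using reg_nonzero[OF s] by (simp add: z_def)
  have der: "(zeta_reg has_field_derivative deriv zeta_reg s) (at s)"
    using s by (intro holomorphic_derivI[OF holomorphic_zeta_reg]) (auto simp: open_halfspace_Re_gt)
  define v where "v = - ((of_real h * z + D * deriv zeta_reg s) / (D * z)\<^sup>2)"
  have "(Vfac h has_field_derivative v) (at s)"
    unfolding Vfac_def[abs_def] v_def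
    by (rule derivative_eq_intros der refl | simp add: D_def[symmetric] z_def[symmetric] D0 z0)+
       (simp add: power2_eq_square D_def z_def minus_divide_left algebra_simps)
  moreover have "norm v \<le> 2 * C^3 * pw s (-1 + 3/8192) / norm D"
  proof -
    have iz: "1 / norm z \<le> C * pw s (-1 + 1/8192)" unfolding z_def by (rule inverse_reg_le[OF s])
    have v: "v = - (of_real h / (D\<^sup>2 * z) + deriv zeta_reg s / (D * z\<^sup>2))"
      unfolding v_def using D0 z0 by (simp add: field_simps power2_eq_square)
    have "norm v \<le> norm (of_real h / (D\<^sup>2 * z)) + norm (deriv zeta_reg s / (D * z\<^sup>2))"
      unfolding v norm_minus_cancel by (rule norm_triangle_ineq)
    also have "norm (of_real h / (D\<^sup>2 * z)) = (h / norm D) * (1 / norm z) / norm D"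
      using h by (simp add: norm_divide norm_mult norm_power power2_eq_square)
    also have "norm (deriv zeta_reg s / (D * z\<^sup>2)) = norm (deriv zeta_reg s) * ((1 / norm z) * (1 / norm z)) / norm D"
      by (simp add: norm_divide norm_mult norm_power power2_eq_square)
    also have "(h / norm D) * (1 / norm z) / norm D + norm (deriv zeta_reg s) * ((1 / norm z) * (1 / norm z)) / norm D
       \<le> 1 * (C * pw s (-1 + 1/8192)) / norm D + (C * pw s (1 + 1/8192)) * ((C * pw s (-1 + 1/8192)) * (C * pw s (-1 + 1/8192))) / norm D"
      using D0 h iz reg_deriv[of s] s d01 C1 by (intro add_mono divide_right_mono mult_mono) (auto simp: divide_le_eq)
    also have "(C * pw s (1 + 1/8192)) * ((C * pw s (-1 + 1/8192)) * (C * pw s (-1 + 1/8192))) = C^3 * pw s (-1 + 3/8192)"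
      by (simp add: power3_eq_cube flip: powr_add)
    also have "1 * (C * pw s (-1 + 1/8192)) / norm D \<le> C^3 * pw s (-1 + 3/8192) / norm D"
      using C1 power_increasing[of 1 3 C] by (intro divide_right_mono) (auto intro!: mult_mono powr_mono)
    finally show ?thesis by (simp add: field_simps)
  qed
  ultimately show ?thesis by (auto simp: D_def)
qed

end

text \<open>Since 1/n \<le> 1 for the norm n of the damping factor, it may be replaced by its power
  1/512. This turns the exponent -1 + 1/1024 into -(1 + 1/1024), which is integrable, and h^(-1/512)
  = u^(32/512) = u^(1/16) is the price.\<close>

lemma damped_weight_le:
  assumes u: "u \<ge> 1" and \<sigma>: "\<sigma> \<ge> 0"
  shows "nm t powr (-1 + 1/1024) / norm (1 + of_real (u powr -32) * Complex \<sigma> t) \<le> 2 * u powr (1/16) * om t"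
proof -
  define h where "h = u powr -32"
  have h: "h > 0" "h \<le> 1" using u powr_mono[of "-32" 0 u] by (auto simp: h_def)
  define p where "p = 1 + \<bar>t\<bar>"
  have p: "p \<ge> 1" by (simp add: p_def)
  define n where "n = norm (1 + of_real h * Complex \<sigma> t)"
  have n: "n \<ge> 1" "n \<ge> h * norm (Complex \<sigma> t)" unfolding n_def using norm_one_plus_ge[of h "Complex \<sigma> t"] h \<sigma> by auto
  have "h * \<bar>t\<bar> \<le> h * norm (Complex \<sigma> t)" using h abs_Im_le_cmod[of "Complex \<sigma> t"] by (intro mult_left_mono) auto
  then have hp: "h * p \<le> 2 * n" using n h unfolding p_def distrib_left by linarith
  have "1 / n \<le> (1 / n) powr (1/512)"
    using n powr_mono'[of "1/512" 1 "1/n"] by (simp add: divide_le_eq)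
  also have "\<dots> \<le> (2 / (h * p)) powr (1/512)"
    using hp n h p by (intro powr_mono2) (auto simp: field_simps)
  also have "\<dots> = 2 powr (1/512) * (h powr (-(1/512)) * p powr (-(1/512)))"
    using h p by (simp add: powr_divide powr_mult powr_minus field_simps)
  also have "h powr (-(1/512)) = u powr (1/16)" using u by (simp add: h_def powr_powr)
  also have "2 powr (1/512) * (u powr (1/16) * p powr (-(1/512))) \<le> 2 powr 1 * (u powr (1/16) * p powr (-(1/512)))"
    by (intro mult_right_mono powr_mono) auto
  finally have "1 / n \<le> 2 * u powr (1/16) * p powr (-(1/512))" by (simp add: mult_ac)
  then have "p powr (-1 + 1/1024) * (1 / n) \<le> p powr (-1 + 1/1024) * (2 * u powr (1/16) * p powr (-(1/512)))"
    by (intro mult_left_mono) auto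
  also have "\<dots> = 2 * u powr (1/16) * (p powr (-1 + 1/1024) * p powr (-(1/512)))" by (simp add: mult_ac)
  also have "p powr (-1 + 1/1024) * p powr (-(1/512)) = om t"
    by (simp add: om_def p_def flip: powr_add)
  finally show ?thesis by (simp add: p_def n_def h_def)
qed

section \<open>Integrals along vertical lines\<close>

lemma integral_derivative_limits:
  fixes f :: "real \<Rightarrow> complex"
  assumes f: "\<And>t. (f has_vector_derivative f' t) (at t)" and int: "integrable lborel f'"
    and lim: "(f \<longlongrightarrow> l) at_top" "(f \<longlongrightarrow> m) at_bot"
  shows "(LBINT t. f' t) = l - m"
proof -
  have "((\<lambda>T. integral {-T..T} f') \<longlongrightarrow> (LBINT t. f' t)) at_top"
    by (rule integral_truncation_LIMSEQ[OF int])
  moreover have "((\<lambda>T. integral {-T..T} f') \<longlongrightarrow> l - m) at_top"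
  proof (rule Lim_transform_eventually)
    have "((\<lambda>T. f (-T)) \<longlongrightarrow> m) at_top"
      by (rule filterlim_compose[OF lim(2) filterlim_uminus_at_bot_at_top])
    from tendsto_diff[OF lim(1) this] show "((\<lambda>T. f T - f (-T)) \<longlongrightarrow> l - m) at_top" .
    show "eventually (\<lambda>T. f T - f (-T) = integral {-T..T} f') at_top"
      using eventually_ge_at_top[of "0::real"]
    proof eventually_elim
      case (elim T)
      have "(f' has_integral (f T - f (-T))) {-T..T}"
        using elim f by (intro fundamental_theorem_of_calculus) (auto intro: has_vector_derivative_at_within)
      then show ?case by (simp add: integral_unique)
    qed
  qed
  ultimately show ?thesis by (intro tendsto_unique[of at_top]) auto
qed

lemma om_tendsto: "(om \<longlongrightarrow> 0) at_top" "(om \<longlongrightarrow> 0) at_bot"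
proof -
  have "((\<lambda>t::real. nm t powr (-(1 + 1/1024))) \<longlongrightarrow> 0) at_top" by real_asymp
  then show "(om \<longlongrightarrow> 0) at_top" by (simp add: om_def[abs_def])
  have "((\<lambda>t::real. nm t powr (-(1 + 1/1024))) \<longlongrightarrow> 0) at_bot" by real_asymp
  then show "(om \<longlongrightarrow> 0) at_bot" by (simp add: om_def[abs_def])
qed

lemma tendsto_0_om_bound:
  fixes f :: "real \<Rightarrow> complex"
  assumes "\<And>t. norm (f t) \<le> c * om t"
  shows "(f \<longlongrightarrow> 0) at_top" "(f \<longlongrightarrow> 0) at_bot"
proof -
  have "((\<lambda>t. c * om t) \<longlongrightarrow> 0) at_top" "((\<lambda>t. c * om t) \<longlongrightarrow> 0) at_bot"
    using tendsto_mult_right_zero[OF om_tendsto(1)] tendsto_mult_right_zero[OF om_tendsto(2)] by auto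
  then show "(f \<longlongrightarrow> 0) at_top" "(f \<longlongrightarrow> 0) at_bot"
    by (auto intro!: Lim_null_comparison[of f "\<lambda>t. c * om t"] always_eventually assms)
qed

lemma integrable_om_bound:
  fixes f :: "real \<Rightarrow> complex"
  assumes "\<And>t. norm (f t) \<le> c * om t" "f \<in> borel_measurable borel"
  shows "integrable lborel f"
proof (rule Bochner_Integration.integrable_bound)
  show "integrable lborel (\<lambda>t. c * om t)" by (intro integrable_mult_right om_integrable)
  show "AE t in lborel. norm (f t) \<le> norm (c * om t)" using assms(1) by (auto intro: order_trans[OF _ abs_ge_self])
qed (use assms(2) in simp)

lemma Complex_has_vector_derivative [derivative_intros]:
  "((\<lambda>t. Complex a t) has_vector_derivative \<i>) (at t within A)"
  unfolding Complex_eq has_vector_derivative_def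
  by (auto intro!: derivative_eq_intros simp: scaleR_conv_of_real)

lemma vertical_chain:
  assumes "(f has_field_derivative f') (at (Complex a t))"
  shows "((\<lambda>t. f (Complex a t)) has_vector_derivative (\<i> * f')) (at t)"
  using field_vector_diff_chain_at[OF Complex_has_vector_derivative assms] by (simp only: o_def)

lemma integrable_inverse_Complex_square:
  assumes "c > 0"
  shows "integrable lborel (\<lambda>x. 1 / (norm (Complex c x))\<^sup>2)"
proof (rule Bochner_Integration.integrable_bound)
  define m where "m = min c 1 / 2"
  have m: "m > 0" using assms by (simp add: m_def)
  show "integrable lborel (\<lambda>t. 1 / m\<^sup>2 * nm t powr (-2))"
    by (intro integrable_mult_right integrable_one_plus_abs_powr) simp
  show "(\<lambda>x. 1 / (norm (Complex c x))\<^sup>2) \<in> borel_measurable lborel" unfolding complex_norm by measurable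
  show "AE t in lborel. norm (1 / (norm (Complex c t))\<^sup>2) \<le> norm (1 / m\<^sup>2 * nm t powr (-2))"
  proof (rule AE_I2)
    fix t
    have 1: "norm (Complex c t) \<ge> m * nm t" unfolding m_def by (rule norm_Complex_ge[OF assms])
    have "1 / (norm (Complex c t))\<^sup>2 \<le> 1 / (m * nm t)\<^sup>2"
      using 1 m by (intro frac_le power_mono) auto
    also have "\<dots> = 1 / m\<^sup>2 * nm t powr (-2)"
      by (simp add: powr_minus powr_numeral power_mult_distrib divide_simps)
    finally show "norm (1 / (norm (Complex c t))\<^sup>2) \<le> norm (1 / m\<^sup>2 * nm t powr (-2))" by simp
  qed
qed

lemma Complex_nonzero: "c > 0 \<Longrightarrow> Complex c x \<noteq> 0" by (simp add: complex_eq_iff)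

text \<open>The inverse Laplace transform of 1/s^2 at 1, read off from Perron's formula. As h tends
  to infinity, h times \<open>perron_fun h 1\<close> tends to exp s / s^2, while h times the weight,
  h (1 - exp (-1/h)), tends to 1.\<close>

lemma
  assumes c: "c > 0"
  shows exp_over_square_integrable: "integrable lborel (\<lambda>x. exp (Complex c x) / (Complex c x)\<^sup>2)"
    and exp_over_square_integral: "(LBINT x. exp (Complex c x) / (Complex c x)\<^sup>2) = 2 * pi"
proof -
  have meas: "(\<lambda>x. exp (Complex c x) / (Complex c x)\<^sup>2) \<in> borel_measurable lborel"
    using Complex_nonzero[OF c] by (simp, intro borel_measurable_continuous_onI continuous_intros) auto
  have dom: "integrable lborel (\<lambda>x. exp c * (1 / (norm (Complex c x))\<^sup>2))"
    by (intro integrable_mult_right integrable_inverse_Complex_square c)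
  show i: "integrable lborel (\<lambda>x. exp (Complex c x) / (Complex c x)\<^sup>2)"
    by (rule Bochner_Integration.integrable_bound[OF dom meas]) (simp add: norm_divide norm_power)
  define F where "F = (\<lambda>h x. of_real h * perron_fun h 1 (Complex c x))"
  have F: "F h x = exp (Complex c x) / (Complex c x * (of_real (1 / h) + Complex c x))" if "h > 0" for h x
  proof -
    have "1 + of_real h * Complex c x = of_real h * (of_real (1 / h) + Complex c x)" using that by (simp add: distrib_left)
    then show ?thesis using that by (simp add: F_def perron_fun_def)
  qed
  have "((\<lambda>h. LBINT x. F h x) \<longlongrightarrow> (LBINT x. exp (Complex c x) / (Complex c x)\<^sup>2)) at_top"
  proof (rule integral_dominated_convergence_at_top[OF meas _ dom])
    show "F h \<in> borel_measurable lborel" for h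
    proof (cases "h > 0")
      case True
      then show ?thesis unfolding F_def using perron_integrable[OF c True, of 1] by auto
    next
      case False
      have "1 + of_real h * Complex c x \<noteq> 0 \<or> True" for x by simp
      show ?thesis unfolding F_def perron_fun_def Complex_eq by measurable
    qed
    show "\<forall>\<^sub>F h in at_top. AE x in lborel. norm (F h x) \<le> exp c * (1 / (norm (Complex c x))\<^sup>2)"
      using eventually_gt_at_top[of 0]
    proof eventually_elim
      case (elim h)
      show ?case
      proof (rule AE_I2)
        fix x
        have 1: "norm (of_real (1 / h) + Complex c x) \<ge> norm (Complex c x)"
        proof -
          have "of_real (1 / h) + Complex c x = Complex (1 / h + c) x" by (simp add: complex_eq_iff)
          then show ?thesis using c elim by (simp add: cmod_def power_mono)
        qed
        have "norm (F h x) = exp c / (norm (Complex c x) * norm (of_real (1 / h) + Complex c x))"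
          by (simp add: F[OF elim] norm_divide norm_mult)
        also have "\<dots> \<le> exp c / (norm (Complex c x) * norm (Complex c x))"
          using 1 Complex_nonzero[OF c, of x] by (intro divide_left_mono mult_left_mono) (auto intro!: mult_pos_pos less_le_trans[OF _ 1])
        finally show "norm (F h x) \<le> exp c * (1 / (norm (Complex c x))\<^sup>2)" by (simp add: power2_eq_square)
      qed
    qed
    show "AE x in lborel. ((\<lambda>h. F h x) \<longlongrightarrow> exp (Complex c x) / (Complex c x)\<^sup>2) at_top"
    proof (rule AE_I2)
      fix x
      have z: "((\<lambda>h::real. complex_of_real (1 / h)) \<longlongrightarrow> of_real 0) at_top"
        by (intro tendsto_of_real) real_asymp
      have "((\<lambda>h::real. exp (Complex c x) / (Complex c x * (of_real (1 / h) + Complex c x))) \<longlongrightarrow> exp (Complex c x) / (Complex c x * (of_real 0 + Complex c x))) at_top"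
        by (intro tendsto_intros z) (use Complex_nonzero[OF c] in auto)
      then have "((\<lambda>h::real. exp (Complex c x) / (Complex c x * (of_real (1 / h) + Complex c x))) \<longlongrightarrow> exp (Complex c x) / (Complex c x)\<^sup>2) at_top"
        by (simp add: power2_eq_square)
      then show "((\<lambda>h. F h x) \<longlongrightarrow> exp (Complex c x) / (Complex c x)\<^sup>2) at_top"
        by (rule Lim_transform_eventually) (use eventually_gt_at_top[of "0::real"] in eventually_elim, simp add: F)
    qed
  qed
  moreover have "((\<lambda>h. LBINT x. F h x) \<longlongrightarrow> of_real (2 * pi)) at_top"
  proof (rule Lim_transform_eventually)
    have "((\<lambda>h::real. 2 * pi * (h * (1 - exp (- 1 / h)))) \<longlongrightarrow> 2 * pi) at_top" by real_asymp
    then show "((\<lambda>h::real. complex_of_real (2 * pi * (h * (1 - exp (- 1 / h))))) \<longlongrightarrow> of_real (2 * pi)) at_top"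
      by (rule tendsto_of_real)
    show "eventually (\<lambda>h. complex_of_real (2 * pi * (h * (1 - exp (- 1 / h)))) = (LBINT x. F h x)) at_top"
      using eventually_gt_at_top[of 0]
    proof eventually_elim
      case (elim h)
      then show ?case by (simp add: F_def perron_formula[OF c elim] perron_weight_def)
    qed
  qed
  ultimately show "(LBINT x. exp (Complex c x) / (Complex c x)\<^sup>2) = 2 * pi"
    using tendsto_unique[of at_top] by force
qed

section \<open>The case k = 1\<close>

definition sg :: "real \<Rightarrow> real \<Rightarrow> complex" where "sg u t = Complex (1 / u) t"

text \<open>The exponent has to exceed 16, so that a layer of width u^(-16) is wide compared with h.
  Its effect on the damped bounds is only the factor u^(32/512) per variable.\<close>

definition hh :: "real \<Rightarrow> real" where "hh u = u powr -32"

lemma hh_bounds: "u \<ge> 1 \<Longrightarrow> 0 < hh u \<and> hh u \<le> 1"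
  using powr_mono[of "-32" 0 u] by (simp add: hh_def)

lemma one_plus_hh_nonzero: "u \<ge> 1 \<Longrightarrow> 1 + of_real (hh u) * sg u t \<noteq> 0"
  using norm_one_plus_ge(1)[of "hh u" "sg u t"] hh_bounds[of u] by (auto simp: sg_def)

lemma sg_add: "sg u a + sg u b = Complex (2 / u) (a + b)" by (simp add: sg_def complex_eq_iff)

lemma Re_sg [simp]: "Re (sg u t) = 1 / u" and Im_sg [simp]: "Im (sg u t) = t" by (simp_all add: sg_def)

lemma kk_eq_sg: "1 + 1 / norm (sg u a + sg u b) = kk u (a + b)" by (simp add: sg_add kk_def)

lemma continuous_on_sg [continuous_intros]: "continuous_on A f \<Longrightarrow> continuous_on A (\<lambda>x. sg u (f x))"
  unfolding sg_def by (intro continuous_intros)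

lemma continuous_on_zeta_reg_comp:
  assumes "continuous_on A f" "\<And>x. x \<in> A \<Longrightarrow> Re (f x) > -1"
  shows "continuous_on A (\<lambda>x. zeta_reg (f x))"
  by (rule continuous_on_compose2[OF continuous_zeta_reg assms(1)]) (use assms(2) in auto)

lemma continuous_on_vec2 [continuous_intros]:
  assumes "continuous_on A f" "continuous_on A g"
  shows "continuous_on A (\<lambda>x. vec2 (f x) (g x))"
proof (rule continuous_on_coordinatewise_then_product)
  fix j show "continuous_on A (\<lambda>x. vec2 (f x) (g x) j)" unfolding vec2_def by (cases "j = 0") (use assms in auto)
qed

lemma vec2_Gregion_nonneg: "Re z \<ge> 0 \<Longrightarrow> Re w \<ge> 0 \<Longrightarrow> vec2 z w \<in> Gregion 1"
  by (rule vec2_Gregion) linarith+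

lemma continuous_on_Gext_1_comp:
  assumes "continuous_on A f" "continuous_on A g" "\<And>x. x \<in> A \<Longrightarrow> Re (f x) \<ge> 0" "\<And>x. x \<in> A \<Longrightarrow> Re (g x) \<ge> 0"
  shows "continuous_on A (\<lambda>x. Gext 1 (vec2 (f x) (g x)))"
  by (rule continuous_on_compose2[OF continuous_on_Gext continuous_on_vec2[OF assms(1,2)]])
     (use assms(3,4) vec2_Gregion_nonneg in blast)

definition Phi1 :: "real \<Rightarrow> real \<Rightarrow> real \<Rightarrow> complex" where
  "Phi1 u a b = exp (of_real u * (sg u a + sg u b)) * (Vfac (hh u) (sg u a) * Vfac (hh u) (sg u b)) *
     (zeta_reg (sg u a + sg u b) / (sg u a + sg u b)) * Gext 1 (vec2 (sg u a) (sg u b))"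

text \<open>\<open>Phi1\<close> with its pole doubled, the term that appears when the integration by
  parts differentiates 1/(s + w).\<close>

definition A1 :: "real \<Rightarrow> real \<Rightarrow> real \<Rightarrow> complex" where
  "A1 u a b = exp (of_real u * (sg u a + sg u b)) * (Vfac (hh u) (sg u a) * Vfac (hh u) (sg u b)) *
     (zeta_reg (sg u a + sg u b) / (sg u a + sg u b)\<^sup>2) * Gext 1 (vec2 (sg u a) (sg u b))"

lemma norm_exp_sg: "u > 0 \<Longrightarrow> norm (exp (of_real u * (sg u a + sg u b))) = exp 2"
  by (simp add: sg_add)

lemma perron_kernel_zeta:
  assumes "s \<noteq> 0" "zeta_reg s \<noteq> 0"
  shows "perron_kernel u h s / zeta (1 + s) = exp (of_real u * s) * Vfac h s"
  using assms by (simp add: perron_kernel_def zeta_eq_reg Vfac_def)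

context zeta_estimates
begin

lemma u_bounds:
  assumes "u \<ge> 4 / d" shows "u \<ge> 4" "1 / u > 0" "4 / u \<le> d" "u \<ge> 1" "u > 0" "1 / u \<le> d" "2 / u \<le> d" "3 / u \<le> d"
proof -
  have "4 / d \<ge> 4 / 1" using d01 by (intro divide_left_mono) auto
  then show "u \<ge> 4" using assms by linarith
  then show "1 / u > 0" "u \<ge> 1" "u > 0" by auto
  show "4 / u \<le> d" using assms d01 \<open>u > 0\<close> by (simp add: field_simps)
  moreover have "1 / u \<le> 4 / u" "2 / u \<le> 4 / u" "3 / u \<le> 4 / u" using \<open>u > 0\<close> by (auto intro: divide_right_mono)
  ultimately show "1 / u \<le> d" "2 / u \<le> d" "3 / u \<le> d" by linarith+
qed

lemma integrand_eq_Phi1: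
  assumes u: "u \<ge> 4 / d"
  shows "perron_kernel u (hh u) (sg u a) * perron_kernel u (hh u) (sg u b) * Mfun 1 (vec2 (sg u a) (sg u b)) = Phi1 u a b"
proof -
  note ub = u_bounds[OF u]
  have nz: "sg u t \<noteq> 0" for t using ub by (simp add: sg_def Complex_nonzero)
  have nz2: "sg u a + sg u b \<noteq> 0" using ub by (simp add: sg_add Complex_nonzero)
  have r: "zeta_reg (sg u t) \<noteq> 0" for t using ub by (intro reg_nonzero) auto
  have "Mfun 1 (vec2 (sg u a) (sg u b)) = Gext 1 (vec2 (sg u a) (sg u b)) * zeta (1 + (sg u a + sg u b)) / (zeta (1 + sg u a) * zeta (1 + sg u b))"
    using ub by (subst Mfun_eq_Gext) (auto simp: vec2_def prods_sS_1[where g = "\<lambda>x. zeta (1 + x)"] simp del: One_nat_def)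
  then have "perron_kernel u (hh u) (sg u a) * perron_kernel u (hh u) (sg u b) * Mfun 1 (vec2 (sg u a) (sg u b)) =
     (perron_kernel u (hh u) (sg u a) / zeta (1 + sg u a)) * (perron_kernel u (hh u) (sg u b) / zeta (1 + sg u b)) *
     zeta (1 + (sg u a + sg u b)) * Gext 1 (vec2 (sg u a) (sg u b))"
    by simp
  also have "\<dots> = Phi1 u a b"
    unfolding perron_kernel_zeta[OF nz r] zeta_eq_reg[OF nz2] by (simp add: Phi1_def distrib_left exp_add)
  finally show ?thesis .
qed

lemma V_weight_le:
  assumes u: "u \<ge> 4 / d"
  shows "pe t * norm (Vfac (hh u) (sg u t)) \<le> 2 * C * u powr (1/16) * om t"
proof -
  note ub = u_bounds[OF u]
  define n where "n = norm (1 + of_real (hh u) * sg u t)"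
  have n: "n > 0" unfolding n_def using one_plus_hh_nonzero[OF ub(4)] by simp
  have "norm (Vfac (hh u) (sg u t)) \<le> C * nm t powr (-1 + 1/8192) / n"
    using Vfac_le(1)[of "sg u t" "hh u"] ub hh_bounds[OF ub(4)] by (simp add: n_def)
  then have "pe t * norm (Vfac (hh u) (sg u t)) \<le> pe t * (C * nm t powr (-1 + 1/8192) / n)"
    by (intro mult_left_mono) auto
  also have "\<dots> = C * (nm t powr (-1 + 2/8192) / n)" by (simp flip: powr_add)
  also have "\<dots> \<le> C * (nm t powr (-1 + 1/1024) / n)"
    using n C1 by (intro mult_left_mono divide_right_mono powr_mono) auto
  also have "\<dots> \<le> C * (2 * u powr (1/16) * om t)"
    using damped_weight_le[of u "1/u" t] ub C1 by (intro mult_left_mono) (auto simp: n_def hh_def sg_def)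
  finally show ?thesis by (simp add: mult_ac)
qed

lemma pw_add_le: "nm (a + b) powr e \<le> nm a powr e * nm b powr e" if "e \<ge> 0" for a b :: real
proof -
  have "1 + \<bar>a + b\<bar> \<le> 1 + \<bar>a\<bar> + \<bar>b\<bar> + \<bar>a\<bar> * \<bar>b\<bar>" using abs_triangle_ineq[of a b] by (simp add: add_increasing2)
  also have "\<dots> = nm a * nm b" by (simp add: algebra_simps)
  finally have "nm (a + b) powr e \<le> (nm a * nm b) powr e" using that by (intro powr_mono2) auto
  then show ?thesis by (simp add: powr_mult)
qed

lemma ratio_sum_le:
  assumes u: "u \<ge> 4 / d"
  shows "norm (zeta_reg (sg u a + sg u b) / (sg u a + sg u b)) \<le> C * (pe a * pe b) * kk u (a + b)"
    and "norm (deriv zeta_reg (sg u a + sg u b) / (sg u a + sg u b)) \<le> C * (pe a * pe b) * kk u (a + b)"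
proof -
  note ub = u_bounds[OF u]
  define s where "s = sg u a + sg u b"
  have s: "0 \<le> Re s" "Re s \<le> 1" "s \<noteq> 0" "\<bar>Im s\<bar> = \<bar>a + b\<bar>" using ub d01 by (auto simp: s_def sg_add Complex_nonzero)
  have le: "C * pe (Im s) * (1 + 1 / norm s) \<le> C * (pe a * pe b) * kk u (a + b)"
    unfolding s(4) kk_eq_sg[symmetric] s_def[symmetric] using C1 by (intro mult_right_mono mult_left_mono pw_add_le) auto
  show "norm (zeta_reg (sg u a + sg u b) / (sg u a + sg u b)) \<le> C * (pe a * pe b) * kk u (a + b)"
    using reg_upper_ratio[OF s(1-3)] le unfolding s_def by linarith
  show "norm (deriv zeta_reg (sg u a + sg u b) / (sg u a + sg u b)) \<le> C * (pe a * pe b) * kk u (a + b)"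
    using reg_deriv_ratio[OF s(1-3)] le unfolding s_def by linarith
qed

lemma open_strip: "open {s::complex. 0 < Re s \<and> Re s < d}"
proof -
  have "{s::complex. 0 < Re s \<and> Re s < d} = {s. Re s > 0} \<inter> {s. Re s < d}" by auto
  then show ?thesis by (simp add: open_Int open_halfspace_Re_gt open_halfspace_Re_lt)
qed

lemma Vfac_holomorphic:
  assumes "0 \<le> h" "h \<le> 1" shows "Vfac h holomorphic_on {s. 0 < Re s \<and> Re s < d}"
  unfolding holomorphic_on_open[OF open_strip]
proof
  fix s assume "s \<in> {s. 0 < Re s \<and> Re s < d}"
  then obtain v where "(Vfac h has_field_derivative v) (at s)" using Vfac_deriv[of s h] assms by auto
  then show "\<exists>v. (Vfac h has_field_derivative v) (at s)" by blast
qed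

text \<open>All of the integrand that depends on the first variable except the exponential, which is
  the part to be integrated.\<close>

definition Qfun :: "real \<Rightarrow> complex \<Rightarrow> complex \<Rightarrow> complex" where
  "Qfun u w s = Vfac (hh u) s * (zeta_reg (s + w) / (s + w)) * Gext 1 (vec2 s w)"

text \<open>Of the terms in the product rule only the one that differentiates 1/(s + w) raises the
  order of the pole, and adding it back removes it. The others differentiate
  \<open>zeta_reg\<close>, \<open>Vfac\<close> or G, keep a simple pole, and are therefore
  negligible.\<close>

lemma Qfun_deriv:
  fixes u a b :: real
  assumes u: "u \<ge> 4 / d"
  defines "w \<equiv> sg u b" and "s \<equiv> sg u a"
  shows "(Qfun u w has_field_derivative deriv (Qfun u w) s) (at s)"
    and "norm (deriv (Qfun u w) s + Vfac (hh u) s * (zeta_reg (s + w) / (s + w)\<^sup>2) * Gext 1 (vec2 s w))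
      \<le> 8 * C^5 * u powr (1/16) * kk u (a + b) * om a * pe b"
proof -
  note ub = u_bounds[OF u]
  have hb: "0 \<le> hh u" "hh u \<le> 1" using hh_bounds[OF ub(4)] by auto
  have s: "0 \<le> Re s" "Re s \<le> d" using ub by (auto simp: s_def)
  obtain v where v: "(Vfac (hh u) has_field_derivative v) (at s)" "norm v \<le> 2 * C^3 * pw s (-1 + 3/8192) / norm (1 + of_real (hh u) * s)"
    using Vfac_deriv[OF s hb] by blast
  have "2 / u > 0" using ub by simp
  moreover have "s + w = Complex (2 / u) (a + b)" by (simp add: s_def w_def sg_add)
  ultimately have "s + w \<noteq> 0" "Re (s + w) > 0" using Complex_nonzero[of "2 / u"] by auto
  then have sw: "s + w \<noteq> 0" "Re (s + w) > -1" by linarith+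
  define z where "z = deriv zeta_reg (s + w)"
  have z: "((\<lambda>s. zeta_reg (s + w)) has_field_derivative z * 1) (at s)"
    unfolding z_def
  proof (rule DERIV_chain2[where f = zeta_reg and g = "\<lambda>s. s + w"])
    show "(zeta_reg has_field_derivative deriv zeta_reg (s + w)) (at (s + w))"
      using sw by (intro holomorphic_derivI[OF holomorphic_zeta_reg]) (auto simp: open_halfspace_Re_gt)
  qed (auto intro!: derivative_eq_intros)
  define G where "G = (\<lambda>s. Gext 1 (vec2 s w))"
  have g: "(G has_field_derivative deriv G s) (at s)"
    unfolding G_def using ub s
    by (intro holomorphic_derivI[OF holomorphic_Gext_1[of w]]) (auto simp: open_halfspace_Re_gt w_def)
  define V where "V = Vfac (hh u) s"
  define R where "R = V * (z / (s + w)) * G s + v * (zeta_reg (s + w) / (s + w)) * G s + V * (zeta_reg (s + w) / (s + w)) * deriv G s"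
  have der: "(Qfun u w has_field_derivative (R - V * (zeta_reg (s + w) / (s + w)\<^sup>2) * G s)) (at s)"
  proof -
    have q: "((\<lambda>s. zeta_reg (s + w) / (s + w)) has_field_derivative (z / (s + w) - zeta_reg (s + w) / (s + w)\<^sup>2)) (at s)"
    proof -
      have "((\<lambda>s. zeta_reg (s + w) / (s + w)) has_field_derivative ((z * 1) * (s + w) - zeta_reg (s + w) * 1) / ((s + w) * (s + w))) (at s)"
        by (intro DERIV_divide z) (use sw in \<open>auto intro!: derivative_eq_intros\<close>)
      moreover have "((z * 1) * (s + w) - zeta_reg (s + w) * 1) / ((s + w) * (s + w)) = z / (s + w) - zeta_reg (s + w) / (s + w)\<^sup>2"
        using sw by (simp add: diff_divide_distrib power2_eq_square)
      ultimately show ?thesis by simp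
    qed
    have "(Qfun u w has_field_derivative ((v * (zeta_reg (s + w) / (s + w)) + (z / (s + w) - zeta_reg (s + w) / (s + w)\<^sup>2) * V) * G s + deriv G s * (V * (zeta_reg (s + w) / (s + w))))) (at s)"
      unfolding Qfun_def[abs_def] V_def G_def[symmetric]
      using DERIV_mult[OF DERIV_mult[OF v(1) q] g] by (simp add: G_def)
    moreover have "(v * (zeta_reg (s + w) / (s + w)) + (z / (s + w) - zeta_reg (s + w) / (s + w)\<^sup>2) * V) * G s + deriv G s * (V * (zeta_reg (s + w) / (s + w)))
        = R - V * (zeta_reg (s + w) / (s + w)\<^sup>2) * G s"
      by (simp add: R_def algebra_simps)
    ultimately show ?thesis by simp
  qed
  then have dq: "deriv (Qfun u w) s = R - V * (zeta_reg (s + w) / (s + w)\<^sup>2) * G s" by (rule DERIV_imp_deriv)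
  show "(Qfun u w has_field_derivative deriv (Qfun u w) s) (at s)" using der dq by simp
  define n where "n = norm (1 + of_real (hh u) * s)"
  have n: "n > 0" unfolding n_def s_def using one_plus_hh_nonzero[OF ub(4)] by simp
  define pa where "pa = 1 + \<bar>a\<bar>"
  define pb where "pb = 1 + \<bar>b\<bar>"
  define k where "k = kk u (a + b)"
  have k: "k \<ge> 0" using kk_ge_1[of u "a + b"] by (simp add: k_def)
  define T where "T = C * (pa powr (1/8192) * pb powr (1/8192)) * k"
  have T: "norm (zeta_reg (s + w) / (s + w)) \<le> T" "norm (z / (s + w)) \<le> T" "T \<ge> 0"
    using ratio_sum_le[OF u, of a b] C1 k by (auto simp: T_def s_def w_def pa_def pb_def k_def z_def)
  have nV: "norm V \<le> C^3 * pa powr (-1 + 3/8192) / n"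
  proof -
    have "norm V \<le> C * pa powr (-1 + 1/8192) / n"
      using Vfac_le(1)[OF s hb(1)] by (simp add: V_def n_def pa_def s_def)
    also have "\<dots> \<le> C^3 * pa powr (-1 + 3/8192) / n"
      using n C1 power_increasing[of 1 3 C] by (intro divide_right_mono mult_mono powr_mono) (auto simp: pa_def)
    finally show ?thesis .
  qed
  have nv: "norm v \<le> 2 * (C^3 * pa powr (-1 + 3/8192) / n)" using v(2) by (simp add: n_def pa_def s_def)
  define L where "L = C^3 * pa powr (-1 + 3/8192) / n"
  have L: "L \<ge> 0" using C1 n by (simp add: L_def)
  have G: "norm (G s) \<le> C" "norm (deriv G s) \<le> C"
    unfolding G_def using s ub by (auto intro!: G1 dG1 vec2_Gregion_nonneg simp: w_def simp del: One_nat_def)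
  have "norm R \<le> norm V * norm (z / (s + w)) * norm (G s) + norm v * norm (zeta_reg (s + w) / (s + w)) * norm (G s) + norm V * norm (zeta_reg (s + w) / (s + w)) * norm (deriv G s)"
    unfolding R_def by (rule order_trans[OF norm_triangle_ineq add_mono[OF order_trans[OF norm_triangle_ineq]]]) (auto simp: norm_mult norm_divide)
  also have "\<dots> \<le> L * T * C + (2 * L) * T * C + L * T * C"
    using nV nv T G L C1 unfolding L_def[symmetric] by (intro add_mono mult_mono mult_nonneg_nonneg) auto
  also have "\<dots> = 4 * C^5 * k * pb powr (1/8192) * ((pa powr (-1 + 3/8192) * pa powr (1/8192)) / n)"
    by (simp add: L_def T_def power_numeral_reduce field_simps)
  also have "pa powr (-1 + 3/8192) * pa powr (1/8192) = pa powr (-1 + 4/8192)" by (simp flip: powr_add)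
  also have "4 * C^5 * k * pb powr (1/8192) * (pa powr (-1 + 4/8192) / n) \<le> 4 * C^5 * k * pb powr (1/8192) * (pa powr (-1 + 1/1024) / n)"
    using C1 k n by (intro mult_left_mono divide_right_mono powr_mono) (auto simp: pa_def)
  also have "\<dots> \<le> 4 * C^5 * k * pb powr (1/8192) * (2 * u powr (1/16) * om a)"
    using damped_weight_le[of u "1/u" a] ub C1 k by (intro mult_left_mono) (auto simp: n_def s_def sg_def hh_def pa_def)
  also have "\<dots> = 8 * C^5 * u powr (1/16) * kk u (a + b) * om a * pe b" by (simp add: k_def pb_def)
  finally show "norm (deriv (Qfun u w) s + Vfac (hh u) s * (zeta_reg (s + w) / (s + w)\<^sup>2) * Gext 1 (vec2 s w))
      \<le> 8 * C^5 * u powr (1/16) * kk u (a + b) * om a * pe b"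
    unfolding dq by (simp add: V_def G_def)
qed

end

lemma
  assumes u: "u \<ge> 1"
  shows om_kk_integrable: "integrable lborel (\<lambda>t. om t * kk u (x + t))"
    and om_kk_integral_le: "(LBINT t. om t * kk u (x + t)) \<le> kappa u"
proof -
  have nn: "om t * kk u (x + t) \<ge> 0" for t
    using om_pos[of t] kk_ge_1[of u "x + t"] by (intro mult_nonneg_nonneg) auto
  show i: "integrable lborel (\<lambda>t. om t * kk u (x + t))"
  proof (rule integrableI_bounded)
    have "(\<integral>\<^sup>+t. ennreal (norm (om t * kk u (x + t))) \<partial>lborel) = (\<integral>\<^sup>+t. ennreal (om t * kk u (x + t)) \<partial>lborel)"
      using nn by simp
    then show "(\<integral>\<^sup>+t. ennreal (norm (om t * kk u (x + t))) \<partial>lborel) < \<infinity>"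
      using nn_integral_kk_om[OF u, of x] by (simp add: le_less_trans)
  qed measurable
  have "ennreal (LBINT t. om t * kk u (x + t)) \<le> ennreal (kappa u)"
    using nn_integral_kk_om[OF u, of x] nn by (subst nn_integral_eq_integral[OF i, symmetric]) auto
  then show "(LBINT t. om t * kk u (x + t)) \<le> kappa u" using kappa_ge_0[OF u] by (simp add: ennreal_le_iff)
qed

context zeta_estimates
begin

lemma continuous_on_Vfac_sg:
  assumes "u \<ge> 4 / d" "continuous_on A f"
  shows "continuous_on A (\<lambda>x. Vfac (hh u) (sg u (f x)))"
  unfolding Vfac_def
  using u_bounds[OF assms(1)] one_plus_hh_nonzero[of u] reg_nonzero
  by (intro continuous_intros continuous_on_zeta_reg_comp assms(2)) (auto intro: less_trans[of _ 0])

lemma sg_sum_nonzero: "u \<ge> 4 / d \<Longrightarrow> sg u a + sg u b \<noteq> 0"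
  using u_bounds[of u] by (simp add: sg_add Complex_nonzero)

lemma continuous_on_Phi1:
  assumes u: "u \<ge> 4 / d" and f: "continuous_on A f" "continuous_on A g"
  shows "continuous_on A (\<lambda>x. Phi1 u (f x) (g x))" and "continuous_on A (\<lambda>x. A1 u (f x) (g x))"
proof -
  have re: "Re (sg u (f x) + sg u (g x)) > -1" for x
  proof -
    have "1 / u > 0" using u_bounds[OF u] by simp
    then show ?thesis unfolding plus_complex.sel Re_sg by linarith
  qed
  show "continuous_on A (\<lambda>x. Phi1 u (f x) (g x))"
    unfolding Phi1_def using u_bounds[OF u] sg_sum_nonzero[OF u] re
    by (intro continuous_intros f continuous_on_Vfac_sg u continuous_on_zeta_reg_comp continuous_on_Gext_1_comp) auto
  show "continuous_on A (\<lambda>x. A1 u (f x) (g x))"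
    unfolding A1_def using u_bounds[OF u] sg_sum_nonzero[OF u] re
    by (intro continuous_intros f continuous_on_Vfac_sg u continuous_on_zeta_reg_comp continuous_on_Gext_1_comp) auto
qed

definition cPhi :: real where "cPhi = 4 * exp 2 * C^4"
definition cErr :: real where "cErr = 16 * exp 2 * C^6"

lemma cPhi_pos: "cPhi \<ge> 0" "cErr \<ge> 0" using C1 by (auto simp: cPhi_def cErr_def)

lemma Phi1_bound:
  assumes u: "u \<ge> 4 / d"
  shows "norm (Phi1 u a b) \<le> cPhi * u powr (1/8) * (om a * kk u (a + b) * om b)"
proof -
  note ub = u_bounds[OF u]
  define va where "va = norm (Vfac (hh u) (sg u a))"
  define vb where "vb = norm (Vfac (hh u) (sg u b))"
  define pa where "pa = pe a"
  define pb where "pb = pe b"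
  define k where "k = kk u (a + b)"
  have k: "k \<ge> 0" using kk_ge_1[of u "a + b"] by (simp add: k_def)
  have a: "pa * va \<le> 2 * C * u powr (1/16) * om a" and b: "pb * vb \<le> 2 * C * u powr (1/16) * om b"
    using V_weight_le[OF u] by (auto simp: pa_def va_def pb_def vb_def)
  have nn: "pa \<ge> 0" "pb \<ge> 0" "va \<ge> 0" "vb \<ge> 0" by (auto simp: pa_def pb_def va_def vb_def)
  have "norm (Phi1 u a b) = exp 2 * (va * vb) * norm (zeta_reg (sg u a + sg u b) / (sg u a + sg u b)) * norm (Gext 1 (vec2 (sg u a) (sg u b)))"
    using norm_exp_sg[OF ub(5), of a b] by (simp only: Phi1_def norm_mult va_def vb_def)
  also have "\<dots> \<le> exp 2 * (va * vb) * (C * (pa * pb) * k) * C"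
    using ratio_sum_le(1)[OF u, of a b] nn C1 k ub unfolding pa_def[symmetric] pb_def[symmetric] k_def[symmetric]
    by (intro mult_mono mult_nonneg_nonneg G1 vec2_Gregion_nonneg) auto
  also have "\<dots> = exp 2 * C\<^sup>2 * k * ((pa * va) * (pb * vb))" by (simp add: power2_eq_square mult_ac)
  also have "\<dots> \<le> exp 2 * C\<^sup>2 * k * ((2 * C * u powr (1/16) * om a) * (2 * C * u powr (1/16) * om b))"
    using mult_mono[OF a b] nn C1 k om_pos[of a] by (intro mult_left_mono) (auto simp: less_imp_le)
  also have "\<dots> = 4 * exp 2 * C^4 * (u powr (1/16) * u powr (1/16)) * (om a * k * om b)"
    by (simp add: power_numeral_reduce mult_ac)
  also have "u powr (1/16) * u powr (1/16) = u powr (1/8)" by (simp flip: powr_add)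
  finally show ?thesis by (simp add: cPhi_def k_def)
qed

lemma A1_eq: "u \<ge> 4 / d \<Longrightarrow> A1 u a b = Phi1 u a b / (sg u a + sg u b)"
  by (simp add: A1_def Phi1_def power2_eq_square)

text \<open>The second pole costs at most a factor u in general and nothing at all where |a + b|
  \<ge> 1.\<close>

lemma A1_bound:
  assumes u: "u \<ge> 4 / d"
  shows "norm (A1 u a b) \<le> u * (cPhi * u powr (1/8) * (om a * kk u (a + b) * om b))"
    and "\<bar>a + b\<bar> \<ge> 1 \<Longrightarrow> norm (A1 u a b) \<le> cPhi * u powr (1/8) * (om a * kk u (a + b) * om b)"
proof -
  note ub = u_bounds[OF u]
  define B where "B = cPhi * u powr (1/8) * (om a * kk u (a + b) * om b)"
  have B: "norm (Phi1 u a b) \<le> B" "B \<ge> 0" using Phi1_bound[OF u, of a b] by (auto simp: B_def intro: order_trans[OF norm_ge_zero])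
  have nz: "sg u a + sg u b \<noteq> 0" by (rule sg_sum_nonzero[OF u])
  have le: "norm (A1 u a b) \<le> c * B" if "1 / norm (sg u a + sg u b) \<le> c" for c
  proof -
    have "norm (A1 u a b) = 1 / norm (sg u a + sg u b) * norm (Phi1 u a b)" by (simp add: A1_eq[OF u] norm_divide)
    also have "\<dots> \<le> c * B" using that B by (intro mult_mono) (auto intro: order_trans[OF _ that])
    finally show ?thesis .
  qed
  have "norm (sg u a + sg u b) \<ge> 2 / u" unfolding sg_add using abs_Re_le_cmod[of "Complex (2/u) (a+b)"] ub by simp
  then have "1 / norm (sg u a + sg u b) \<le> 1 / (2 / u)" using ub by (intro divide_left_mono) (auto intro!: mult_pos_pos simp: nz)
  also have "\<dots> \<le> u" using ub by simp
  finally show "norm (A1 u a b) \<le> u * (cPhi * u powr (1/8) * (om a * kk u (a + b) * om b))"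
    using le by (simp add: B_def)
  assume "\<bar>a + b\<bar> \<ge> 1"
  then have "norm (sg u a + sg u b) \<ge> 1" unfolding sg_add using abs_Im_le_cmod[of "Complex (2/u) (a+b)"] by simp
  then have "1 / norm (sg u a + sg u b) \<le> 1" by (simp add: divide_le_eq)
  from le[OF this] show "norm (A1 u a b) \<le> cPhi * u powr (1/8) * (om a * kk u (a + b) * om b)"
    by (simp add: B_def)
qed

text \<open>Multiplying by \<open>u\<close> and integrating by parts replaces the simple pole, whose contribution
  converges only conditionally, by a double pole.\<close>

lemma by_parts_bound:
  assumes u: "u \<ge> 4 / d"
  shows "norm (of_real u * (LBINT a. Phi1 u a b) - (LBINT a. A1 u a b)) \<le> cErr * u powr (1/8) * kappa u * om b"
proof -
  note ub = u_bounds[OF u]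
  define w where "w = sg u b"
  define K where "K = (\<lambda>a. exp (of_real u * (sg u a + w)) * Vfac (hh u) w)"
  define E where "E = (\<lambda>a. K a * (deriv (Qfun u w) (sg u a) + Vfac (hh u) (sg u a) * (zeta_reg (sg u a + w) / (sg u a + w)\<^sup>2) * Gext 1 (vec2 (sg u a) w)))"
  have Phi: "Phi1 u a b = K a * Qfun u w (sg u a)" for a
    by (simp add: Phi1_def K_def Qfun_def w_def mult_ac)
  have A: "A1 u a b = K a * (Vfac (hh u) (sg u a) * (zeta_reg (sg u a + w) / (sg u a + w)\<^sup>2) * Gext 1 (vec2 (sg u a) w))" for a
    by (simp add: A1_def K_def w_def mult_ac)
  define f' where "f' = (\<lambda>a. \<i> * (of_real u * Phi1 u a b + (E a - A1 u a b)))"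
  have f': "((\<lambda>a. Phi1 u a b) has_vector_derivative f' a) (at a)" for a
  proof -
    have Q: "(Qfun u w has_field_derivative deriv (Qfun u w) (Complex (1/u) a)) (at (Complex (1/u) a))"
      using Qfun_deriv(1)[OF u, of b a] by (simp add: w_def sg_def)
    have "((\<lambda>s. exp (of_real u * (s + w)) * Vfac (hh u) w) has_field_derivative of_real u * exp (of_real u * (Complex (1/u) a + w)) * Vfac (hh u) w) (at (Complex (1/u) a))"
      by (auto intro!: derivative_eq_intros)
    from vertical_chain[OF DERIV_mult[OF this Q]]
    have "((\<lambda>a. K a * Qfun u w (sg u a)) has_vector_derivative \<i> * (of_real u * K a * Qfun u w (sg u a) + deriv (Qfun u w) (sg u a) * K a)) (at a)"
      by (simp add: K_def sg_def mult.assoc)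
    moreover have "\<i> * (of_real u * K a * Qfun u w (sg u a) + deriv (Qfun u w) (sg u a) * K a) = f' a"
      unfolding f'_def Phi A E_def by (simp add: algebra_simps)
    ultimately show ?thesis by (simp only: Phi)
  qed
  have Ebound: "norm (E a) \<le> cErr * u powr (1/8) * om b * (om a * kk u (b + a))" for a
  proof -
    define pb where "pb = pe b"
    have "norm (E a) = exp 2 * norm (Vfac (hh u) w) * norm (deriv (Qfun u w) (sg u a) + Vfac (hh u) (sg u a) * (zeta_reg (sg u a + w) / (sg u a + w)\<^sup>2) * Gext 1 (vec2 (sg u a) w))"
      unfolding E_def K_def norm_mult using norm_exp_sg[OF ub(5), of a b] by (simp add: w_def)
    also have "\<dots> \<le> exp 2 * norm (Vfac (hh u) w) * (8 * C^5 * u powr (1/16) * kk u (a + b) * om a * pb)"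
      using Qfun_deriv(2)[OF u, of b a] by (intro mult_left_mono) (auto simp: w_def pb_def)
    also have "\<dots> = 8 * exp 2 * C^5 * u powr (1/16) * kk u (a + b) * om a * (pb * norm (Vfac (hh u) w))" by (simp add: mult_ac)
    also have "\<dots> \<le> 8 * exp 2 * C^5 * u powr (1/16) * kk u (a + b) * om a * (2 * C * u powr (1/16) * om b)"
      using V_weight_le[OF u, of b] C1 om_pos[of a] kk_ge_1[of u "a + b"]
      by (intro mult_left_mono mult_nonneg_nonneg) (auto simp: pb_def w_def)
    also have "\<dots> = 16 * exp 2 * C^6 * (u powr (1/16) * u powr (1/16)) * om b * (om a * kk u (b + a))"
      by (simp add: power_numeral_reduce mult_ac add.commute)
    also have "u powr (1/16) * u powr (1/16) = u powr (1/8)" by (simp flip: powr_add)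
    finally show ?thesis by (simp add: cErr_def)
  qed
  have kb: "kk u x \<le> 2 * u" for x by (rule kk_le[OF ub(4)])
  have omk: "om a * kk u x * om b \<le> om a * (2 * u)" for a x
  proof -
    have "om a * kk u x * om b \<le> om a * (2 * u) * 1"
      using om_pos om_le_1 kb kk_ge_1[of u x] ub by (intro mult_mono mult_nonneg_nonneg) (auto simp: less_imp_le)
    then show ?thesis by simp
  qed
  have omX: "c * (om a * kk u x * om b) \<le> c * (2 * u) * om a" if "c \<ge> 0" for c a x
    using mult_left_mono[OF omk that] by (simp add: mult_ac)
  have c0: "cPhi * u powr (1/8) \<ge> 0" "cErr * u powr (1/8) \<ge> 0" using cPhi_pos by auto
  have Phi_om: "norm (Phi1 u a b) \<le> cPhi * u powr (1/8) * (2 * u) * om a" for a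
    by (rule order_trans[OF Phi1_bound[OF u] omX[OF c0(1)]])
  have A_om: "norm (A1 u a b) \<le> u * (cPhi * u powr (1/8) * (2 * u)) * om a" for a
  proof -
    have "norm (A1 u a b) \<le> u * (cPhi * u powr (1/8) * (om a * kk u (a + b) * om b))" by (rule A1_bound(1)[OF u])
    also have "\<dots> \<le> u * (cPhi * u powr (1/8) * (2 * u) * om a)" using ub by (intro mult_left_mono omX c0) auto
    finally show ?thesis by (simp add: mult.assoc)
  qed
  have E_om: "norm (E a) \<le> cErr * u powr (1/8) * (2 * u) * om a" for a
  proof -
    have "norm (E a) \<le> cErr * u powr (1/8) * (om a * kk u (b + a) * om b)" using Ebound[of a] by (simp add: mult_ac)
    also have "\<dots> \<le> cErr * u powr (1/8) * (2 * u) * om a" by (rule omX[OF c0(2)])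
    finally show ?thesis .
  qed
  have Phi_i: "integrable lborel (\<lambda>a. Phi1 u a b)"
    by (rule integrable_om_bound[OF Phi_om]) (intro borel_measurable_continuous_onI continuous_on_Phi1 u continuous_intros)
  have A_i: "integrable lborel (\<lambda>a. A1 u a b)"
    by (rule integrable_om_bound[OF A_om]) (intro borel_measurable_continuous_onI continuous_on_Phi1 u continuous_intros)
  \<comment> \<open>Measurability of \<open>E\<close> comes from continuity, and that from
    holomorphy of the derivative of \<open>Qfun\<close> on an open strip around the line of
    integration.\<close>
  have E_i: "integrable lborel E"
  proof (rule integrable_om_bound[OF E_om], rule borel_measurable_continuous_onI)
    define S where "S = {s::complex. 0 < Re s \<and> Re s < d}"
    have w: "Re w = 1 / u" by (simp add: w_def)
    have shift: "s + w \<noteq> 0 \<and> Re (s + w) > -1" if "s \<in> S" for s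
    proof -
      have "Re (s + w) > 0" using that w ub by (simp add: S_def add_pos_pos)
      then have "s + w \<noteq> 0" by (metis less_irrefl zero_complex.sel(1))
      with \<open>Re (s + w) > 0\<close> show ?thesis by linarith
    qed
    have "(zeta_reg \<circ> (\<lambda>s. s + w)) holomorphic_on S"
    proof (rule holomorphic_on_compose_gen[OF _ holomorphic_zeta_reg])
      show "(\<lambda>s. s + w) holomorphic_on S" by (intro holomorphic_intros)
      show "(\<lambda>s. s + w) ` S \<subseteq> {s. Re s > -1}" using shift by blast
    qed
    then have "(\<lambda>s. zeta_reg (s + w)) holomorphic_on S" by (simp add: o_def)
    moreover have "(\<lambda>s. Gext 1 (vec2 s w)) holomorphic_on S"
      by (rule holomorphic_on_subset[OF holomorphic_Gext_1]) (use ub w in \<open>auto simp: S_def intro: less_trans[of _ 0]\<close>)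
    moreover have "Vfac (hh u) holomorphic_on S"
      unfolding S_def using hh_bounds[OF ub(4)] by (intro Vfac_holomorphic) auto
    ultimately have "Qfun u w holomorphic_on S"
      unfolding Qfun_def[abs_def] using shift by (intro holomorphic_intros) auto
    then have "deriv (Qfun u w) holomorphic_on S"
      unfolding S_def by (rule holomorphic_deriv[OF _ open_strip])
    then have "continuous_on S (deriv (Qfun u w))" by (rule holomorphic_on_imp_continuous_on)
    moreover have "sg u a \<in> S" for a
    proof -
      have "1 / u < 4 / u" using ub by (intro divide_strict_right_mono) auto
      then have "1 / u < d" using ub by linarith
      with ub(5) show ?thesis by (simp add: S_def)
    qed
    ultimately have "continuous_on UNIV (\<lambda>a. deriv (Qfun u w) (sg u a))"
      by (intro continuous_on_compose2[where g = "deriv (Qfun u w)" and f = "sg u" and t = S] continuous_intros) auto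
    moreover have "E = (\<lambda>a. K a * deriv (Qfun u w) (sg u a) + A1 u a b)" by (auto simp: E_def A algebra_simps)
    ultimately show "continuous_on UNIV E"
      unfolding K_def by (simp only:) (intro continuous_intros continuous_on_Phi1 u)
  qed
  have "(LBINT a. f' a) = 0 - 0"
  proof (rule integral_derivative_limits[OF f'])
    show "integrable lborel f'" unfolding f'_def using Phi_i A_i E_i by simp
    show "((\<lambda>a. Phi1 u a b) \<longlongrightarrow> 0) at_top" "((\<lambda>a. Phi1 u a b) \<longlongrightarrow> 0) at_bot"
      by (rule tendsto_0_om_bound[OF Phi_om])+
  qed
  then have "of_real u * (LBINT a. Phi1 u a b) + ((LBINT a. E a) - (LBINT a. A1 u a b)) = 0"
    unfolding f'_def using Phi_i A_i E_i by simp
  then have "of_real u * (LBINT a. Phi1 u a b) - (LBINT a. A1 u a b) = - (LBINT a. E a)"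
    by (simp add: algebra_simps eq_neg_iff_add_eq_0)
  then have "norm (of_real u * (LBINT a. Phi1 u a b) - (LBINT a. A1 u a b)) = norm (LBINT a. E a)" by simp
  also have "\<dots> \<le> (LBINT a. norm (E a))" by (rule integral_norm_bound)
  also have "\<dots> \<le> (LBINT a. cErr * u powr (1/8) * om b * (om a * kk u (b + a)))"
    using E_i om_kk_integrable[OF ub(4)] Ebound by (intro integral_mono) auto
  also have "\<dots> = cErr * u powr (1/8) * om b * (LBINT a. om a * kk u (b + a))" by simp
  also have "\<dots> \<le> cErr * u powr (1/8) * om b * kappa u"
    using om_kk_integral_le[OF ub(4)] cPhi_pos om_pos[of b] by (intro mult_left_mono mult_nonneg_nonneg) (auto simp: less_imp_le)
  finally show ?thesis by (simp add: mult_ac)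
qed

end

text \<open>The dominated convergence theorem along \<open>at_top\<close> asks for measurability at
  every parameter, but the integrands are controlled only for u \<ge> b; before b they are replaced
  by 0.\<close>

lemma tendsto_integral_eventually_dominated:
  fixes P :: "real \<Rightarrow> 'a \<Rightarrow> complex"
  assumes L: "L \<in> borel_measurable M" and w: "integrable M w"
    and P: "\<And>u. u \<ge> b \<Longrightarrow> P u \<in> borel_measurable M" "\<And>u z. u \<ge> b \<Longrightarrow> norm (P u z) \<le> w z"
    and lim: "\<And>z. ((\<lambda>u. P u z) \<longlongrightarrow> L z) at_top"
  shows "((\<lambda>u. integral\<^sup>L M (P u)) \<longlongrightarrow> integral\<^sup>L M L) at_top"
proof -
  define Q where "Q = (\<lambda>u. if u \<ge> b then P u else (\<lambda>_. 0))"
  have ev: "\<forall>\<^sub>F u in at_top. Q u = P u"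
    using eventually_ge_at_top[of b] by eventually_elim (simp add: Q_def)
  have "((\<lambda>u. integral\<^sup>L M (Q u)) \<longlongrightarrow> integral\<^sup>L M L) at_top"
  proof (rule integral_dominated_convergence_at_top[OF L _ w])
    show "Q u \<in> borel_measurable M" for u using P(1)[of u] by (simp add: Q_def)
    show "\<forall>\<^sub>F u in at_top. AE z in M. norm (Q u z) \<le> w z"
      using ev eventually_ge_at_top[of b] by eventually_elim (use P(2) in auto)
    show "AE z in M. ((\<lambda>u. Q u z) \<longlongrightarrow> L z) at_top"
      by (intro AE_I2 Lim_transform_eventually[OF lim]) (use ev in \<open>auto elim!: eventually_mono\<close>)
  qed
  then show ?thesis by (rule Lim_transform_eventually) (use ev in \<open>auto elim!: eventually_mono\<close>)
qed

lemma tendsto_coordinatewise: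
  fixes f :: "'x \<Rightarrow> 'i \<Rightarrow> 'b::topological_space"
  assumes "\<And>i. ((\<lambda>x. f x i) \<longlongrightarrow> l i) F"
  shows "(f \<longlongrightarrow> l) F"
proof -
  have "limitin (product_topology (\<lambda>_. euclidean) UNIV) f l F"
    unfolding limitin_componentwise using assms by simp
  then show ?thesis by (simp add: euclidean_product_topology)
qed

lemma tendsto_zeta_reg:
  assumes "(f \<longlongrightarrow> l) F" "Re l > -1"
  shows "((\<lambda>x. zeta_reg (f x)) \<longlongrightarrow> zeta_reg l) F"
proof (rule isCont_tendsto_compose[OF _ assms(1)])
  show "isCont zeta_reg l"
    using continuous_zeta_reg assms(2) by (auto intro: continuous_on_interior simp: interior_open open_halfspace_Re_gt)
qed

lemma tendsto_Gext:
  assumes lim: "\<And>j. ((\<lambda>x. f x j) \<longlongrightarrow> l j) F" and "l \<in> Gregion k" "eventually (\<lambda>x. f x \<in> Gregion k) F"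
  shows "((\<lambda>x. Gext k (f x)) \<longlongrightarrow> Gext k l) F"
  by (rule continuous_on_tendsto_compose[OF continuous_on_Gext tendsto_coordinatewise[OF lim] assms(2,3)])

lemma tendsto_sg:
  assumes "(t \<longlongrightarrow> t0) at_top"
  shows "((\<lambda>u. sg u (t u)) \<longlongrightarrow> Complex 0 t0) at_top"
proof -
  have "((\<lambda>u::real. 1 / u) \<longlongrightarrow> 0) at_top" by real_asymp
  then show ?thesis unfolding sg_def by (intro tendsto_Complex assms)
qed

lemma zeta_reg_cnj: "Re s > -1 \<Longrightarrow> zeta_reg (cnj s) = cnj (zeta_reg s)"
proof -
  assume s: "Re s > -1"
  show ?thesis
  proof (cases "s = 0")
    case False
    have "zeta (cnj (1 + s)) = cnj (zeta (1 + s))" using s False by (intro zeta_cnj) auto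
    then have "zeta_reg (cnj s) / cnj s = cnj (zeta_reg s / s)"
      using zeta_eq_reg[of s] zeta_eq_reg[of "cnj s"] False by simp
    then show ?thesis using False by simp
  qed simp
qed

text \<open>The integrand of the theorem with the t^2 absorbed into \<open>zeta_reg\<close>, which
  makes it continuous at t = 0 as well.\<close>

definition g1 :: "real \<Rightarrow> complex" where
  "g1 a = Gext 1 (line2 a) / (zeta_reg (Complex 0 a) * zeta_reg (Complex 0 (-a)))"

text \<open>\<open>A1\<close> in the coordinates a and b = -a + x/u, divided by u^2. The indicator
  is the condition |a + b| < 1.\<close>

definition Psi1 :: "real \<Rightarrow> real \<Rightarrow> real \<Rightarrow> complex" where
  "Psi1 u a x = indicator {-u<..<u} x *\<^sub>R (exp (Complex 2 x) / (Complex 2 x)\<^sup>2 *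
     (zeta_reg (Complex (2 / u) (x / u)) * Vfac (hh u) (sg u a) * Vfac (hh u) (sg u (-a + x / u)) * Gext 1 (vec2 (sg u a) (sg u (-a + x / u)))))"

context zeta_estimates
begin

lemma tendsto_Vfac:
  assumes "(t \<longlongrightarrow> t0) at_top"
  shows "((\<lambda>u. Vfac (hh u) (sg u (t u))) \<longlongrightarrow> 1 / zeta_reg (Complex 0 t0)) at_top"
proof -
  have "((\<lambda>u::real. u powr -32) \<longlongrightarrow> 0) at_top" by real_asymp
  then have h: "((\<lambda>u. complex_of_real (hh u)) \<longlongrightarrow> of_real 0) at_top" unfolding hh_def by (rule tendsto_of_real)
  have "((\<lambda>u. Vfac (hh u) (sg u (t u))) \<longlongrightarrow> 1 / ((1 + of_real 0 * Complex 0 t0) * zeta_reg (Complex 0 t0))) at_top"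
    unfolding Vfac_def using reg_nonzero[of "Complex 0 t0"] d01
    by (intro tendsto_intros tendsto_zeta_reg tendsto_sg assms h) auto
  then show ?thesis by simp
qed

text \<open>Two errors arise, both of size u^(1/8) times a logarithm: the regular part of the
  integration by parts, and the region |a + b| \<ge> 1, where the double pole is harmless. The main
  term is of order u because of the multiplication by u.\<close>

lemma smooth_1_minus_near:
  assumes u: "u \<ge> 4 / d"
  defines "B \<equiv> (\<lambda>z. indicator {z. \<bar>fst z + snd z\<bar> < 1} z *\<^sub>R A1 u (fst z) (snd z))"
  shows "integrable lborel B"
    and "norm (of_real (u * ((2 * pi)^2 * smooth_Mk 1 u (hh u))) - (LBINT z. B z)) \<le> (cErr + cPhi) * u powr (1/8) * kappa u * om_mass"
proof -
  note ub = u_bounds[OF u]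
  define P where "P = (\<lambda>z. Phi1 u (fst z) (snd z))"
  have Peq: "(\<lambda>z. perron_kernel u (hh u) (Complex (1/u) (fst z)) * perron_kernel u (hh u) (Complex (1/u) (snd z)) *
            Mfun 1 (vec2 (Complex (1/u) (fst z)) (Complex (1/u) (snd z)))) = P"
    unfolding P_def integrand_eq_Phi1[OF u, symmetric] sg_def ..
  have hpos: "hh u > 0" using hh_bounds[OF ub(4)] by simp
  have Pi: "integrable lborel P" and Pint: "of_real ((2 * pi)^2 * smooth_Mk 1 u (hh u)) = (LBINT z. P z)"
    using smooth_Mk_1_integral[OF ub(2) hpos, of u] unfolding Peq by simp_all
  have omi: "integrable lborel (\<lambda>z. u * (cPhi * u powr (1/8) * (2 * u)) * (om (fst z) * om (snd z)))"
    by (intro integrable_mult_right integrable_lborel_times om_integrable)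
  have setm: "{z::real\<times>real. \<bar>fst z + snd z\<bar> < 1} \<in> sets borel"
    by (intro borel_open open_Collect_less continuous_intros)
  have meas: "(\<lambda>z. A1 u (fst z) (snd z)) \<in> borel_measurable borel"
    by (intro borel_measurable_continuous_onI continuous_on_Phi1 u continuous_intros)
  have kb: "kk u x \<le> 2 * u" for x by (rule kk_le[OF ub(4)])
  have Ab: "norm (A1 u a b) \<le> u * (cPhi * u powr (1/8) * (2 * u)) * (om a * om b)" for a b
  proof -
    have "norm (A1 u a b) \<le> u * (cPhi * u powr (1/8) * (om a * kk u (a + b) * om b))" by (rule A1_bound(1)[OF u])
    also have "\<dots> \<le> u * (cPhi * u powr (1/8) * (om a * (2 * u) * om b))"
      using ub kb om_pos[of a] om_pos[of b] cPhi_pos by (intro mult_left_mono mult_right_mono mult_nonneg_nonneg) (auto simp: less_imp_le)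
    finally show ?thesis by (simp add: mult_ac)
  qed
  show Bi: "integrable lborel B"
  proof (rule Bochner_Integration.integrable_bound[OF omi])
    show "B \<in> borel_measurable lborel" unfolding B_def using setm meas by simp
    show "AE z in lborel. norm (B z) \<le> norm (u * (cPhi * u powr (1/8) * (2 * u)) * (om (fst z) * om (snd z)))"
      using Ab by (auto simp: B_def indicator_def intro: order_trans[OF _ abs_ge_self])
  qed
  define I where "I = (\<lambda>b. of_real u * (LBINT a. Phi1 u a b) - (LBINT a. B (a, b)))"
  have P2: "integrable (lborel \<Otimes>\<^sub>M lborel) (case_prod (Phi1 u))" and B2: "integrable (lborel \<Otimes>\<^sub>M lborel) (\<lambda>(a, b). B (a, b))"
    using Pi Bi by (simp_all add: P_def lborel_prod case_prod_unfold)
  have Ib: "norm (I b) \<le> (cErr + cPhi) * u powr (1/8) * kappa u * om b" for b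
  proof -
    define F where "F = (\<lambda>a. indicator {a. \<bar>a + b\<bar> \<ge> 1} a *\<^sub>R A1 u a b)"
    have A_m: "(\<lambda>a. A1 u a b) \<in> borel_measurable borel"
      by (intro borel_measurable_continuous_onI continuous_on_Phi1 u continuous_intros)
    have A_i: "integrable lborel (\<lambda>a. A1 u a b)"
    proof (rule integrable_om_bound[OF _ A_m])
      fix a
      have "u * (cPhi * u powr (1/8) * (2 * u)) * (om a * om b) \<le> u * (cPhi * u powr (1/8) * (2 * u)) * (om a * 1)"
        using om_le_1[of b] om_pos[of a] cPhi_pos ub by (intro mult_left_mono) auto
      also have "\<dots> = u * (cPhi * u powr (1/8) * (2 * u)) * om a" by simp
      finally show "norm (A1 u a b) \<le> u * (cPhi * u powr (1/8) * (2 * u)) * om a" using Ab[of a b] by (rule order_trans[rotated])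
    qed
    have "closed {a::real. \<bar>a + b\<bar> \<ge> 1}" by (intro closed_Collect_le continuous_intros)
    then have sm: "{a::real. \<bar>a + b\<bar> \<ge> 1} \<in> sets lborel" by (simp add: borel_closed)
    have F_i: "integrable lborel F" unfolding F_def by (rule integrable_mult_indicator[OF sm A_i])
    have "(\<lambda>a. B (a, b)) = (\<lambda>a. A1 u a b - F a)" by (auto simp: B_def F_def indicator_def)
    then have "I b = (of_real u * (LBINT a. Phi1 u a b) - (LBINT a. A1 u a b)) + (LBINT a. F a)"
      unfolding I_def using A_i F_i by simp
    also have "norm \<dots> \<le> cErr * u powr (1/8) * kappa u * om b + cPhi * u powr (1/8) * kappa u * om b"
    proof (rule order_trans[OF norm_triangle_ineq add_mono[OF by_parts_bound[OF u]]])
      have "norm (LBINT a. F a) \<le> (LBINT a. norm (F a))" by (rule integral_norm_bound)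
      also have "\<dots> \<le> (LBINT a. cPhi * u powr (1/8) * om b * (om a * kk u (b + a)))"
      proof (rule integral_mono)
        show "integrable lborel (\<lambda>a. norm (F a))" using F_i by simp
        show "integrable lborel (\<lambda>a. cPhi * u powr (1/8) * om b * (om a * kk u (b + a)))"
          by (intro integrable_mult_right om_kk_integrable ub)
        fix a
        have "0 \<le> cPhi * u powr (1/8) * om b * (om a * kk u (b + a))"
          using cPhi_pos om_pos[of a] om_pos[of b] kk_ge_1[of u "b + a"] by (intro mult_nonneg_nonneg) auto
        then show "norm (F a) \<le> cPhi * u powr (1/8) * om b * (om a * kk u (b + a))"
          using A1_bound(2)[OF u, of a b] by (auto simp: F_def indicator_def mult_ac add.commute)
      qed
      also have "\<dots> = cPhi * u powr (1/8) * om b * (LBINT a. om a * kk u (b + a))" by simp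
      also have "\<dots> \<le> cPhi * u powr (1/8) * om b * kappa u"
        using om_kk_integral_le[OF ub(4)] cPhi_pos om_pos[of b] by (intro mult_left_mono mult_nonneg_nonneg) (auto simp: less_imp_le)
      finally show "norm (LBINT a. F a) \<le> cPhi * u powr (1/8) * kappa u * om b" by (simp add: mult_ac)
    qed
    finally show ?thesis by (simp add: algebra_simps)
  qed
  have P3: "integrable lborel (\<lambda>b. LBINT a. Phi1 u a b)" "(LBINT b. (LBINT a. Phi1 u a b)) = (LBINT z. P z)"
    using lborel_pair.integrable_snd[OF P2] lborel_pair.integral_snd[OF P2] by (simp_all add: P_def lborel_prod case_prod_unfold)
  have B3: "integrable lborel (\<lambda>b. LBINT a. B (a, b))" "(LBINT b. (LBINT a. B (a, b))) = (LBINT z. B z)"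
    using lborel_pair.integrable_snd[OF B2] lborel_pair.integral_snd[OF B2] by (simp_all add: lborel_prod case_prod_unfold)
  have "of_real (u * ((2 * pi)^2 * smooth_Mk 1 u (hh u))) - (LBINT z. B z) = (LBINT b. I b)"
    unfolding of_real_mult[of u] Pint I_def using P3 B3 by simp
  also have "norm \<dots> \<le> (LBINT b. norm (I b))" by (rule integral_norm_bound)
  also have "\<dots> \<le> (LBINT b. (cErr + cPhi) * u powr (1/8) * kappa u * om b)"
    using P3 B3 Ib by (intro integral_mono integrable_norm integrable_mult_right om_integrable) (auto simp: I_def)
  also have "\<dots> = (cErr + cPhi) * u powr (1/8) * kappa u * om_mass" by (simp add: om_mass_def)
  finally show "norm (of_real (u * ((2 * pi)^2 * smooth_Mk 1 u (hh u))) - (LBINT z. B z)) \<le> (cErr + cPhi) * u powr (1/8) * kappa u * om_mass" .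
qed

lemma om_ge_powr: "e \<le> -(1 + 1/1024) \<Longrightarrow> nm a powr e \<le> om a"
  unfolding om_def by (intro powr_mono) auto

text \<open>For |a + b| < 1 both V factors decay like |a|^(-1 + 1/8192), and their product is
  integrable without any damping. Hence the majorant does not involve u.\<close>

lemma Psi1_bound:
  assumes u: "u \<ge> 4 / d"
  shows "norm (Psi1 u a x) \<le> (exp 2 * 10 * C^4) * (om a * (1 / (norm (Complex 2 x))\<^sup>2))"
proof (cases "x \<in> {-u<..<u}")
  case True
  note ub = u_bounds[OF u]
  define b where "b = -a + x / u"
  have ab: "\<bar>a + b\<bar> < 1" using True ub by (simp add: b_def abs_less_iff field_simps)
  have va: "norm (Vfac (hh u) (sg u a)) \<le> C * nm a powr (-1 + 1/8192)"
    using Vfac_le(2)[of "sg u a" "hh u"] ub hh_bounds[OF ub(4)] by simp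
  have vb: "norm (Vfac (hh u) (sg u b)) \<le> C * (2 * nm a powr (-1 + 1/8192))"
  proof -
    have "norm (Vfac (hh u) (sg u b)) \<le> C * nm b powr (-1 + 1/8192)"
      using Vfac_le(2)[of "sg u b" "hh u"] ub hh_bounds[OF ub(4)] by simp
    also have "nm b powr (-1 + 1/8192) \<le> (nm a / 2) powr (-1 + 1/8192)"
      using ab by (intro powr_mono2') auto
    also have "\<dots> = nm a powr (-1 + 1/8192) * 2 powr (1 - 1/8192)" by (simp add: powr_divide powr_minus field_simps)
    also have "\<dots> \<le> nm a powr (-1 + 1/8192) * 2 powr 1" by (intro mult_left_mono powr_mono) auto
    finally show ?thesis using C1 by (simp add: mult_left_mono mult.commute)
  qed
  define s where "s = Complex (2 / u) (x / u)"
  have s: "0 \<le> Re s" "Re s \<le> 1" "\<bar>Im s\<bar> < 1" using ub d01 True by (auto simp: s_def abs_less_iff field_simps)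
  have z: "norm (zeta_reg s) \<le> 5 * C"
  proof -
    have "norm s \<le> 2" using cmod_le[of s] s by simp
    have "norm (xi s) \<le> C * pe (Im s)" using s by (intro xi_upper) auto
    also have "pe (Im s) \<le> nm (Im s) powr 1" by (intro powr_mono) auto
    also have "\<dots> \<le> 2" using s by simp
    finally have "norm (xi s) \<le> C * 2" using C1 by simp
    then have "norm s * norm (xi s) \<le> 2 * (C * 2)" using \<open>norm s \<le> 2\<close> C1 by (intro mult_mono) auto
    moreover have "norm (zeta_reg s) \<le> norm (1::complex) + norm (s * xi s)" unfolding zeta_reg_def by (rule norm_triangle_ineq)
    ultimately show ?thesis using C1 by (simp add: norm_mult)
  qed
  have g: "norm (Gext 1 (vec2 (sg u a) (sg u b))) \<le> C" using ub by (intro G1 vec2_Gregion_nonneg) auto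
  define p where "p = nm a powr (-1 + 1/8192)"
  have pp: "p * p \<le> om a" unfolding p_def by (simp flip: powr_add) (rule om_ge_powr, simp)
  have "norm (Psi1 u a x) = exp 2 / (norm (Complex 2 x))\<^sup>2 * (norm (zeta_reg s) * norm (Vfac (hh u) (sg u a)) * norm (Vfac (hh u) (sg u b)) * norm (Gext 1 (vec2 (sg u a) (sg u b))))"
    using True by (simp add: Psi1_def norm_mult norm_divide norm_power b_def s_def)
  also have "\<dots> \<le> exp 2 / (norm (Complex 2 x))\<^sup>2 * ((5 * C) * (C * p) * (C * (2 * p)) * C)"
    using va vb z g C1 by (intro mult_left_mono mult_mono mult_nonneg_nonneg) (auto simp: p_def)
  also have "\<dots> = exp 2 * 10 * C^4 * ((p * p) * (1 / (norm (Complex 2 x))\<^sup>2))" by (simp add: power_numeral_reduce)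
  also have "\<dots> \<le> exp 2 * 10 * C^4 * (om a * (1 / (norm (Complex 2 x))\<^sup>2))"
    using pp C1 by (intro mult_left_mono mult_right_mono) auto
  finally show ?thesis .
next
  case False
  then show ?thesis using om_pos[of a] C1 by (simp add: Psi1_def)
qed

lemma Psi1_measurable:
  assumes u: "u \<ge> 4 / d"
  shows "(\<lambda>z. Psi1 u (fst z) (snd z)) \<in> borel_measurable borel"
proof -
  note ub = u_bounds[OF u]
  have re: "- 1 < 2 / u" using divide_pos_pos[of 2 u] ub by linarith
  have "(\<lambda>z. exp (Complex 2 (snd z)) / (Complex 2 (snd z))\<^sup>2 *
     (zeta_reg (Complex (2 / u) (snd z / u)) * Vfac (hh u) (sg u (fst z)) * Vfac (hh u) (sg u (-fst z + snd z / u)) * Gext 1 (vec2 (sg u (fst z)) (sg u (-fst z + snd z / u))))) \<in> borel_measurable borel"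
    using ub re
    by (intro borel_measurable_continuous_onI continuous_intros continuous_on_Vfac_sg u continuous_on_zeta_reg_comp continuous_on_Gext_1_comp)
       (auto simp: Complex_nonzero)
  moreover have "(\<lambda>z::real\<times>real. indicator {-u<..<u} (snd z) :: real) \<in> borel_measurable borel" 
    by (rule measurable_compose[of snd borel borel]) (auto intro!: borel_measurable_continuous_onI continuous_intros)
  ultimately show ?thesis unfolding Psi1_def by (intro borel_measurable_scaleR)
qed

lemma Psi1_dominating: "integrable lborel (\<lambda>z. (exp 2 * 10 * C^4) * (om (fst z) * (1 / (norm (Complex 2 (snd z)))\<^sup>2)))"
  by (intro integrable_mult_right integrable_lborel_times om_integrable integrable_inverse_Complex_square) simp

lemma Psi1_integrable:
  assumes u: "u \<ge> 4 / d" shows "integrable lborel (\<lambda>z. Psi1 u (fst z) (snd z))"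
proof (rule Bochner_Integration.integrable_bound[OF Psi1_dominating])
  show "AE z in lborel. norm (Psi1 u (fst z) (snd z)) \<le> norm ((exp 2 * 10 * C^4) * (om (fst z) * (1 / (norm (Complex 2 (snd z)))\<^sup>2)))"
    unfolding real_norm_def by (intro AE_I2 order_trans[OF Psi1_bound[OF u] abs_ge_self])
qed (use Psi1_measurable[OF u] in simp)

lemma near_eq_Psi1:
  assumes u: "u \<ge> 4 / d"
  shows "(LBINT z. indicator {z. \<bar>fst z + snd z\<bar> < 1} z *\<^sub>R A1 u (fst z) (snd z)) = of_real u * (LBINT z. Psi1 u (fst z) (snd z))"
proof -
  note ub = u_bounds[OF u]
  define B where "B = (\<lambda>z. indicator {z. \<bar>fst z + snd z\<bar> < 1} z *\<^sub>R A1 u (fst z) (snd z))"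
  have Bi: "integrable lborel B" unfolding B_def by (rule smooth_1_minus_near(1)[OF u])
  have key: "B (a, -a + (1/u) * x) = (u * u) *\<^sub>R Psi1 u a x" for a x
  proof -
    have sum: "sg u a + sg u (-a + x / u) = Complex (2 / u) (x / u)" by (simp add: sg_add)
    have C: "Complex (2 / u) (x / u) = Complex 2 x / of_real u" by (simp add: complex_eq_iff)
    have iff: "\<bar>x / u\<bar> < 1 \<longleftrightarrow> x \<in> {-u<..<u}" using ub by (auto simp: abs_less_iff field_simps)
    have e: "exp (of_real u * Complex (2 / u) (x / u)) = exp (Complex 2 x)" using ub by (simp add: C)
    show ?thesis
    proof (cases "x \<in> {-u<..<u}")
      case True
      then have "B (a, -a + (1/u) * x) = A1 u a (-a + x / u)" using iff by (simp add: B_def)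
      also have "\<dots> = of_real (u * u) * Psi1 u a x"
        unfolding A1_def sum e using True ub by (simp add: Psi1_def C power_divide power2_eq_square)
      finally show ?thesis by (simp add: scaleR_conv_of_real)
    next
      case False
      then have "\<not> \<bar>x / u\<bar> < 1" using iff by blast
      then show ?thesis using False by (simp add: B_def Psi1_def)
    qed
  qed
  have B2: "integrable (lborel \<Otimes>\<^sub>M lborel) (\<lambda>(a, b). B (a, b))" and P2: "integrable (lborel \<Otimes>\<^sub>M lborel) (\<lambda>(a, b). Psi1 u a b)"
    using Bi Psi1_integrable[OF u] by (simp_all add: lborel_prod case_prod_unfold)
  have "(LBINT z. B z) = (\<integral>a. \<integral>b. B (a, b) \<partial>lborel \<partial>lborel)"
    using lborel_pair.integral_fst[OF B2] by (simp add: lborel_prod case_prod_unfold)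
  also have "\<dots> = (LBINT a. of_real u * (LBINT x. Psi1 u a x))"
  proof (rule Bochner_Integration.integral_cong[OF refl])
    fix a
    have "(LBINT b. B (a, b)) = \<bar>1/u\<bar> *\<^sub>R (LBINT x. B (a, -a + (1/u) * x))"
      using ub by (intro lborel_integral_real_affine) simp
    also have "\<dots> = \<bar>1/u\<bar> *\<^sub>R ((u * u) *\<^sub>R (LBINT x. Psi1 u a x))" unfolding key by simp
    finally show "(LBINT b. B (a, b)) = of_real u * (LBINT x. Psi1 u a x)"
      using ub by (simp add: scaleR_conv_of_real)
  qed
  also have "\<dots> = of_real u * (\<integral>a. \<integral>x. Psi1 u a x \<partial>lborel \<partial>lborel)" by simp
  also have "(\<integral>a. \<integral>x. Psi1 u a x \<partial>lborel \<partial>lborel) = (LBINT z. Psi1 u (fst z) (snd z))"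
    using lborel_pair.integral_fst[OF P2] by (simp add: lborel_prod case_prod_unfold)
  finally show ?thesis by (simp add: B_def)
qed

lemma g1_integrable: "integrable lborel g1"
proof (rule integrable_om_bound)
  fix a
  have "norm (g1 a) = norm (Gext 1 (line2 a)) * ((1 / norm (zeta_reg (Complex 0 a))) * (1 / norm (zeta_reg (Complex 0 (-a)))))"
    by (simp add: g1_def norm_mult norm_divide)
  also have "\<dots> \<le> C * ((C * nm a powr (-1 + 1/8192)) * (C * nm a powr (-1 + 1/8192)))"
    using inverse_reg_le[of "Complex 0 a"] inverse_reg_le[of "Complex 0 (-a)"] d01 C1
    by (intro mult_mono mult_nonneg_nonneg G1 vec2_Gregion_nonneg) auto
  also have "\<dots> = C^3 * (nm a powr (-1 + 1/8192) * nm a powr (-1 + 1/8192))" by (simp add: power3_eq_cube)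
  also have "\<dots> \<le> C^3 * om a"
    using C1 by (intro mult_left_mono) (auto simp flip: powr_add intro!: om_ge_powr)
  finally show "norm (g1 a) \<le> C^3 * om a" .
next
  show "g1 \<in> borel_measurable borel"
    unfolding g1_def[abs_def] using reg_nonzero d01
    by (intro borel_measurable_continuous_onI continuous_intros continuous_on_zeta_reg_comp continuous_on_Gext_1_comp) auto
qed

text \<open>The limit integrand is a product of a function of a and a function of x: in the limit b
  becomes -a, and the pole separates as exp (2 + ix) / (2 + ix)^2 with integral 2 pi.\<close>

lemma Psi1_limit:
  "((\<lambda>u. LBINT z. Psi1 u (fst z) (snd z)) \<longlongrightarrow> 2 * pi * (LBINT a. g1 a)) at_top"
proof -
  define L where "L = (\<lambda>z. g1 (fst z) * (exp (Complex 2 (snd z)) / (Complex 2 (snd z))\<^sup>2))"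
  have Li: "integrable lborel L" unfolding L_def
    by (intro integrable_lborel_times g1_integrable exp_over_square_integrable) simp
  have Lv: "(LBINT z. L z) = (LBINT a. g1 a) * (2 * pi)"
    unfolding L_def by (subst integral_lborel_times) (auto intro: g1_integrable exp_over_square_integrable simp: exp_over_square_integral)
  have "((\<lambda>u. LBINT z. Psi1 u (fst z) (snd z)) \<longlongrightarrow> (LBINT z. L z)) at_top"
  proof (rule tendsto_integral_eventually_dominated[OF borel_measurable_integrable[OF Li] Psi1_dominating, where b = "4 / d"])
    show "(\<lambda>z. Psi1 u (fst z) (snd z)) \<in> borel_measurable lborel" if "u \<ge> 4 / d" for u using Psi1_measurable[OF that] by simp
    show "norm (Psi1 u (fst z) (snd z)) \<le> (exp 2 * 10 * C^4) * (om (fst z) * (1 / (norm (Complex 2 (snd z)))\<^sup>2))" if "u \<ge> 4 / d" for u z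
      by (rule Psi1_bound[OF that])
  next
    fix z :: "real \<times> real"
    define a where "a = fst z"
    define x where "x = snd z"
    have xu: "((\<lambda>u. x / u) \<longlongrightarrow> 0) at_top" by real_asymp
    have b: "((\<lambda>u. -a + x / u) \<longlongrightarrow> -a) at_top" using tendsto_add[OF tendsto_const xu, of "-a"] by simp
    have u2: "((\<lambda>u::real. 2 / u) \<longlongrightarrow> 0) at_top" by real_asymp
    have zr: "((\<lambda>u. zeta_reg (Complex (2 / u) (x / u))) \<longlongrightarrow> zeta_reg (Complex 0 0)) at_top"
      by (intro tendsto_zeta_reg tendsto_Complex u2 xu) simp
    have G: "((\<lambda>u. Gext 1 (vec2 (sg u a) (sg u (-a + x / u)))) \<longlongrightarrow> Gext 1 (line2 a)) at_top"
    proof (rule tendsto_Gext)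
      fix j show "((\<lambda>u. vec2 (sg u a) (sg u (-a + x / u)) j) \<longlongrightarrow> line2 a j) at_top"
        unfolding vec2_def by (cases "j = 0") (use tendsto_sg[OF b] tendsto_sg[OF tendsto_const[of a]] in simp_all)
      show "line2 a \<in> Gregion 1" by (rule vec2_Gregion_nonneg) auto
      show "\<forall>\<^sub>F u in at_top. vec2 (sg u a) (sg u (-a + x / u)) \<in> Gregion 1"
        using eventually_gt_at_top[of "0::real"] by eventually_elim (rule vec2_Gregion_nonneg, auto)
    qed
    have "((\<lambda>u. exp (Complex 2 x) / (Complex 2 x)\<^sup>2 *
       (zeta_reg (Complex (2 / u) (x / u)) * Vfac (hh u) (sg u a) * Vfac (hh u) (sg u (-a + x / u)) * Gext 1 (vec2 (sg u a) (sg u (-a + x / u)))))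
       \<longlongrightarrow> exp (Complex 2 x) / (Complex 2 x)\<^sup>2 * (zeta_reg (Complex 0 0) * (1 / zeta_reg (Complex 0 a)) * (1 / zeta_reg (Complex 0 (-a))) * Gext 1 (line2 a))) at_top"
      by (intro tendsto_mult tendsto_const zr G tendsto_Vfac b)
    also have "exp (Complex 2 x) / (Complex 2 x)\<^sup>2 * (zeta_reg (Complex 0 0) * (1 / zeta_reg (Complex 0 a)) * (1 / zeta_reg (Complex 0 (-a))) * Gext 1 (line2 a)) = L z"
      by (simp add: L_def g1_def a_def x_def mult_ac flip: zero_complex.code)
    finally have lim: "((\<lambda>u. exp (Complex 2 x) / (Complex 2 x)\<^sup>2 *
       (zeta_reg (Complex (2 / u) (x / u)) * Vfac (hh u) (sg u a) * Vfac (hh u) (sg u (-a + x / u)) * Gext 1 (vec2 (sg u a) (sg u (-a + x / u))))) \<longlongrightarrow> L z) at_top" .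

    show "((\<lambda>u. Psi1 u (fst z) (snd z)) \<longlongrightarrow> L z) at_top"
      by (rule Lim_transform_eventually[OF lim], use eventually_gt_at_top[of "\<bar>x\<bar>"] in eventually_elim)
        (auto simp: Psi1_def a_def[symmetric] x_def[symmetric] indicator_def abs_less_iff)
  qed
  then show ?thesis by (simp add: Lv mult.commute)
qed

lemma smooth_1_limit:
  "((\<lambda>u. of_real (smooth_Mk 1 u (hh u))) \<longlongrightarrow> 1 / (2 * pi) * (LBINT a. g1 a)) at_top"
proof -
  define S where "S = (\<lambda>u. complex_of_real ((2 * pi)^2 * smooth_Mk 1 u (hh u)))"
  define I where "I = (\<lambda>u. LBINT z. Psi1 u (fst z) (snd z))"
  have "((\<lambda>u. S u - I u) \<longlongrightarrow> 0) at_top"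
  proof (rule Lim_null_comparison)
    show "\<forall>\<^sub>F u in at_top. norm (S u - I u) \<le> (cErr + cPhi) * om_mass * (u powr (1/8) * (4 * (1 + ln u) + 2 * om_mass) / u)"
      using eventually_ge_at_top[of "4 / d"]
    proof eventually_elim
      case (elim u)
      note ub = u_bounds[OF elim]
      have "norm (of_real u * S u - of_real u * I u) \<le> (cErr + cPhi) * u powr (1/8) * kappa u * om_mass"
        using smooth_1_minus_near(2)[OF elim] unfolding near_eq_Psi1[OF elim] by (simp add: S_def I_def)
      moreover have "norm (of_real u * S u - of_real u * I u) = u * norm (S u - I u)"
        unfolding right_diff_distrib[symmetric] norm_mult using ub by simp
      ultimately have "norm (S u - I u) \<le> (cErr + cPhi) * u powr (1/8) * kappa u * om_mass / u"
        using ub by (simp add: field_simps)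
      then show ?case by (simp add: kappa_def mult_ac)
    qed
    have "((\<lambda>u. u powr (1/8) * (4 * (1 + ln u) + 2 * om_mass) / u) \<longlongrightarrow> 0) at_top" by real_asymp
    then show "((\<lambda>u. (cErr + cPhi) * om_mass * (u powr (1/8) * (4 * (1 + ln u) + 2 * om_mass) / u)) \<longlongrightarrow> 0) at_top"
      by (rule tendsto_mult_right_zero)
  qed
  from tendsto_add[OF this Psi1_limit[folded I_def]] have "(S \<longlongrightarrow> 2 * pi * (LBINT a. g1 a)) at_top" by simp
  from tendsto_divide[OF this tendsto_const[of "complex_of_real ((2 * pi)^2)"]]
  have "((\<lambda>u. S u / of_real ((2 * pi)^2)) \<longlongrightarrow> 2 * pi * (LBINT a. g1 a) / of_real ((2 * pi)^2)) at_top" by simp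
  moreover have "S u / of_real ((2 * pi)^2) = of_real (smooth_Mk 1 u (hh u))" for u
    by (simp add: S_def)
  moreover have "2 * pi * (LBINT a. g1 a) / of_real ((2 * pi)^2) = 1 / (2 * pi) * (LBINT a. g1 a)"
    by (simp add: power2_eq_square)
  ultimately show ?thesis by simp
qed

end

section \<open>The case \<open>k = 2\<close>\<close>

text \<open>Each of the four triples cancels one edge of the corresponding triangle, so that what
  remains of the complete graph on the four variables is a spanning tree or a 4-cycle.\<close>

lemma two_triangles_le:
  fixes k13 k14 k23 k24 k34 t1 t2 :: real
  assumes nn: "0 \<le> k13" "0 \<le> k14" "0 \<le> k23" "0 \<le> k24" "0 \<le> k34" "0 \<le> t2" "t2 \<le> 1"
    and t1: "t1 * (k13 * k14 * k34) \<le> 3 * (k14 * k34 + k13 * k34 + k13 * k14)"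
    and t2: "t2 * (k23 * k24 * k34) \<le> 3 * (k24 * k34 + k23 * k34 + k23 * k24)"
  shows "t1 * t2 * (k13 * k14 * k23 * k24 * k34) \<le> 9 * ((k13 + k14) * (k23 * k24 + k23 * k34 + k24 * k34) + k13 * k14 * k23 * k24)"
proof -
  have "t1 * t2 * (k13 * k14 * k23 * k24 * k34) = (t1 * (k13 * k14 * k34)) * (t2 * (k23 * k24))" by (simp add: mult_ac)
  also have "\<dots> \<le> (3 * (k14 * k34 + k13 * k34 + k13 * k14)) * (t2 * (k23 * k24))"
    using nn by (intro mult_right_mono t1) auto
  also have "\<dots> = 3 * ((k13 + k14) * (t2 * (k23 * k24 * k34)) + t2 * (k13 * k14 * k23 * k24))" by (simp add: algebra_simps)
  also have "\<dots> \<le> 3 * ((k13 + k14) * (3 * (k24 * k34 + k23 * k34 + k23 * k24)) + 1 * (k13 * k14 * k23 * k24))"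
    using nn t2 by (intro mult_left_mono add_mono mult_right_mono) auto
  also have "\<dots> \<le> 9 * ((k13 + k14) * (k23 * k24 + k23 * k34 + k24 * k34) + k13 * k14 * k23 * k24)"
    using nn by (simp add: algebra_simps)
  finally show ?thesis .
qed

text \<open>With vertices 1, 2, 3, 4 and the edge 12 missing: six spanning trees of the remaining
  graph and its 4-cycle.\<close>

definition trees_cycle :: "real \<Rightarrow> real fun4" where
  "trees_cycle k13 k14 k23 k24 k34 = (k13 + k14) * (k23 * k24 + k23 * k34 + k24 * k34) + k13 * k14 * k23 * k24"

text \<open>The factor for the triangle 123 removes one of its edges. Each of the three outcomes is
  a complete graph without one edge, consisting of two triangles that share an edge, to which
  \<open>two_triangles_le\<close> applies; the fourth triple factor is simply bounded by 1.\<close>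

lemma complete_graph_le:
  fixes k12 k13 k14 k23 k24 k34 t123 t124 t134 t234 :: real
  assumes nn: "0 \<le> k12" "0 \<le> k13" "0 \<le> k14" "0 \<le> k23" "0 \<le> k24" "0 \<le> k34"
    and t01: "0 \<le> t123" "t123 \<le> 1" "0 \<le> t124" "t124 \<le> 1" "0 \<le> t134" "t134 \<le> 1" "0 \<le> t234" "t234 \<le> 1"
    and t123: "t123 * (k12 * k13 * k23) \<le> 3 * (k13 * k23 + k12 * k23 + k12 * k13)"
    and t124: "t124 * (k12 * k14 * k24) \<le> 3 * (k14 * k24 + k12 * k24 + k12 * k14)"
    and t134: "t134 * (k13 * k14 * k34) \<le> 3 * (k14 * k34 + k13 * k34 + k13 * k14)"
    and t234: "t234 * (k23 * k24 * k34) \<le> 3 * (k24 * k34 + k23 * k34 + k23 * k24)"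
  shows "t123 * t124 * t134 * t234 * (k12 * k13 * k14 * k23 * k24 * k34) \<le>
     27 * (trees_cycle k13 k14 k23 k24 k34 + trees_cycle k12 k14 k23 k34 k24 + trees_cycle k12 k24 k13 k34 k14)"
proof -
  have "t134 * t234 * (k13 * k14 * k23 * k24 * k34) \<le> 9 * trees_cycle k13 k14 k23 k24 k34"
    unfolding trees_cycle_def by (rule two_triangles_le) (use nn t01 t134 t234 in auto)
  from mult_mono[OF t01(4) this] have A: "t124 * (t134 * t234 * (k13 * k14 * k23 * k24 * k34)) \<le> 1 * (9 * trees_cycle k13 k14 k23 k24 k34)"
    using t01 nn by simp
  have "t124 * t234 * (k12 * k14 * k23 * k34 * k24) \<le> 9 * trees_cycle k12 k14 k23 k34 k24"
    unfolding trees_cycle_def by (rule two_triangles_le) (use nn t01 t124 t234 in \<open>auto simp: algebra_simps\<close>)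
  from mult_mono[OF t01(6) this] have B: "t134 * (t124 * t234 * (k12 * k14 * k23 * k34 * k24)) \<le> 1 * (9 * trees_cycle k12 k14 k23 k34 k24)"
    using t01 nn by simp
  have "t124 * t134 * (k12 * k24 * k13 * k34 * k14) \<le> 9 * trees_cycle k12 k24 k13 k34 k14"
    unfolding trees_cycle_def by (rule two_triangles_le) (use nn t01 t124 t134 in \<open>auto simp: algebra_simps\<close>)
  from mult_mono[OF t01(8) this] have D: "t234 * (t124 * t134 * (k12 * k24 * k13 * k34 * k14)) \<le> 1 * (9 * trees_cycle k12 k24 k13 k34 k14)"
    using t01 nn by simp
  have "t123 * t124 * t134 * t234 * (k12 * k13 * k14 * k23 * k24 * k34) = (t123 * (k12 * k13 * k23)) * (t124 * t134 * t234 * (k14 * k24 * k34))"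
    by (simp add: mult_ac)
  also have "\<dots> \<le> (3 * (k13 * k23 + k12 * k23 + k12 * k13)) * (t124 * t134 * t234 * (k14 * k24 * k34))"
    using nn t01 by (intro mult_right_mono t123) auto
  also have "\<dots> = 3 * (t124 * (t134 * t234 * (k13 * k14 * k23 * k24 * k34)) + t134 * (t124 * t234 * (k12 * k14 * k23 * k34 * k24))
     + t234 * (t124 * t134 * (k12 * k24 * k13 * k34 * k14)))"
    by (simp add: algebra_simps)
  also have "\<dots> \<le> 3 * (1 * (9 * trees_cycle k13 k14 k23 k24 k34) + 1 * (9 * trees_cycle k12 k14 k23 k34 k24) + 1 * (9 * trees_cycle k12 k24 k13 k34 k14))"
    using A B D by (intro mult_left_mono add_mono) auto
  finally show ?thesis by (simp add: algebra_simps)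
qed

text \<open>For x, y, z the three pair sums of a triple with sum s, the identity 2 s = x + y + z
  bounds |s| by 3/2 of the longest side. The zero at s therefore cancels the factor of that side,
  and the other two factors remain.\<close>

lemma triangle_le:
  fixes x y z s :: complex
  assumes s: "2 * s = x + y + z" and nz: "x \<noteq> 0" "y \<noteq> 0" "z \<noteq> 0"
  defines "k \<equiv> (\<lambda>w. 1 + 1 / norm w)"
  shows "min 1 (norm s) * (k x * k y * k z) \<le> 3 * (k y * k z + k x * k z + k x * k y)"
proof -
  have k: "k w \<ge> 0" for w by (simp add: k_def)
  have max: "min 1 (norm s) * k a \<le> 3" if m: "norm x \<le> norm a" "norm y \<le> norm a" "norm z \<le> norm a" for a
  proof -
    have a: "norm a > 0" using m nz by (metis less_le_trans zero_less_norm_iff)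
    have "2 * norm s = norm (x + y + z)" using s by (metis norm_mult norm_numeral)
    also have "\<dots> \<le> norm x + norm y + norm z" by (meson add_right_mono norm_triangle_ineq order_trans)
    finally have "norm s \<le> 3/2 * norm a" using m by linarith
    then have "min 1 (norm s) * (1 / norm a) \<le> (3/2 * norm a) * (1 / norm a)" using a by (intro mult_right_mono) auto
    then have "min 1 (norm s) * (1 / norm a) \<le> 3/2" using a by simp
    moreover have "min 1 (norm s) * k a = min 1 (norm s) + min 1 (norm s) * (1 / norm a)" by (simp add: k_def distrib_left)
    moreover have "min 1 (norm s) \<le> 1" by simp
    ultimately show ?thesis by linarith
  qed
  consider "norm y \<le> norm x" "norm z \<le> norm x" | "norm x \<le> norm y" "norm z \<le> norm y" | "norm x \<le> norm z" "norm y \<le> norm z" by linarith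
  then show ?thesis
  proof cases
    case 1
    then have "min 1 (norm s) * k x * (k y * k z) \<le> 3 * (k y * k z)" using max[of x] k by (intro mult_right_mono) auto
    moreover have "0 \<le> k x * k z" "0 \<le> k x * k y" using k by auto
    ultimately show ?thesis by (simp add: mult_ac)
  next
    case 2
    then have "min 1 (norm s) * k y * (k x * k z) \<le> 3 * (k x * k z)" using max[of y] k by (intro mult_right_mono) auto
    moreover have "0 \<le> k y * k z" "0 \<le> k x * k y" using k by auto
    ultimately show ?thesis by (simp add: mult_ac)
  next
    case 3
    then have "min 1 (norm s) * k z * (k x * k y) \<le> 3 * (k x * k y)" using max[of z] k by (intro mult_right_mono) auto
    moreover have "0 \<le> k y * k z" "0 \<le> k x * k z" using k by auto
    ultimately show ?thesis by (simp add: mult_ac)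
  qed
qed

section \<open>Fourfold integrals of spanning trees\<close>

definition N4 :: "ennreal fun4 \<Rightarrow> ennreal" where
  "N4 F = (\<integral>\<^sup>+a. \<integral>\<^sup>+b. \<integral>\<^sup>+c. \<integral>\<^sup>+e. F a b c e \<partial>lborel \<partial>lborel \<partial>lborel \<partial>lborel)"

abbreviation uncurry4 :: "'b fun4 \<Rightarrow> real4 \<Rightarrow> 'b" where
  "uncurry4 F z \<equiv> F (fst z) (fst (snd z)) (fst (snd (snd z))) (snd (snd (snd z)))"

lemma nn_integral_eq_N4:
  assumes [measurable]: "uncurry4 F \<in> borel_measurable borel"
  shows "(\<integral>\<^sup>+z. uncurry4 F z \<partial>lborel) = N4 F"
proof -
  have m: "uncurry4 F \<in> borel_measurable (lborel \<Otimes>\<^sub>M lborel)" using assms by (simp add: lborel_prod)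
  have e0: "(\<integral>\<^sup>+z. uncurry4 F z \<partial>lborel) = (\<integral>\<^sup>+a. \<integral>\<^sup>+z. F a (fst z) (fst (snd z)) (snd (snd z)) \<partial>lborel \<partial>lborel)"
    using lborel.nn_integral_fst[OF m] by (simp add: lborel_prod)
  have e1: "(\<integral>\<^sup>+z. F a (fst z) (fst (snd z)) (snd (snd z)) \<partial>lborel) = (\<integral>\<^sup>+b. \<integral>\<^sup>+z. F a b (fst z) (snd z) \<partial>lborel \<partial>lborel)" for a
  proof -
    have "(\<lambda>z. uncurry4 F (a, z)) \<in> borel_measurable borel"
      by (rule measurable_compose[OF _ assms]) (intro borel_measurable_continuous_onI continuous_intros)
    then have "(\<lambda>z. F a (fst z) (fst (snd z)) (snd (snd z))) \<in> borel_measurable (lborel \<Otimes>\<^sub>M lborel)"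
      by (simp add: lborel_prod)
    from lborel.nn_integral_fst[OF this] show ?thesis by (simp add: lborel_prod)
  qed
  have e2: "(\<integral>\<^sup>+z. F a b (fst z) (snd z) \<partial>lborel) = (\<integral>\<^sup>+c. \<integral>\<^sup>+e. F a b c e \<partial>lborel \<partial>lborel)" for a b
  proof -
    have "(\<lambda>z. uncurry4 F (a, b, z)) \<in> borel_measurable borel"
      by (rule measurable_compose[OF _ assms]) (intro borel_measurable_continuous_onI continuous_intros)
    then have "(\<lambda>z. F a b (fst z) (snd z)) \<in> borel_measurable (lborel \<Otimes>\<^sub>M lborel)"
      by (simp add: lborel_prod)
    from lborel.nn_integral_fst[OF this] show ?thesis by (simp add: lborel_prod)
  qed
  show ?thesis by (simp only: e0 e1 e2 N4_def)
qed

text \<open>Together with \<open>N4_swap_23\<close> this generates all permutations of the last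
  three variables. The first variable stays fixed because it carries an additional factor in the
  tree integrals.\<close>

lemma N4_swap_34:
  assumes "uncurry4 F \<in> borel_measurable borel"
  shows "N4 F = N4 (\<lambda>a b c e. F a b e c)"
proof -
  have "(\<integral>\<^sup>+c. \<integral>\<^sup>+e. F a b c e \<partial>lborel \<partial>lborel) = (\<integral>\<^sup>+c. \<integral>\<^sup>+e. F a b e c \<partial>lborel \<partial>lborel)" for a b
  proof -
    have "(\<lambda>z. uncurry4 F (a, b, z)) \<in> borel_measurable borel"
      by (rule measurable_compose[OF _ assms]) (intro borel_measurable_continuous_onI continuous_intros)
    then have "(\<lambda>(c, e). F a b c e) \<in> borel_measurable (lborel \<Otimes>\<^sub>M lborel)"
      by (simp add: lborel_prod case_prod_unfold)
    from lborel_pair.Fubini'[OF this] show ?thesis by simp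
  qed
  then show ?thesis by (simp add: N4_def)
qed

lemma N4_swap_23:
  assumes "uncurry4 F \<in> borel_measurable borel"
  shows "N4 F = N4 (\<lambda>a b c e. F a c b e)"
proof -
  have "(\<integral>\<^sup>+b. \<integral>\<^sup>+c. (\<integral>\<^sup>+e. F a b c e \<partial>lborel) \<partial>lborel \<partial>lborel) = (\<integral>\<^sup>+b. \<integral>\<^sup>+c. (\<integral>\<^sup>+e. F a c b e \<partial>lborel) \<partial>lborel \<partial>lborel)" for a
  proof -
    have "(\<lambda>w. uncurry4 F (a, fst (fst w), snd (fst w), snd w)) \<in> borel_measurable borel"
      by (rule measurable_compose[OF _ assms]) (intro borel_measurable_continuous_onI continuous_intros)
    then have "(\<lambda>w. F a (fst (fst w)) (snd (fst w)) (snd w)) \<in> borel_measurable ((lborel :: (real \<times> real) measure) \<Otimes>\<^sub>M lborel)"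
      by (simp add: lborel_prod)
    from lborel.borel_measurable_nn_integral_fst[OF this]
    have "(\<lambda>(b, c). \<integral>\<^sup>+e. F a b c e \<partial>lborel) \<in> borel_measurable (lborel \<Otimes>\<^sub>M lborel)"
      by (simp add: lborel_prod case_prod_unfold)
    from lborel_pair.Fubini'[OF this] show ?thesis by simp
  qed
  then show ?thesis by (simp add: N4_def)
qed

text \<open>The extra factor \<open>kk u a\<close> pays for breaking a 4-cycle: outside the main
  region some edge of the cycle is at most 11 * \<open>kk u a\<close>.\<close>

definition tree_fun :: "real \<Rightarrow> real fun4 \<Rightarrow> ennreal fun4" where
  "tree_fun u T a b c e = ennreal (om a * om b * om c * om e * (kk u a * T a b c e))"

text \<open>A tree is integrated leaf by leaf. Whatever vertex the last variable is attached to, its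
  integral is at most \<open>kappa u\<close>, uniformly in the shift. The functions P, Q, R say
  where the new vertices are attached, and the factor \<open>kk u a\<close> is itself handled by the
  shift 0.\<close>

lemma tree_std:
  assumes u: "u \<ge> 1"
  shows "N4 (tree_fun u (\<lambda>a b c e. kk u (P a + b) * kk u (Q a b + c) * kk u (R a b c + e))) \<le> ennreal (kappa u ^ 4)"
proof -
  note k = nn_integral_kk_om[OF u]
  have nn: "om t * kk u x \<ge> 0" for t x using om_pos[of t] kk_ge_1[of u x] by (intro mult_nonneg_nonneg) auto
  define A where "A = (\<lambda>a. ennreal (om a * kk u a))"
  define B where "B = (\<lambda>a b. ennreal (om b * kk u (P a + b)))"
  define D where "D = (\<lambda>a b c. ennreal (om c * kk u (Q a b + c)))"
  define E where "E = (\<lambda>a b c e. ennreal (om e * kk u (R a b c + e)))"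
  define K where "K = ennreal (kappa u)"
  have [measurable]: "A \<in> borel_measurable borel" "B a \<in> borel_measurable borel" "D a b \<in> borel_measurable borel" "E a b c \<in> borel_measurable borel" for a b c
    unfolding A_def B_def D_def E_def by measurable
  have le: "(\<integral>\<^sup>+a. A a \<partial>lborel) \<le> K" "(\<integral>\<^sup>+b. B a b \<partial>lborel) \<le> K" "(\<integral>\<^sup>+c. D a b c \<partial>lborel) \<le> K" "(\<integral>\<^sup>+e. E a b c e \<partial>lborel) \<le> K" for a b c
    unfolding A_def B_def D_def E_def K_def using k[of 0] k by simp_all
  have eq: "tree_fun u (\<lambda>a b c e. kk u (P a + b) * kk u (Q a b + c) * kk u (R a b c + e)) a b c e = A a * B a b * D a b c * E a b c e" for a b c e
    unfolding A_def B_def D_def E_def by (simp add: tree_fun_def ennreal_mult'[symmetric] nn mult_ac)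
  have "N4 (tree_fun u (\<lambda>a b c e. kk u (P a + b) * kk u (Q a b + c) * kk u (R a b c + e))) =
    (\<integral>\<^sup>+a. \<integral>\<^sup>+b. \<integral>\<^sup>+c. A a * B a b * D a b c * (\<integral>\<^sup>+e. E a b c e \<partial>lborel) \<partial>lborel \<partial>lborel \<partial>lborel)"
    unfolding N4_def eq by (simp add: nn_integral_cmult)
  also have "\<dots> \<le> (\<integral>\<^sup>+a. \<integral>\<^sup>+b. \<integral>\<^sup>+c. A a * B a b * D a b c * K \<partial>lborel \<partial>lborel \<partial>lborel)"
    by (intro nn_integral_mono mult_left_mono le) auto
  also have "\<dots> = (\<integral>\<^sup>+a. \<integral>\<^sup>+b. A a * B a b * (\<integral>\<^sup>+c. D a b c \<partial>lborel) * K \<partial>lborel \<partial>lborel)"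
    by (simp add: nn_integral_cmult nn_integral_multc)
  also have "\<dots> \<le> (\<integral>\<^sup>+a. \<integral>\<^sup>+b. A a * B a b * K * K \<partial>lborel \<partial>lborel)"
    by (intro nn_integral_mono mult_left_mono mult_right_mono le) auto
  also have "\<dots> = (\<integral>\<^sup>+a. A a * (\<integral>\<^sup>+b. B a b \<partial>lborel) * K * K \<partial>lborel)"
    by (simp add: nn_integral_cmult nn_integral_multc)
  also have "\<dots> \<le> (\<integral>\<^sup>+a. A a * K * K * K \<partial>lborel)"
    by (intro nn_integral_mono mult_left_mono mult_right_mono le) auto
  also have "\<dots> = (\<integral>\<^sup>+a. A a \<partial>lborel) * K * K * K" by (simp add: nn_integral_multc)
  also have "\<dots> \<le> K * K * K * K" by (intro mult_right_mono le) auto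
  also have "\<dots> = ennreal (kappa u ^ 4)"
    unfolding K_def using kappa_ge_0[OF u] by (simp add: ennreal_mult'[symmetric] power4_eq_xxxx)
  finally show ?thesis .
qed


definition tree_mass :: "real \<Rightarrow> real \<Rightarrow> real fun4 \<Rightarrow> bool" where
  "tree_mass u m T \<longleftrightarrow> uncurry4 T \<in> borel_measurable borel \<and> (\<forall>a b c e. T a b c e \<ge> 0) \<and> N4 (tree_fun u T) \<le> ennreal (m * kappa u ^ 4)"

lemma projections_measurable:
  "(fst :: real4 \<Rightarrow> _) \<in> borel_measurable borel" "(\<lambda>z::real4. fst (snd z)) \<in> borel_measurable borel"
  "(\<lambda>z::real4. fst (snd (snd z))) \<in> borel_measurable borel" "(\<lambda>z::real4. snd (snd (snd z))) \<in> borel_measurable borel"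
  by (intro borel_measurable_continuous_onI continuous_intros)+

lemma tree_fun_measurable:
  assumes [measurable]: "uncurry4 T \<in> borel_measurable borel"
  shows "uncurry4 (tree_fun u T) \<in> borel_measurable borel"
proof -
  note [measurable] = projections_measurable
  show ?thesis unfolding tree_fun_def by measurable
qed

lemma tree_mass_swap:
  assumes "tree_mass u m T"
  shows "tree_mass u m (\<lambda>a b c e. T a c b e)" and "tree_mass u m (\<lambda>a b c e. T a b e c)"
proof -
  have T: "uncurry4 T \<in> borel_measurable borel" "\<And>a b c e. T a b c e \<ge> 0" "N4 (tree_fun u T) \<le> ennreal (m * kappa u ^ 4)"
    using assms by (auto simp: tree_mass_def)
  have "(\<lambda>z::real4. uncurry4 T (fst z, fst (snd (snd z)), fst (snd z), snd (snd (snd z)))) \<in> borel_measurable borel"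
    by (rule measurable_compose[OF _ T(1)]) (intro borel_measurable_continuous_onI continuous_intros)
  moreover have "tree_fun u (\<lambda>a b c e. T a c b e) = (\<lambda>a b c e. tree_fun u T a c b e)"
    by (simp add: tree_fun_def mult_ac fun_eq_iff)
  ultimately show "tree_mass u m (\<lambda>a b c e. T a c b e)"
    using T N4_swap_23[OF tree_fun_measurable[OF T(1)], of u] by (simp add: tree_mass_def)
  have "(\<lambda>z::real4. uncurry4 T (fst z, fst (snd z), snd (snd (snd z)), fst (snd (snd z)))) \<in> borel_measurable borel"
    by (rule measurable_compose[OF _ T(1)]) (intro borel_measurable_continuous_onI continuous_intros)
  moreover have "tree_fun u (\<lambda>a b c e. T a b e c) = (\<lambda>a b c e. tree_fun u T a b e c)"
    by (simp add: tree_fun_def mult_ac fun_eq_iff)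
  ultimately show "tree_mass u m (\<lambda>a b c e. T a b e c)"
    using T N4_swap_34[OF tree_fun_measurable[OF T(1)], of u] by (simp add: tree_mass_def)
qed

lemma N4_add:
  assumes F: "uncurry4 F \<in> borel_measurable borel" and G: "uncurry4 G \<in> borel_measurable borel"
  shows "N4 (\<lambda>a b c e. F a b c e + G a b c e) = N4 F + N4 G"
proof -
  have "(\<lambda>z. uncurry4 F z + uncurry4 G z) \<in> borel_measurable borel" using F G by measurable
  then have "N4 (\<lambda>a b c e. F a b c e + G a b c e) = (\<integral>\<^sup>+z. uncurry4 F z + uncurry4 G z \<partial>lborel)"
    using nn_integral_eq_N4[of "\<lambda>a b c e. F a b c e + G a b c e"] by simp
  also have "\<dots> = N4 F + N4 G" using F G by (subst nn_integral_add) (auto simp: nn_integral_eq_N4)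
  finally show ?thesis .
qed

lemma tree_mass_add:
  assumes S: "tree_mass u m S" and T: "tree_mass u n T" and mn: "m \<ge> 0" "n \<ge> 0"
  shows "tree_mass u (m + n) (\<lambda>a b c e. S a b c e + T a b c e)"
proof -
  have nn: "om t \<ge> 0" "kk u t \<ge> 0" for t using om_pos[of t] kk_ge_1[of u t] by simp_all
  have ST: "uncurry4 S \<in> borel_measurable borel" "uncurry4 T \<in> borel_measurable borel" "\<And>a b c e. S a b c e \<ge> 0" "\<And>a b c e. T a b c e \<ge> 0"
    using S T by (auto simp: tree_mass_def)
  have "tree_fun u (\<lambda>a b c e. S a b c e + T a b c e) = (\<lambda>a b c e. tree_fun u S a b c e + tree_fun u T a b c e)"
    unfolding tree_fun_def distrib_left using nn ST by (intro ext ennreal_plus mult_nonneg_nonneg) auto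
  then have "N4 (tree_fun u (\<lambda>a b c e. S a b c e + T a b c e)) = N4 (tree_fun u S) + N4 (tree_fun u T)"
    using ST by (simp add: N4_add tree_fun_measurable)
  also have "\<dots> \<le> ennreal (m * kappa u ^ 4) + ennreal (n * kappa u ^ 4)"
    using S T by (intro add_mono) (auto simp: tree_mass_def)
  also have "\<dots> = ennreal ((m + n) * kappa u ^ 4)" using mn by (simp add: distrib_right flip: ennreal_plus)
  finally show ?thesis using ST by (auto simp: tree_mass_def intro: borel_measurable_add)
qed

lemma tree_mass_cmult:
  assumes T: "tree_mass u m T" and k: "k \<ge> 0"
  shows "tree_mass u (k * m) (\<lambda>a b c e. k * T a b c e)"
proof -
  have m: "uncurry4 T \<in> borel_measurable borel" using T by (simp add: tree_mass_def)
  have "tree_fun u (\<lambda>a b c e. k * T a b c e) = (\<lambda>a b c e. ennreal k * tree_fun u T a b c e)"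
    using k by (simp add: tree_fun_def fun_eq_iff ennreal_mult'[symmetric] mult_ac)
  then have "N4 (tree_fun u (\<lambda>a b c e. k * T a b c e)) = (\<integral>\<^sup>+z. ennreal k * uncurry4 (tree_fun u T) z \<partial>lborel)"
    using nn_integral_eq_N4[of "\<lambda>a b c e. ennreal k * tree_fun u T a b c e"] tree_fun_measurable[OF m, of u] by simp
  also have "\<dots> = ennreal k * N4 (tree_fun u T)"
    using tree_fun_measurable[OF m, of u] by (simp add: nn_integral_cmult nn_integral_eq_N4)
  also have "\<dots> \<le> ennreal k * ennreal (m * kappa u ^ 4)" using T by (intro mult_left_mono) (auto simp: tree_mass_def)
  also have "\<dots> = ennreal (k * m * kappa u ^ 4)" using k by (simp add: ennreal_mult'[symmetric] mult.assoc)
  finally show ?thesis using T k by (auto simp: tree_mass_def)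
qed

text \<open>Q and R name the parent of the third and of the fourth vertex among the earlier
  ones.\<close>

lemma tree_mass_std:
  assumes u: "u \<ge> 1"
    and QR: "Q = (\<lambda>a b. a) \<or> Q = (\<lambda>a b. b)" "R = (\<lambda>a b c. a) \<or> R = (\<lambda>a b c. b) \<or> R = (\<lambda>a b c. c)"
  shows "tree_mass u 1 (\<lambda>a b c e. kk u (a + b) * kk u (Q a b + c) * kk u (R a b c + e))"
proof -
  note [measurable] = projections_measurable
  have "uncurry4 (\<lambda>a b c e. kk u (a + b) * kk u (Q a b + c) * kk u (R a b c + e)) \<in> borel_measurable borel"
    using QR by (elim disjE; simp; measurable)
  moreover have "kk u t \<ge> 0" for t using kk_ge_1[of u t] by simp
  ultimately show ?thesis
    using tree_std[OF u, of "\<lambda>a. a" Q R] by (auto simp: tree_mass_def)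
qed

abbreviation paths :: "real fun4" where
  "paths w x y z \<equiv> x * y * z + w * y * z + w * x * z + w * x * y"

text \<open>The 4-cycle of \<open>trees_cycle\<close> is replaced by the four paths left after
  deleting one of its edges; 11 is the constant of \<open>kk_far\<close>.\<close>

definition tree_sum :: "real \<Rightarrow> real fun4" where
  "tree_sum k13 k14 k23 k24 k34 = (k13 + k14) * (k23 * k24 + k23 * k34 + k24 * k34) + 11 * paths k13 k14 k23 k24"

lemma trees_cycle_le_tree_sum:
  assumes k: "1 \<le> k" "0 \<le> k13" "0 \<le> k14" "0 \<le> k23" "0 \<le> k24" "0 \<le> k34"
    and le: "k13 \<le> 11 * k \<or> k14 \<le> 11 * k \<or> k23 \<le> 11 * k \<or> k24 \<le> 11 * k"
  shows "trees_cycle k13 k14 k23 k24 k34 \<le> k * tree_sum k13 k14 k23 k24 k34"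
proof -
  have nn: "0 \<le> k14 * k23 * k24" "0 \<le> k13 * k23 * k24" "0 \<le> k13 * k14 * k24" "0 \<le> k13 * k14 * k23" using k by auto
  have p: "11 * k * paths k13 k14 k23 k24 = 11 * k * (k14 * k23 * k24) + 11 * k * (k13 * k23 * k24) + 11 * k * (k13 * k14 * k24) + 11 * k * (k13 * k14 * k23)"
    by (simp only: distrib_left)
  have n2: "0 \<le> 11 * k * (k14 * k23 * k24)" "0 \<le> 11 * k * (k13 * k23 * k24)" "0 \<le> 11 * k * (k13 * k14 * k24)" "0 \<le> 11 * k * (k13 * k14 * k23)"
    using k nn by (auto intro: mult_nonneg_nonneg)
  have c: "k13 * k14 * k23 * k24 \<le> 11 * k * paths k13 k14 k23 k24"
    using le
  proof (elim disjE)
    assume "k13 \<le> 11 * k" from mult_right_mono[OF this nn(1)] show ?thesis using n2 unfolding p by (simp add: mult_ac)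
  next
    assume "k14 \<le> 11 * k" from mult_right_mono[OF this nn(2)] show ?thesis using n2 unfolding p by (simp add: mult_ac)
  next
    assume "k23 \<le> 11 * k" from mult_right_mono[OF this nn(3)] show ?thesis using n2 unfolding p by (simp add: mult_ac)
  next
    assume "k24 \<le> 11 * k" from mult_right_mono[OF this nn(4)] show ?thesis using n2 unfolding p by (simp add: mult_ac)
  qed
  have t: "0 \<le> (k13 + k14) * (k23 * k24 + k23 * k34 + k24 * k34)" using k by auto
  have "trees_cycle k13 k14 k23 k24 k34 \<le> k * ((k13 + k14) * (k23 * k24 + k23 * k34 + k24 * k34)) + 11 * k * paths k13 k14 k23 k24"
    unfolding trees_cycle_def by (intro add_mono c) (use mult_right_mono[OF k(1) t] in simp)
  then show ?thesis by (simp only: tree_sum_def distrib_left mult_ac)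
qed

abbreviation (input) pairs6 :: "real \<Rightarrow> real fun4" where
  "pairs6 u a b c e \<equiv> kk u (a+b) * kk u (a+c) * kk u (a+e) * kk u (b+c) * kk u (b+e) * kk u (c+e)"

definition T_all :: "real \<Rightarrow> real fun4" where
  "T_all u a b c e = tree_sum (kk u (a+c)) (kk u (a+e)) (kk u (b+c)) (kk u (b+e)) (kk u (c+e))
     + tree_sum (kk u (a+b)) (kk u (a+e)) (kk u (b+c)) (kk u (c+e)) (kk u (b+e))
     + tree_sum (kk u (a+b)) (kk u (b+e)) (kk u (a+c)) (kk u (c+e)) (kk u (a+e))"

text \<open>The eight hypotheses are the eight spanning trees of the complete graph on four vertices
  without one edge: two of the four paths already occur among the six trees. The total is 50 = 6 +
  11 * 4.\<close>

lemma tree_mass_tree_sum: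
  assumes "tree_mass u 1 (\<lambda>a b c e. A a b c e * C a b c e * D a b c e)"
    "tree_mass u 1 (\<lambda>a b c e. A a b c e * C a b c e * E a b c e)"
    "tree_mass u 1 (\<lambda>a b c e. A a b c e * D a b c e * E a b c e)"
    "tree_mass u 1 (\<lambda>a b c e. B a b c e * C a b c e * D a b c e)"
    "tree_mass u 1 (\<lambda>a b c e. B a b c e * C a b c e * E a b c e)"
    "tree_mass u 1 (\<lambda>a b c e. B a b c e * D a b c e * E a b c e)"
    "tree_mass u 1 (\<lambda>a b c e. A a b c e * B a b c e * D a b c e)"
    "tree_mass u 1 (\<lambda>a b c e. A a b c e * B a b c e * C a b c e)"
  shows "tree_mass u 50 (\<lambda>a b c e. tree_sum (A a b c e) (B a b c e) (C a b c e) (D a b c e) (E a b c e))"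
proof -
  have 1: "tree_mass u (1+1+(1+1)+(1+1)) (\<lambda>a b c e. A a b c e * C a b c e * D a b c e + A a b c e * C a b c e * E a b c e
     + (A a b c e * D a b c e * E a b c e + B a b c e * C a b c e * D a b c e)
     + (B a b c e * C a b c e * E a b c e + B a b c e * D a b c e * E a b c e))"
    using assms by (intro tree_mass_add) simp_all
  have 2: "tree_mass u (11 * (1+1+(1+1))) (\<lambda>a b c e. 11 * (B a b c e * C a b c e * D a b c e + A a b c e * C a b c e * D a b c e
     + (A a b c e * B a b c e * D a b c e + A a b c e * B a b c e * C a b c e)))"
    using assms by (intro tree_mass_cmult tree_mass_add) simp_all
  from tree_mass_add[OF 1 2] show ?thesis by (simp add: tree_sum_def algebra_simps)
qed

text \<open>Only b, c and e may be permuted. Up to such permutations a spanning tree on four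
  vertices is one of four kinds, a star or a path with a at an outer or an inner vertex; these are
  \<open>P\<close>, \<open>T2\<close>, \<open>T3\<close> and \<open>S\<close>.\<close>

lemma tree_mass_T_all:
  assumes u: "u \<ge> 1"
  shows "tree_mass u 150 (T_all u)"
proof -
  define k where "k = kk u"
  have P: "tree_mass u 1 (\<lambda>a b c e. k (a + b) * k (b + c) * k (c + e))"
    and T2: "tree_mass u 1 (\<lambda>a b c e. k (a + b) * k (b + c) * k (b + e))"
    and T3: "tree_mass u 1 (\<lambda>a b c e. k (a + b) * k (a + c) * k (c + e))"
    and S: "tree_mass u 1 (\<lambda>a b c e. k (a + b) * k (a + c) * k (a + e))"
    unfolding k_def by (rule tree_mass_std[OF u]; simp)+
  note acbe = tree_mass_swap(1) and abec = tree_mass_swap(2)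
  note aebc = abec[OF acbe] and aceb = acbe[OF abec]
  note aecb = acbe[OF aebc]
  have 1: "tree_mass u 50 (\<lambda>a b c e. tree_sum (k (a+c)) (k (a+e)) (k (b+c)) (k (b+e)) (k (c+e)))"
    by (rule tree_mass_tree_sum) (use acbe[OF P] acbe[OF T2] aceb[OF P] aebc[OF P] aecb[OF P] aebc[OF T2] aceb[OF T3] aecb[OF T3] in \<open>simp_all add: mult_ac add.commute\<close>)
  have 2: "tree_mass u 50 (\<lambda>a b c e. tree_sum (k (a+b)) (k (a+e)) (k (b+c)) (k (c+e)) (k (b+e)))"
    using acbe[OF 1] by (simp add: add.commute)
  have 3: "tree_mass u 50 (\<lambda>a b c e. tree_sum (k (a+b)) (k (b+e)) (k (a+c)) (k (c+e)) (k (a+e)))"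
    by (rule tree_mass_tree_sum) (use T3 S abec[OF T3] aceb[OF P] aceb[OF T3] aebc[OF T2] abec[OF P] acbe[OF T3] in \<open>simp_all add: mult_ac add.commute\<close>)
  have "tree_mass u (50 + 50 + 50) (\<lambda>a b c e. tree_sum (k (a+c)) (k (a+e)) (k (b+c)) (k (b+e)) (k (c+e))
     + tree_sum (k (a+b)) (k (a+e)) (k (b+c)) (k (c+e)) (k (b+e)) + tree_sum (k (a+b)) (k (b+e)) (k (a+c)) (k (c+e)) (k (a+e)))"
    by (intro tree_mass_add 1 2 3) simp_all
  moreover have "T_all u = (\<lambda>a b c e. tree_sum (k (a+c)) (k (a+e)) (k (b+c)) (k (b+e)) (k (c+e))
     + tree_sum (k (a+b)) (k (a+e)) (k (b+c)) (k (c+e)) (k (b+e)) + tree_sum (k (a+b)) (k (b+e)) (k (a+c)) (k (c+e)) (k (a+e)))"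
    by (simp add: T_all_def k_def fun_eq_iff)
  ultimately show ?thesis by simp
qed

text \<open>The region that carries the main term, with \<open>e\<close> as the partner of \<open>a\<close>; the other two pairings are
  \<open>near a c e b\<close> and \<open>near a b e c\<close>.\<close>

definition near :: "bool fun4" where
  "near a b c e \<longleftrightarrow> \<bar>a + b\<bar> < min 1 \<bar>a\<bar> / 10 \<and> \<bar>a + c\<bar> < min 1 \<bar>a\<bar> / 10 \<and> \<bar>b + e\<bar> < min 1 \<bar>a\<bar> / 10 \<and> \<bar>c + e\<bar> < min 1 \<bar>a\<bar> / 10"

text \<open>\<open>near a b c e\<close> puts b and c close to -a and e close to a, and its strict
  inequalities exclude a = 0. Two pairings at once would put some variable close to both a and
  -a.\<close>

lemma near_disjoint: "\<not> (near a b c e \<and> near a c e b)" "\<not> (near a b c e \<and> near a b e c)" "\<not> (near a c e b \<and> near a b e c)"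
  unfolding near_def by (auto simp: abs_if min_def split: if_splits)

text \<open>A pair sum that is not small compared with min 1 |a| has a pole at most ten times as
  strong as one at a, and the constant summand 1 accounts for the eleventh.\<close>

lemma kk_far:
  assumes u: "u \<ge> 1" and t: "\<not> \<bar>t\<bar> < min 1 \<bar>a\<bar> / 10"
  shows "kk u t \<le> 11 * kk u a"
proof (cases "\<bar>a\<bar> \<ge> 1")
  case True
  have "norm (Complex (2/u) t) \<ge> 1/10" using abs_Im_le_cmod[of "Complex (2/u) t"] t True by simp
  then have "1 / norm (Complex (2/u) t) \<le> 1 / (1/10)" by (intro divide_left_mono) auto
  then have "kk u t \<le> 11" by (simp add: kk_def)
  then show ?thesis using kk_ge_1[of u a] by linarith
next
  case False
  have "norm (Complex (2/u) a / 10) \<le> norm (Complex (2/u) t)"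
  proof -
    have "Complex (2/u) a / 10 = Complex (2/u/10) (a/10)" by (simp add: complex_eq_iff)
    moreover have "norm (Complex (2/u/10) (a/10)) \<le> norm (Complex (2/u) t)"
      unfolding complex_norm
    proof (intro real_sqrt_le_mono add_mono)
      show "(2/u/10)\<^sup>2 \<le> (2/u)\<^sup>2" using u by (intro power_mono) (auto simp: field_simps)
      have "\<bar>a/10\<bar> \<le> \<bar>t\<bar>" using t False by simp
      then show "(a/10)\<^sup>2 \<le> t\<^sup>2" by (simp only: abs_le_square_iff)
    qed
    ultimately show ?thesis by simp
  qed
  moreover have "norm (Complex (2/u) a) > 0" using u by (simp add: complex_eq_iff)
  ultimately have "1 / norm (Complex (2/u) t) \<le> 1 / (norm (Complex (2/u) a) / 10)"
    by (intro divide_left_mono) (auto simp: norm_divide intro!: mult_pos_pos)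
  then have "1 / norm (Complex (2/u) t) \<le> 10 * (1 / norm (Complex (2/u) a))" by simp
  moreover have "1 / norm (Complex (2/u) a) \<ge> 0" by simp
  ultimately show ?thesis unfolding kk_def distrib_left by linarith
qed

text \<open>Each of the three 4-cycles consists of the four pair sums that one of the three pairings
  requires to be small. If the pairing fails, one of these edges is weak, and the cycle breaks into
  a path.\<close>

lemma complete_graph_far:
  fixes a b c e :: real
  assumes u: "u \<ge> 1" and far: "\<not> near a b c e" "\<not> near a c e b" "\<not> near a b e c"
    and t: "t123 = min 1 (norm (Complex (3/u) (a+b+c)))" "t124 = min 1 (norm (Complex (3/u) (a+b+e)))"
      "t134 = min 1 (norm (Complex (3/u) (a+c+e)))" "t234 = min 1 (norm (Complex (3/u) (b+c+e)))"
  shows "t123 * t124 * t134 * t234 * pairs6 u a b c e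
    \<le> 27 * (kk u a * T_all u a b c e)"
proof -
  note k1 = kk_ge_1[of u]
  have k0: "kk u x \<ge> 0" for x using k1[of x] by simp
  have tri: "min 1 (norm (Complex (3/u) (x+y+z))) * (kk u (x+y) * kk u (x+z) * kk u (y+z)) \<le>
     3 * (kk u (x+z) * kk u (y+z) + kk u (x+y) * kk u (y+z) + kk u (x+y) * kk u (x+z))" for x y z
  proof -
    have "2 * Complex (3/u) (x+y+z) = Complex (2/u) (x+y) + Complex (2/u) (x+z) + Complex (2/u) (y+z)"
      by (simp add: complex_eq_iff)
    from triangle_le[OF this] show ?thesis unfolding kk_def using u by (simp add: Complex_nonzero)
  qed
  have "t123 * t124 * t134 * t234 * pairs6 u a b c e
    \<le> 27 * (trees_cycle (kk u (a+c)) (kk u (a+e)) (kk u (b+c)) (kk u (b+e)) (kk u (c+e))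
      + trees_cycle (kk u (a+b)) (kk u (a+e)) (kk u (b+c)) (kk u (c+e)) (kk u (b+e))
      + trees_cycle (kk u (a+b)) (kk u (b+e)) (kk u (a+c)) (kk u (c+e)) (kk u (a+e)))"
    unfolding t by (rule complete_graph_le) (rule k0 tri | simp)+
  also have "\<dots> \<le> 27 * (kk u a * tree_sum (kk u (a+c)) (kk u (a+e)) (kk u (b+c)) (kk u (b+e)) (kk u (c+e))
      + kk u a * tree_sum (kk u (a+b)) (kk u (a+e)) (kk u (b+c)) (kk u (c+e)) (kk u (b+e))
      + kk u a * tree_sum (kk u (a+b)) (kk u (b+e)) (kk u (a+c)) (kk u (c+e)) (kk u (a+e)))"
  proof (intro mult_left_mono add_mono trees_cycle_le_tree_sum k0 k1)
    show "kk u (a+c) \<le> 11 * kk u a \<or> kk u (a+e) \<le> 11 * kk u a \<or> kk u (b+c) \<le> 11 * kk u a \<or> kk u (b+e) \<le> 11 * kk u a"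
      using far(2) kk_far[OF u, of _ a] unfolding near_def by (metis add.commute)
    show "kk u (a+b) \<le> 11 * kk u a \<or> kk u (a+e) \<le> 11 * kk u a \<or> kk u (b+c) \<le> 11 * kk u a \<or> kk u (c+e) \<le> 11 * kk u a"
      using far(3) kk_far[OF u, of _ a] unfolding near_def by (metis add.commute)
    show "kk u (a+b) \<le> 11 * kk u a \<or> kk u (b+e) \<le> 11 * kk u a \<or> kk u (a+c) \<le> 11 * kk u a \<or> kk u (c+e) \<le> 11 * kk u a"
      using far(1) kk_far[OF u, of _ a] unfolding near_def by metis
  qed simp
  also have "\<dots> = 27 * (kk u a * T_all u a b c e)" by (simp only: T_all_def distrib_left)
  finally show ?thesis .
qed

section \<open>The integrand for k = 2\<close>

definition rz :: "complex \<Rightarrow> complex" where "rz s = zeta_reg s / s"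

definition Phi2 :: "real \<Rightarrow> complex fun4" where
  "Phi2 u a b c e = exp (of_real u * (sg u a + sg u b + sg u c + sg u e)) *
     (Vfac (hh u) (sg u a) * Vfac (hh u) (sg u b) * Vfac (hh u) (sg u c) * Vfac (hh u) (sg u e)) *
     (rz (sg u a + sg u b) * rz (sg u a + sg u c) * rz (sg u a + sg u e) * rz (sg u b + sg u c) * rz (sg u b + sg u e) * rz (sg u c + sg u e)) *
     rz (sg u a + sg u b + sg u c + sg u e) *
     (1 / rz (sg u a + sg u b + sg u c) * (1 / rz (sg u a + sg u b + sg u e)) * (1 / rz (sg u a + sg u c + sg u e)) * (1 / rz (sg u b + sg u c + sg u e))) *
     Gext 2 (vec4 (sg u a) (sg u b) (sg u c) (sg u e))"

lemma zeta_eq_rz: "s \<noteq> 0 \<Longrightarrow> zeta (1 + s) = rz s"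
  by (simp add: rz_def zeta_eq_reg)

text \<open>The symmetry is read off from the Euler factors of M, where permuting the entries only
  permutes a product over four indices.\<close>

lemma Mfun_2_swap:
  "Mfun 2 (vec4 a c b e) = Mfun 2 (vec4 a b c e)" "Mfun 2 (vec4 a b e c) = Mfun 2 (vec4 a b c e)"
proof -
  have "(\<Prod>j<2*2. 1 - (of_nat p :: complex) powr (- vec4 a c b e j)) = (\<Prod>j<2*2. 1 - of_nat p powr (- vec4 a b c e j))"
    "(\<Prod>j<2*2. 1 - (of_nat p :: complex) powr (- vec4 a b e c j)) = (\<Prod>j<2*2. 1 - of_nat p powr (- vec4 a b c e j))" for p
    unfolding lessThan_2_2 by (simp_all add: vec4_def mult_ac)
  then show "Mfun 2 (vec4 a c b e) = Mfun 2 (vec4 a b c e)" "Mfun 2 (vec4 a b e c) = Mfun 2 (vec4 a b c e)"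
    unfolding Mfun_def by (simp_all only:)
qed

context zeta_estimates
begin

lemma integrand_eq_Phi2:
  assumes u: "u \<ge> 4 / d"
  shows "perron_kernel u (hh u) (sg u a) * (perron_kernel u (hh u) (sg u b) * (perron_kernel u (hh u) (sg u c) * perron_kernel u (hh u) (sg u e))) *
     Mfun 2 (vec4 (sg u a) (sg u b) (sg u c) (sg u e)) = Phi2 u a b c e"
proof -
  note ub = u_bounds[OF u]
  have nz: "s \<noteq> 0" if "Re s > 0" for s using that by auto
  have re: "Re (sg u t) > 0" for t using ub by simp
  have r: "zeta_reg (sg u t) \<noteq> 0" for t using ub by (intro reg_nonzero) auto
  define A where "A = sg u a"
  define B where "B = sg u b"
  define D where "D = sg u c"
  define E where "E = sg u e"
  have pos: "Re A > 0" "Re B > 0" "Re D > 0" "Re E > 0" using re by (simp_all add: A_def B_def D_def E_def)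
  define V where "V = Gext 2 (vec4 A B D E)"
  have M: "Mfun 2 (vec4 A B D E) = V * (zeta (1 + (A + E)) * zeta (1 + (A + B)) * zeta (1 + (A + D)) * zeta (1 + (E + B)) * zeta (1 + (E + D)) * zeta (1 + (B + D))
     * zeta (1 + (A + E + B + D))) / (zeta (1 + A) * zeta (1 + E) * zeta (1 + B) * zeta (1 + D) *
      (zeta (1 + (A + E + B)) * zeta (1 + (A + E + D)) * zeta (1 + (A + B + D)) * zeta (1 + (E + B + D))))"
    unfolding V_def by (subst Mfun_eq_Gext) (use pos in \<open>auto simp: vec4_def prods_sS_2[where g = "\<lambda>x. zeta (1 + x)"]\<close>)
  have z: "zeta (1 + s) = rz s" if "Re s > 0" for s using that by (intro zeta_eq_rz nz)
  have eqs: "E + B = B + E" "E + D = D + E" "A + E + B + D = A + B + D + E" "A + B + E + D = A + B + D + E" "A + E + B = A + B + E" "A + E + D = A + D + E" "B + E + D = B + D + E"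
    by simp_all
  have pair: "zeta (1 + (A + E)) = rz (A + E)" "zeta (1 + (A + B)) = rz (A + B)" "zeta (1 + (A + D)) = rz (A + D)"
    "zeta (1 + (E + B)) = rz (B + E)" "zeta (1 + (E + D)) = rz (D + E)" "zeta (1 + (B + D)) = rz (B + D)"
    "zeta (1 + (A + E + B + D)) = rz (A + B + D + E)" "zeta (1 + (A + E + B)) = rz (A + B + E)"
    "zeta (1 + (A + E + D)) = rz (A + D + E)" "zeta (1 + (A + B + D)) = rz (A + B + D)" "zeta (1 + (E + B + D)) = rz (B + D + E)"
    using pos by (simp_all add: z add_pos_pos eqs)
  have zn0: "zeta (1 + sg u t) \<noteq> 0" for t using r nz[OF re] by (simp add: zeta_eq_reg)
  have k: "perron_kernel u (hh u) (sg u t) = exp (of_real u * sg u t) * Vfac (hh u) (sg u t) * zeta (1 + sg u t)" for t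
    using perron_kernel_zeta[OF nz[OF re] r, of u "hh u" t] zn0[of t] by (simp only: divide_eq_eq if_False simp_thms)
  have zn: "zeta (1 + A) \<noteq> 0" "zeta (1 + B) \<noteq> 0" "zeta (1 + D) \<noteq> 0" "zeta (1 + E) \<noteq> 0"
    using zn0 by (simp_all add: A_def B_def D_def E_def)
  have "perron_kernel u (hh u) A * (perron_kernel u (hh u) B * (perron_kernel u (hh u) D * perron_kernel u (hh u) E)) * Mfun 2 (vec4 A B D E)
    = (exp (of_real u * A) * exp (of_real u * B) * exp (of_real u * D) * exp (of_real u * E)) * (Vfac (hh u) A * Vfac (hh u) B * Vfac (hh u) D * Vfac (hh u) E) *
     (rz (A + B) * rz (A + D) * rz (A + E) * rz (B + D) * rz (B + E) * rz (D + E)) * rz (A + B + D + E) *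
     (1 / rz (A + B + D) * (1 / rz (A + B + E)) * (1 / rz (A + D + E)) * (1 / rz (B + D + E))) * V"
    unfolding M pair k[of a, folded A_def] k[of b, folded B_def] k[of c, folded D_def] k[of e, folded E_def] using zn by (simp add: field_simps)
  also have "exp (of_real u * A) * exp (of_real u * B) * exp (of_real u * D) * exp (of_real u * E) = exp (of_real u * (A + B + D + E))"
    by (simp add: exp_add distrib_left)
  finally show ?thesis unfolding Phi2_def A_def B_def D_def E_def V_def .
qed

lemma Phi2_swap:
  assumes u: "u \<ge> 4 / d"
  shows "Phi2 u a c b e = Phi2 u a b c e" "Phi2 u a b e c = Phi2 u a b c e"
  unfolding integrand_eq_Phi2[OF u, symmetric] Mfun_2_swap[of _ "sg u c"] Mfun_2_swap(2)[of _ _ "sg u e"] by (simp_all add: mult_ac)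

lemma smooth_Mk_2_Phi2:
  assumes u: "u \<ge> 4 / d"
  shows "integrable lborel (uncurry4 (Phi2 u))"
    and "of_real ((2 * pi)^4 * smooth_Mk 2 u (hh u)) = (LBINT z. uncurry4 (Phi2 u) z)"
proof -
  note ub = u_bounds[OF u]
  have hpos: "hh u > 0" using hh_bounds[OF ub(4)] by simp
  show "integrable lborel (uncurry4 (Phi2 u))"
    and "of_real ((2 * pi)^4 * smooth_Mk 2 u (hh u)) = (LBINT z. uncurry4 (Phi2 u) z)"
    using smooth_Mk_2_integral[OF ub(2) hpos, of u] unfolding integrand_eq_Phi2[OF u, symmetric] sg_def by simp_all
qed

lemma rz_pair_le:
  assumes u: "u \<ge> 4 / d"
  shows "norm (rz (sg u a + sg u b)) \<le> C * (pe a * pe b) * kk u (a + b)"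
  using ratio_sum_le(1)[OF u, of a b] by (simp add: rz_def)

lemma sg_add3: "sg u a + sg u b + sg u c = Complex (3 / u) (a + b + c)" and sg_add4: "sg u a + sg u b + sg u c + sg u e = Complex (4 / u) (a + b + c + e)"
  by (simp_all add: sg_def complex_eq_iff)

lemma pw_add3_le:
  fixes a b c e x :: real
  assumes "x \<ge> 0"
  shows "nm (a + b + c) powr x \<le> nm a powr x * nm b powr x * nm c powr x"
    and "nm (a + b + c + e) powr x \<le> nm a powr x * nm b powr x * nm c powr x * nm e powr x"
proof -
  show 3: "nm (a + b + c) powr x \<le> nm a powr x * nm b powr x * nm c powr x"
    by (rule order_trans[OF pw_add_le[OF assms] mult_right_mono[OF pw_add_le[OF assms]]]) simp
  show "nm (a + b + c + e) powr x \<le> nm a powr x * nm b powr x * nm c powr x * nm e powr x"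
    by (rule order_trans[OF pw_add_le[OF assms] mult_right_mono[OF 3]]) simp
qed

lemma rz_triple_le:
  assumes u: "u \<ge> 4 / d"
  shows "norm (1 / rz (sg u a + sg u b + sg u c)) \<le> 2 * C * (pe a * pe b * pe c) *
    min 1 (norm (Complex (3 / u) (a + b + c)))"
proof -
  note ub = u_bounds[OF u]
  have "norm (1 / rz (sg u a + sg u b + sg u c)) \<le> 2 * C * pe (a + b + c) * min 1 (norm (Complex (3 / u) (a + b + c)))"
    using ratio_reg_le[of "Complex (3 / u) (a + b + c)"] ub by (simp add: rz_def sg_add3)
  also have "\<dots> \<le> 2 * C * (pe a * pe b * pe c) * min 1 (norm (Complex (3 / u) (a + b + c)))"
    using C1 by (intro mult_right_mono mult_left_mono pw_add3_le) auto
  finally show ?thesis .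
qed

lemma rz_quad_le:
  assumes u: "u \<ge> 4 / d"
  shows "norm (rz (sg u a + sg u b + sg u c + sg u e)) \<le> C * (pe a * pe b * pe c * pe e) *
    (1 + 1 / norm (Complex (4 / u) (a + b + c + e)))"
proof -
  note ub = u_bounds[OF u]
  have "norm (rz (sg u a + sg u b + sg u c + sg u e)) \<le> C * pe (a + b + c + e) * (1 + 1 / norm (Complex (4 / u) (a + b + c + e)))"
    using reg_upper_ratio[of "Complex (4 / u) (a + b + c + e)"] ub d01 by (simp add: rz_def sg_add4 Complex_nonzero)
  also have "\<dots> \<le> C * (pe a * pe b * pe c * pe e) * (1 + 1 / norm (Complex (4 / u) (a + b + c + e)))"
    using C1 by (intro mult_right_mono mult_left_mono pw_add3_le) auto
  finally show ?thesis .
qed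

definition t3 :: "real \<Rightarrow> real \<Rightarrow> real" where "t3 u x = min 1 (norm (Complex (3 / u) x))"

abbreviation (input) triples4 :: "real \<Rightarrow> real fun4" where
  "triples4 u a b c e \<equiv> t3 u (a+b+c) * t3 u (a+b+e) * t3 u (a+c+e) * t3 u (b+c+e)"

text \<open>The exponent 7/8192 collects the growth from the three pairs, the three triples and the
  full sum in which the variable occurs.\<close>

definition Vw :: "real \<Rightarrow> real \<Rightarrow> real" where "Vw u t = nm t powr (7/8192) * norm (Vfac (hh u) (sg u t))"

text \<open>C^12 counts six pairs, the full sum, four triples and G; 16 is the factor 2 from each
  triple, and exp 4 comes from the four real parts 1/u.\<close>

definition c2 :: real where "c2 = 16 * exp 4 * C^12"

lemma c2_pos: "c2 > 0" using C1 by (simp add: c2_def)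

lemma Phi2_bound:
  assumes u: "u \<ge> 4 / d"
  shows "norm (Phi2 u a b c e) \<le> c2 * (Vw u a * Vw u b * Vw u c * Vw u e) *
    (triples4 u a b c e * pairs6 u a b c e) *
    (1 + 1 / norm (Complex (4 / u) (a + b + c + e)))"
proof -
  note ub = u_bounds[OF u]
  define q where "q = 1 + 1 / norm (Complex (4 / u) (a + b + c + e))"
  define p where "p = (\<lambda>x::real. pe x)"
  define v where "v = (\<lambda>x. norm (Vfac (hh u) (sg u x)))"
  have k0: "kk u x \<ge> 0" for x using kk_ge_1[of u x] by simp
  have nn: "p x \<ge> 0" "v x \<ge> 0" "t3 u x \<ge> 0" for x by (simp_all add: p_def v_def t3_def)
  have q: "q \<ge> 0" by (simp add: q_def)
  have R: "norm (rz (sg u x + sg u y)) \<le> C * (p x * p y) * kk u (x + y)" for x y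
    unfolding p_def by (rule rz_pair_le[OF u])
  have T: "norm (1 / rz (sg u x + sg u y + sg u z)) \<le> 2 * C * (p x * p y * p z) * t3 u (x + y + z)" for x y z
    unfolding p_def t3_def by (rule rz_triple_le[OF u])
  have Q: "norm (rz (sg u a + sg u b + sg u c + sg u e)) \<le> C * (p a * p b * p c * p e) * q"
    unfolding p_def q_def by (rule rz_quad_le[OF u])
  have G: "norm (Gext 2 (vec4 (sg u a) (sg u b) (sg u c) (sg u e))) \<le> C" using ub by (intro G2 vec4_Gregion) auto
  have pp: "Vw u x = p x ^ 7 * v x" for x
    by (simp add: Vw_def p_def v_def powr_power)
  have ex: "norm (exp (of_real u * (sg u a + sg u b + sg u c + sg u e))) = exp 4"
    using ub by (simp add: sg_add4)
  have "norm (Phi2 u a b c e) = exp 4 * (v a * v b * v c * v e) *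
     (norm (rz (sg u a + sg u b)) * norm (rz (sg u a + sg u c)) * norm (rz (sg u a + sg u e)) * norm (rz (sg u b + sg u c)) * norm (rz (sg u b + sg u e)) * norm (rz (sg u c + sg u e))) *
     norm (rz (sg u a + sg u b + sg u c + sg u e)) *
     (norm (1 / rz (sg u a + sg u b + sg u c)) * norm (1 / rz (sg u a + sg u b + sg u e)) * norm (1 / rz (sg u a + sg u c + sg u e)) * norm (1 / rz (sg u b + sg u c + sg u e))) *
     norm (Gext 2 (vec4 (sg u a) (sg u b) (sg u c) (sg u e)))"
    unfolding Phi2_def norm_mult ex v_def by (rule refl)
  also have "\<dots> \<le> exp 4 * (v a * v b * v c * v e) *
     ((C * (p a * p b) * kk u (a + b)) * (C * (p a * p c) * kk u (a + c)) * (C * (p a * p e) * kk u (a + e)) * (C * (p b * p c) * kk u (b + c)) * (C * (p b * p e) * kk u (b + e)) * (C * (p c * p e) * kk u (c + e))) *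
     (C * (p a * p b * p c * p e) * q) *
     ((2 * C * (p a * p b * p c) * t3 u (a + b + c)) * (2 * C * (p a * p b * p e) * t3 u (a + b + e)) * (2 * C * (p a * p c * p e) * t3 u (a + c + e)) * (2 * C * (p b * p c * p e) * t3 u (b + c + e))) * C"
  proof (rule mult_mono[OF mult_mono[OF mult_mono[OF mult_left_mono Q]] G])
    show "norm (rz (sg u a + sg u b)) * norm (rz (sg u a + sg u c)) * norm (rz (sg u a + sg u e)) * norm (rz (sg u b + sg u c)) * norm (rz (sg u b + sg u e)) * norm (rz (sg u c + sg u e))
      \<le> (C * (p a * p b) * kk u (a + b)) * (C * (p a * p c) * kk u (a + c)) * (C * (p a * p e) * kk u (a + e)) * (C * (p b * p c) * kk u (b + c)) * (C * (p b * p e) * kk u (b + e)) * (C * (p c * p e) * kk u (c + e))"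
      using C1 by (intro mult_mono R mult_nonneg_nonneg nn k0 norm_ge_zero) auto
    show "norm (1 / rz (sg u a + sg u b + sg u c)) * norm (1 / rz (sg u a + sg u b + sg u e)) * norm (1 / rz (sg u a + sg u c + sg u e)) * norm (1 / rz (sg u b + sg u c + sg u e))
      \<le> (2 * C * (p a * p b * p c) * t3 u (a + b + c)) * (2 * C * (p a * p b * p e) * t3 u (a + b + e)) * (2 * C * (p a * p c * p e) * t3 u (a + c + e)) * (2 * C * (p b * p c * p e) * t3 u (b + c + e))"
      using C1 by (intro mult_mono T mult_nonneg_nonneg nn norm_ge_zero) auto
  qed (use C1 q in \<open>auto intro!: mult_nonneg_nonneg nn k0\<close>)
  also have "\<dots> = c2 * (Vw u a * Vw u b * Vw u c * Vw u e) *
    (triples4 u a b c e * pairs6 u a b c e) * q"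
    unfolding pp c2_def by (simp add: power_numeral_reduce mult_ac)
  finally show ?thesis by (simp add: q_def)
qed

text \<open>The damped bound is integrable but costs u^(1/16), and serves away from the main region.
  The undamped one costs nothing and serves inside it, where two variables decay together.\<close>

lemma Vw_le:
  assumes u: "u \<ge> 4 / d"
  shows "Vw u t \<le> 2 * C * u powr (1/16) * om t" and "Vw u t \<le> C * nm t powr (-1 + 1/1024)"
proof -
  note ub = u_bounds[OF u]
  define n where "n = norm (1 + of_real (hh u) * sg u t)"
  have n: "n > 0" unfolding n_def using one_plus_hh_nonzero[OF ub(4)] by simp
  have "norm (Vfac (hh u) (sg u t)) \<le> C * nm t powr (-1 + 1/8192) / n"
    using Vfac_le(1)[of "sg u t" "hh u"] ub hh_bounds[OF ub(4)] by (simp add: n_def)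
  then have "Vw u t \<le> nm t powr (7/8192) * (C * nm t powr (-1 + 1/8192) / n)"
    unfolding Vw_def by (intro mult_left_mono) auto
  also have "\<dots> = C * (nm t powr (-1 + 1/1024) / n)" by (simp flip: powr_add)
  also have "\<dots> \<le> C * (2 * u powr (1/16) * om t)"
    using damped_weight_le[of u "1/u" t] ub C1 by (intro mult_left_mono) (auto simp: n_def hh_def sg_def)
  finally show "Vw u t \<le> 2 * C * u powr (1/16) * om t" by (simp add: mult_ac)
  have "norm (Vfac (hh u) (sg u t)) \<le> C * nm t powr (-1 + 1/8192)"
    using Vfac_le(2)[of "sg u t" "hh u"] ub hh_bounds[OF ub(4)] by simp
  then have "Vw u t \<le> nm t powr (7/8192) * (C * nm t powr (-1 + 1/8192))"
    unfolding Vw_def by (intro mult_left_mono) auto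
  also have "\<dots> = C * nm t powr (-1 + 1/1024)" by (simp flip: powr_add)
  finally show "Vw u t \<le> C * nm t powr (-1 + 1/1024)" .
qed

lemma Vw_nonneg: "Vw u t \<ge> 0" by (simp add: Vw_def)

definition cF :: real where "cF = c2 * (16 * C^4) * 27"

lemma cF_pos: "cF \<ge> 0" using C1 c2_pos by (simp add: cF_def)

text \<open>The exponent is 5/4 = 4 * (1/16) + 1: four damped variables, and a factor u as a crude
  bound for the pole of the full sum. Since the trees cost only logarithms, this stays below the
  order u^2 of the main term.\<close>

lemma Phi2_far:
  assumes u: "u \<ge> 4 / d" and far: "\<not> near a b c e" "\<not> near a c e b" "\<not> near a b e c"
  shows "norm (Phi2 u a b c e) \<le> cF * u powr (5/4) * (om a * om b * om c * om e * (kk u a * T_all u a b c e))"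
proof -
  note ub = u_bounds[OF u]
  have om0: "om x \<ge> 0" for x using om_pos[of x] by simp
  have k0: "kk u x \<ge> 0" for x using kk_ge_1[of u x] by simp
  have t0: "t3 u x \<ge> 0" for x by (simp add: t3_def)
  have V: "Vw u a * Vw u b * Vw u c * Vw u e \<le> (2 * C * u powr (1/16) * om a) * (2 * C * u powr (1/16) * om b) * (2 * C * u powr (1/16) * om c) * (2 * C * u powr (1/16) * om e)"
    using C1 by (intro mult_mono Vw_le[OF u] mult_nonneg_nonneg om0 Vw_nonneg) auto
  have q: "1 + 1 / norm (Complex (4 / u) (a + b + c + e)) \<le> u"
  proof -
    have "norm (Complex (4 / u) (a + b + c + e)) \<ge> 4 / u" using abs_Re_le_cmod[of "Complex (4/u) (a + b + c + e)"] ub by simp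
    then have "1 / norm (Complex (4 / u) (a + b + c + e)) \<le> 1 / (4 / u)" using ub by (intro frac_le) auto
    then show ?thesis using ub by simp
  qed
  have K: "triples4 u a b c e * pairs6 u a b c e
    \<le> 27 * (kk u a * T_all u a b c e)"
    by (rule complete_graph_far[OF ub(4) far]) (simp_all add: t3_def)
  have "norm (Phi2 u a b c e) \<le> c2 * ((2 * C * u powr (1/16) * om a) * (2 * C * u powr (1/16) * om b) * (2 * C * u powr (1/16) * om c) * (2 * C * u powr (1/16) * om e)) *
     (27 * (kk u a * T_all u a b c e)) * u"
  proof (rule order_trans[OF Phi2_bound[OF u]], rule mult_mono[OF mult_mono[OF mult_left_mono[OF V] K] q])
    show "0 \<le> c2 * ((2 * C * u powr (1/16) * om a) * (2 * C * u powr (1/16) * om b) * (2 * C * u powr (1/16) * om c) * (2 * C * u powr (1/16) * om e))"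
      using C1 c2_pos by (intro mult_nonneg_nonneg om0) auto
    then show "0 \<le> c2 * ((2 * C * u powr (1/16) * om a) * (2 * C * u powr (1/16) * om b) * (2 * C * u powr (1/16) * om c) * (2 * C * u powr (1/16) * om e)) * (27 * (kk u a * T_all u a b c e))"
      by (rule mult_nonneg_nonneg) (rule order_trans[OF _ K], intro mult_nonneg_nonneg t0 k0)
  qed (use c2_pos in \<open>auto intro!: mult_nonneg_nonneg t0 k0\<close>)
  also have "\<dots> = cF * (u powr (1/16) * u powr (1/16) * u powr (1/16) * u powr (1/16) * u) * (om a * om b * om c * om e * (kk u a * T_all u a b c e))"
    by (simp add: cF_def power_numeral_reduce mult_ac)
  also have "u powr (1/16) * u powr (1/16) * u powr (1/16) * u powr (1/16) * u = u powr (5/4)"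
    using ub powr_add[of u "1/4" 1] by (simp flip: powr_add)
  finally show ?thesis .
qed

end

section \<open>Changes of variables in four dimensions\<close>

lemma integral_change_of_variables:
  fixes T :: "'a::euclidean_space \<Rightarrow> 'a" and F :: "'a \<Rightarrow> complex"
  assumes T [measurable]: "T \<in> borel_measurable borel" and F [measurable]: "F \<in> borel_measurable borel" and c: "c \<ge> 0"
    and g: "\<And>g::'a \<Rightarrow> ennreal. g \<in> borel_measurable borel \<Longrightarrow> (\<integral>\<^sup>+z. g (T z) \<partial>lborel) = ennreal c * (\<integral>\<^sup>+z. g z \<partial>lborel)"
  shows "(LBINT z. F (T z)) = of_real c * (LBINT z. F z)"
proof -
  \<comment> \<open>Nonnegative integrands determine the image of Lebesgue measure, so for complex
    integrands it is enough to know the formula that Tonelli's theorem provides.\<close>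
  have "distr lborel borel T = density lborel (\<lambda>_. ennreal c)"
  proof (rule measure_eqI)
    fix A assume "A \<in> sets (distr lborel borel T)"
    then have A: "A \<in> sets borel" by simp
    have "emeasure (distr lborel borel T) A = (\<integral>\<^sup>+z. indicator A z \<partial>distr lborel borel T)" using A by simp
    also have "\<dots> = (\<integral>\<^sup>+z. indicator A (T z) \<partial>lborel)" using A by (subst nn_integral_distr) auto
    also have "\<dots> = ennreal c * (\<integral>\<^sup>+z. indicator A z \<partial>lborel)" using A by (intro g) auto
    also have "\<dots> = emeasure (density lborel (\<lambda>_. ennreal c)) A"
      using A by (subst emeasure_density) (auto simp: nn_integral_cmult)
    finally show "emeasure (distr lborel borel T) A = emeasure (density lborel (\<lambda>_. ennreal c)) A" .
  qed simp
  moreover have "integral\<^sup>L (distr lborel borel T) F = (LBINT z. F (T z))" by (rule integral_distr) auto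
  moreover have "integral\<^sup>L (density lborel (\<lambda>_. ennreal c)) F = (LBINT z. c *\<^sub>R F z)"
    using c by (intro integral_density) auto
  ultimately show ?thesis by (simp add: scaleR_conv_of_real)
qed

definition swap23 :: "real4 \<Rightarrow> real4" where "swap23 z = (fst z, fst (snd (snd z)), fst (snd z), snd (snd (snd z)))"

definition swap34 :: "real4 \<Rightarrow> real4" where "swap34 z = (fst z, fst (snd z), snd (snd (snd z)), fst (snd (snd z)))"

lemma swap_measurable [measurable]: "swap23 \<in> borel_measurable borel" "swap34 \<in> borel_measurable borel"
  unfolding swap23_def[abs_def] swap34_def[abs_def] by (intro borel_measurable_continuous_onI continuous_intros)+

lemma
  fixes g :: "real4 \<Rightarrow> ennreal"
  assumes g: "g \<in> borel_measurable borel"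
  shows nn_integral_swap_23: "(\<integral>\<^sup>+z. g (swap23 z) \<partial>lborel) = (\<integral>\<^sup>+z. g z \<partial>lborel)"
    and nn_integral_swap_34: "(\<integral>\<^sup>+z. g (swap34 z) \<partial>lborel) = (\<integral>\<^sup>+z. g z \<partial>lborel)"
proof -
  define F where "F = (\<lambda>a b c e. g (a, b, c, e))"
  have F: "uncurry4 F \<in> borel_measurable borel" using g by (simp add: F_def)
  note m = measurable_compose[OF swap_measurable(1) g] measurable_compose[OF swap_measurable(2) g]
  show "(\<integral>\<^sup>+z. g (swap23 z) \<partial>lborel) = (\<integral>\<^sup>+z. g z \<partial>lborel)"
    using nn_integral_eq_N4[of "\<lambda>a b c e. F a c b e"] nn_integral_eq_N4[OF F] N4_swap_23[OF F] m(1) by (simp add: F_def swap23_def)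
  show "(\<integral>\<^sup>+z. g (swap34 z) \<partial>lborel) = (\<integral>\<^sup>+z. g z \<partial>lborel)"
    using nn_integral_eq_N4[of "\<lambda>a b c e. F a b e c"] nn_integral_eq_N4[OF F] N4_swap_34[OF F] m(2) by (simp add: F_def swap34_def)
qed

text \<open>The coordinates y = u (a + b), w = u (a + c) and q = u (a + b + c + e) resolve all five
  poles of the main region, because u (b + e) = q - w and u (c + e) = q - y. The first variable is
  not rescaled.\<close>

definition aff :: "real \<Rightarrow> real4 \<Rightarrow> real4" where
  "aff u z = (fst z, - fst z + fst (snd z) / u, - fst z + fst (snd (snd z)) / u, fst z + (snd (snd (snd z)) - fst (snd z) - fst (snd (snd z))) / u)"

lemma aff_measurable: "u > 0 \<Longrightarrow> aff u \<in> borel_measurable borel"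
  unfolding aff_def[abs_def] by (intro borel_measurable_continuous_onI continuous_intros) auto

lemma nn_integral_affine4:
  fixes g :: "real4 \<Rightarrow> ennreal"
  assumes g: "g \<in> borel_measurable borel" and u: "u > 0"
  shows "(\<integral>\<^sup>+z. g (aff u z) \<partial>lborel)
    = ennreal (u^3) * (\<integral>\<^sup>+z. g z \<partial>lborel)"
proof -
  define F where "F = (\<lambda>a b c e. g (a, b, c, e))"
  have F: "uncurry4 F \<in> borel_measurable borel" using g by (simp add: F_def)
  have [measurable]: "g \<in> borel_measurable (borel \<Otimes>\<^sub>M (borel \<Otimes>\<^sub>M (borel \<Otimes>\<^sub>M borel)))" using g by (simp add: borel_prod)
  have m: "(\<lambda>e. F a b c e) \<in> borel_measurable borel" "(\<lambda>c. \<integral>\<^sup>+e. F a b c e \<partial>lborel) \<in> borel_measurable borel"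
    "(\<lambda>b. \<integral>\<^sup>+c. \<integral>\<^sup>+e. F a b c e \<partial>lborel \<partial>lborel) \<in> borel_measurable borel" 
    "(\<lambda>a. \<integral>\<^sup>+b. \<integral>\<^sup>+c. \<integral>\<^sup>+e. F a b c e \<partial>lborel \<partial>lborel \<partial>lborel) \<in> borel_measurable borel" for a b c
    unfolding F_def by measurable
  define G where "G = (\<lambda>a y w q. F a (-a + y/u) (-a + w/u) (a + (q - y - w)/u))"
  have af: "(\<integral>\<^sup>+x. f (t + x / u) \<partial>lborel) = ennreal u * (\<integral>\<^sup>+x. f x \<partial>lborel)" if "f \<in> borel_measurable borel" for f :: "real \<Rightarrow> ennreal" and t
  proof -
    have "(\<integral>\<^sup>+x. f x \<partial>lborel) = ennreal (1/u) * (\<integral>\<^sup>+x. f (t + x / u) \<partial>lborel)"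
      using nn_integral_real_affine[OF that, of "1/u" t] u by simp
    then have "ennreal u * (\<integral>\<^sup>+x. f x \<partial>lborel) = (ennreal u * ennreal (1/u)) * (\<integral>\<^sup>+x. f (t + x / u) \<partial>lborel)" by (simp add: mult.assoc)
    also have "ennreal u * ennreal (1/u) = 1" using u by (simp add: ennreal_mult'[symmetric])
    finally show ?thesis by simp
  qed
  have e1: "(\<integral>\<^sup>+q. G a y w q \<partial>lborel) = ennreal u * (\<integral>\<^sup>+e. F a (-a + y/u) (-a + w/u) e \<partial>lborel)" for a y w
  proof -
    have "(\<integral>\<^sup>+q. G a y w q \<partial>lborel) = (\<integral>\<^sup>+q. F a (-a + y/u) (-a + w/u) ((a - (y + w) / u) + q/u) \<partial>lborel)"
      by (simp add: G_def diff_divide_distrib add_divide_distrib algebra_simps)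
    then show ?thesis by (simp only: af[OF m(1)])
  qed
  have e2: "(\<integral>\<^sup>+w. \<integral>\<^sup>+q. G a y w q \<partial>lborel \<partial>lborel) = ennreal u * (ennreal u * (\<integral>\<^sup>+c. \<integral>\<^sup>+e. F a (-a + y/u) c e \<partial>lborel \<partial>lborel))" for a y
  proof -
    have m': "(\<lambda>w. \<integral>\<^sup>+e. F a (-a + y/u) (-a + w/u) e \<partial>lborel) \<in> borel_measurable lborel" unfolding F_def by measurable
    show ?thesis unfolding e1 nn_integral_cmult[OF m'] af[OF m(2), of a "-a + y/u" "-a"] by (rule refl)
  qed
  have e3: "(\<integral>\<^sup>+y. \<integral>\<^sup>+w. \<integral>\<^sup>+q. G a y w q \<partial>lborel \<partial>lborel \<partial>lborel) = ennreal u * (ennreal u * (ennreal u * (\<integral>\<^sup>+b. \<integral>\<^sup>+c. \<integral>\<^sup>+e. F a b c e \<partial>lborel \<partial>lborel \<partial>lborel)))" for a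
  proof -
    have m': "(\<lambda>y. \<integral>\<^sup>+c. \<integral>\<^sup>+e. F a (-a + y/u) c e \<partial>lborel \<partial>lborel) \<in> borel_measurable lborel"
      and m'': "(\<lambda>y. ennreal u * (\<integral>\<^sup>+c. \<integral>\<^sup>+e. F a (-a + y/u) c e \<partial>lborel \<partial>lborel)) \<in> borel_measurable lborel" unfolding F_def by measurable
    show ?thesis unfolding e2 nn_integral_cmult[OF m''] nn_integral_cmult[OF m'] af[OF m(3), of a "-a"] by (rule refl)
  qed
  have GM: "uncurry4 G \<in> borel_measurable borel"
    using measurable_compose[OF aff_measurable[OF u] g] by (simp add: G_def F_def aff_def)
  have "(\<integral>\<^sup>+z. g (aff u z) \<partial>lborel) = N4 G"
    unfolding nn_integral_eq_N4[OF GM, symmetric] by (simp add: G_def F_def aff_def)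
  also have "\<dots> = ennreal u * (ennreal u * (ennreal u * N4 F))"
    unfolding N4_def e3 using m(4) by (simp add: nn_integral_cmult)
  also have "N4 F = (\<integral>\<^sup>+z. g z \<partial>lborel)" unfolding nn_integral_eq_N4[OF F, symmetric] by (simp add: F_def)
  also have "ennreal u * (ennreal u * (ennreal u * (\<integral>\<^sup>+z. g z \<partial>lborel))) = ennreal (u^3) * (\<integral>\<^sup>+z. g z \<partial>lborel)"
    using u by (simp add: ennreal_mult' power3_eq_cube mult.assoc)
  finally show ?thesis .
qed

definition near_set :: "real4 set" where "near_set = {z. uncurry4 near z}"

lemma near_set_measurable [measurable]: "near_set \<in> sets borel"
  unfolding near_set_def near_def
  by (intro borel_open open_Collect_conj open_Collect_less continuous_intros) auto

context zeta_estimates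
begin

definition NPhi :: "real \<Rightarrow> real4 \<Rightarrow> complex" where
  "NPhi u z = indicator near_set z *\<^sub>R uncurry4 (Phi2 u) z"

lemma NPhi_integrable: "u \<ge> 4 / d \<Longrightarrow> integrable lborel (NPhi u)"
  unfolding NPhi_def by (intro integrable_mult_indicator smooth_Mk_2_Phi2) auto

text \<open>The three pairings give disjoint regions that are permuted by the swaps, and
  \<open>Phi2\<close> is invariant, so they contribute equally. On the complement of the three the
  tree bound applies; 150 is the mass of \<open>T_all\<close>.\<close>

lemma smooth_2_minus_near:
  assumes u: "u \<ge> 4 / d"
  shows "norm (of_real ((2 * pi)^4 * smooth_Mk 2 u (hh u)) - 3 * (LBINT z. NPhi u z)) \<le> 150 * cF * (u powr (5/4) * kappa u ^ 4)"
proof -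
  note ub = u_bounds[OF u]
  have int23: "(LBINT z. F (swap23 z)) = (LBINT z. F z)" and int34: "(LBINT z. F (swap34 z)) = (LBINT z. F z)"
    if "F \<in> borel_measurable borel" for F :: "_ \<Rightarrow> complex"
    using integral_change_of_variables[of swap23 F 1] integral_change_of_variables[of swap34 F 1] that nn_integral_swap_23 nn_integral_swap_34 by simp_all
  define P where "P = uncurry4 (Phi2 u)"
  have Pi: "integrable lborel P" and Pint: "of_real ((2 * pi)^4 * smooth_Mk 2 u (hh u)) = (LBINT z. P z)"
    using smooth_Mk_2_Phi2[OF u] by (simp_all add: P_def)
  have Ni: "integrable lborel (NPhi u)" by (rule NPhi_integrable[OF u])
  have Nm [measurable]: "NPhi u \<in> borel_measurable borel" using borel_measurable_integrable[OF Ni] by simp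
  have Psym: "P (swap23 z) = P z" "P (swap34 z) = P z" for z
    by (simp_all add: P_def swap23_def swap34_def Phi2_swap[OF u])
  have NP: "NPhi u = (\<lambda>z. indicator near_set z *\<^sub>R P z)" by (simp add: NPhi_def P_def fun_eq_iff)
  define N2 where "N2 = (\<lambda>z. NPhi u (swap34 (swap23 z)))"
  define N3 where "N3 = (\<lambda>z. NPhi u (swap34 z))"
  have N3v: "(LBINT z. N3 z) = (LBINT z. NPhi u z)" unfolding N3_def by (rule int34[OF Nm])
  have N2v: "(LBINT z. N2 z) = (LBINT z. NPhi u z)"
    unfolding N2_def using int23[of "\<lambda>z. NPhi u (swap34 z)"] int34[OF Nm] by simp
  have N3eq: "N3 z = indicator (swap34 -` near_set) z *\<^sub>R P z" and N2eq: "N2 z = indicator ((\<lambda>z. swap34 (swap23 z)) -` near_set) z *\<^sub>R P z" for z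
    by (simp_all add: N2_def N3_def NP Psym indicator_def)
  have s2: "(\<lambda>z. swap34 (swap23 z)) -` near_set \<in> sets borel" and s3: "swap34 -` near_set \<in> sets borel"
    by (rule measurable_sets_borel[OF _ near_set_measurable]; measurable)+
  have N3i: "integrable lborel N3" and N2i: "integrable lborel N2"
    unfolding N2eq[abs_def] N3eq[abs_def] using s2 s3 Pi by (auto intro!: integrable_mult_indicator)
  define Q where "Q = (\<lambda>z. P z - NPhi u z - N2 z - N3 z)"
  have Qi: "integrable lborel Q" unfolding Q_def using Pi Ni N2i N3i by auto
  have "(LBINT z. Q z) = (LBINT z. P z) - (LBINT z. NPhi u z) - (LBINT z. N2 z) - (LBINT z. N3 z)"
    unfolding Q_def using Pi Ni N2i N3i by simp
  then have Qv: "(LBINT z. Q z) = of_real ((2 * pi)^4 * smooth_Mk 2 u (hh u)) - 3 * (LBINT z. NPhi u z)"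
    unfolding Pint N2v N3v by simp
  have T0: "uncurry4 (T_all u) \<in> borel_measurable borel" "\<And>a b c e. T_all u a b c e \<ge> 0" "N4 (tree_fun u (T_all u)) \<le> ennreal (150 * kappa u ^ 4)"
    using tree_mass_T_all[OF ub(4)] by (auto simp: tree_mass_def)
  have c0: "cF * u powr (5/4) \<ge> 0" using cF_pos by simp
  have bound: "ennreal (norm (Q z)) \<le> ennreal (cF * u powr (5/4)) * uncurry4 (tree_fun u (T_all u)) z" for z
  proof -
    obtain a b c e where z: "z = (a, b, c, e)" by (metis prod.exhaust)
    have om0: "om x \<ge> 0" and k0: "kk u x \<ge> 0" for x using om_pos[of x] kk_ge_1[of u x] by simp_all
    have nn: "0 \<le> cF * u powr (5/4) * (om a * om b * om c * om e * (kk u a * T_all u a b c e))"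
      by (rule mult_nonneg_nonneg[OF c0]) (intro mult_nonneg_nonneg om0 k0 T0(2))
    have ind: "swap34 z \<in> near_set \<longleftrightarrow> near a b e c" "swap34 (swap23 z) \<in> near_set \<longleftrightarrow> near a c e b" "z \<in> near_set \<longleftrightarrow> near a b c e"
      by (simp_all add: z swap34_def swap23_def near_set_def)
    have "norm (Q z) \<le> cF * u powr (5/4) * (om a * om b * om c * om e * (kk u a * T_all u a b c e))"
    proof (cases "near a b c e \<or> near a c e b \<or> near a b e c")
      case True
      then have "Q z = 0"
        using near_disjoint[where a = a and b = b and c = c and e = e] ind by (auto simp: Q_def N2eq N3eq NP indicator_def)
      then show ?thesis using nn by simp
    next
      case False
      then have "Q z = Phi2 u a b c e" using ind by (simp add: Q_def N2eq N3eq NPhi_def indicator_def) (simp add: P_def z)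
      then show ?thesis using Phi2_far[OF u, of a b c e] False by simp
    qed
    then have "ennreal (norm (Q z)) \<le> ennreal (cF * u powr (5/4) * (om a * om b * om c * om e * (kk u a * T_all u a b c e)))" by (rule ennreal_leI)
    also have "\<dots> = ennreal (cF * u powr (5/4)) * uncurry4 (tree_fun u (T_all u)) z"
      using c0 by (simp add: z tree_fun_def ennreal_mult')
    finally show ?thesis .
  qed
  have "ennreal (norm (LBINT z. Q z)) \<le> (\<integral>\<^sup>+z. ennreal (norm (Q z)) \<partial>lborel)" by (rule integral_norm_bound_ennreal[OF Qi])
  also have "\<dots> \<le> (\<integral>\<^sup>+z. ennreal (cF * u powr (5/4)) * uncurry4 (tree_fun u (T_all u)) z \<partial>lborel)" by (intro nn_integral_mono bound)
  also have "\<dots> = ennreal (cF * u powr (5/4)) * N4 (tree_fun u (T_all u))"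
    using tree_fun_measurable[OF T0(1), of u] by (simp add: nn_integral_cmult nn_integral_eq_N4)
  also have "\<dots> \<le> ennreal (cF * u powr (5/4)) * ennreal (150 * kappa u ^ 4)" by (intro mult_left_mono T0) auto
  also have "\<dots> = ennreal (150 * cF * (u powr (5/4) * kappa u ^ 4))" using c0 by (simp add: ennreal_mult'[symmetric] mult_ac)
  finally have "norm (LBINT z. Q z) \<le> 150 * cF * (u powr (5/4) * kappa u ^ 4)"
    using cF_pos kappa_ge_0[OF ub(4)] by (subst (asm) ennreal_le_iff) auto
  then show ?thesis by (simp only: Qv)
qed

text \<open>The power u^2 arises as 5 - 3: a factor u from each of the four pair poles and the pole
  of the full sum, against u^(-3) from the change of variables.\<close>

lemma NPhi_affine:
  assumes u: "u \<ge> 4 / d"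
  shows "(LBINT z. NPhi u z) = of_real (u\<^sup>2) * (LBINT z. NPhi u (aff u z) / of_real (u^5))"
proof -
  note ub = u_bounds[OF u]
  have [measurable]: "NPhi u \<in> borel_measurable borel" using borel_measurable_integrable[OF NPhi_integrable[OF u]] by simp
  have "(LBINT z. NPhi u (aff u z)) = of_real (u^3) * (LBINT z. NPhi u z)"
  proof (rule integral_change_of_variables[OF aff_measurable[OF ub(5)]])
    show "(\<integral>\<^sup>+z. g (aff u z) \<partial>lborel) = ennreal (u^3) * (\<integral>\<^sup>+z. g z \<partial>lborel)" if "g \<in> borel_measurable borel" for g
      by (rule nn_integral_affine4[OF that ub(5)])
  qed (use ub in auto)
  then show ?thesis using ub by (simp add: field_simps flip: power_add)
qed

end

section \<open>The local integral at the 4-cycle\<close>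

definition conv_kernel :: "real \<Rightarrow> real \<Rightarrow> complex" where
  "conv_kernel q y = 1 / (Complex 2 y * Complex 2 (q - y))"

lemma continuous_conv_kernel: "continuous_on UNIV (conv_kernel q)"
  unfolding conv_kernel_def[abs_def] by (intro continuous_intros) (auto simp: Complex_nonzero)

lemma conv_kernel_integrable: "integrable lborel (conv_kernel q)"
proof (rule Bochner_Integration.integrable_bound)
  note i = integrable_inverse_Complex_square[of 2]
  have "integrable lborel (\<lambda>y. 1 / (norm (Complex 2 (q + (-1) * y)))\<^sup>2)"
    using lborel_integrable_real_affine[OF i, of "-1" q] by simp
  then show "integrable lborel (\<lambda>y. 1 / (norm (Complex 2 y))\<^sup>2 + 1 / (norm (Complex 2 (q - y)))\<^sup>2)"
    using i by (intro Bochner_Integration.integrable_add) auto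
  show "conv_kernel q \<in> borel_measurable lborel"
    using borel_measurable_continuous_onI[OF continuous_conv_kernel] by simp
  have "x * y \<le> x\<^sup>2 + y\<^sup>2" if "x \<ge> 0" "y \<ge> 0" for x y :: real
    using sum_squares_bound[of x y] zero_le_power2[of x] zero_le_power2[of y] mult_nonneg_nonneg[OF that] by linarith
  from this[of "1 / norm (Complex 2 y)" "1 / norm (Complex 2 (q - y))" for y]
  show "AE y in lborel. norm (conv_kernel q y) \<le> norm (1 / (norm (Complex 2 y))\<^sup>2 + 1 / (norm (Complex 2 (q - y)))\<^sup>2)"
    by (intro AE_I2) (simp add: conv_kernel_def norm_divide norm_mult power_divide)
qed

text \<open>Partial fractions; the antiderivative is a branch of the logarithm of \<open>(2 + \<i>y) / (2 + \<i>(q - y))\<close>.\<close>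

lemma conv_kernel_integral: "(LBINT y. conv_kernel q y) = 2 * pi / Complex 4 q"
proof -
  define H where "H = (\<lambda>v::real. Complex (ln (4 + v\<^sup>2) / 2) (arctan (v / 2)))"
  have p: "4 + v\<^sup>2 > 0" for v :: real using zero_le_power2[of v] by linarith
  have H: "(H has_vector_derivative (\<i> / Complex 2 v)) (at v)" for v
  proof -
    have 1: "((\<lambda>v. ln (4 + v\<^sup>2) / 2) has_real_derivative v / (4 + v\<^sup>2)) (at v)"
      using p[of v] by (auto intro!: derivative_eq_intros simp: field_simps)
    have 2: "((\<lambda>v. arctan (v / 2)) has_real_derivative 2 / (4 + v\<^sup>2)) (at v)"
      using p[of v] by (auto intro!: derivative_eq_intros simp: field_simps)
    have "(H has_vector_derivative Complex (v / (4 + v\<^sup>2)) (2 / (4 + v\<^sup>2))) (at v)"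
      unfolding H_def Complex_eq
      by (intro has_vector_derivative_add has_vector_derivative_mult_right bounded_linear.has_vector_derivative[OF bounded_linear_of_real]
            1[unfolded has_real_derivative_iff_has_vector_derivative] 2[unfolded has_real_derivative_iff_has_vector_derivative])
    moreover have "Complex (v / (4 + v\<^sup>2)) (2 / (4 + v\<^sup>2)) = \<i> / Complex 2 v"
      by (simp add: complex_eq_iff Re_divide Im_divide)
    ultimately show ?thesis by simp
  qed
  define f where "f = (\<lambda>y. (H y - H (q - y)) / (\<i> * Complex 4 q))"
  have f: "(f has_vector_derivative conv_kernel q y) (at y)" for y
  proof -
    have "((\<lambda>y. q - y) has_real_derivative -1) (at y)" by (auto intro!: derivative_eq_intros)
    from vector_diff_chain_at[OF this[unfolded has_real_derivative_iff_has_vector_derivative] H]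
    have "((\<lambda>y. H (q - y)) has_vector_derivative (-1) *\<^sub>R (\<i> / Complex 2 (q - y))) (at y)" by (simp add: o_def)
    then have "(f has_vector_derivative (\<i> / Complex 2 y - (-1) *\<^sub>R (\<i> / Complex 2 (q - y))) / (\<i> * Complex 4 q)) (at y)"
      unfolding f_def by (intro has_vector_derivative_divide has_vector_derivative_diff H)
    moreover have "(\<i> / Complex 2 y - (-1) *\<^sub>R (\<i> / Complex 2 (q - y))) / (\<i> * Complex 4 q) = conv_kernel q y"
    proof -
      have s: "Complex 4 q = Complex 2 y + Complex 2 (q - y)" by (simp add: complex_eq_iff)
      have nz: "Complex 2 y \<noteq> 0" "Complex 2 (q - y) \<noteq> 0" "Complex 4 q \<noteq> 0" by (auto simp: Complex_nonzero)
      have "\<i> / Complex 2 y - (-1) *\<^sub>R (\<i> / Complex 2 (q - y)) = \<i> * Complex 4 q * conv_kernel q y"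
        unfolding conv_kernel_def s using nz(1,2) by (simp add: field_simps)
      then show ?thesis using nz(3) by simp
    qed
    ultimately show ?thesis by simp
  qed
  have dec: "f = (\<lambda>y. Complex (ln (4 + y\<^sup>2) / 2 - ln (4 + (q - y)\<^sup>2) / 2) (arctan (y / 2) - arctan ((q - y) / 2)) / (\<i> * Complex 4 q))"
    by (simp add: f_def H_def complex_diff)
  have at: "filterlim (\<lambda>y::real. y / 2) at_top at_top" "filterlim (\<lambda>y. (q - y) / 2) at_bot at_top"
    "filterlim (\<lambda>y::real. y / 2) at_bot at_bot" "filterlim (\<lambda>y. (q - y) / 2) at_top at_bot"
    by real_asymp+
  have l: "((\<lambda>y::real. ln (4 + y\<^sup>2) / 2 - ln (4 + (q - y)\<^sup>2) / 2) \<longlongrightarrow> 0) at_top" "((\<lambda>y::real. ln (4 + y\<^sup>2) / 2 - ln (4 + (q - y)\<^sup>2) / 2) \<longlongrightarrow> 0) at_bot"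
    by real_asymp+
  have "(f \<longlongrightarrow> Complex 0 (pi/2 - (-(pi/2))) / (\<i> * Complex 4 q)) at_top"
    unfolding dec by (intro tendsto_divide tendsto_Complex tendsto_diff l tendsto_const filterlim_compose[OF tendsto_arctan_at_top at(1)] filterlim_compose[OF tendsto_arctan_at_bot at(2)])
      (simp add: complex_eq_iff)
  moreover have "(f \<longlongrightarrow> Complex 0 (-(pi/2) - pi/2) / (\<i> * Complex 4 q)) at_bot"
    unfolding dec by (intro tendsto_divide tendsto_Complex tendsto_diff l tendsto_const filterlim_compose[OF tendsto_arctan_at_bot at(3)] filterlim_compose[OF tendsto_arctan_at_top at(4)])
      (simp add: complex_eq_iff)
  ultimately have "(LBINT y. conv_kernel q y) = Complex 0 (pi/2 - (-(pi/2))) / (\<i> * Complex 4 q) - Complex 0 (-(pi/2) - pi/2) / (\<i> * Complex 4 q)"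
    by (rule integral_derivative_limits[OF f conv_kernel_integrable])
  also have "\<dots> = Complex 0 (2 * pi) / (\<i> * Complex 4 q)" by (simp add: diff_divide_distrib[symmetric] complex_diff)
  also have "Complex 0 (2 * pi) = \<i> * (2 * pi)" by (simp add: complex_eq_iff)
  finally show ?thesis by simp
qed

lemma exp_over_cube_integrable: "integrable lborel (\<lambda>q. exp (Complex 4 q) / Complex 4 q ^ 3)"
proof (rule Bochner_Integration.integrable_bound[OF exp_over_square_integrable[of 4]])
  show "(\<lambda>q. exp (Complex 4 q) / Complex 4 q ^ 3) \<in> borel_measurable lborel"
    by (simp, intro borel_measurable_continuous_onI continuous_intros) (auto simp: Complex_nonzero)
  show "AE q in lborel. norm (exp (Complex 4 q) / Complex 4 q ^ 3) \<le> norm (exp (Complex 4 q) / (Complex 4 q)\<^sup>2)"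
  proof (rule AE_I2)
    fix q
    have n: "norm (Complex 4 q) \<ge> 4" using abs_Re_le_cmod[of "Complex 4 q"] by simp
    have "norm (Complex 4 q) ^ 2 \<le> norm (Complex 4 q) ^ 3" using n by (intro power_increasing) auto
    then show "norm (exp (Complex 4 q) / Complex 4 q ^ 3) \<le> norm (exp (Complex 4 q) / (Complex 4 q)\<^sup>2)"
      unfolding norm_divide norm_power using n by (intro divide_left_mono) (auto intro!: mult_pos_pos zero_less_power less_le_trans[OF _ n])
  qed
qed simp

text \<open>The derivative of exp s / s^2 integrates to 0 along the line, so the integral with the
  cube is half of the one with the square.\<close>

lemma exp_over_cube_integral: "(LBINT q. exp (Complex 4 q) / Complex 4 q ^ 3) = pi"
proof -
  note i2 = exp_over_square_integrable[of 4] and i3 = exp_over_cube_integrable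
  define f where "f = (\<lambda>q. exp (Complex 4 q) / (Complex 4 q)\<^sup>2)"
  define f' where "f' = (\<lambda>q. \<i> * (exp (Complex 4 q) / (Complex 4 q)\<^sup>2 - 2 * (exp (Complex 4 q) / Complex 4 q ^ 3)))"
  have "(LBINT q. f' q) = 0 - 0"
  proof (rule integral_derivative_limits)
    fix q
    have nz: "Complex 4 q \<noteq> 0" by (simp add: Complex_nonzero)
    have "((\<lambda>s. exp s / s\<^sup>2) has_field_derivative (exp s / s\<^sup>2 - 2 * (exp s / s ^ 3))) (at s)" if "s \<noteq> 0" for s :: complex
    proof -
      have "((\<lambda>s. exp s / s\<^sup>2) has_field_derivative (exp s * s\<^sup>2 - exp s * (2 * s)) / (s\<^sup>2 * s\<^sup>2)) (at s)"
        using that by (auto intro!: derivative_eq_intros)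
      moreover have "(exp s * s\<^sup>2 - exp s * (2 * s)) / (s\<^sup>2 * s\<^sup>2) = exp s / s\<^sup>2 - 2 * (exp s / s ^ 3)"
        using that by (simp add: divide_simps) (simp add: power_numeral_reduce algebra_simps)
      ultimately show ?thesis by simp
    qed
    from vertical_chain[OF this[OF nz]]
    show "(f has_vector_derivative f' q) (at q)" by (simp add: f_def f'_def)
  next
    show "integrable lborel f'" unfolding f'_def by (intro integrable_mult_right Bochner_Integration.integrable_diff i2 i3) simp
    have n: "norm (f q) \<le> exp 4 / (1 + q\<^sup>2)" for q
    proof -
      have "(norm (Complex 4 q))\<^sup>2 = 16 + q\<^sup>2" by (simp add: cmod_power2)
      then show ?thesis unfolding f_def by (simp add: norm_divide norm_power) (intro divide_left_mono, auto intro!: mult_pos_pos add_pos_nonneg)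
    qed
    have "((\<lambda>q::real. exp 4 / (1 + q\<^sup>2)) \<longlongrightarrow> 0) at_top" "((\<lambda>q::real. exp 4 / (1 + q\<^sup>2)) \<longlongrightarrow> 0) at_bot" by real_asymp+
    then show "(f \<longlongrightarrow> 0) at_top" "(f \<longlongrightarrow> 0) at_bot"
      by (auto intro!: Lim_null_comparison[of f "\<lambda>q. exp 4 / (1 + q\<^sup>2)"] always_eventually n)
  qed
  moreover have "(LBINT q. f' q) = \<i> * ((LBINT q. exp (Complex 4 q) / (Complex 4 q)\<^sup>2) - 2 * (LBINT q. exp (Complex 4 q) / Complex 4 q ^ 3))"
    unfolding f'_def
    by (subst integral_mult_right_zero, subst Bochner_Integration.integral_diff[OF i2 integrable_mult_right[OF i3]], simp, subst integral_mult_right_zero, rule refl)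
  ultimately show ?thesis by (simp add: exp_over_square_integral)
qed

definition D3 :: "real \<times> real \<times> real \<Rightarrow> real" where
  "D3 p = norm (conv_kernel (snd (snd p)) (fst p)) * norm (conv_kernel (snd (snd p)) (fst (snd p))) / norm (Complex 4 (snd (snd p)))"

text \<open>The argument is (y, w, q). One convolution kernel joins the opposite edges a + b and c +
  e of the cycle, with rescaled sums y and q - y, the other joins a + c and b + e; the pole of the
  full sum gives the remaining denominator.\<close>

definition H3 :: "real \<times> real \<times> real \<Rightarrow> complex" where
  "H3 p = exp (Complex 4 (snd (snd p))) / Complex 4 (snd (snd p)) * conv_kernel (snd (snd p)) (fst p) * conv_kernel (snd (snd p)) (fst (snd p))"

lemma continuous_on_H3: "continuous_on UNIV H3"
  unfolding H3_def[abs_def] conv_kernel_def by (intro continuous_intros) (auto simp: Complex_nonzero)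

lemma continuous_on_D3: "continuous_on UNIV D3"
  unfolding D3_def[abs_def] conv_kernel_def by (intro continuous_intros) (auto simp: Complex_nonzero)

lemma norm_H3: "norm (H3 p) = exp 4 * D3 p"
  by (simp add: H3_def D3_def norm_mult norm_divide)

text \<open>The last coordinate becomes the outermost variable: for fixed q the integrals over y and
  w separate.\<close>

lemma nn_integral_reverse3:
  fixes F :: "real \<times> real \<times> real \<Rightarrow> ennreal"
  assumes F: "F \<in> borel_measurable borel"
  shows "(\<integral>\<^sup>+p. F p \<partial>lborel) = (\<integral>\<^sup>+q. \<integral>\<^sup>+w. \<integral>\<^sup>+y. F (y, w, q) \<partial>lborel \<partial>lborel \<partial>lborel)"
proof -
  have m: "F \<in> borel_measurable (lborel \<Otimes>\<^sub>M lborel)" using F by (simp add: lborel_prod)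
  have "(\<integral>\<^sup>+p. F p \<partial>lborel) = (\<integral>\<^sup>+r. \<integral>\<^sup>+y. F (y, r) \<partial>lborel \<partial>lborel)"
    using lborel_pair.nn_integral_snd[OF m] by (simp add: lborel_prod)
  also have "(\<lambda>r. \<integral>\<^sup>+y. F (y, r) \<partial>lborel) \<in> borel_measurable (lborel \<Otimes>\<^sub>M lborel)"
    using lborel.borel_measurable_nn_integral_fst[OF measurable_pair_swap[OF m]] by (simp add: lborel_prod)
  from lborel_pair.nn_integral_snd[OF this]
  have "(\<integral>\<^sup>+r. \<integral>\<^sup>+y. F (y, r) \<partial>lborel \<partial>lborel) = (\<integral>\<^sup>+q. \<integral>\<^sup>+w. \<integral>\<^sup>+y. F (y, w, q) \<partial>lborel \<partial>lborel \<partial>lborel)"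
    by (simp add: lborel_prod)
  finally show ?thesis .
qed

lemma integral_reverse3:
  fixes F :: "real \<times> real \<times> real \<Rightarrow> complex"
  assumes F: "integrable lborel F"
  shows "(LBINT p. F p) = (\<integral>q. \<integral>w. \<integral>y. F (y, w, q) \<partial>lborel \<partial>lborel \<partial>lborel)"
proof -
  have i: "integrable (lborel \<Otimes>\<^sub>M lborel) (\<lambda>(y, r). F (y, r))" using F by (simp add: lborel_prod case_prod_unfold)
  have "(LBINT p. F p) = (\<integral>r. \<integral>y. F (y, r) \<partial>lborel \<partial>lborel)"
    using lborel_pair.integral_snd[OF i] by (simp add: lborel_prod case_prod_unfold)
  moreover have "integrable (lborel \<Otimes>\<^sub>M lborel) (\<lambda>(w, q). LBINT y. F (y, w, q))"
    using lborel_pair.integrable_snd[OF i] by (simp add: lborel_prod case_prod_unfold)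
  from lborel_pair.integral_snd[OF this]
  have "(\<integral>r. \<integral>y. F (y, r) \<partial>lborel \<partial>lborel) = (\<integral>q. \<integral>w. \<integral>y. F (y, w, q) \<partial>lborel \<partial>lborel \<partial>lborel)"
    by (simp add: lborel_prod case_prod_unfold)
  ultimately show ?thesis by simp
qed

text \<open>The larger of 1 + |y| and 1 + |q - y| is at least half of 1 + |q|. Half a power of it is
  spent on decay in q and the other half on raising the smaller one to the integrable exponent -3/2.
  Two kernels and the factor 1/|4 + iq| then give the decay |q|^(-2).\<close>

lemma conv_kernel_le: "norm (conv_kernel q y) \<le> 8 * nm q powr (-1/2) * (nm y powr (-3/2) + nm (q - y) powr (-3/2))"
proof -
  have pos: "nm x \<ge> 1" for x by simp
  have le: "nm x / 2 \<le> norm (Complex 2 x)" for x using norm_Complex_ge_half[of 2 x] by simp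
  have half: "1 / (nm x * nm z) \<le> 2 * nm q powr (-1/2) * nm x powr (-3/2)" if xz: "nm x \<le> nm z" "nm q \<le> nm x + nm z" for x z
  proof -
    have "nm q \<le> nm z + nm z" using xz by linarith
    then have z: "nm z \<ge> nm q / 2" by simp
    have "nm x powr (1/2) * (nm q / 2) powr (1/2) \<le> nm z powr (1/2) * nm z powr (1/2)"
      using xz z pos[of x] pos[of q] by (intro mult_mono powr_mono2) auto
    also have "\<dots> = nm z" using pos[of z] by (simp flip: powr_add)
    finally have "nm x * (nm x powr (1/2) * (nm q / 2) powr (1/2)) \<le> nm x * nm z" by (rule mult_left_mono) (use pos[of x] in simp)
    then have "1 / (nm x * nm z) \<le> 1 / (nm x * (nm x powr (1/2) * (nm q / 2) powr (1/2)))"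
      by (rule divide_left_mono) (use pos[of x] pos[of z] pos[of q] in \<open>auto intro!: mult_pos_pos\<close>)
    also have "nm x * (nm x powr (1/2) * (nm q / 2) powr (1/2)) = nm x powr (3/2) * (nm q / 2) powr (1/2)"
      using pos[of x] powr_add[of "nm x" 1 "1/2"] by simp
    also have "1 / (nm x powr (3/2) * (nm q / 2) powr (1/2)) = 2 powr (1/2) * nm q powr (-1/2) * nm x powr (-3/2)"
      by (simp add: powr_divide powr_minus divide_simps add_nonneg_eq_0_iff)
    also have "\<dots> \<le> 2 powr 1 * nm q powr (-1/2) * nm x powr (-3/2)" by (intro mult_right_mono powr_mono) auto
    finally show ?thesis by simp
  qed
  have sum: "nm q \<le> nm y + nm (q - y)" using abs_triangle_ineq[of y "q - y"] by simp
  have k: "1 / (nm y * nm (q - y)) \<le> 2 * nm q powr (-1/2) * (nm y powr (-3/2) + nm (q - y) powr (-3/2))"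
  proof (cases "nm y \<le> nm (q - y)")
    case True
    from half[OF this sum] show ?thesis unfolding distrib_left by (rule order_trans) simp
  next
    case False
    then have "1 / (nm (q - y) * nm y) \<le> 2 * nm q powr (-1/2) * nm (q - y) powr (-3/2)" using sum by (intro half) auto
    then have "1 / (nm y * nm (q - y)) \<le> 2 * nm q powr (-1/2) * nm (q - y) powr (-3/2)" by (simp add: mult.commute)
    then show ?thesis unfolding distrib_left by (rule order_trans) simp
  qed
  have "norm (conv_kernel q y) = 1 / (norm (Complex 2 y) * norm (Complex 2 (q - y)))" by (simp add: conv_kernel_def norm_divide norm_mult)
  also have "\<dots> \<le> 1 / ((nm y / 2) * (nm (q - y) / 2))"
    using pos[of y] pos[of "q - y"] by (intro divide_left_mono mult_mono le) (auto intro!: mult_pos_pos simp: Complex_nonzero)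
  also have "\<dots> = 4 * (1 / (nm y * nm (q - y)))" by simp
  also have "\<dots> \<le> 4 * (2 * nm q powr (-1/2) * (nm y powr (-3/2) + nm (q - y) powr (-3/2)))" by (intro mult_left_mono k) auto
  finally show ?thesis by simp
qed

lemma nn_integral_conv_kernel_le:
  "\<exists>M\<ge>0. \<forall>q. (\<integral>\<^sup>+y. ennreal (norm (conv_kernel q y)) \<partial>lborel) \<le> ennreal (M * nm q powr (-1/2))"
proof -
  define f where "f = (\<lambda>y. nm y powr (-3/2))"
  have f0: "f y \<ge> 0" for y by (simp add: f_def)
  have fi: "integrable lborel f" unfolding f_def using integrable_one_plus_abs_powr[of "3/2"] by simp
  have [measurable]: "f \<in> borel_measurable borel" using borel_measurable_integrable[OF fi] by simp
  define m where "m = (LBINT y. f y)"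
  have m0: "m \<ge> 0" unfolding m_def by (intro integral_nonneg_AE) (simp add: f0)
  have 1: "(\<integral>\<^sup>+y. ennreal (f y) \<partial>lborel) = ennreal m" unfolding m_def by (rule nn_integral_eq_integral[OF fi]) (simp add: f0)
  have 2: "(\<integral>\<^sup>+y. ennreal (f (q - y)) \<partial>lborel) = ennreal m" for q
    using nn_integral_real_affine[of "\<lambda>y. ennreal (f y)" "-1" q] 1 by simp
  have "(\<integral>\<^sup>+y. ennreal (norm (conv_kernel q y)) \<partial>lborel) \<le> ennreal (16 * m * nm q powr (-1/2))" for q
  proof -
    have "(\<integral>\<^sup>+y. ennreal (norm (conv_kernel q y)) \<partial>lborel) \<le> (\<integral>\<^sup>+y. ennreal (8 * nm q powr (-1/2)) * (ennreal (f y) + ennreal (f (q - y))) \<partial>lborel)"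
    proof (intro nn_integral_mono)
      fix y
      have "ennreal (norm (conv_kernel q y)) \<le> ennreal (8 * nm q powr (-1/2) * (f y + f (q - y)))"
        unfolding f_def by (intro ennreal_leI conv_kernel_le)
      then show "ennreal (norm (conv_kernel q y)) \<le> ennreal (8 * nm q powr (-1/2)) * (ennreal (f y) + ennreal (f (q - y)))"
        using f0 by (simp add: ennreal_mult' flip: ennreal_plus)
    qed
    also have "\<dots> = ennreal (8 * nm q powr (-1/2)) * (ennreal m + ennreal m)"
      by (subst nn_integral_cmult) (auto simp: nn_integral_add 1 2)
    also have "\<dots> = ennreal (16 * m * nm q powr (-1/2))"
      using m0 by (simp add: ennreal_mult'[symmetric] flip: ennreal_plus)
    finally show ?thesis .
  qed
  then show ?thesis using m0 by (intro exI[of _ "16 * m"]) auto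
qed

lemma D3_integrable: "integrable lborel D3"
proof (rule integrableI_bounded)
  show "D3 \<in> borel_measurable lborel" using borel_measurable_continuous_onI[OF continuous_on_D3] by simp
  have Dm: "(\<lambda>p. ennreal (D3 p)) \<in> borel_measurable borel"
    using borel_measurable_continuous_onI[OF continuous_on_D3] by measurable
  have [measurable]: "conv_kernel q \<in> borel_measurable borel" for q by (rule borel_measurable_continuous_onI[OF continuous_conv_kernel])
  obtain M where M: "M \<ge> 0" "\<And>q. (\<integral>\<^sup>+y. ennreal (norm (conv_kernel q y)) \<partial>lborel) \<le> ennreal (M * nm q powr (-1/2))"
    using nn_integral_conv_kernel_le by blast
  have D0: "D3 p \<ge> 0" for p by (simp add: D3_def)
  define I where "I = (\<lambda>q. \<integral>\<^sup>+y. ennreal (norm (conv_kernel q y)) \<partial>lborel)"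
  have inner: "(\<integral>\<^sup>+w. \<integral>\<^sup>+y. ennreal (D3 (y, w, q)) \<partial>lborel \<partial>lborel) \<le> ennreal (2 * M\<^sup>2 * nm q powr (-2))" for q
  proof -
    have e: "ennreal (D3 (y, w, q)) = ennreal (norm (conv_kernel q w)) * ennreal (1 / norm (Complex 4 q)) * ennreal (norm (conv_kernel q y))" for y w
      by (simp add: D3_def ennreal_mult'[symmetric] mult_ac)
    have "(\<integral>\<^sup>+w. \<integral>\<^sup>+y. ennreal (D3 (y, w, q)) \<partial>lborel \<partial>lborel) = (\<integral>\<^sup>+w. ennreal (norm (conv_kernel q w)) * (ennreal (1 / norm (Complex 4 q)) * I q) \<partial>lborel)"
      unfolding e I_def by (simp add: nn_integral_cmult mult.assoc)
    also have "\<dots> = I q * (ennreal (1 / norm (Complex 4 q)) * I q)" unfolding I_def by (rule nn_integral_multc) simp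
    also have "\<dots> \<le> ennreal (M * nm q powr (-1/2)) * (ennreal (2 / nm q) * ennreal (M * nm q powr (-1/2)))"
    proof (intro mult_mono)
      have "nm q / 2 \<le> norm (Complex 4 q)" "nm q / 2 > 0" using norm_Complex_ge_half[of 4 q] by (simp_all add:)
      then have "1 / norm (Complex 4 q) \<le> 1 / (nm q / 2)" by (intro frac_le) auto
      then show "ennreal (1 / norm (Complex 4 q)) \<le> ennreal (2 / nm q)" by (intro ennreal_leI) simp
    qed (use M in \<open>auto simp: I_def\<close>)
    also have "\<dots> = ennreal (2 * M\<^sup>2 * (nm q powr (-1/2) * nm q powr (-1/2) * nm q powr (-1)))"
      using M by (simp add: ennreal_mult'[symmetric] powr_minus_divide power2_eq_square mult_ac)
    also have "nm q powr (-1/2) * nm q powr (-1/2) * nm q powr (-1) = nm q powr (-2)" unfolding powr_add[symmetric] by simp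
    finally show ?thesis .
  qed
  have "(\<integral>\<^sup>+p. ennreal (norm (D3 p)) \<partial>lborel) = (\<integral>\<^sup>+q. \<integral>\<^sup>+w. \<integral>\<^sup>+y. ennreal (D3 (y, w, q)) \<partial>lborel \<partial>lborel \<partial>lborel)"
    using nn_integral_reverse3[OF Dm] D0 by simp
  also have "\<dots> \<le> (\<integral>\<^sup>+q. ennreal (2 * M\<^sup>2 * nm q powr (-2)) \<partial>lborel)" by (intro nn_integral_mono inner)
  also have "\<dots> = ennreal (LBINT q. 2 * M\<^sup>2 * nm q powr (-2))"
    using integrable_one_plus_abs_powr[of 2] by (intro nn_integral_eq_integral integrable_mult_right) auto
  finally show "(\<integral>\<^sup>+p. ennreal (norm (D3 p)) \<partial>lborel) < \<infinity>" by (rule le_less_trans) simp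
qed

lemma H3_integrable: "integrable lborel H3"
proof (rule Bochner_Integration.integrable_bound)
  show "integrable lborel (\<lambda>p. exp 4 * D3 p)" by (intro integrable_mult_right D3_integrable)
  show "H3 \<in> borel_measurable lborel" using borel_measurable_continuous_onI[OF continuous_on_H3] by simp
  show "AE p in lborel. norm (H3 p) \<le> norm (exp 4 * D3 p)" unfolding norm_H3 by (intro AE_I2) (simp add: abs_ge_self)
qed

lemma H3_integral: "(LBINT p. H3 p) = 4 * pi^3"
proof -
  have "(LBINT p. H3 p) = (LBINT q. (2 * pi)\<^sup>2 * (exp (Complex 4 q) / Complex 4 q ^ 3))"
    unfolding integral_reverse3[OF H3_integrable]
  proof (intro Bochner_Integration.integral_cong refl)
    fix q
    have y: "(LBINT y. H3 (y, w, q)) = exp (Complex 4 q) / Complex 4 q * (2 * pi / Complex 4 q) * conv_kernel q w" for w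
      using conv_kernel_integrable[of q] by (simp add: H3_def conv_kernel_integral)
    show "(\<integral>w. \<integral>y. H3 (y, w, q) \<partial>lborel \<partial>lborel) = (2 * pi)\<^sup>2 * (exp (Complex 4 q) / Complex 4 q ^ 3)"
      unfolding y using conv_kernel_integrable[of q] by (simp add: conv_kernel_integral power2_eq_square power3_eq_cube mult_ac)
  qed
  also have "\<dots> = (2 * pi)\<^sup>2 * pi" unfolding integral_mult_right_zero exp_over_cube_integral by simp
  finally show ?thesis by (simp add: power2_eq_square power3_eq_cube)
qed

section \<open>The main term for k = 2\<close>

lemma norm_Complex_mono: "\<bar>p\<bar> \<le> \<bar>q\<bar> \<Longrightarrow> \<bar>x\<bar> \<le> \<bar>y\<bar> \<Longrightarrow> norm (Complex p x) \<le> norm (Complex q y)"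
  unfolding complex_norm by (intro real_sqrt_le_mono add_mono) (simp_all only: abs_le_square_iff)

lemma near_geometry:
  assumes "near a b c e"
  shows "\<bar>a + b\<bar> < 1/10" "\<bar>a + c\<bar> < 1/10" "\<bar>b + e\<bar> < 1/10" "\<bar>c + e\<bar> < 1/10"
    and "\<bar>a + e\<bar> \<ge> 9/5 * \<bar>a\<bar>" "\<bar>b + c\<bar> \<ge> 9/5 * \<bar>a\<bar>" "\<bar>a + b + e\<bar> \<le> 13/10 * \<bar>a\<bar>" "\<bar>a + b + c\<bar> \<le> 13/10 * \<bar>a\<bar>" "\<bar>b\<bar> \<ge> 9/10 * \<bar>a\<bar>"
proof -
  define m where "m = min 1 \<bar>a\<bar> / 10"
  have m: "m \<le> 1/10" "m \<le> \<bar>a\<bar> / 10" by (auto simp: m_def)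
  have 1: "\<bar>a + b\<bar> < m" and 2: "\<bar>a + c\<bar> < m" and 3: "\<bar>b + e\<bar> < m" and 4: "\<bar>c + e\<bar> < m" using assms by (auto simp: near_def m_def)
  show "\<bar>a + b\<bar> < 1/10" "\<bar>a + c\<bar> < 1/10" "\<bar>b + e\<bar> < 1/10" "\<bar>c + e\<bar> < 1/10" using 1 2 3 4 m by linarith+
  show "\<bar>a + e\<bar> \<ge> 9/5 * \<bar>a\<bar>" "\<bar>b + c\<bar> \<ge> 9/5 * \<bar>a\<bar>" "\<bar>a + b + e\<bar> \<le> 13/10 * \<bar>a\<bar>" "\<bar>a + b + c\<bar> \<le> 13/10 * \<bar>a\<bar>" "\<bar>b\<bar> \<ge> 9/10 * \<bar>a\<bar>"
    using 1 2 3 m(2) by linarith+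
qed

text \<open>At the limit point the four triple sums are ia, ia, -ia, -ia and the two large pair sums
  are 2ia and -2ia, so the zeros and poles leave a^4 / (4 a^2) = a^2 / 4.\<close>

definition g2 :: "real \<Rightarrow> complex" where
  "g2 a = Gext 2 (line4 a) *
     (zeta_reg (Complex 0 (2 * a)) * zeta_reg (Complex 0 (-2 * a))) * of_real (a\<^sup>2 / 4) / (zeta_reg (Complex 0 a) * zeta_reg (Complex 0 (-a))) ^ 4"

lemma kk_cross_le:
  assumes "u \<ge> 4" "\<bar>x\<bar> < 1/10"
  shows "kk u x \<le> 2 * (1 / norm (Complex (2/u) x))"
proof -
  have p: "norm (Complex (2/u) x) > 0" using assms(1) by (simp add: Complex_nonzero)
  have "2 / u \<le> 1/2" "2 / u \<ge> 0" using assms(1) by (auto simp: field_simps)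
  then have "norm (Complex (2/u) x) \<le> 1" using cmod_le[of "Complex (2/u) x"] assms(2) by simp
  then have "1 \<le> 1 / norm (Complex (2/u) x)" using p by (simp add: le_divide_eq)
  then show ?thesis by (simp add: kk_def)
qed

context zeta_estimates
begin

text \<open>In the main region two of the triple sums are at most about |a|, whereas the pairs a + e
  and b + c are almost 2 |a|. The zero of such a triple controls the pole of such a pair even when a
  is small; the ratio 3/2 also covers the real parts 3/u and 2/u.\<close>

lemma triple_pair_le:
  assumes u: "u \<ge> 4" and xy: "\<bar>x\<bar> \<le> 13/10 * r" "\<bar>y\<bar> \<ge> 9/5 * r"
  shows "t3 u x * kk u y \<le> 4"
proof -
  define N where "N = norm (Complex (2/u) y)"
  have N: "N > 0" using u by (simp add: N_def Complex_nonzero)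
  have "r \<ge> 0" using xy by linarith
  then have "\<bar>x\<bar> \<le> \<bar>3/2 * y\<bar>" using xy by (simp add: abs_mult)
  then have "norm (Complex (3/u) x) \<le> norm (Complex (3/2 * (2/u)) (3/2 * y))" by (intro norm_Complex_mono) auto
  also have "Complex (3/2 * (2/u)) (3/2 * y) = of_real (3/2) * Complex (2/u) y" by (simp add: complex_eq_iff)
  also have "norm \<dots> = 3/2 * N" unfolding norm_mult by (simp add: N_def)
  finally have t: "t3 u x \<le> 1" "t3 u x \<le> 3/2 * N" "t3 u x \<ge> 0" by (auto simp: t3_def)
  have "t3 u x * (1 / N) \<le> (3/2 * N) * (1 / N)" using t N by (intro mult_right_mono) auto
  then have "t3 u x * (1 / N) \<le> 3/2" using N by simp
  then show ?thesis using t(1) unfolding kk_def N_def[symmetric] distrib_left by linarith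
qed

definition cN :: real where "cN = c2 * (2 * C^4) * (4 * 4) * 16 * 3"

lemma cN_pos: "cN \<ge> 0" using C1 c2_pos by (simp add: cN_def)

text \<open>Four small pair sums and the full sum keep their poles. The two large pairs are absorbed
  by two triples, the other two triples are bounded by 1. The decay in a comes from the undamped V
  factors at a and b; those at c and e are merely bounded.\<close>

lemma Phi2_near:
  assumes u: "u \<ge> 4 / d" and near: "near a b c e"
  shows "norm (Phi2 u a b c e) \<le> cN * om a * ((1 / norm (Complex (2/u) (a+b))) * (1 / norm (Complex (2/u) (a+c))) * (1 / norm (Complex (2/u) (b+e))) *
     (1 / norm (Complex (2/u) (c+e))) * (1 / norm (Complex (4/u) (a+b+c+e))))"
proof -
  note ub = u_bounds[OF u] and ng = near_geometry[OF near]
  have om0: "om x \<ge> 0" for x using om_pos[of x] by simp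
  have k0: "kk u x \<ge> 0" for x using kk_ge_1[of u x] by simp
  have t0: "t3 u x \<ge> 0" "t3 u x \<le> 1" for x by (simp_all add: t3_def)
  define n2 where "n2 = (\<lambda>x. 1 / norm (Complex (2/u) x))"
  define n4 where "n4 = 1 / norm (Complex (4/u) (a+b+c+e))"
  have n0: "n2 x \<ge> 0" "n4 \<ge> 0" for x by (auto simp: n2_def n4_def)
  have kc: "kk u x \<le> 2 * n2 x" if "\<bar>x\<bar> < 1/10" for x unfolding n2_def by (rule kk_cross_le[OF ub(1) that])
  have q: "1 + 1 / norm (Complex (4/u) (a+b+c+e)) \<le> 3 * n4"
  proof -
    have p: "norm (Complex (4/u) (a+b+c+e)) > 0" using ub by (simp add: Complex_nonzero)
    have "\<bar>a+b+c+e\<bar> \<le> 1" using ng(1,4) by linarith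
    then have "norm (Complex (4/u) (a+b+c+e)) \<le> 2" using cmod_le[of "Complex (4/u) (a+b+c+e)"] ub d01 by simp
    then have "1 \<le> 2 / norm (Complex (4/u) (a+b+c+e))" using p by (simp add: le_divide_eq)
    then show ?thesis by (simp add: n4_def)
  qed
  have V1: "Vw u x \<le> C" for x
  proof -
    have "nm x powr (-1 + 1/1024) \<le> nm x powr 0" by (intro powr_mono) auto
    also have "\<dots> = 1" by (simp add: add_nonneg_eq_0_iff)
    finally have "nm x powr (-1 + 1/1024) \<le> 1" .
    then have "C * nm x powr (-1 + 1/1024) \<le> C * 1" using C1 by (intro mult_left_mono) auto
    then show ?thesis using Vw_le(2)[OF u, of x] by linarith
  qed
  have Vb: "Vw u b \<le> C * (2 * nm a powr (-1 + 1/1024))"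
  proof -
    have "nm b powr (-1 + 1/1024) \<le> (nm a / 2) powr (-1 + 1/1024)"
      using ng(9) by (intro powr_mono2') auto
    also have "\<dots> = 2 powr (1 - 1/1024) * nm a powr (-1 + 1/1024)"
      using powr_divide[of "1 + \<bar>a\<bar>" 2 "-1 + 1/1024"] powr_minus_divide[of "2::real" "-1 + 1/1024"] by (simp add: mult.commute)
    also have "\<dots> \<le> 2 powr 1 * nm a powr (-1 + 1/1024)" by (intro mult_right_mono powr_mono) auto
    finally have "C * nm b powr (-1 + 1/1024) \<le> C * (2 * nm a powr (-1 + 1/1024))" using C1 by (intro mult_left_mono) auto
    then show ?thesis using Vw_le(2)[OF u, of b] by linarith
  qed
  have V: "Vw u a * Vw u b * Vw u c * Vw u e \<le> 2 * C^4 * om a"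
  proof -
    have "Vw u a * Vw u b * Vw u c * Vw u e \<le> (C * nm a powr (-1 + 1/1024)) * (C * (2 * nm a powr (-1 + 1/1024))) * C * C"
      using C1 by (intro mult_mono Vw_le(2)[OF u] Vb V1 mult_nonneg_nonneg Vw_nonneg) auto
    also have "\<dots> = 2 * C^4 * (nm a powr (-1 + 1/1024) * nm a powr (-1 + 1/1024))" by (simp add: power4_eq_xxxx mult_ac)
    also have "nm a powr (-1 + 1/1024) * nm a powr (-1 + 1/1024) = nm a powr (-2 + 2/1024)" by (simp flip: powr_add)
    also have "2 * C^4 * nm a powr (-2 + 2/1024) \<le> 2 * C^4 * om a"
      unfolding om_def using C1 by (intro mult_left_mono powr_mono) auto
    finally show ?thesis .
  qed
  have K: "triples4 u a b c e * pairs6 u a b c e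
     \<le> 4 * 4 * (1 * 1) * ((2 * n2 (a+b)) * (2 * n2 (a+c)) * (2 * n2 (b+e)) * (2 * n2 (c+e)))"
  proof -
    have "triples4 u a b c e * pairs6 u a b c e
      = (t3 u (a+b+c) * kk u (b+c)) * (t3 u (a+b+e) * kk u (a+e)) * (t3 u (a+c+e) * t3 u (b+c+e)) * (kk u (a+b) * kk u (a+c) * kk u (b+e) * kk u (c+e))"
      by (simp add: mult_ac)
    also have "\<dots> \<le> 4 * 4 * (1 * 1) * ((2 * n2 (a+b)) * (2 * n2 (a+c)) * (2 * n2 (b+e)) * (2 * n2 (c+e)))"
      by (intro mult_mono triple_pair_le[OF ub(1) ng(8) ng(6)] triple_pair_le[OF ub(1) ng(7) ng(5)] kc ng(1-4) t0 mult_nonneg_nonneg k0 n0) simp_all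
    finally show ?thesis .
  qed
  have "norm (Phi2 u a b c e) \<le> c2 * (2 * C^4 * om a) * (4 * 4 * (1 * 1) * ((2 * n2 (a+b)) * (2 * n2 (a+c)) * (2 * n2 (b+e)) * (2 * n2 (c+e)))) * (3 * n4)"
  proof (rule order_trans[OF Phi2_bound[OF u]], rule mult_mono[OF mult_mono[OF mult_left_mono[OF V] K] q])
    show "0 \<le> c2 * (2 * C^4 * om a)" using C1 c2_pos by (intro mult_nonneg_nonneg om0) auto
    then show "0 \<le> c2 * (2 * C^4 * om a) * (4 * 4 * (1 * 1) * ((2 * n2 (a+b)) * (2 * n2 (a+c)) * (2 * n2 (b+e)) * (2 * n2 (c+e))))"
      by (rule mult_nonneg_nonneg) (intro mult_nonneg_nonneg n0, simp_all)
  qed (use c2_pos in \<open>auto intro!: mult_nonneg_nonneg t0 k0\<close>)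
  also have "\<dots> = cN * om a * (n2 (a+b) * n2 (a+c) * n2 (b+e) * n2 (c+e) * n4)" by (simp add: cN_def mult_ac)
  finally show ?thesis by (simp add: n2_def n4_def)
qed

definition Psi2 :: "real \<Rightarrow> real4 \<Rightarrow> complex" where
  "Psi2 u z = NPhi u (aff u z) / of_real (u^5)"

lemma aff_sums:
  fixes a y w q :: real
  assumes u: "u > 0"
  defines "b \<equiv> -a + y/u" and "c \<equiv> -a + w/u" and "e \<equiv> a + (q - y - w)/u"
  shows "a + b = y/u \<and> a + c = w/u \<and> b + e = (q - w)/u \<and> c + e = (q - y)/u \<and> a + b + c + e = q/u"
  using u by (simp_all add: b_def c_def e_def field_simps)

lemma Complex_scale: "u > 0 \<Longrightarrow> Complex (r / u) (x / u) = Complex r x / of_real u"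
  by (simp add: complex_eq_iff)

text \<open>After rescaling, each of the five poles equals exactly u times a pole independent of u,
  and the division by u^5 removes these factors. The majorant is therefore the same for all
  u.\<close>

lemma Psi2_bound:
  assumes u: "u \<ge> 4 / d"
  shows "norm (Psi2 u z) \<le> cN * (om (fst z) * D3 (snd z))"
proof -
  note ub = u_bounds[OF u]
  obtain a y w q where z: "z = (a, y, w, q)" by (metis prod.exhaust)
  define b where "b = -a + y/u"
  define c where "c = -a + w/u"
  define e where "e = a + (q - y - w)/u"
  note s0 = aff_sums[OF ub(5), where a = a and y = y and w = w and q = q, folded b_def c_def e_def]
  note s = s0[THEN conjunct1] s0[THEN conjunct2, THEN conjunct1] s0[THEN conjunct2, THEN conjunct2, THEN conjunct1]
    s0[THEN conjunct2, THEN conjunct2, THEN conjunct2, THEN conjunct1] s0[THEN conjunct2, THEN conjunct2, THEN conjunct2, THEN conjunct2]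
  have aff: "aff u z = (a, b, c, e)" by (simp add: aff_def z b_def c_def e_def)
  have nn: "0 \<le> cN * (om (fst z) * D3 (snd z))" using om_pos[of "fst z"] by (intro mult_nonneg_nonneg cN_pos) (auto simp: D3_def)
  show ?thesis
  proof (cases "near a b c e")
    case True
    have "norm (Psi2 u z) = norm (Phi2 u a b c e) / u^5"
      using True ub by (simp add: Psi2_def NPhi_def aff near_set_def norm_divide norm_power)
    also have "\<dots> \<le> cN * om a * ((1 / norm (Complex (2/u) (a+b))) * (1 / norm (Complex (2/u) (a+c))) * (1 / norm (Complex (2/u) (b+e))) *
     (1 / norm (Complex (2/u) (c+e))) * (1 / norm (Complex (4/u) (a+b+c+e)))) / u^5"
      using ub by (intro divide_right_mono Phi2_near[OF u True]) auto
    also have "\<dots> = cN * om a * ((1 / norm (Complex 2 y)) * (1 / norm (Complex 2 w)) * (1 / norm (Complex 2 (q - w))) * (1 / norm (Complex 2 (q - y))) * (1 / norm (Complex 4 q)))"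
      unfolding s(5) unfolding s(1-4) Complex_scale[OF ub(5)] norm_divide using ub by (simp add: power_numeral_reduce)
    also have "\<dots> = cN * (om (fst z) * D3 (snd z))"
      by (simp add: D3_def z conv_kernel_def norm_divide norm_mult mult_ac)
    finally show ?thesis .
  next
    case False
    then have "Psi2 u z = 0" by (simp add: Psi2_def NPhi_def aff near_set_def)
    then show ?thesis using nn by simp
  qed
qed

lemma Psi2_dominating: "integrable lborel (\<lambda>z. cN * (om (fst z) * D3 (snd z)))"
  by (intro integrable_mult_right integrable_lborel_times om_integrable D3_integrable)

lemma Psi2_measurable: "u \<ge> 4 / d \<Longrightarrow> Psi2 u \<in> borel_measurable borel"
proof -
  assume u: "u \<ge> 4 / d"
  note ub = u_bounds[OF u]
  have [measurable]: "NPhi u \<in> borel_measurable borel" using borel_measurable_integrable[OF NPhi_integrable[OF u]] by simp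
  note [measurable] = aff_measurable[OF ub(5)]
  show ?thesis unfolding Psi2_def by measurable
qed

lemma tendsto_rz:
  assumes "(f \<longlongrightarrow> Complex 0 x) F" "x \<noteq> 0"
  shows "((\<lambda>u. rz (f u)) \<longlongrightarrow> zeta_reg (Complex 0 x) / Complex 0 x) F" "((\<lambda>u. 1 / rz (f u)) \<longlongrightarrow> Complex 0 x / zeta_reg (Complex 0 x)) F"
proof -
  have x: "Complex 0 x \<noteq> 0" using assms(2) by (simp add: complex_eq_iff)
  have z: "zeta_reg (Complex 0 x) \<noteq> 0" using d01 by (intro reg_nonzero) auto
  show 1: "((\<lambda>u. rz (f u)) \<longlongrightarrow> zeta_reg (Complex 0 x) / Complex 0 x) F"
    unfolding rz_def by (intro tendsto_divide tendsto_zeta_reg assms x) simp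
  have "((\<lambda>u. 1 / rz (f u)) \<longlongrightarrow> 1 / (zeta_reg (Complex 0 x) / Complex 0 x)) F"
    by (intro tendsto_divide 1 tendsto_const) (use x z in simp)
  then show "((\<lambda>u. 1 / rz (f u)) \<longlongrightarrow> Complex 0 x / zeta_reg (Complex 0 x)) F" by simp
qed

lemma near_eventually:
  assumes "a \<noteq> 0"
  shows "\<forall>\<^sub>F u in at_top. aff u (a, y, w, q) \<in> near_set"
proof -
  define m where "m = min 1 \<bar>a\<bar> / 10"
  have m: "m > 0" using assms by (simp add: m_def)
  have ev: "\<forall>\<^sub>F u::real in at_top. \<bar>x / u\<bar> < m" for x
  proof -
    have "((\<lambda>u. x / u) \<longlongrightarrow> 0) at_top" by real_asymp
    then have "((\<lambda>u. \<bar>x / u\<bar>) \<longlongrightarrow> 0) at_top" by (rule tendsto_rabs_zero)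
    then show ?thesis using m by (intro order_tendstoD(2))
  qed
  show ?thesis using ev[of y] ev[of w] ev[of "q - w"] ev[of "q - y"] eventually_gt_at_top[of "0::real"]
  proof eventually_elim
    case (elim u)
    note s0 = aff_sums[OF elim(5), where a = a and y = y and w = w and q = q]
    note s = s0[THEN conjunct1] s0[THEN conjunct2, THEN conjunct1] s0[THEN conjunct2, THEN conjunct2, THEN conjunct1]
      s0[THEN conjunct2, THEN conjunct2, THEN conjunct2, THEN conjunct1] s0[THEN conjunct2, THEN conjunct2, THEN conjunct2, THEN conjunct2]
    show ?case unfolding near_set_def near_def aff_def mem_Collect_eq fst_conv snd_conv s m_def[symmetric] using elim by simp
  qed
qed

lemma Psi2_tendsto:
  "((\<lambda>u. Psi2 u z) \<longlongrightarrow> g2 (fst z) * H3 (snd z)) at_top"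
proof -
  obtain a y w q where z: "z = (a, y, w, q)" by (metis prod.exhaust)
  show ?thesis
  proof (cases "a = 0")
    \<comment> \<open>At a = 0 the condition \<open>near\<close> fails for every u, and
      \<open>g2 0\<close> vanishes through its factor a^2, so both sides are 0.\<close>
    case True
    then have "Psi2 u z = 0" for u by (simp add: Psi2_def NPhi_def near_set_def near_def z aff_def)
    then show ?thesis using True by (simp add: z g2_def)
  next
    case a: False
    define b where "b = (\<lambda>u. -a + y/u)"
    define c where "c = (\<lambda>u. -a + w/u)"
    define e where "e = (\<lambda>u. a + (q - y - w)/u)"
    have x0: "((\<lambda>u. x / u) \<longlongrightarrow> 0) at_top" for x :: real by real_asymp
    have sh: "((\<lambda>u. p + x / u) \<longlongrightarrow> p) at_top" for p x :: real using tendsto_add[OF tendsto_const[of p] x0[of x]] by simp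
    have lb: "(b \<longlongrightarrow> -a) at_top" and lc: "(c \<longlongrightarrow> -a) at_top" and le: "(e \<longlongrightarrow> a) at_top"
      unfolding b_def c_def e_def by (rule sh)+
    note sg = tendsto_sg[OF tendsto_const[of a]] tendsto_sg[OF lb] tendsto_sg[OF lc] tendsto_sg[OF le]
    have small: "((\<lambda>u. zeta_reg (Complex (r / u) (x / u))) \<longlongrightarrow> 1) at_top" for r x
      using tendsto_zeta_reg[OF tendsto_Complex[OF x0[of r] x0[of x]]] by (simp flip: zero_complex.code)
    have add: "Complex 0 s + Complex 0 t = Complex 0 (s + t)" for s t by (simp add: complex_eq_iff)
    note sg2 = tendsto_add[OF sg(1) sg(4), unfolded add] tendsto_add[OF sg(2) sg(3), unfolded add]
    note sg3 = tendsto_add[OF tendsto_add[OF sg(1) sg(2)] sg(3), unfolded add] tendsto_add[OF tendsto_add[OF sg(1) sg(2)] sg(4), unfolded add]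
       tendsto_add[OF tendsto_add[OF sg(1) sg(3)] sg(4), unfolded add] tendsto_add[OF tendsto_add[OF sg(2) sg(3)] sg(4), unfolded add]
    have r2: "((\<lambda>u. rz (sg u a + sg u (e u))) \<longlongrightarrow> zeta_reg (Complex 0 (2*a)) / Complex 0 (2*a)) at_top"
      "((\<lambda>u. rz (sg u (b u) + sg u (c u))) \<longlongrightarrow> zeta_reg (Complex 0 (-2*a)) / Complex 0 (-2*a)) at_top"
      using tendsto_rz(1)[OF sg2(1)] tendsto_rz(1)[OF sg2(2)] a by simp_all
    have r3: "((\<lambda>u. 1 / rz (sg u a + sg u (b u) + sg u (c u))) \<longlongrightarrow> Complex 0 (-a) / zeta_reg (Complex 0 (-a))) at_top"
      "((\<lambda>u. 1 / rz (sg u a + sg u (b u) + sg u (e u))) \<longlongrightarrow> Complex 0 a / zeta_reg (Complex 0 a)) at_top"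
      "((\<lambda>u. 1 / rz (sg u a + sg u (c u) + sg u (e u))) \<longlongrightarrow> Complex 0 a / zeta_reg (Complex 0 a)) at_top"
      "((\<lambda>u. 1 / rz (sg u (b u) + sg u (c u) + sg u (e u))) \<longlongrightarrow> Complex 0 (-a) / zeta_reg (Complex 0 (-a))) at_top"
      using tendsto_rz(2)[OF sg3(1)] tendsto_rz(2)[OF sg3(2)] tendsto_rz(2)[OF sg3(3)] tendsto_rz(2)[OF sg3(4)] a by simp_all
    have G: "((\<lambda>u. Gext 2 (vec4 (sg u a) (sg u (b u)) (sg u (c u)) (sg u (e u)))) \<longlongrightarrow> Gext 2 (line4 a)) at_top"
    proof (rule tendsto_Gext)
      fix j show "((\<lambda>u. vec4 (sg u a) (sg u (b u)) (sg u (c u)) (sg u (e u)) j) \<longlongrightarrow> (line4 a) j) at_top"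
        unfolding vec4_def by (cases "j = 0"; cases "j = 1"; cases "j = 2") (use sg in simp_all)
      show "line4 a \<in> Gregion 2" by (rule vec4_Gregion) auto
      show "\<forall>\<^sub>F u in at_top. vec4 (sg u a) (sg u (b u)) (sg u (c u)) (sg u (e u)) \<in> Gregion 2"
        using eventually_gt_at_top[of "0::real"] by eventually_elim (rule vec4_Gregion, auto)
    qed
    define E where "E = exp (Complex 4 q) / (Complex 2 y * Complex 2 w * Complex 2 (q - w) * Complex 2 (q - y) * Complex 4 q)"
    define F where "F = (\<lambda>u. E *
      (zeta_reg (Complex (2/u) (y/u)) * zeta_reg (Complex (2/u) (w/u)) * zeta_reg (Complex (2/u) ((q - w)/u)) * zeta_reg (Complex (2/u) ((q - y)/u)) * zeta_reg (Complex (4/u) (q/u))) *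
      (Vfac (hh u) (sg u a) * Vfac (hh u) (sg u (b u)) * Vfac (hh u) (sg u (c u)) * Vfac (hh u) (sg u (e u))) *
      (rz (sg u a + sg u (e u)) * rz (sg u (b u) + sg u (c u))) *
      (1 / rz (sg u a + sg u (b u) + sg u (c u)) * (1 / rz (sg u a + sg u (b u) + sg u (e u))) * (1 / rz (sg u a + sg u (c u) + sg u (e u))) * (1 / rz (sg u (b u) + sg u (c u) + sg u (e u)))) *
      Gext 2 (vec4 (sg u a) (sg u (b u)) (sg u (c u)) (sg u (e u))))"
    define Z where "Z = zeta_reg (Complex 0 a)"
    define Z' where "Z' = zeta_reg (Complex 0 (-a))"
    define V0 where "V0 = 1 / Z * (1 / Z') * (1 / Z') * (1 / Z)"
    define R0 where "R0 = zeta_reg (Complex 0 (2*a)) / Complex 0 (2*a) * (zeta_reg (Complex 0 (-2*a)) / Complex 0 (-2*a))"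
    define T0 where "T0 = Complex 0 (-a) / Z' * (Complex 0 a / Z) * (Complex 0 a / Z) * (Complex 0 (-a) / Z')"
    define G0 where "G0 = Gext 2 (line4 a)"
    have "(F \<longlongrightarrow> E * (1 * 1 * 1 * 1 * 1) * V0 * R0 * T0 * G0) at_top"
      unfolding F_def V0_def R0_def T0_def G0_def Z_def Z'_def by (intro tendsto_mult tendsto_const small r2 r3 G tendsto_Vfac lb lc le)
    also have "E * (1 * 1 * 1 * 1 * 1) * V0 * R0 * T0 * G0 = E * G0 * (V0 * R0 * T0)" by simp
    also have "V0 * R0 * T0 = zeta_reg (Complex 0 (2*a)) * zeta_reg (Complex 0 (-2*a)) * of_real (a\<^sup>2 / 4) / (Z * Z') ^ 4"
    proof -
      have i: "Complex 0 x = \<i> * of_real x" for x by (simp add: complex_eq_iff)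
      have "(Complex 0 (-a) * Complex 0 a * Complex 0 a * Complex 0 (-a)) / (Complex 0 (2*a) * Complex 0 (-2*a)) = of_real (a\<^sup>2 / 4)"
        unfolding i using a by (simp add: field_simps power2_eq_square)
      moreover have "V0 * R0 * T0 = zeta_reg (Complex 0 (2*a)) * zeta_reg (Complex 0 (-2*a)) *
         ((Complex 0 (-a) * Complex 0 a * Complex 0 a * Complex 0 (-a)) / (Complex 0 (2*a) * Complex 0 (-2*a))) / (Z * Z') ^ 4"
        by (simp add: V0_def R0_def T0_def power4_eq_xxxx mult_ac)
      ultimately show ?thesis by (simp only:)
    qed
    also have "E * G0 * \<dots> = g2 (fst z) * H3 (snd z)"
      by (simp add: z g2_def H3_def E_def conv_kernel_def Z_def Z'_def G0_def mult_ac)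
    finally have lim: "(F \<longlongrightarrow> g2 (fst z) * H3 (snd z)) at_top" .
    show ?thesis
    proof (rule Lim_transform_eventually[OF lim])
      show "\<forall>\<^sub>F u in at_top. F u = Psi2 u z"
        using near_eventually[OF a, of y w q] eventually_gt_at_top[of "0::real"]
      proof eventually_elim
        case (elim u)
        have s: "a + b u = y/u" "a + c u = w/u" "b u + e u = (q - w)/u" "c u + e u = (q - y)/u" "a + b u + c u + e u = q/u"
          using aff_sums[OF elim(2), of a y w q] by (simp_all add: b_def c_def e_def)
        have aff: "aff u z = (a, b u, c u, e u)" by (simp add: aff_def z b_def c_def e_def)
        have r: "rz (sg u p + sg u r) = of_real u * (zeta_reg (Complex (2/u) (x/u)) / Complex 2 x)" if "p + r = x/u" for p r x
          unfolding rz_def sg_add that Complex_scale[OF elim(2)] using elim(2) by simp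
        have r4: "rz (sg u a + sg u (b u) + sg u (c u) + sg u (e u)) = of_real u * (zeta_reg (Complex (4/u) (q/u)) / Complex 4 q)"
          unfolding rz_def sg_add4 s(5) Complex_scale[OF elim(2)] using elim(2) by simp
        have ex: "exp (of_real u * (sg u a + sg u (b u) + sg u (c u) + sg u (e u))) = exp (Complex 4 q)"
          unfolding sg_add4 s(5) Complex_scale[OF elim(2)] using elim(2) by simp
        have "Psi2 u z = Phi2 u a (b u) (c u) (e u) / of_real (u^5)"
          using elim(1) unfolding Psi2_def NPhi_def aff z[symmetric] by simp
        also have "\<dots> = F u"
          unfolding Phi2_def ex r4 r[OF s(1)] r[OF s(2)] r[OF s(3)] r[OF s(4)] F_def E_def
          using elim(2) by (simp add: power_numeral_reduce mult_ac)
        finally show "F u = Psi2 u z" by simp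
      qed
    qed
  qed
qed

end

context zeta_estimates
begin

text \<open>The bound is inherited from \<open>Psi2_bound\<close> by letting u tend to infinity at
  one fixed point of the other three coordinates, where \<open>D3\<close> is positive; no new
  estimate of zeta is needed.\<close>

lemma g2_bound: "norm (g2 a) \<le> cN * om a"
proof -
  define p where "p = (0::real, 0::real, 0::real)"
  have D: "D3 p > 0" by (simp add: D3_def conv_kernel_def p_def Complex_nonzero norm_divide norm_mult)
  have "norm (g2 (fst (a, p)) * H3 (snd (a, p))) \<le> cN * (om (fst (a, p)) * D3 (snd (a, p)))"
  proof (rule Lim_norm_ubound[OF _ Psi2_tendsto])
    show "\<forall>\<^sub>F u in at_top. norm (Psi2 u (a, p)) \<le> cN * (om (fst (a, p)) * D3 (snd (a, p)))"
      using eventually_ge_at_top[of "4 / d"] by eventually_elim (rule Psi2_bound)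
  qed simp
  then have "norm (g2 a) * exp 4 * D3 p \<le> cN * om a * D3 p" by (simp add: norm_mult norm_H3)
  then have "norm (g2 a) * exp 4 \<le> cN * om a" using D by simp
  moreover have "norm (g2 a) * 1 \<le> norm (g2 a) * exp 4" by (intro mult_left_mono) auto
  ultimately show ?thesis by simp
qed

lemma continuous_g2: "continuous_on UNIV g2"
proof -
  have v: "continuous_on UNIV (\<lambda>a. line4 a)"
  proof (rule continuous_on_coordinatewise_then_product)
    fix j show "continuous_on UNIV (\<lambda>a. (line4 a) j)"
      unfolding vec4_def by (cases "j = 0"; cases "j = 1"; cases "j = 2") (auto intro!: continuous_intros)
  qed
  have G: "continuous_on UNIV (\<lambda>a. Gext 2 (line4 a))"
    by (rule continuous_on_compose2[OF continuous_on_Gext v]) (auto intro: vec4_Gregion)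
  show ?thesis
    unfolding g2_def[abs_def] using reg_nonzero d01
    by (intro continuous_intros continuous_on_zeta_reg_comp G) auto
qed

lemma g2_integrable: "integrable lborel g2"
  by (rule integrable_om_bound[OF g2_bound borel_measurable_continuous_onI[OF continuous_g2]])

lemma Psi2_limit: "((\<lambda>u. LBINT z. Psi2 u z) \<longlongrightarrow> 4 * pi^3 * (LBINT a. g2 a)) at_top"
proof -
  define L where "L = (\<lambda>z. g2 (fst z) * H3 (snd z))"
  have Li: "integrable lborel L" unfolding L_def by (intro integrable_lborel_times g2_integrable H3_integrable)
  have Lv: "(LBINT z. L z) = (LBINT a. g2 a) * (4 * pi^3)"
    unfolding L_def integral_lborel_times[OF g2_integrable H3_integrable] H3_integral by simp
  have "((\<lambda>u. LBINT z. Psi2 u z) \<longlongrightarrow> (LBINT z. L z)) at_top"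
    using Psi2_measurable by (intro tendsto_integral_eventually_dominated[OF borel_measurable_integrable[OF Li] Psi2_dominating, where b = "4 / d"])
      (auto intro: Psi2_bound Psi2_tendsto[folded L_def] simp: L_def Psi2_tendsto)
  then show ?thesis by (simp add: Lv mult.commute)
qed

text \<open>The error after division by u^2 is u^(5/4 - 2) times a power of the logarithm. The
  constant is 3 * 4 pi^3 / (2 pi)^4 = 3 / (4 pi), with the 3 from the three pairings.\<close>

lemma smooth_2_limit:
  "((\<lambda>u. of_real (smooth_Mk 2 u (hh u) / u\<^sup>2)) \<longlongrightarrow> 3 / (4 * pi) * (LBINT a. g2 a)) at_top"
proof -
  define S where "S = (\<lambda>u. complex_of_real ((2 * pi)^4 * (smooth_Mk 2 u (hh u) / u\<^sup>2)))"
  define I where "I = (\<lambda>u. 3 * (LBINT z. Psi2 u z))"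
  have "((\<lambda>u. S u - I u) \<longlongrightarrow> 0) at_top"
  proof (rule Lim_null_comparison)
    show "\<forall>\<^sub>F u in at_top. norm (S u - I u) \<le> 150 * cF * (u powr (5/4) * (4 * (1 + ln u) + 2 * om_mass) ^ 4 / u\<^sup>2)"
      using eventually_ge_at_top[of "4 / d"]
    proof eventually_elim
      case (elim u)
      note ub = u_bounds[OF elim]
      have "of_real (u\<^sup>2) * (S u - I u) = of_real ((2 * pi)^4 * smooth_Mk 2 u (hh u)) - 3 * (LBINT z. NPhi u z)"
        unfolding NPhi_affine[OF elim] S_def I_def Psi2_def using ub by (simp add: algebra_simps)
      then have "norm (of_real (u\<^sup>2) * (S u - I u)) \<le> 150 * cF * (u powr (5/4) * kappa u ^ 4)"
        using smooth_2_minus_near[OF elim] by simp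
      then have "u\<^sup>2 * norm (S u - I u) \<le> 150 * cF * (u powr (5/4) * kappa u ^ 4)"
        unfolding norm_mult norm_of_real by simp
      then have "norm (S u - I u) \<le> 150 * cF * (u powr (5/4) * kappa u ^ 4) / u\<^sup>2"
        using ub by (simp add: le_divide_eq mult.commute)
      then show ?case by (simp add: kappa_def)
    qed
    have "((\<lambda>u. u powr (5/4) * (4 * (1 + ln u) + 2 * om_mass) ^ 4 / u\<^sup>2) \<longlongrightarrow> 0) at_top" by real_asymp
    then show "((\<lambda>u. 150 * cF * (u powr (5/4) * (4 * (1 + ln u) + 2 * om_mass) ^ 4 / u\<^sup>2)) \<longlongrightarrow> 0) at_top"
      by (rule tendsto_mult_right_zero)
  qed
  moreover have "(I \<longlongrightarrow> 3 * (4 * pi^3 * (LBINT a. g2 a))) at_top"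
    unfolding I_def by (intro tendsto_mult tendsto_const Psi2_limit)
  ultimately have "((\<lambda>u. (S u - I u) + I u) \<longlongrightarrow> 0 + 3 * (4 * pi^3 * (LBINT a. g2 a))) at_top"
    by (rule tendsto_add)
  then have "(S \<longlongrightarrow> 12 * pi^3 * (LBINT a. g2 a)) at_top" by (simp add: mult.assoc)
  from tendsto_divide[OF this tendsto_const[of "complex_of_real ((2 * pi)^4)"]]
  have "((\<lambda>u. S u / of_real ((2 * pi)^4)) \<longlongrightarrow> 12 * pi^3 * (LBINT a. g2 a) / of_real ((2 * pi)^4)) at_top" by simp
  moreover have "S u / of_real ((2 * pi)^4) = of_real (smooth_Mk 2 u (hh u) / u\<^sup>2)" for u
    by (simp add: S_def)
  moreover have "12 * pi^3 * (LBINT a. g2 a) / of_real ((2 * pi)^4) = 3 / (4 * pi) * (LBINT a. g2 a)"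
    by (simp add: power4_eq_xxxx power3_eq_cube)
  ultimately show ?thesis by simp
qed

end

section \<open>Positivity of G on the line\<close>

lemma Gext_pos:
  assumes s: "s \<in> Gregion k" and pos: "\<And>p. \<exists>r>0. gfac k s p = of_real r"
  shows "\<exists>r>0. Gext k s = of_real r"
proof -
  obtain r where r: "\<And>p. r p > 0" "\<And>p. gfac k s p = of_real (r p)" using pos by metis
  obtain K where K: "\<And>p. norm (gfac k s p - 1) \<le> K * real p powr (-3/2)" using gfac_bound[of k] s by blast
  have "summable (\<lambda>p. norm (r p - 1))"
  proof (rule summable_comparison_test)
    have "norm (norm (r p - 1)) \<le> K * real p powr (-3/2)" for p
    proof -
      have "gfac k s p - 1 = of_real (r p - 1)" by (simp add: r(2))
      then show ?thesis using K[of p] by (simp only: norm_of_real real_norm_def abs_idempotent)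
    qed
    then show "\<exists>N. \<forall>n\<ge>N. norm (norm (r n - 1)) \<le> K * real n powr (-3/2)" by blast
    show "summable (\<lambda>p. K * real p powr (-3/2))" by (intro summable_mult) (simp add: summable_real_powr_iff)
  qed
  then have cp: "convergent_prod r" by (intro abs_convergent_prod_imp_convergent_prod summable_imp_abs_convergent_prod)
  define R where "R = prodinf r"
  have "(\<lambda>N. \<Prod>p\<le>N. r p) \<longlonglongrightarrow> R" unfolding R_def by (rule convergent_prod_LIMSEQ[OF cp])
  then have lim: "(\<lambda>N. \<Prod>p<N. r p) \<longlonglongrightarrow> R" by (intro LIMSEQ_imp_Suc[of "\<lambda>N. \<Prod>p<N. r p"]) (simp add: lessThan_Suc_atMost)
  have "R \<ge> 0" by (rule LIMSEQ_le_const[OF lim]) (intro exI allI impI prod_nonneg less_imp_le r)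
  \<comment> \<open>Convergence of an infinite product includes a nonzero limit when no factor
    vanishes.\<close>
  moreover have "R \<noteq> 0" unfolding R_def using r(1) by (intro prodinf_nonzero cp) (auto simp: less_imp_neq[symmetric])
  ultimately have "R > 0" by simp
  moreover have "Gext k s = of_real R"
  proof (rule LIMSEQ_unique)
    show "(\<lambda>N. \<Prod>p<N. gfac k s p) \<longlonglongrightarrow> Gext k s" by (rule tendsto_uniform_limitI[OF uniform_limit_Gext s])
    show "(\<lambda>N. \<Prod>p<N. gfac k s p) \<longlonglongrightarrow> of_real R" unfolding r(2) of_real_prod[symmetric] by (intro tendsto_of_real lim)
  qed
  ultimately show ?thesis by blast
qed

lemma powr_imaginary_cnj: "of_nat p powr (-(Complex 0 (-t))) = cnj (of_nat p powr (-(Complex 0 t)))" if "p > 0"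
proof -
  have "cnj (of_nat p powr (-(Complex 0 t))) = cnj (of_nat p) powr cnj (-(Complex 0 t))"
    using that by (intro cnj_powr) auto
  also have "cnj (-(Complex 0 t)) = -(Complex 0 (-t))" by (simp add: complex_eq_iff)
  finally show ?thesis by simp
qed

lemma powr_line: "of_nat p powr (-(1 + Complex 0 t)) = of_nat p powr (-(Complex 0 t)) / of_nat p" if "p > 0"
  using that by (simp add: powr_diff powr_minus divide_inverse mult.commute)

text \<open>The variables are it and -it, so all local factors occur in conjugate pairs. With q =
  1/p, X, Y and W are squared moduli coming from the Euler factor at z, the Euler factor at 2z and 1
  - p^(-z); each local factor of G is a quotient of positive real numbers.\<close>

lemma
  fixes t :: real
  defines "z \<equiv> Complex 0 t" and "w \<equiv> Complex 0 (-t)"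
  shows Gext_1_pos: "\<exists>r>0. Gext 1 (vec2 z w) = of_real r"
    and Gext_2_pos: "\<exists>r>0. Gext 2 (vec4 z w w z) = of_real r"
proof -
  have fac: "\<exists>r>0. gfac 1 (vec2 z w) p = of_real r" "\<exists>r>0. gfac 2 (vec4 z w w z) p = of_real r" for p
  proof -
    have "(\<exists>r>0. gfac 1 (vec2 z w) p = of_real r) \<and> (\<exists>r>0. gfac 2 (vec4 z w w z) p = of_real r)"
    proof (cases "prime p")
      case False
      then have "gfac 1 (vec2 z w) p = of_real 1" "gfac 2 (vec4 z w w z) p = of_real 1"
        by (simp_all add: gfac_def Mfac_def euler_fac_def)
      then show ?thesis by (metis zero_less_one)
    next
      case True
      then have p: "p \<ge> 2" "p > 0" using prime_ge_2_nat prime_gt_0_nat by auto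
      define x where "x = of_nat p powr (-z)"
      define q where "q = 1 / real p"
      have q: "0 < q" "q < 1" using p by (auto simp: q_def)
      have w: "of_nat p powr (-w) = cnj x" unfolding x_def z_def w_def by (rule powr_imaginary_cnj[OF p(2)])
      have nx: "norm x = 1" unfolding x_def z_def using p by (subst norm_powr_real_powr) auto
      have e1: "euler_fac (1 + z) p = 1 - of_real q * x" and e2: "euler_fac (1 + w) p = cnj (1 - of_real q * x)"
        using True powr_line[OF p(2), of t] powr_line[OF p(2), of "-t"] w by (simp_all add: euler_fac_def x_def z_def w_def q_def divide_inverse mult.commute)
      have zw: "z + w = 0" "w + z = 0" by (simp_all add: z_def w_def complex_eq_iff)
      have e0: "euler_fac 1 p = of_real (1 - q)" using True p by (simp add: euler_fac_def powr_minus q_def inverse_eq_divide)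
      define y where "y = euler_fac (1 + (z + z)) p"
      have ey: "euler_fac (1 + (w + w)) p = cnj y"
      proof -
        have "z + z = Complex 0 (2*t)" "w + w = Complex 0 (-(2*t))" by (simp_all add: z_def w_def complex_eq_iff)
        then show ?thesis using True powr_line[OF p(2), of "2*t"] powr_line[OF p(2), of "-(2*t)"] powr_imaginary_cnj[OF p(2), of "2*t"]
          by (simp add: y_def euler_fac_def)
      qed
      have y0: "y \<noteq> 0"
      proof -
        have "norm (of_nat p powr (-(1 + (z + z)))) = q"
          unfolding z_def q_def using p by (subst norm_powr_real_powr) (auto simp: powr_minus divide_inverse)
        then show ?thesis using True q by (auto simp: y_def euler_fac_def)
      qed
      have x0: "1 - of_real q * x \<noteq> 0"
      proof
        assume "1 - of_real q * x = 0"
        then have "of_real q * x = 1" by simp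
        then have "norm (of_real q * x) = 1" by (metis norm_one)
        then show False using nx q by (simp add: norm_mult)
      qed
      define X where "X = (norm (1 - of_real q * x))\<^sup>2"
      define Y where "Y = (norm y)\<^sup>2"
      define W where "W = (norm (1 - x))\<^sup>2"
      have pos: "X > 0" "Y > 0" "W \<ge> 0" using x0 y0 by (auto simp: X_def Y_def W_def)
      have X: "(1 - of_real q * x) * cnj (1 - of_real q * x) = of_real X" unfolding X_def complex_norm_square ..
      have Y: "y * cnj y = of_real Y" unfolding Y_def complex_norm_square ..
      have W: "(1 - x) * (1 - cnj x) = of_real W" unfolding W_def complex_norm_square by simp
      have qp: "1 / (of_nat p :: complex) = of_real q" by (simp add: q_def)
      have "gfac 1 (vec2 z w) p = of_real ((1 - q + q * W) * (1 - q) / X)"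
      proof -
        have "Mfac 1 (vec2 z w) p = of_real (1 - q + q * W)"
          using True unfolding Mfac_def lessThan_2_1 qp by (simp add: vec2_def w x_def[symmetric] W)
        moreover have "(\<Prod>S\<in>Even_sets 1. euler_fac (1 + sS (vec2 z w) S) p) = of_real (1 - q)"
          unfolding prods_sS_1[where g = "\<lambda>x. euler_fac (1 + x) p"] by (simp add: vec2_def zw e0 del: One_nat_def)
        moreover have "(\<Prod>S\<in>Odd_sets 1. euler_fac (1 + sS (vec2 z w) S) p) = of_real X"
          unfolding prods_sS_1[where g = "\<lambda>x. euler_fac (1 + x) p"] by (simp add: vec2_def e1 e2 X[symmetric])
        ultimately show ?thesis by (simp add: gfac_def)
      qed
      moreover have "(1 - q + q * W) * (1 - q) / X > 0" using q pos by (intro divide_pos_pos mult_pos_pos add_pos_nonneg) auto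
      moreover have "gfac 2 (vec4 z w w z) p = of_real ((1 - q + q * W\<^sup>2) * (Y * (1 - q)^5) / X^4)"
      proof -
        have "Mfac 2 (vec4 z w w z) p = of_real (1 - q + q * W\<^sup>2)"
        proof -
          have "(\<Prod>j<2*2. 1 - (of_nat p :: complex) powr (- vec4 z w w z j)) = ((1 - x) * (1 - cnj x))\<^sup>2"
            unfolding lessThan_2_2 by (simp add: vec4_def w x_def[symmetric] power2_eq_square mult_ac)
          then show ?thesis using True unfolding Mfac_def qp W by simp
        qed
        moreover have "(\<Prod>S\<in>Even_sets 2. euler_fac (1 + sS (vec4 z w w z) S) p) = of_real (Y * (1 - q)^5)"
        proof -
          \<comment> \<open>Four of the pair sums and the full sum vanish, and each contributes the
            Euler factor 1 - q, hence the fifth power; the remaining two pairs give y and its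
            conjugate.\<close>
          have "z + z + w + w = 0" using zw by (metis add.assoc add.right_neutral)
          then have "(\<Prod>S\<in>Even_sets 2. euler_fac (1 + sS (vec4 z w w z) S) p) = (y * cnj y) * of_real (1 - q)^5"
            unfolding prods_sS_2[where g = "\<lambda>x. euler_fac (1 + x) p"]
            using ey by (simp add: vec4_def zw e0 y_def power_numeral_reduce)
          then show ?thesis by (simp add: Y)
        qed
        moreover have "(\<Prod>S\<in>Odd_sets 2. euler_fac (1 + sS (vec4 z w w z) S) p) = of_real (X^4)"
        proof -
          \<comment> \<open>Each triple sum collapses to z or w, so the eight odd sets yield four
            conjugate pairs.\<close>
          have s: "z + z + w = z" "z + w + w = w" by (simp_all add: z_def w_def complex_eq_iff)
          have v: "vec4 z w w z 0 = z" "vec4 z w w z 1 = z" "vec4 z w w z 2 = w" "vec4 z w w z 3 = w" by (simp_all add: vec4_def)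
          have "(\<Prod>S\<in>Odd_sets 2. euler_fac (1 + sS (vec4 z w w z) S) p) = ((1 - of_real q * x) * cnj (1 - of_real q * x)) ^ 4"
            unfolding prods_sS_2[where g = "\<lambda>x. euler_fac (1 + x) p"] v s e1 e2
            by (simp add: power4_eq_xxxx)
          then show ?thesis by (simp only: X of_real_power)
        qed
        ultimately show ?thesis by (simp add: gfac_def)
      qed
      moreover have "(1 - q + q * W\<^sup>2) * (Y * (1 - q)^5) / X^4 > 0" using q pos by (intro divide_pos_pos mult_pos_pos add_pos_nonneg zero_less_power) auto
      ultimately show ?thesis by metis
    qed
    then show "\<exists>r>0. gfac 1 (vec2 z w) p = of_real r" "\<exists>r>0. gfac 2 (vec4 z w w z) p = of_real r" by auto
  qed
  show "\<exists>r>0. Gext 1 (vec2 z w) = of_real r" by (rule Gext_pos[OF vec2_Gregion_nonneg fac(1)]) (simp_all add: z_def w_def)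
  show "\<exists>r>0. Gext 2 (vec4 z w w z) = of_real r" by (rule Gext_pos[OF vec4_Gregion fac(2)]) (simp_all add: z_def w_def)
qed

text \<open>The point 0 is excepted because \<open>g2\<close> vanishes there.\<close>

lemma integral_positive_neq_0:
  fixes g :: "real \<Rightarrow> complex"
  assumes int: "integrable lborel g" and pos: "\<And>t. t \<noteq> 0 \<Longrightarrow> \<exists>r>0. g t = of_real r"
  shows "(LBINT t. g t) \<noteq> 0"
proof
  assume 0: "(LBINT t. g t) = 0"
  have i: "integrable lborel (\<lambda>t. Re (g t))" using int by simp
  have "(LBINT t. Re (g t)) = 0" using integral_Re[OF int] 0 by simp
  moreover have z: "AE t in lborel. t \<noteq> (0::real)" by (rule AE_lborel_singleton)
  then have nn: "AE t in lborel. 0 \<le> Re (g t)" by eventually_elim (use pos in \<open>force simp: less_imp_le\<close>)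
  ultimately have "AE t in lborel. Re (g t) = 0" using integral_nonneg_eq_0_iff_AE[OF i nn] by simp
  with z have "AE t in (lborel :: real measure). False"
    by eventually_elim (use pos in force)
  then show False by (simp add: AE_iff_null null_sets_def)
qed

lemma zeta_reg_line: "zeta_reg (Complex 0 a) * zeta_reg (Complex 0 (-a)) = of_real ((norm (zeta_reg (Complex 0 a)))\<^sup>2)"
proof -
  have "Complex 0 (-a) = cnj (Complex 0 a)" by (simp add: complex_eq_iff)
  then have "zeta_reg (Complex 0 (-a)) = cnj (zeta_reg (Complex 0 a))" using zeta_reg_cnj[of "Complex 0 a"] by simp
  then show ?thesis by (simp only: complex_norm_square)
qed

lemma norm_zeta_line: "a \<noteq> 0 \<Longrightarrow> norm (zeta (1 + \<i> * complex_of_real a)) = norm (zeta_reg (Complex 0 a)) / \<bar>a\<bar>"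
  by (simp add: zeta_eq_reg Complex_eq norm_divide norm_mult)

lemma Gk_1_eq: "Gk 1 a = Gext 1 (line2 a)"
proof -
  have "(\<lambda>j. if j < 1 then \<i> * complex_of_real a else - (\<i> * complex_of_real a)) = line2 a"
    by (auto simp: vec2_def fun_eq_iff Complex_eq)
  then show ?thesis by (simp only: Gk_eq_Gext)
qed

lemma Gk_2_eq: "Gk 2 a = Gext 2 (line4 a)"
proof -
  have "(\<lambda>j. if j < 2 then \<i> * complex_of_real a else - (\<i> * complex_of_real a)) = line4 a"
    by (auto simp: vec4_def fun_eq_iff Complex_eq less_2_cases_iff)
  then show ?thesis by (simp only: Gk_eq_Gext)
qed

lemma g1_eq: "a \<noteq> 0 \<Longrightarrow> Gk 1 a / complex_of_real ((cmod (zeta (1 + \<i> * complex_of_real a)))\<^sup>2 * a\<^sup>2) = g1 a"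
  unfolding Gk_1_eq g1_def zeta_reg_line by (simp add: norm_zeta_line power_divide)

lemma g2_eq:
  assumes "a \<noteq> 0"
  shows "complex_of_real ((cmod (zeta (1 + 2 * \<i> * complex_of_real a)))\<^sup>2 / ((cmod (zeta (1 + \<i> * complex_of_real a))) ^ 8 * a ^ 4)) * Gk 2 a = g2 a"
proof -
  define Z where "Z = norm (zeta_reg (Complex 0 a))"
  define Y where "Y = norm (zeta_reg (Complex 0 (2 * a)))"
  have 1: "cmod (zeta (1 + \<i> * complex_of_real a)) = Z / \<bar>a\<bar>" using norm_zeta_line[OF assms] by (simp add: Z_def)
  have 2: "cmod (zeta (1 + 2 * \<i> * complex_of_real a)) = Y / \<bar>2 * a\<bar>" using norm_zeta_line[of "2 * a"] assms by (simp add: Y_def mult_ac)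
  have pw: "\<bar>a\<bar> ^ 8 = a ^ 8" "\<bar>2 * a\<bar>\<^sup>2 = 4 * a\<^sup>2" by (simp_all add: power_even_abs power_mult_distrib)
  have e: "(Y / \<bar>2 * a\<bar>)\<^sup>2 / ((Z / \<bar>a\<bar>) ^ 8 * a ^ 4) = Y\<^sup>2 * (a\<^sup>2 / 4) / (Z\<^sup>2) ^ 4"
    unfolding power_divide pw using assms by (cases "Z = 0") (simp_all add: field_simps power_numeral_reduce)
  have "g2 a = Gk 2 a * of_real (Y\<^sup>2) * of_real (a\<^sup>2 / 4) / of_real (Z\<^sup>2) ^ 4"
    unfolding g2_def Gk_2_eq[symmetric] zeta_reg_line Z_def Y_def using zeta_reg_line[of "2 * a"] by simp
  also have "\<dots> = of_real (Y\<^sup>2 * (a\<^sup>2 / 4) / (Z\<^sup>2) ^ 4) * Gk 2 a" by simp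
  finally show ?thesis unfolding 1 2 e by simp
qed

text \<open>At t = 0 the integrands of the theorem contain divisions by 0 and take default values;
  one point is negligible. This passes from the gauge integral over the line to the Lebesgue
  integral.\<close>

lemma integral_eq_lborel:
  fixes f g :: "real \<Rightarrow> complex"
  assumes "integrable lborel g" "\<And>t. t \<noteq> 0 \<Longrightarrow> f t = g t"
  shows "integral UNIV f = (LBINT t. g t)"
proof (rule integral_unique)
  show "(f has_integral (LBINT t. g t)) UNIV"
    by (rule has_integral_spike[OF negligible_sing[of 0] _ has_integral_integral_lborel[OF assms(1)]]) (use assms(2) in auto)
qed

section \<open>Removing the smoothing, and the asymptotics\<close>

context zeta_estimates
begin

text \<open>\<open>B\<close> is the bound of \<open>Mk_minus_smooth_le\<close> at layer width
  u^(-16), divided by the order u^m of the main term. It is left as a hypothesis because its decay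
  is checked for the concrete values of k. The passage from u to ln z is a composition of
  limits.\<close>

lemma Mk_limit:
  fixes k m :: nat
  defines "n \<equiv> 2 ^ (2*k) - 1 :: nat"
  assumes k: "k \<ge> 1"
    and B: "((\<lambda>u::real. real (2*k) * (real n * ((exp (- ((u - u powr -16) / real n)) + u powr -16) * (1 + u) ^ (n - 1)) + exp (- (u powr -16) / u powr -32) * (1 + u) ^ n) / u ^ m) \<longlongrightarrow> 0) at_top"
    and lim: "((\<lambda>u. complex_of_real (smooth_Mk k u (hh u) / u ^ m)) \<longlongrightarrow> L) at_top"
  shows "((\<lambda>z. of_real (Mk k z / ln z ^ m)) \<longlongrightarrow> L) at_top"
proof -
  have "((\<lambda>u. (Mk k (exp u) - smooth_Mk k u (hh u)) / u ^ m) \<longlongrightarrow> 0) at_top"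
  proof (rule Lim_null_comparison[OF _ B], use eventually_ge_at_top[of 1] in eventually_elim)
    case (elim u)
    have "u powr -16 \<le> u powr 1" using elim by (intro powr_mono) auto
    then have "0 \<le> u powr -16" "u powr -16 \<le> u" using elim by auto
    from Mk_minus_smooth_le[OF k this, of "hh u"] hh_bounds[OF elim] elim show ?case
      by (simp only: n_def hh_def real_norm_def abs_divide power_abs abs_of_nonneg[OF order_trans[OF zero_le_one elim]]) (intro divide_right_mono, auto)
  qed
  from tendsto_add[OF tendsto_of_real[OF this] lim]
  have "((\<lambda>u. of_real (Mk k (exp u) / u ^ m)) \<longlongrightarrow> L) at_top" by (simp add: diff_divide_distrib)
  from filterlim_compose[OF this ln_at_top] show ?thesis
    by (rule Lim_transform_eventually) (use eventually_gt_at_top[of 0] in eventually_elim, simp)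
qed

lemma Mk_1_limit: "((\<lambda>z. of_real (Mk 1 z)) \<longlongrightarrow> 1 / (2 * pi) * (LBINT a. g1 a)) at_top"
proof -
  have "((\<lambda>z. of_real (Mk 1 z / ln z ^ 0)) \<longlongrightarrow> 1 / (2 * pi) * (LBINT a. g1 a)) at_top"
  proof (rule Mk_limit)
    show "((\<lambda>u. of_real (smooth_Mk 1 u (hh u) / u ^ 0)) \<longlongrightarrow> 1 / (2 * pi) * (LBINT a. g1 a)) at_top"
      using smooth_1_limit by simp
  qed (simp, simp, real_asymp)
  then show ?thesis by simp
qed

lemma Mk_2_limit: "((\<lambda>z. of_real (Mk 2 z / (ln z)\<^sup>2)) \<longlongrightarrow> 3 / (4 * pi) * (LBINT a. g2 a)) at_top"
  by (rule Mk_limit[OF _ _ smooth_2_limit]) (simp, simp, real_asymp)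

lemma g1_integral_nonzero: "(LBINT a. g1 a) \<noteq> 0"
proof (rule integral_positive_neq_0[OF g1_integrable])
  fix t :: real
  obtain r where r: "r > 0" "Gext 1 (line2 t) = of_real r" using Gext_1_pos by blast
  have "zeta_reg (Complex 0 t) \<noteq> 0" using d01 by (intro reg_nonzero) auto
  then have "r / (norm (zeta_reg (Complex 0 t)))\<^sup>2 > 0" using r by simp
  moreover have "g1 t = of_real (r / (norm (zeta_reg (Complex 0 t)))\<^sup>2)" unfolding g1_def r zeta_reg_line by simp
  ultimately show "\<exists>r>0. g1 t = of_real r" by blast
qed

lemma g2_integral_nonzero: "(LBINT a. g2 a) \<noteq> 0"
proof (rule integral_positive_neq_0[OF g2_integrable])
  fix t :: real assume t: "t \<noteq> 0"
  obtain r where r: "r > 0" "Gext 2 (line4 t) = of_real r" using Gext_2_pos by blast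
  have "zeta_reg (Complex 0 t) \<noteq> 0" "zeta_reg (Complex 0 (2 * t)) \<noteq> 0" by (rule reg_nonzero; use d01 in simp)+
  then have "r * (norm (zeta_reg (Complex 0 (2 * t))))\<^sup>2 * (t\<^sup>2 / 4) / ((norm (zeta_reg (Complex 0 t)))\<^sup>2) ^ 4 > 0"
    using r t by (intro divide_pos_pos mult_pos_pos) auto
  moreover have "g2 t = of_real (r * (norm (zeta_reg (Complex 0 (2 * t))))\<^sup>2 * (t\<^sup>2 / 4) / ((norm (zeta_reg (Complex 0 t)))\<^sup>2) ^ 4)"
    unfolding g2_def r zeta_reg_line using zeta_reg_line[of "2 * t"] by simp
  ultimately show "\<exists>r>0. g2 t = of_real r" by blast
qed

end

theorem mainTheorem1:
  shows "((\<lambda>z. complex_of_real (Mk 1 z)) \<sim>[at_top]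
           (\<lambda>z. complex_of_real (1 / (2 * pi)) *
              integral UNIV (\<lambda>t::real. Gk 1 t / complex_of_real ((cmod (zeta (1 + \<i> * complex_of_real t)))\<^sup>2 * t\<^sup>2)))) \<and>
         ((\<lambda>z. complex_of_real (Mk 2 z)) \<sim>[at_top]
           (\<lambda>z. complex_of_real (3 / (4 * pi) * (ln z)\<^sup>2) *
              integral UNIV (\<lambda>t::real. complex_of_real ((cmod (zeta (1 + 2 * \<i> * complex_of_real t)))\<^sup>2
                    / ((cmod (zeta (1 + \<i> * complex_of_real t))) ^ 8 * t ^ 4)) * Gk 2 t)))"
proof -
  obtain C d where "zeta_estimates C d" using zeta_estimates_exist by blast
  then interpret zeta_estimates C d .
  define I1 where "I1 = (LBINT a. g1 a)"
  define I2 where "I2 = (LBINT a. g2 a)"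
  have nz: "I1 \<noteq> 0" "I2 \<noteq> 0" unfolding I1_def I2_def by (rule g1_integral_nonzero, rule g2_integral_nonzero)
  have 1: "integral UNIV (\<lambda>t::real. Gk 1 t / complex_of_real ((cmod (zeta (1 + \<i> * complex_of_real t)))\<^sup>2 * t\<^sup>2)) = I1"
    unfolding I1_def by (rule integral_eq_lborel[OF g1_integrable g1_eq])
  have 2: "integral UNIV (\<lambda>t::real. complex_of_real ((cmod (zeta (1 + 2 * \<i> * complex_of_real t)))\<^sup>2
                    / ((cmod (zeta (1 + \<i> * complex_of_real t))) ^ 8 * t ^ 4)) * Gk 2 t) = I2"
    unfolding I2_def by (rule integral_eq_lborel[OF g2_integrable g2_eq])
  have "(\<lambda>z. complex_of_real (Mk 1 z)) \<sim>[at_top] (\<lambda>z. complex_of_real (1 / (2 * pi)) * I1)"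
  proof (rule asymp_equivI')
    from tendsto_divide[OF Mk_1_limit[folded I1_def] tendsto_const[of "complex_of_real (1 / (2 * pi)) * I1"]] nz
    show "((\<lambda>z. complex_of_real (Mk 1 z) / (complex_of_real (1 / (2 * pi)) * I1)) \<longlongrightarrow> 1) at_top" by simp
  qed
  moreover have "(\<lambda>z. complex_of_real (Mk 2 z)) \<sim>[at_top] (\<lambda>z. complex_of_real (3 / (4 * pi) * (ln z)\<^sup>2) * I2)"
  proof (rule asymp_equivI')
    from tendsto_divide[OF Mk_2_limit[folded I2_def] tendsto_const[of "complex_of_real (3 / (4 * pi)) * I2"]] nz
    have "((\<lambda>z. complex_of_real (Mk 2 z / (ln z)\<^sup>2) / (complex_of_real (3 / (4 * pi)) * I2)) \<longlongrightarrow> 1) at_top" by simp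
    then show "((\<lambda>z. complex_of_real (Mk 2 z) / (complex_of_real (3 / (4 * pi) * (ln z)\<^sup>2) * I2)) \<longlongrightarrow> 1) at_top"
      by (simp add: mult_ac)
  qed
  ultimately show ?thesis unfolding 1 2 by blast
qed

end
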